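(* Let $G=GL_n(\Bbbk)$, let $0<r<n$, and let $P\subset G$ be the standard maximal parabolic subgroup of block upper triangular matrices $\begin{pmatrix}A&B\\0&C\end{pmatrix}$ with $A$ of size $r\times r$. Then $\widehat{\mathcal{O}_q(G/P)^\vee}$ is a left coideal of $\widehat{\mathcal{O}_q(G)^\vee}$, i.e. the coproduct $\widehat{\Delta}$ of $\widehat{\mathcal{O}_q(G)^\vee}$ satisfies $$\widehat{\Delta}\Big(\widehat{\mathcal{O}_q(G/P)^\vee}\Big)\subseteq\widehat{\mathcal{O}_q(G)^\vee}\,\widehat{\otimes}\,\widehat{\mathcal{O}_q(G/P)^\vee}.$$
   Context: $\Bbbk$ is a field of characteristic zero, $\Bbbk_q=\Bbbk[q,q^{-1}]$ with $q$ an indeterminate, and $\Bbbk(q)$ is the field of rational functions. Quantum group. $\mathcal{O}_q(M_n)$ is the unital $\Bbbk_q$-algebra generated by $x_{ij}$ ($1\le i,j\le n$) with relations $x_{ij}x_{ik}=q\,x_{ik}x_{ij}$ and $x_{ji}x_{ki}=q\,x_{ki}x_{ji}$ for $j<k$; $x_{ij}x_{kl}=x_{kl}x_{ij}$ for $i<k,\ j>l$ or $i>k,\ j<l$; $x_{ij}x_{kl}-x_{kl}x_{ij}=(q-q^{-1})x_{kj}x_{il}$ for $i<k,\ j<l$. The quantum determinant $D_q=\sum_{\sigma\in\mathcal{S}_n}(-q)^{\ell(\sigma)}x_{1\sigma(1)}\cdots x_{n\sigma(n)}$ is central, and $\mathcal{O}_q(G)=\mathcal{O}_q(GL_n)$ is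 $\mathcal{O}_q(M_n)$ with $D_q$ inverted, a Hopf $\Bbbk_q$-algebra with $\Delta(x_{ij})=\sum_k x_{ik}\otimes x_{kj}$, $\epsilon(x_{ij})=\delta_{ij}$. Quantum Grassmannian and big cell. For $I=\{i_1<\dots<i_r\}\subseteq\{1,\dots,n\}$ put $D^I=D^{i_1\dots i_r}=\sum_{\sigma\in\mathcal{S}_r}(-q)^{\ell(\sigma)}x_{i_1\sigma(1)}\cdots x_{i_r\sigma(r)}$. $\mathcal{O}_q(G/P)$ is the $\Bbbk_q$-subalgebra of $\mathcal{O}_q(G)$ generated by all the $D^I$. Put $D_0:=D^{1\dots r}$, and let $\mathcal{O}_q(G)[D_0^{-1}]$ be the algebra obtained from $\mathcal{O}_q(G)$ by adjoining a two-sided inverse $D_0^{-1}$ of $D_0$. The big cell ring $\mathcal{O}_q^{loc}(G/P)$ is the $\Bbbk_q$-subalgebra of $\mathcal{O}_q(G)[D_0^{-1}]$ generated by $t_{ij}:=(-q)^{r-j}D^{1\dots\widehat{j}\dots r\,i}D_0^{-1}$, $1\le j\le r<i\le n$ ($\widehat{j}$ means $j$ is omitted). The functor $\vee$. Let $J=\mathrm{Ker}(\epsilon)\subset\mathcal{O}_q(G)$ and $\mathcal{O}_q(G)^\vee:=\sum_{m\ge0}(q-1)^{-m}J^m\subset\mathcal{O}_q(G)\otimes_{\Bbbk_q}\Bbbk(q)$; it is a Hopf algebra with the structure induced from $\mathcal{O}_q(G)$. Let $\epsilon'$ be the natural extension to $\mathcal{O}_q^{loc}(G/P)$ of $\epsilon|_{\mathcal{O}_q(G/P)}$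 (note $\epsilon(D_0)=1$), $J^{loc}_{G/P}=\mathrm{Ker}(\epsilon')$, and $\mathcal{O}_q(G/P)^\vee:=\sum_{m\ge0}(q-1)^{-m}(J^{loc}_{G/P})^m\subset\mathcal{O}_q^{loc}(G/P)\otimes_{\Bbbk_q}\Bbbk(q)$. Completions. $\widehat{A}$ denotes the $(q-1)$-adic completion of a $\Bbbk_q$-algebra $A$, and $\widehat{\otimes}$ the $(q-1)$-adic completion of the algebraic tensor product. $\widehat{\mathcal{O}_q(G)^\vee}$ is a topological Hopf algebra with coproduct $\widehat{\Delta}$ induced by $\Delta$, with values in $\widehat{\mathcal{O}_q(G)^\vee}\,\widehat{\otimes}\,\widehat{\mathcal{O}_q(G)^\vee}$. Since $D_0\in1+(q-1)\mathcal{O}_q(G)^\vee$ is invertible in $\widehat{\mathcal{O}_q(G)^\vee}$, one has embeddings $\mathcal{O}_q(G/P)^\vee\subset\mathcal{O}_q(G)^\vee[D_0^{-1}]\subset\widehat{\mathcal{O}_q(G)^\vee}$; moreover $\mathcal{O}_q(G/P)^\vee\cap(q-1)\widehat{\mathcal{O}_q(G)^\vee}=(q-1)\mathcal{O}_q(G/P)^\vee$, so that $\widehat{\mathcal{O}_q(G/P)^\vee}$ is identified with the closure of $\mathcal{O}_q(G/P)^\vee$ in $\widehat{\mathcal{O}_q(G)^\vee}$. *)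

theory Defs
  imports
    "HOL-Library.Poly_Mapping"
    "HOL-Computational_Algebra.Fraction_Field"
    "HOL-Combinatorics.Permutations"
    "HOL-Algebra.Module"
    "HOL-Algebra.QuotRing"
    "HOL-Algebra.Ideal_Product"
    "HOL-Algebra.Generated_Groups"
    "HOL-Algebra.Generated_Rings"
begin

section \<open>Associative algebras over a commutative ring\<close>

text \<open>
  The scalars form a type \<open>'r\<close> of class \<^class>\<open>comm_ring_1\<close>; an associative, not necessarily
  commutative \<open>'r\<close>-algebra with carrier in \<open>'a\<close> is an \<open>('r, 'a) module\<close> record.  The library
  locale \<^locale>\<open>algebra\<close> is not used, because it requires the multiplication to be commutative.
\<close>

definition scalar_alg :: "('r::comm_ring_1, 'r) module" where
  "scalar_alg = \<lparr>carrier = UNIV, mult = (*), one = 1, zero = 0, add = (+), smult = (*)\<rparr>"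

definition fract_alg :: "('r::idom, 'r fract) module" where
  "fract_alg = \<lparr>carrier = UNIV, mult = (*), one = 1, zero = 0, add = (+),
     smult = (\<lambda>c x. Fraction_Field.Fract c 1 * x)\<rparr>"

definition monoid_alg :: "('m, 'z) monoid_scheme \<Rightarrow> ('r::comm_ring_1, 'm \<Rightarrow>\<^sub>0 'r) module" where
  "monoid_alg M = \<lparr>
     carrier = {f. Poly_Mapping.keys f \<subseteq> carrier M},
     mult = (\<lambda>f g. \<Sum>x\<in>Poly_Mapping.keys f. \<Sum>y\<in>Poly_Mapping.keys g.
       Poly_Mapping.single (x \<otimes>\<^bsub>M\<^esub> y) (Poly_Mapping.lookup f x * Poly_Mapping.lookup g y)),
     one = Poly_Mapping.single \<one>\<^bsub>M\<^esub> 1,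
     zero = 0,
     add = (+),
     smult = (\<lambda>c. Poly_Mapping.map ((*) c))\<rparr>"

text \<open>The linear extension of \<open>\<phi> : M \<rightarrow> T\<close> to formal linear combinations of elements of \<open>M\<close>.\<close>

definition lin_ext :: "('r::comm_ring_1, 'b) module \<Rightarrow> ('m \<Rightarrow> 'b) \<Rightarrow> ('m \<Rightarrow>\<^sub>0 'r) \<Rightarrow> 'b" where
  "lin_ext T \<phi> p = (\<Oplus>\<^bsub>T\<^esub>m\<in>Poly_Mapping.keys p. Poly_Mapping.lookup p m \<odot>\<^bsub>T\<^esub> \<phi> m)"

definition quot_alg :: "('r, 'a) module \<Rightarrow> 'a set \<Rightarrow> ('r, 'a set) module" where
  "quot_alg A I = ring.extend (A Quot I)
     (module.fields (\<lambda>c X. \<Union>x\<in>X. I +>\<^bsub>A\<^esub> (c \<odot>\<^bsub>A\<^esub> x)))"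

text \<open>An arbitrary representative of a coset.\<close>

definition rep :: "'a set \<Rightarrow> 'a" where
  "rep X = (SOME x. x \<in> X)"

definition subalg_gen :: "('r, 'a) module \<Rightarrow> 'a set \<Rightarrow> ('r, 'a) module" where
  "subalg_gen A S = A\<lparr>carrier := generate_ring A (range (\<lambda>c. c \<odot>\<^bsub>A\<^esub> \<one>\<^bsub>A\<^esub>) \<union> S)\<rparr>"

fun ideal_pow :: "('r, 'a) module \<Rightarrow> 'a set \<Rightarrow> nat \<Rightarrow> 'a set" where
  "ideal_pow A J 0 = carrier A"
| "ideal_pow A J (Suc m) = ideal_prod A J (ideal_pow A J m)"


subsection \<open>Generators and relations\<close>

definition free_alg :: "'g set \<Rightarrow> ('r::comm_ring_1, 'g list \<Rightarrow>\<^sub>0 'r) module" where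
  "free_alg G = monoid_alg \<lparr>carrier = lists G, mult = (@), one = []\<rparr>"

definition pres_class :: "'g set \<Rightarrow> ('g list \<Rightarrow>\<^sub>0 'r) set \<Rightarrow> ('g list \<Rightarrow>\<^sub>0 'r::comm_ring_1)
    \<Rightarrow> ('g list \<Rightarrow>\<^sub>0 'r) set" where
  "pres_class G Rel p = (Idl\<^bsub>free_alg G\<^esub> Rel) +>\<^bsub>free_alg G\<^esub> p"

definition pres_alg :: "'g set \<Rightarrow> ('g list \<Rightarrow>\<^sub>0 'r) set
    \<Rightarrow> ('r::comm_ring_1, ('g list \<Rightarrow>\<^sub>0 'r) set) module" where
  "pres_alg G Rel = quot_alg (free_alg G) (Idl\<^bsub>free_alg G\<^esub> Rel)"

text \<open>
  The algebra homomorphism from a presented algebra to \<open>B\<close> with values \<open>f g\<close> on the generators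
  \<open>g\<close>.  It is independent of the representative whenever \<open>f\<close> respects the relations.
\<close>

definition pres_hom :: "('r::comm_ring_1, 'b) module \<Rightarrow> ('g \<Rightarrow> 'b) \<Rightarrow> ('g list \<Rightarrow>\<^sub>0 'r) set \<Rightarrow> 'b" where
  "pres_hom B f X = lin_ext B (\<lambda>w. foldr (\<lambda>g b. f g \<otimes>\<^bsub>B\<^esub> b) w \<one>\<^bsub>B\<^esub>) (rep X)"


subsection \<open>Tensor products\<close>

type_synonym ('r, 'a, 'b) tensor = "('a \<times> 'b \<Rightarrow>\<^sub>0 'r) set"

definition bilinear_rels :: "('r::comm_ring_1, 'a) module \<Rightarrow> ('r, 'b) module \<Rightarrow> ('a \<times> 'b \<Rightarrow>\<^sub>0 'r) set" where
  "bilinear_rels A B =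
     {Poly_Mapping.single (a \<oplus>\<^bsub>A\<^esub> a', b) 1 - Poly_Mapping.single (a, b) 1 - Poly_Mapping.single (a', b) 1
        | a a' b. a \<in> carrier A \<and> a' \<in> carrier A \<and> b \<in> carrier B}
   \<union> {Poly_Mapping.single (a, b \<oplus>\<^bsub>B\<^esub> b') 1 - Poly_Mapping.single (a, b) 1 - Poly_Mapping.single (a, b') 1
        | a b b'. a \<in> carrier A \<and> b \<in> carrier B \<and> b' \<in> carrier B}
   \<union> {Poly_Mapping.single (c \<odot>\<^bsub>A\<^esub> a, b) 1 - Poly_Mapping.single (a, b) c
        | c a b. a \<in> carrier A \<and> b \<in> carrier B}
   \<union> {Poly_Mapping.single (a, c \<odot>\<^bsub>B\<^esub> b) 1 - Poly_Mapping.single (a, b) c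
        | c a b. a \<in> carrier A \<and> b \<in> carrier B}"

text \<open>
  The free module on \<open>A \<times> B\<close> is the monoid algebra of the product of the multiplicative monoids
  of \<open>A\<close> and \<open>B\<close>; the submodule spanned by the bilinearity relations is a two-sided ideal in it, so
  the following is the usual tensor product over \<open>'r\<close> with
  \<open>(a \<otimes> b) (a' \<otimes> b') = a a' \<otimes> b b'\<close>.
\<close>

definition tensor_ideal :: "('r::comm_ring_1, 'a) module \<Rightarrow> ('r, 'b) module \<Rightarrow> ('a \<times> 'b \<Rightarrow>\<^sub>0 'r) set" where
  "tensor_ideal A B = Idl\<^bsub>monoid_alg (A \<times>\<times> B)\<^esub> (bilinear_rels A B)"

definition tensor_alg :: "('r::comm_ring_1, 'a) module \<Rightarrow> ('r, 'b) module
    \<Rightarrow> ('r, ('r, 'a, 'b) tensor) module" where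
  "tensor_alg A B = quot_alg (monoid_alg (A \<times>\<times> B)) (tensor_ideal A B)"

definition pure_tensor :: "('r::comm_ring_1, 'a) module \<Rightarrow> ('r, 'b) module
    \<Rightarrow> 'a \<Rightarrow> 'b \<Rightarrow> ('r, 'a, 'b) tensor" where
  "pure_tensor A B a b =
     tensor_ideal A B +>\<^bsub>monoid_alg (A \<times>\<times> B)\<^esub> Poly_Mapping.single (a, b) 1"

text \<open>The linear map \<open>a \<otimes> b \<mapsto> \<phi> a b\<close> for bilinear \<open>\<phi>\<close>.\<close>

definition tensor_lift :: "('r::comm_ring_1, 'c) module \<Rightarrow> ('a \<Rightarrow> 'b \<Rightarrow> 'c)
    \<Rightarrow> ('r, 'a, 'b) tensor \<Rightarrow> 'c" where
  "tensor_lift T \<phi> X = lin_ext T (\<lambda>(a, b). \<phi> a b) (rep X)"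

definition tensor_map :: "('r::comm_ring_1, 'c) module \<Rightarrow> ('r, 'd) module
    \<Rightarrow> ('a \<Rightarrow> 'c) \<Rightarrow> ('b \<Rightarrow> 'd) \<Rightarrow> ('r, 'a, 'b) tensor \<Rightarrow> ('r, 'c, 'd) tensor" where
  "tensor_map C D f g = tensor_lift (tensor_alg C D) (\<lambda>a b. pure_tensor C D (f a) (g b))"


subsection \<open>Adic completions\<close>

text \<open>
  For a scalar \<open>h\<close>, the \<open>h\<close>-adic completion of \<open>A\<close> is the inverse limit of the algebras
  \<open>A / h^m A\<close>; for cosets \<open>z (m + 1)\<close> and \<open>z m\<close>, the inclusion below says that the former maps to
  the latter under the projection \<open>A / h^(m+1) A \<rightarrow> A / h^m A\<close>.
\<close>

type_synonym 'a hat = "nat \<Rightarrow> 'a set"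

definition scalar_ideal :: "'r::comm_ring_1 \<Rightarrow> ('r, 'a) module \<Rightarrow> nat \<Rightarrow> 'a set" where
  "scalar_ideal h A m = (\<lambda>a. h ^ m \<odot>\<^bsub>A\<^esub> a) ` carrier A"

definition completion :: "'r::comm_ring_1 \<Rightarrow> ('r, 'a) module \<Rightarrow> ('r, 'a hat) module" where
  "completion h A = (let Q = (\<lambda>m. quot_alg A (scalar_ideal h A m)) in \<lparr>
     carrier = {z. \<forall>m. z m \<in> carrier (Q m) \<and> z (Suc m) \<subseteq> z m},
     mult = (\<lambda>y z m. y m \<otimes>\<^bsub>Q m\<^esub> z m),
     one = (\<lambda>m. \<one>\<^bsub>Q m\<^esub>),
     zero = (\<lambda>m. \<zero>\<^bsub>Q m\<^esub>),
     add = (\<lambda>y z m. y m \<oplus>\<^bsub>Q m\<^esub> z m),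
     smult = (\<lambda>c z m. c \<odot>\<^bsub>Q m\<^esub> z m)\<rparr>)"

definition to_completion :: "'r::comm_ring_1 \<Rightarrow> ('r, 'a) module \<Rightarrow> 'a \<Rightarrow> 'a hat" where
  "to_completion h A a = (\<lambda>m. scalar_ideal h A m +>\<^bsub>A\<^esub> a)"

text \<open>
  The unique continuous extension to the completion of \<open>A\<close> of a linear map \<open>f\<close> from \<open>A\<close> into some
  completion: modulo \<open>h^m\<close>, the value \<open>f a\<close> depends only on \<open>a\<close> modulo \<open>h^m\<close>.
\<close>

definition hat_ext :: "('a \<Rightarrow> 'c hat) \<Rightarrow> 'a hat \<Rightarrow> 'c hat" where
  "hat_ext f z = (\<lambda>m. f (rep (z m)) m)"

definition ctensor_alg :: "'r::comm_ring_1 \<Rightarrow> ('r, 'a) module \<Rightarrow> ('r, 'b) module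
    \<Rightarrow> ('r, ('r, 'a, 'b) tensor hat) module" where
  "ctensor_alg h A B = completion h (tensor_alg A B)"

definition ctensor_map :: "'r::comm_ring_1 \<Rightarrow> ('r, 'c) module \<Rightarrow> ('r, 'd) module
    \<Rightarrow> ('a \<Rightarrow> 'c) \<Rightarrow> ('b \<Rightarrow> 'd) \<Rightarrow> ('r, 'a, 'b) tensor hat \<Rightarrow> ('r, 'c, 'd) tensor hat" where
  "ctensor_map h C D f g = hat_ext (\<lambda>x. to_completion h (tensor_alg C D) (tensor_map C D f g x))"


subsection \<open>The algebra \<open>\<Sum>m. h^(-m) J^m\<close>\<close>

definition vee_alg :: "'r::idom \<Rightarrow> ('r, 'a) module \<Rightarrow> 'a set
    \<Rightarrow> ('r, ('r, 'a, 'r fract) tensor) module" where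
  "vee_alg h A J = (tensor_alg A fract_alg)\<lparr>carrier :=
     generate (add_monoid (tensor_alg A fract_alg))
       {pure_tensor A fract_alg j (Fraction_Field.Fract 1 (h ^ m)) | j m. j \<in> ideal_pow A J m}\<rparr>"


section \<open>The quantum general linear group\<close>

type_synonym 'k laurent = "int \<Rightarrow>\<^sub>0 'k"

definition qq :: "'k::field laurent" where
  "qq = Poly_Mapping.single 1 1"

definition qq_inv :: "'k::field laurent" where
  "qq_inv = Poly_Mapping.single (- 1) 1"

abbreviation q1 :: "'k::field laurent" where
  "q1 \<equiv> qq - 1"

text \<open>
  \<open>X i j\<close> stands for \<open>x\<^sub>i\<^sub>j\<close>, \<open>Dinv\<close> for the inverse of the quantum determinant \<open>D\<^sub>q\<close> and
  \<open>D0inv\<close> for the inverse of \<open>D\<^sub>0\<close>.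
\<close>

datatype gen = X nat nat | Dinv | D0inv

type_synonym 'k word_poly = "gen list \<Rightarrow>\<^sub>0 'k laurent"

definition mat_rels :: "nat \<Rightarrow> 'k::field word_poly set" where
  "mat_rels n = (let mon = (\<lambda>w. Poly_Mapping.single w (1::'k laurent)) in
     {mon [X i j, X i k] - Poly_Mapping.single [X i k, X i j] qq
        | i j k. {i, j, k} \<subseteq> {1..n} \<and> j < k}
   \<union> {mon [X j i, X k i] - Poly_Mapping.single [X k i, X j i] qq
        | i j k. {i, j, k} \<subseteq> {1..n} \<and> j < k}
   \<union> {mon [X i j, X k l] - mon [X k l, X i j]
        | i j k l. {i, j, k, l} \<subseteq> {1..n} \<and> (i < k \<and> j > l \<or> i > k \<and> j < l)}
   \<union> {mon [X i j, X k l] - mon [X k l, X i j] - Poly_Mapping.single [X k j, X i l] (qq - qq_inv)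
        | i j k l. {i, j, k, l} \<subseteq> {1..n} \<and> i < k \<and> j < l})"

definition perm_length :: "nat \<Rightarrow> (nat \<Rightarrow> nat) \<Rightarrow> nat" where
  "perm_length r \<sigma> = card {(i, j). 1 \<le> i \<and> i < j \<and> j \<le> r \<and> \<sigma> i > \<sigma> j}"

text \<open>
  The quantum minor \<open>D\<^sup>I\<close> on the rows in \<open>I\<close> and the columns \<open>1, \<dots>, card I\<close>, as an element of the
  free algebra.  In particular \<open>qminor {1..n}\<close> is the quantum determinant \<open>D\<^sub>q\<close> and
  \<open>qminor {1..r}\<close> is \<open>D\<^sub>0\<close>.
\<close>

definition qminor :: "nat set \<Rightarrow> 'k::field word_poly" where
  "qminor I = (\<Sum>\<sigma> | \<sigma> permutes {1..card I}.
     Poly_Mapping.single (map (\<lambda>k. X (sorted_list_of_set I ! (k - 1)) (\<sigma> k)) [1..<Suc (card I)])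
       ((- qq) ^ perm_length (card I) \<sigma>))"

definition inverse_rels :: "gen set \<Rightarrow> 'k::field word_poly \<Rightarrow> gen \<Rightarrow> 'k word_poly set" where
  "inverse_rels G p g =
     {p \<otimes>\<^bsub>free_alg G\<^esub> Poly_Mapping.single [g] 1 - \<one>\<^bsub>free_alg G\<^esub>,
      Poly_Mapping.single [g] 1 \<otimes>\<^bsub>free_alg G\<^esub> p - \<one>\<^bsub>free_alg G\<^esub>}"

definition GL_gens :: "nat \<Rightarrow> gen set" where
  "GL_gens n = {X i j | i j. i \<in> {1..n} \<and> j \<in> {1..n}} \<union> {Dinv}"

definition GL_rels :: "nat \<Rightarrow> 'k::field word_poly set" where
  "GL_rels n = mat_rels n \<union> inverse_rels (GL_gens n) (qminor {1..n}) Dinv"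

definition OG :: "nat \<Rightarrow> ('k::field laurent, 'k word_poly set) module" where
  "OG n = pres_alg (GL_gens n) (GL_rels n)"

definition OG_class :: "nat \<Rightarrow> 'k::field word_poly \<Rightarrow> 'k word_poly set" where
  "OG_class n = pres_class (GL_gens n) (GL_rels n)"

abbreviation OG_gen :: "nat \<Rightarrow> gen \<Rightarrow> 'k::field word_poly set" where
  "OG_gen n g \<equiv> OG_class n (Poly_Mapping.single [g] 1)"

text \<open>\<open>D0inv\<close> is not a generator of \<open>OG n\<close>, so its value is irrelevant.\<close>

definition OG_Delta :: "nat \<Rightarrow> 'k::field word_poly set
    \<Rightarrow> ('k laurent, 'k word_poly set, 'k word_poly set) tensor" where
  "OG_Delta n = pres_hom (tensor_alg (OG n) (OG n)) (\<lambda>g. case g of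
       X i j \<Rightarrow> \<Oplus>\<^bsub>tensor_alg (OG n) (OG n)\<^esub>k\<in>{1..n}.
                  pure_tensor (OG n) (OG n) (OG_gen n (X i k)) (OG_gen n (X k j))
     | Dinv \<Rightarrow> pure_tensor (OG n) (OG n) (OG_gen n Dinv) (OG_gen n Dinv)
     | D0inv \<Rightarrow> undefined)"

text \<open>
  The counit of \<open>OG n\<close>, and at the same time its unique extension to the localization at \<open>D\<^sub>0\<close>.
\<close>

definition counit :: "'k::field word_poly set \<Rightarrow> 'k laurent" where
  "counit = pres_hom scalar_alg (\<lambda>g. case g of X i j \<Rightarrow> if i = j then 1 else 0 | _ \<Rightarrow> 1)"


subsection \<open>The localization at \<open>D\<^sub>0\<close> and the big cell\<close>

definition loc_gens :: "nat \<Rightarrow> gen set" where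
  "loc_gens n = GL_gens n \<union> {D0inv}"

definition loc_rels :: "nat \<Rightarrow> nat \<Rightarrow> 'k::field word_poly set" where
  "loc_rels n r = GL_rels n \<union> inverse_rels (loc_gens n) (qminor {1..r}) D0inv"

definition OG_loc :: "nat \<Rightarrow> nat \<Rightarrow> ('k::field laurent, 'k word_poly set) module" where
  "OG_loc n r = pres_alg (loc_gens n) (loc_rels n r)"

definition OG_loc_class :: "nat \<Rightarrow> nat \<Rightarrow> 'k::field word_poly \<Rightarrow> 'k word_poly set" where
  "OG_loc_class n r = pres_class (loc_gens n) (loc_rels n r)"

definition cell_coord :: "nat \<Rightarrow> nat \<Rightarrow> nat \<Rightarrow> nat \<Rightarrow> 'k::field word_poly set" where
  "cell_coord n r i j = ((- qq) ^ (r - j)) \<odot>\<^bsub>OG_loc n r\<^esub>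
     (OG_loc_class n r (qminor (insert i ({1..r} - {j})))
        \<otimes>\<^bsub>OG_loc n r\<^esub> OG_loc_class n r (Poly_Mapping.single [D0inv] 1))"

definition big_cell :: "nat \<Rightarrow> nat \<Rightarrow> ('k::field laurent, 'k word_poly set) module" where
  "big_cell n r = subalg_gen (OG_loc n r)
     {cell_coord n r i j | i j. 1 \<le> j \<and> j \<le> r \<and> r < i \<and> i \<le> n}"


subsection \<open>The functor \<open>\<or>\<close>\<close>

type_synonym 'k vee_elem = "('k laurent, 'k word_poly set, 'k laurent fract) tensor"

definition OG_vee :: "nat \<Rightarrow> ('k::field laurent, 'k vee_elem) module" where
  "OG_vee n = vee_alg q1 (OG n) (a_kernel (OG n) scalar_alg counit)"

definition OGP_vee :: "nat \<Rightarrow> nat \<Rightarrow> ('k::field laurent, 'k vee_elem) module" where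
  "OGP_vee n r = vee_alg q1 (big_cell n r) (a_kernel (big_cell n r) scalar_alg counit)"

abbreviation OG_base :: "nat \<Rightarrow> ('k::field laurent, 'k vee_elem) module" where
  "OG_base n \<equiv> tensor_alg (OG n) fract_alg"

abbreviation to_base :: "nat \<Rightarrow> 'k::field word_poly set \<Rightarrow> 'k vee_elem" where
  "to_base n a \<equiv> pure_tensor (OG n) fract_alg a 1"

text \<open>
  The coproduct of \<open>OG_base n = OG n \<otimes> k(q)\<close>, sending \<open>a \<otimes> c\<close> to \<open>c \<Delta>(a)\<close>.  The tensor square of
  \<open>OG_base n\<close> over \<open>k[q, q\<inverse>]\<close> coincides with the one over \<open>k(q)\<close>, and \<open>c\<close> acts on it through
  multiplication by \<open>(1 \<otimes> c) \<otimes> 1\<close>.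
\<close>

definition base_Delta :: "nat \<Rightarrow> 'k::field vee_elem
    \<Rightarrow> ('k laurent, 'k vee_elem, 'k vee_elem) tensor" where
  "base_Delta n = tensor_lift (tensor_alg (OG_base n) (OG_base n)) (\<lambda>a c.
     pure_tensor (OG_base n) (OG_base n)
         (pure_tensor (OG n) fract_alg \<one>\<^bsub>OG n\<^esub> c) \<one>\<^bsub>OG_base n\<^esub>
       \<otimes>\<^bsub>tensor_alg (OG_base n) (OG_base n)\<^esub>
     tensor_map (OG_base n) (OG_base n) (to_base n) (to_base n) (OG_Delta n a))"

text \<open>
  The coproduct of \<open>OG_vee n\<close> is the restriction of the one of \<open>OG_base n\<close>; the map from the tensor
  square of \<open>OG_vee n\<close> to the tensor square of \<open>OG_base n\<close> induced by the inclusion is injective.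
\<close>

definition vee_Delta :: "nat \<Rightarrow> 'k::field vee_elem
    \<Rightarrow> ('k laurent, 'k vee_elem, 'k vee_elem) tensor" where
  "vee_Delta n v = (SOME w. w \<in> carrier (tensor_alg (OG_vee n) (OG_vee n)) \<and>
     tensor_map (OG_base n) (OG_base n) (\<lambda>x. x) (\<lambda>x. x) w = base_Delta n v)"


subsection \<open>Completions\<close>

definition OG_hat :: "nat \<Rightarrow> ('k::field laurent, 'k vee_elem hat) module" where
  "OG_hat n = completion q1 (OG_vee n)"

definition OGP_hat :: "nat \<Rightarrow> nat \<Rightarrow> ('k::field laurent, 'k vee_elem hat) module" where
  "OGP_hat n r = completion q1 (OGP_vee n r)"

definition Delta_hat :: "nat \<Rightarrow> 'k::field vee_elem hat
    \<Rightarrow> ('k laurent, 'k vee_elem hat, 'k vee_elem hat) tensor hat" where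
  "Delta_hat n = hat_ext (\<lambda>v. to_completion q1 (tensor_alg (OG_hat n) (OG_hat n))
     (tensor_map (OG_hat n) (OG_hat n)
        (to_completion q1 (OG_vee n)) (to_completion q1 (OG_vee n)) (vee_Delta n v)))"

text \<open>
  The canonical homomorphism \<open>OG n \<rightarrow> OG_hat n\<close> and its extension to the localization, which exists
  because \<open>D\<^sub>0\<close> is invertible in \<open>OG_hat n\<close>.
\<close>

definition OG_to_hat :: "nat \<Rightarrow> 'k::field word_poly set \<Rightarrow> 'k vee_elem hat" where
  "OG_to_hat n a = to_completion q1 (OG_vee n) (to_base n a)"

definition loc_to_hat :: "nat \<Rightarrow> nat \<Rightarrow> 'k::field word_poly set \<Rightarrow> 'k vee_elem hat" where
  "loc_to_hat n r = pres_hom (OG_hat n) (\<lambda>g. case g of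
       D0inv \<Rightarrow> inv\<^bsub>OG_hat n\<^esub> (OG_to_hat n (OG_class n (qminor {1..r})))
     | _ \<Rightarrow> OG_to_hat n (OG_gen n g))"

text \<open>
  The embedding of \<open>OGP_vee n r\<close> into \<open>OG_hat n\<close>: the restriction of the \<open>k(q)\<close>-linear extension
  \<open>big_cell n r \<otimes> k(q) \<rightarrow> OG_hat n \<otimes> k(q)\<close> of \<open>loc_to_hat n r\<close>.  Since \<open>OG_hat n\<close> is torsion-free
  over \<open>k[q, q\<inverse>]\<close>, it is contained in \<open>OG_hat n \<otimes> k(q)\<close>.
\<close>

definition OGP_embed :: "nat \<Rightarrow> nat \<Rightarrow> 'k::field vee_elem \<Rightarrow> 'k vee_elem hat" where
  "OGP_embed n r y = (SOME b. b \<in> carrier (OG_hat n) \<and>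
     pure_tensor (OG_hat n) fract_alg b 1
       = tensor_map (OG_hat n) fract_alg (loc_to_hat n r) (\<lambda>c. c) y)"

definition OGP_hat_embed :: "nat \<Rightarrow> nat \<Rightarrow> 'k::field vee_elem hat \<Rightarrow> 'k vee_elem hat" where
  "OGP_hat_embed n r = hat_ext (OGP_embed n r)"

end

theory Submission
  imports Defs
begin

text \<open>
  In the completion \<open>H\<close> of \<open>OG_vee n\<close> the generic matrix \<open>x\<close> is congruent to \<open>1\<close> modulo \<open>q - 1\<close>, so the
  expansion of quantum minors along a row gives \<open>x\<^sub>l\<^sub>c = \<Sum>\<^sub>s E\<^sub>l\<^sub>s x\<^sub>s\<^sub>c\<close> for \<open>s, c \<le> r\<close>, where the \<open>n \<times> r\<close> matrix \<open>E\<close> has the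
  identity in its first \<open>r\<close> rows and the big cell coordinates \<open>t\<^sub>l\<^sub>s\<close> below.  Inserting this into the second
  factor of \<open>\<Delta>(x\<^sub>l\<^sub>c) = \<Sum>\<^sub>k x\<^sub>l\<^sub>k \<otimes> x\<^sub>k\<^sub>c\<close> yields \<open>\<Delta>(x\<^sub>l\<^sub>c) = \<Sum>\<^sub>t C\<^sub>l\<^sub>t (1 \<otimes> x\<^sub>t\<^sub>c)\<close> with \<open>C\<^sub>l\<^sub>t = \<Sum>\<^sub>k x\<^sub>l\<^sub>k \<otimes> E\<^sub>k\<^sub>t\<close>, an element
  of the completed tensor product with the completed big cell, whereas applying \<open>\<Delta>\<close> to the factorization itself yields
  \<open>\<Delta>(x\<^sub>l\<^sub>c) = \<Sum>\<^sub>s \<Delta>(E\<^sub>l\<^sub>s) \<Delta>(x\<^sub>s\<^sub>c)\<close>.  Cancelling the invertible matrix \<open>(1 \<otimes> x\<^sub>t\<^sub>c)\<close> leaves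
  \<open>\<Sum>\<^sub>s \<Delta>(E\<^sub>l\<^sub>s) C\<^sub>s\<^sub>t = C\<^sub>l\<^sub>t\<close>.  The upper block of \<open>C\<close> is congruent to \<open>1\<close> and its lower block to \<open>0\<close> modulo
  \<open>q - 1\<close>, so this linear system can be solved for \<open>(q - 1)\<^sup>-\<^sup>1 \<Delta>(t\<^sub>l\<^sub>s)\<close>, which therefore lies in the image of the
  completed tensor product.  As the \<open>(q - 1)\<^sup>-\<^sup>1 t\<^sub>l\<^sub>s\<close> generate \<open>OGP_vee n r\<close>, successive approximation extends this to the
  completion.

  The tensor products are formed over \<open>k[q, q\<^sup>-\<^sup>1]\<close>, which is not local at \<open>q = 1\<close>.  The ambiguity in
  the coproduct of \<open>OG_vee n\<close> is torsion in a module without \<open>(q - 1)\<close>-torsion, hence infinitely divisible by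
  \<open>q - 1\<close>, and it vanishes in the completion.
\<close>

section \<open>Noncommutative algebras\<close>

text \<open>The direct route would compute \<Delta>(t_is) from \<Delta>(D^I) and the inverse of
  \<Delta>(D_0). That calls for a quantum Cauchy-Binet formula for rectangular minors. Working with
  the matrix entries avoids it: the only minor whose coproduct is computed is D_q, because \<Delta>
  has to be defined on its inverse. Two features shape the argument. The claim concerns the image of
  a map F between completed tensor products, so the linear system is solved upstairs, in the source
  of F, and the solution is identified with the coproduct by uniqueness downstairs, in the target.
  Moreover the generators are (q-1)^{-1} t_is rather than t_is, which leaves one division by q - 1.
  It is possible because the right-hand side of the system is divisible by q - 1 upstairs and the
  target has no (q-1)-torsion; the latter rests on a theorem about tensor products of torsion-free
  modules. All systems are for row vectors with the matrix on the right, as the noncommutative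
  factorization dictates.\<close>

locale ralg = ring A for A :: "('r::comm_ring_1, 'a) module" (structure) +
  assumes smult_closed [simp, intro]: "a \<in> carrier A \<Longrightarrow> c \<odot> a \<in> carrier A"
    and smult_l_distr: "a \<in> carrier A \<Longrightarrow> (c + d) \<odot> a = c \<odot> a \<oplus> d \<odot> a"
    and smult_r_distr: "a \<in> carrier A \<Longrightarrow> b \<in> carrier A \<Longrightarrow> c \<odot> (a \<oplus> b) = c \<odot> a \<oplus> c \<odot> b"
    and smult_assoc: "a \<in> carrier A \<Longrightarrow> (c * d) \<odot> a = c \<odot> (d \<odot> a)"
    and smult_one [simp]: "a \<in> carrier A \<Longrightarrow> 1 \<odot> a = a"
    and smult_mult_l: "a \<in> carrier A \<Longrightarrow> b \<in> carrier A \<Longrightarrow> (c \<odot> a) \<otimes> b = c \<odot> (a \<otimes> b)"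
    and smult_mult_r: "a \<in> carrier A \<Longrightarrow> b \<in> carrier A \<Longrightarrow> a \<otimes> (c \<odot> b) = c \<odot> (a \<otimes> b)"
begin

lemma ralg: "ralg A" by (rule ralg_axioms)

lemma smult_zero_l [simp]: "a \<in> carrier A \<Longrightarrow> 0 \<odot> a = \<zero>"
  by (metis add.r_cancel_one add_0 smult_closed smult_l_distr)

lemma smult_zero_r [simp]: "c \<odot> \<zero> = \<zero>"
  by (metis add.r_cancel_one l_zero smult_closed smult_r_distr zero_closed)

lemma smult_minus_r: "a \<in> carrier A \<Longrightarrow> c \<odot> (\<ominus> a) = \<ominus> (c \<odot> a)"
  by (metis a_inv_closed minus_equality r_neg add.inv_comm smult_closed smult_r_distr smult_zero_r)

lemma smult_minus_l: "a \<in> carrier A \<Longrightarrow> (- c) \<odot> a = \<ominus> (c \<odot> a)"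
  by (metis add.left_inverse minus_equality smult_closed smult_l_distr smult_zero_l)

lemma smult_minus_one: "a \<in> carrier A \<Longrightarrow> (- 1) \<odot> a = \<ominus> a"
  by (simp add: smult_minus_l)

lemma smult_diff_r: "a \<in> carrier A \<Longrightarrow> b \<in> carrier A \<Longrightarrow> c \<odot> (a \<ominus> b) = c \<odot> a \<ominus> c \<odot> b"
  by (simp add: a_minus_def smult_minus_r smult_r_distr)

lemma smult_diff_l: "a \<in> carrier A \<Longrightarrow> (c - d) \<odot> a = c \<odot> a \<ominus> d \<odot> a"
  using smult_l_distr[of a c "- d"] by (simp add: a_minus_def smult_minus_l)

lemma smult_commute: "a \<in> carrier A \<Longrightarrow> c \<odot> (d \<odot> a) = d \<odot> (c \<odot> a)"
  by (simp flip: smult_assoc add: mult.commute)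

lemma smult_finsum:
  "f \<in> S \<rightarrow> carrier A \<Longrightarrow> c \<odot> (\<Oplus>i\<in>S. f i) = (\<Oplus>i\<in>S. c \<odot> f i)"
proof (induction S rule: infinite_finite_induct)
  case (insert x F)
  then have "f \<in> F \<rightarrow> carrier A" "f x \<in> carrier A" by auto
  moreover have "(\<lambda>i. c \<odot> f i) \<in> F \<rightarrow> carrier A" using calculation by auto
  ultimately show ?case using insert by (simp add: smult_r_distr finsum_closed)
qed auto

lemma minus_self_eq: "a \<in> carrier A \<Longrightarrow> b \<in> carrier A \<Longrightarrow> a \<ominus> b = \<zero> \<longleftrightarrow> a = b"
  by (simp add: a_minus_def) (metis a_inv_closed minus_equality minus_minus r_neg)

end

text \<open>Conditions are imposed on the carrier only. Hence one function, such as the identity,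
  can be linear between several carriers, and inclusions of subalgebras need no maps of their
  own.\<close>

definition lin :: "('r, 'a) module \<Rightarrow> ('r, 'b) module \<Rightarrow> ('a \<Rightarrow> 'b) \<Rightarrow> bool" where
  "lin A B f \<longleftrightarrow> f \<in> carrier A \<rightarrow> carrier B \<and>
     (\<forall>a\<in>carrier A. \<forall>b\<in>carrier A. f (a \<oplus>\<^bsub>A\<^esub> b) = f a \<oplus>\<^bsub>B\<^esub> f b) \<and>
     (\<forall>c. \<forall>a\<in>carrier A. f (c \<odot>\<^bsub>A\<^esub> a) = c \<odot>\<^bsub>B\<^esub> f a)"

definition ahom :: "('r, 'a) module \<Rightarrow> ('r, 'b) module \<Rightarrow> ('a \<Rightarrow> 'b) \<Rightarrow> bool" where
  "ahom A B f \<longleftrightarrow> lin A B f \<and> f \<one>\<^bsub>A\<^esub> = \<one>\<^bsub>B\<^esub> \<and>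
     (\<forall>a\<in>carrier A. \<forall>b\<in>carrier A. f (a \<otimes>\<^bsub>A\<^esub> b) = f a \<otimes>\<^bsub>B\<^esub> f b)"

lemma linI:
  assumes "\<And>a. a \<in> carrier A \<Longrightarrow> f a \<in> carrier B"
    and "\<And>a b. a \<in> carrier A \<Longrightarrow> b \<in> carrier A \<Longrightarrow> f (a \<oplus>\<^bsub>A\<^esub> b) = f a \<oplus>\<^bsub>B\<^esub> f b"
    and "\<And>c a. a \<in> carrier A \<Longrightarrow> f (c \<odot>\<^bsub>A\<^esub> a) = c \<odot>\<^bsub>B\<^esub> f a"
  shows "lin A B f"
  using assms by (auto simp: lin_def)

lemma linD:
  assumes "lin A B f"
  shows "a \<in> carrier A \<Longrightarrow> f a \<in> carrier B"
    and "a \<in> carrier A \<Longrightarrow> b \<in> carrier A \<Longrightarrow> f (a \<oplus>\<^bsub>A\<^esub> b) = f a \<oplus>\<^bsub>B\<^esub> f b"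
    and "a \<in> carrier A \<Longrightarrow> f (c \<odot>\<^bsub>A\<^esub> a) = c \<odot>\<^bsub>B\<^esub> f a"
  using assms by (auto simp: lin_def)

lemma ahomI:
  assumes "lin A B f" and "f \<one>\<^bsub>A\<^esub> = \<one>\<^bsub>B\<^esub>"
    and "\<And>a b. a \<in> carrier A \<Longrightarrow> b \<in> carrier A \<Longrightarrow> f (a \<otimes>\<^bsub>A\<^esub> b) = f a \<otimes>\<^bsub>B\<^esub> f b"
  shows "ahom A B f"
  using assms by (auto simp: ahom_def)

lemma ahomD:
  assumes "ahom A B f"
  shows "lin A B f" "f \<one>\<^bsub>A\<^esub> = \<one>\<^bsub>B\<^esub>"
    and "a \<in> carrier A \<Longrightarrow> f a \<in> carrier B"
    and "a \<in> carrier A \<Longrightarrow> b \<in> carrier A \<Longrightarrow> f (a \<oplus>\<^bsub>A\<^esub> b) = f a \<oplus>\<^bsub>B\<^esub> f b"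
    and "a \<in> carrier A \<Longrightarrow> f (c \<odot>\<^bsub>A\<^esub> a) = c \<odot>\<^bsub>B\<^esub> f a"
    and "a \<in> carrier A \<Longrightarrow> b \<in> carrier A \<Longrightarrow> f (a \<otimes>\<^bsub>A\<^esub> b) = f a \<otimes>\<^bsub>B\<^esub> f b"
  using assms by (auto simp: ahom_def lin_def)

lemma lin_comp: "lin A B f \<Longrightarrow> lin B C g \<Longrightarrow> lin A C (\<lambda>x. g (f x))"
  by (auto simp: lin_def Pi_iff)

lemma ahom_comp: "ahom A B f \<Longrightarrow> ahom B C g \<Longrightarrow> ahom A C (\<lambda>x. g (f x))"
  by (auto simp: ahom_def lin_def Pi_iff)

lemma ahom_id: "ahom A A (\<lambda>x. x)"
  by (auto simp: ahom_def lin_def)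

lemma lin_zero: assumes "ralg A" "ralg B" "lin A B f" shows "f \<zero>\<^bsub>A\<^esub> = \<zero>\<^bsub>B\<^esub>"
proof -
  interpret A: ralg A by fact
  interpret B: ralg B by fact
  show ?thesis using linD(1)[OF assms(3) A.zero_closed] linD(3)[OF assms(3) A.zero_closed, of 0] by simp
qed

lemma lin_minus:
  assumes "ralg A" "ralg B" "lin A B f" "a \<in> carrier A" shows "f (\<ominus>\<^bsub>A\<^esub> a) = \<ominus>\<^bsub>B\<^esub> f a"
proof -
  interpret A: ralg A by fact
  interpret B: ralg B by fact
  show ?thesis using linD[OF assms(3)] assms(4)
    by (simp flip: A.smult_minus_one B.smult_minus_one)
qed

lemma lin_diff:
  assumes "ralg A" "ralg B" "lin A B f" "a \<in> carrier A" "b \<in> carrier A"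
  shows "f (a \<ominus>\<^bsub>A\<^esub> b) = f a \<ominus>\<^bsub>B\<^esub> f b"
proof -
  interpret A: ralg A by fact
  interpret B: ralg B by fact
  show ?thesis using linD[OF assms(3)] assms
    by (simp add: a_minus_def lin_minus)
qed

lemma lin_finsum:
  assumes "ralg A" "ralg B" "lin A B f"
  shows "g \<in> S \<rightarrow> carrier A \<Longrightarrow> f (finsum A g S) = finsum B (\<lambda>i. f (g i)) S"
proof (induction S rule: infinite_finite_induct)
  case (infinite S)
  interpret A: ralg A by fact
  interpret B: ralg B by fact
  show ?case using infinite by (simp add: lin_zero[OF assms])
next
  case empty
  interpret A: ralg A by fact
  interpret B: ralg B by fact
  show ?case by (simp add: lin_zero[OF assms])
next
  case (insert x F)
  interpret A: ralg A by fact
  interpret B: ralg B by fact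
  from insert.prems have g: "g \<in> F \<rightarrow> carrier A" "g x \<in> carrier A" by auto
  then have "(\<lambda>i. f (g i)) \<in> F \<rightarrow> carrier B" using linD(1)[OF assms(3)] by auto
  then show ?case using insert g linD[OF assms(3)]
    by (simp add: A.finsum_closed)
qed

text \<open>Kept as a predicate on sets, since generation is always proved by showing that the
  elements with a desired property form such a set. Zero and negatives are the multiples by 0 and
  -1.\<close>

definition subalg :: "('r::comm_ring_1, 'a) module \<Rightarrow> 'a set \<Rightarrow> bool" where
  "subalg A Q \<longleftrightarrow> Q \<subseteq> carrier A \<and> \<one>\<^bsub>A\<^esub> \<in> Q \<and> (\<forall>c. \<forall>a\<in>Q. c \<odot>\<^bsub>A\<^esub> a \<in> Q) \<and>
     (\<forall>a\<in>Q. \<forall>b\<in>Q. a \<oplus>\<^bsub>A\<^esub> b \<in> Q) \<and> (\<forall>a\<in>Q. \<forall>b\<in>Q. a \<otimes>\<^bsub>A\<^esub> b \<in> Q)"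

lemma subalgI:
  assumes "Q \<subseteq> carrier A" "\<one>\<^bsub>A\<^esub> \<in> Q" "\<And>c a. a \<in> Q \<Longrightarrow> c \<odot>\<^bsub>A\<^esub> a \<in> Q"
    "\<And>a b. a \<in> Q \<Longrightarrow> b \<in> Q \<Longrightarrow> a \<oplus>\<^bsub>A\<^esub> b \<in> Q" "\<And>a b. a \<in> Q \<Longrightarrow> b \<in> Q \<Longrightarrow> a \<otimes>\<^bsub>A\<^esub> b \<in> Q"
  shows "subalg A Q"
  using assms by (auto simp: subalg_def)

lemma subalgD:
  assumes "subalg A Q"
  shows "a \<in> Q \<Longrightarrow> a \<in> carrier A" "\<one>\<^bsub>A\<^esub> \<in> Q" "a \<in> Q \<Longrightarrow> c \<odot>\<^bsub>A\<^esub> a \<in> Q"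
    "a \<in> Q \<Longrightarrow> b \<in> Q \<Longrightarrow> a \<oplus>\<^bsub>A\<^esub> b \<in> Q" "a \<in> Q \<Longrightarrow> b \<in> Q \<Longrightarrow> a \<otimes>\<^bsub>A\<^esub> b \<in> Q"
  using assms by (auto simp: subalg_def)

lemma subalg_zero: assumes "ralg A" "subalg A Q" shows "\<zero>\<^bsub>A\<^esub> \<in> Q"
proof -
  interpret A: ralg A by fact
  show ?thesis using subalgD(3)[OF assms(2) subalgD(2)[OF assms(2)], of 0] by simp
qed

lemma subalg_minus: assumes "ralg A" "subalg A Q" "a \<in> Q" shows "\<ominus>\<^bsub>A\<^esub> a \<in> Q"
proof -
  interpret A: ralg A by fact
  have "(-1) \<odot>\<^bsub>A\<^esub> a \<in> Q" using assms by (simp add: subalg_def)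
  then show ?thesis using A.smult_minus_one[of a] assms(3) subalgD(1)[OF assms(2)] by simp
qed

lemma ralg_subalg: assumes "ralg A" "subalg A Q" shows "ralg (A\<lparr>carrier := Q\<rparr>)"
proof -
  interpret A: ralg A by fact
  note Q = subalgD[OF assms(2)]
  show ?thesis
  proof (intro ralg.intro ringI)
    show "abelian_group (A\<lparr>carrier := Q\<rparr>)"
    proof (rule abelian_groupI)
      fix x assume "x \<in> carrier (A\<lparr>carrier := Q\<rparr>)"
      then show "\<exists>y\<in>carrier (A\<lparr>carrier := Q\<rparr>). y \<oplus>\<^bsub>A\<lparr>carrier := Q\<rparr>\<^esub> x = \<zero>\<^bsub>A\<lparr>carrier := Q\<rparr>\<^esub>"
        by (intro bexI[of _ "\<ominus>\<^bsub>A\<^esub> x"]) (auto simp: subalg_minus[OF assms] Q A.l_neg)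
    qed (auto simp: Q subalg_zero[OF assms] A.a_ac)
    show "Group.monoid (A\<lparr>carrier := Q\<rparr>)"
      by (rule monoidI) (auto simp: Q A.m_assoc)
    show "ralg_axioms (A\<lparr>carrier := Q\<rparr>)"
      by unfold_locales (auto simp: Q A.smult_l_distr A.smult_r_distr A.smult_assoc A.smult_mult_l A.smult_mult_r)
  qed (auto simp: Q A.l_distr A.r_distr)
qed

text \<open>Supplies the sets to which the generation lemmas are applied: a property of the form
  "the image lies in \<open>Q\<close>" holds on the whole algebra once it holds for
  generators.\<close>

lemma subalg_preimage:
  assumes "ralg A" "ralg B" "ahom A B f" "subalg B Q"
  shows "subalg A {a \<in> carrier A. f a \<in> Q}"
proof -
  interpret A: ralg A by fact
  show ?thesis
    using ahomD[OF assms(3)] subalgD[OF assms(4)] by (intro subalgI) auto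
qed

lemma subalg_image:
  assumes "ralg A" "ralg B" "ahom A B f"
  shows "subalg B (f ` carrier A)"
proof -
  interpret A: ralg A by fact
  note f = ahomD[OF assms(3)]
  show ?thesis
  proof (rule subalgI)
    show "\<one>\<^bsub>B\<^esub> \<in> f ` carrier A" using f(2) A.one_closed by (metis image_eqI)
  next
    fix c a assume "a \<in> f ` carrier A"
    then obtain x where "x \<in> carrier A" "a = f x" by auto
    then show "c \<odot>\<^bsub>B\<^esub> a \<in> f ` carrier A" using f(5)[of x c] by (metis A.smult_closed image_eqI)
  next
    fix a b assume "a \<in> f ` carrier A" "b \<in> f ` carrier A"
    then obtain x y where "x \<in> carrier A" "a = f x" "y \<in> carrier A" "b = f y" by auto
    then show "a \<oplus>\<^bsub>B\<^esub> b \<in> f ` carrier A" "a \<otimes>\<^bsub>B\<^esub> b \<in> f ` carrier A"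
      using f(4)[of x y] f(6)[of x y] by (metis A.add.m_closed image_eqI, metis A.m_closed image_eqI)
  qed (use f in auto)
qed

section \<open>Monoid algebras and linear extension\<close>

text \<open>Additive induction, by removing one key at a time. The new monomial may overlap with the
  support of \<open>p\<close>, so the step carries no freshness condition and follows from
  additivity of the statement.\<close>

lemma pm_induct [consumes 1, case_names zero add]:
  fixes p :: "'m \<Rightarrow>\<^sub>0 'r::ab_group_add"
  assumes "Poly_Mapping.keys p \<subseteq> U" and "P 0"
    and "\<And>x c p. x \<in> U \<Longrightarrow> Poly_Mapping.keys p \<subseteq> U \<Longrightarrow> P p \<Longrightarrow> P (Poly_Mapping.single x c + p)"
  shows "P p"
proof -
  have "\<forall>p. card (Poly_Mapping.keys p) = n \<longrightarrow> Poly_Mapping.keys p \<subseteq> U \<longrightarrow> P p" for n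
  proof (induction n)
    case 0
    then show ?case using assms(2) by (auto simp: keys_eq_empty)
  next
    case (Suc n)
    show ?case
    proof (intro allI impI)
      fix p :: "'m \<Rightarrow>\<^sub>0 'r"
      assume p: "card (Poly_Mapping.keys p) = Suc n" "Poly_Mapping.keys p \<subseteq> U"
      then obtain x where x: "x \<in> Poly_Mapping.keys p" by fastforce
      define q where "q = p - Poly_Mapping.single x (Poly_Mapping.lookup p x)"
      have lq: "Poly_Mapping.lookup q y = (if y = x then 0 else Poly_Mapping.lookup p y)" for y
        by (simp add: q_def lookup_minus lookup_single)
      have kq: "Poly_Mapping.keys q = Poly_Mapping.keys p - {x}"
        by (auto simp: in_keys_iff lq split: if_splits)
      then have "card (Poly_Mapping.keys q) = n" "Poly_Mapping.keys q \<subseteq> U" using p x by auto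
      then have "P q" using Suc by blast
      then have "P (Poly_Mapping.single x (Poly_Mapping.lookup p x) + q)"
        using assms(3) x p kq by blast
      then show "P p" by (simp add: q_def)
    qed
  qed
  then show ?thesis using assms(1) by blast
qed

lemma lookup_map_mult [simp]:
  "Poly_Mapping.lookup (Poly_Mapping.map ((*) c) p) x = c * Poly_Mapping.lookup p (x :: 'm)"
  for c :: "'r::mult_zero"
  by (simp add: map.rep_eq when_def)

lemma map_mult_single [simp]:
  "Poly_Mapping.map ((*) c) (Poly_Mapping.single x d) = Poly_Mapping.single x (c * d)" for c :: "'r::mult_zero"
  by (rule poly_mapping_eqI) (simp add: lookup_single when_def)

lemma map_mult_zero [simp]: "Poly_Mapping.map ((*) c) 0 = 0" for c :: "'r::mult_zero"
  by (rule poly_mapping_eqI) simp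

lemma keys_map_mult: "Poly_Mapping.keys (Poly_Mapping.map ((*) c) p) \<subseteq> Poly_Mapping.keys p"
  for c :: "'r::mult_zero"
  by (auto simp: in_keys_iff)

lemma map_mult_add: "Poly_Mapping.map ((*) c) (p + q) = Poly_Mapping.map ((*) c) p + Poly_Mapping.map ((*) c) q"
  for c :: "'r::comm_ring_1"
  by (rule poly_mapping_eqI) (simp add: lookup_add distrib_left)

lemma keys_add_subset: "Poly_Mapping.keys p \<subseteq> U \<Longrightarrow> Poly_Mapping.keys q \<subseteq> U \<Longrightarrow> Poly_Mapping.keys (p + q) \<subseteq> U"
  using Poly_Mapping.keys_add[of p q] by blast

lemma keys_minus_subset: "Poly_Mapping.keys p \<subseteq> U \<Longrightarrow> Poly_Mapping.keys q \<subseteq> U \<Longrightarrow> Poly_Mapping.keys (p - q) \<subseteq> U"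
  for p q :: "'m \<Rightarrow>\<^sub>0 'r::ab_group_add"
proof
  fix x assume "x \<in> Poly_Mapping.keys (p - q)"
  then have "x \<in> Poly_Mapping.keys p \<or> x \<in> Poly_Mapping.keys q" by (auto simp: in_keys_iff lookup_minus)
  then show "Poly_Mapping.keys p \<subseteq> U \<Longrightarrow> Poly_Mapping.keys q \<subseteq> U \<Longrightarrow> x \<in> U" by auto
qed

lemma keys_single_subset: "x \<in> U \<Longrightarrow> Poly_Mapping.keys (Poly_Mapping.single x c) \<subseteq> U"
  by auto

section \<open>Linear extension of a map on a basis\<close>

context ralg begin

text \<open>The index set in \<open>lin_ext\<close> is the support of \<open>p\<close>, which can
  shrink when terms cancel. Summing over a fixed larger set adds only zero terms and lets different
  arguments be compared.\<close>

lemma lin_ext_superset: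
  assumes "\<phi> \<in> U \<rightarrow> carrier A" "finite S" "Poly_Mapping.keys p \<subseteq> S" "S \<subseteq> U"
  shows "lin_ext A \<phi> p = (\<Oplus>m\<in>S. Poly_Mapping.lookup p m \<odot> \<phi> m)"
  unfolding lin_ext_def
proof (rule add.finprod_mono_neutral_cong_left)
  fix i assume "i \<in> S - Poly_Mapping.keys p"
  moreover from this have "\<phi> i \<in> carrier A" using assms by auto
  ultimately show "Poly_Mapping.lookup p i \<odot> \<phi> i = \<zero>" by (simp add: in_keys_iff)
qed (use assms in auto)

lemma lin_ext_closed:
  assumes "\<phi> \<in> U \<rightarrow> carrier A" "Poly_Mapping.keys p \<subseteq> U"
  shows "lin_ext A \<phi> p \<in> carrier A"
  unfolding lin_ext_def using assms by (intro finsum_closed) auto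

lemma lin_ext_zero [simp]: "lin_ext A \<phi> 0 = \<zero>"
  by (simp add: lin_ext_def)

lemma lin_ext_single:
  assumes "\<phi> x \<in> carrier A" shows "lin_ext A \<phi> (Poly_Mapping.single x c) = c \<odot> \<phi> x"
proof -
  have "lin_ext A \<phi> (Poly_Mapping.single x c) = (\<Oplus>m\<in>{x}. Poly_Mapping.lookup (Poly_Mapping.single x c) m \<odot> \<phi> m)"
    by (rule lin_ext_superset[of _ "{x}"]) (use assms in auto)
  then show ?thesis using assms by simp
qed

lemma lin_ext_add:
  assumes "\<phi> \<in> U \<rightarrow> carrier A" "Poly_Mapping.keys p \<subseteq> U" "Poly_Mapping.keys q \<subseteq> U"
  shows "lin_ext A \<phi> (p + q) = lin_ext A \<phi> p \<oplus> lin_ext A \<phi> q"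
proof -
  let ?S = "Poly_Mapping.keys p \<union> Poly_Mapping.keys q"
  have fin: "finite ?S" "?S \<subseteq> U" using assms by auto
  have "lin_ext A \<phi> (p + q) = (\<Oplus>m\<in>?S. Poly_Mapping.lookup (p + q) m \<odot> \<phi> m)"
    using Poly_Mapping.keys_add[of p q] by (intro lin_ext_superset[OF assms(1) fin(1) _ fin(2)]) auto
  also have "\<dots> = (\<Oplus>m\<in>?S. Poly_Mapping.lookup p m \<odot> \<phi> m \<oplus> Poly_Mapping.lookup q m \<odot> \<phi> m)"
    using assms fin by (intro finsum_cong') (auto simp: lookup_add smult_l_distr Pi_iff)
  also have "\<dots> = (\<Oplus>m\<in>?S. Poly_Mapping.lookup p m \<odot> \<phi> m) \<oplus> (\<Oplus>m\<in>?S. Poly_Mapping.lookup q m \<odot> \<phi> m)"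
    using assms fin by (intro finsum_addf) auto
  also have "\<dots> = lin_ext A \<phi> p \<oplus> lin_ext A \<phi> q"
    using lin_ext_superset[OF assms(1) fin(1) _ fin(2)] by simp
  finally show ?thesis .
qed

lemma lin_ext_smult:
  assumes "\<phi> \<in> U \<rightarrow> carrier A" "Poly_Mapping.keys p \<subseteq> U"
  shows "lin_ext A \<phi> (Poly_Mapping.map ((*) c) p) = c \<odot> lin_ext A \<phi> p"
proof -
  have "lin_ext A \<phi> (Poly_Mapping.map ((*) c) p)
      = (\<Oplus>m\<in>Poly_Mapping.keys p. Poly_Mapping.lookup (Poly_Mapping.map ((*) c) p) m \<odot> \<phi> m)"
    by (intro lin_ext_superset[OF assms(1) _ keys_map_mult assms(2)]) auto
  also have "\<dots> = (\<Oplus>m\<in>Poly_Mapping.keys p. c \<odot> (Poly_Mapping.lookup p m \<odot> \<phi> m))"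
    using assms by (intro finsum_cong') (auto simp: smult_assoc Pi_iff)
  also have "\<dots> = c \<odot> lin_ext A \<phi> p"
    unfolding lin_ext_def using assms by (intro smult_finsum[symmetric]) auto
  finally show ?thesis .
qed

end

section \<open>Monoid algebras\<close>

lemma monoid_alg_simps:
  "carrier (monoid_alg M) = {f. Poly_Mapping.keys f \<subseteq> carrier M}"
  "\<one>\<^bsub>monoid_alg M\<^esub> = Poly_Mapping.single \<one>\<^bsub>M\<^esub> 1"
  "\<zero>\<^bsub>monoid_alg M\<^esub> = 0"
  "p \<oplus>\<^bsub>monoid_alg M\<^esub> q = p + q"
  "c \<odot>\<^bsub>monoid_alg M\<^esub> p = Poly_Mapping.map ((*) c) p"
  by (simp_all add: monoid_alg_def)

text \<open>As for \<open>lin_ext\<close>: with common finite index sets \<open>S\<close> and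
  \<open>T\<close> the double sum becomes visibly additive in each factor.\<close>

lemma monoid_alg_mult_superset:
  assumes "finite S" "finite T" "Poly_Mapping.keys p \<subseteq> S" "Poly_Mapping.keys q \<subseteq> T"
  shows "p \<otimes>\<^bsub>monoid_alg M\<^esub> q = (\<Sum>x\<in>S. \<Sum>y\<in>T.
    Poly_Mapping.single (x \<otimes>\<^bsub>M\<^esub> y) (Poly_Mapping.lookup p x * Poly_Mapping.lookup q y))"
proof -
  have "p \<otimes>\<^bsub>monoid_alg M\<^esub> q = (\<Sum>x\<in>Poly_Mapping.keys p. \<Sum>y\<in>Poly_Mapping.keys q.
    Poly_Mapping.single (x \<otimes>\<^bsub>M\<^esub> y) (Poly_Mapping.lookup p x * Poly_Mapping.lookup q y))"
    by (simp add: monoid_alg_def)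
  also have "\<dots> = (\<Sum>x\<in>Poly_Mapping.keys p. \<Sum>y\<in>T.
    Poly_Mapping.single (x \<otimes>\<^bsub>M\<^esub> y) (Poly_Mapping.lookup p x * Poly_Mapping.lookup q y))"
    using assms by (intro sum.cong refl sum.mono_neutral_left) (auto simp: in_keys_iff)
  also have "\<dots> = (\<Sum>x\<in>S. \<Sum>y\<in>T.
    Poly_Mapping.single (x \<otimes>\<^bsub>M\<^esub> y) (Poly_Mapping.lookup p x * Poly_Mapping.lookup q y))"
    using assms by (intro sum.mono_neutral_left) (auto simp: in_keys_iff)
  finally show ?thesis .
qed

lemma monoid_alg_mult_add:
  "(p + p') \<otimes>\<^bsub>monoid_alg M\<^esub> q = p \<otimes>\<^bsub>monoid_alg M\<^esub> q + p' \<otimes>\<^bsub>monoid_alg M\<^esub> q"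
  "q \<otimes>\<^bsub>monoid_alg M\<^esub> (p + p') = q \<otimes>\<^bsub>monoid_alg M\<^esub> p + q \<otimes>\<^bsub>monoid_alg M\<^esub> p'"
proof -
  let ?S = "Poly_Mapping.keys p \<union> Poly_Mapping.keys p'"
  let ?T = "Poly_Mapping.keys q"
  have *: "Poly_Mapping.keys (p + p') \<subseteq> ?S" by (rule Poly_Mapping.keys_add)
  note m = monoid_alg_mult_superset[of ?S ?T] monoid_alg_mult_superset[of ?T ?S]
  show "(p + p') \<otimes>\<^bsub>monoid_alg M\<^esub> q = p \<otimes>\<^bsub>monoid_alg M\<^esub> q + p' \<otimes>\<^bsub>monoid_alg M\<^esub> q"
    by (subst (1 2 3) m(1)) (use * in \<open>auto simp: lookup_add distrib_right single_add sum.distrib\<close>)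
  show "q \<otimes>\<^bsub>monoid_alg M\<^esub> (p + p') = q \<otimes>\<^bsub>monoid_alg M\<^esub> p + q \<otimes>\<^bsub>monoid_alg M\<^esub> p'"
    by (subst (1 2 3) m(2)) (use * in \<open>auto simp: lookup_add distrib_left single_add sum.distrib\<close>)
qed

lemma monoid_alg_mult_zero [simp]:
  "0 \<otimes>\<^bsub>monoid_alg M\<^esub> q = 0" "q \<otimes>\<^bsub>monoid_alg M\<^esub> 0 = 0"
  by (simp_all add: monoid_alg_def)

lemma monoid_alg_mult_single [simp]:
  "Poly_Mapping.single x c \<otimes>\<^bsub>monoid_alg M\<^esub> Poly_Mapping.single y d = Poly_Mapping.single (x \<otimes>\<^bsub>M\<^esub> y) (c * d)"
  by (subst monoid_alg_mult_superset[of "{x}" "{y}"]) auto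

text \<open>Distributivity reduces each multiplicative axiom to monomials, where it is the
  corresponding law of \<open>M\<close>; the nested inductions peel off one argument after
  another.\<close>

lemma ralg_monoid_alg:
  assumes "Group.monoid M" shows "ralg (monoid_alg M :: ('r::comm_ring_1, 'm \<Rightarrow>\<^sub>0 'r) module)"
proof -
  interpret M: Group.monoid M by fact
  let ?A = "monoid_alg M :: ('r, 'm \<Rightarrow>\<^sub>0 'r) module"
  let ?C = "\<lambda>p :: 'm \<Rightarrow>\<^sub>0 'r. Poly_Mapping.keys p \<subseteq> carrier M"
  note add = monoid_alg_mult_add
  have closed: "?C (p \<otimes>\<^bsub>?A\<^esub> q)" if "?C p" "?C q" for p q
    using that(1)
  proof (induction p rule: pm_induct)
    case (add x c p)
    have "?C (Poly_Mapping.single x c \<otimes>\<^bsub>?A\<^esub> q)" using that(2)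
    proof (induction q rule: pm_induct)
      case (add y d q)
      then show ?case using \<open>x \<in> carrier M\<close> unfolding monoid_alg_mult_add monoid_alg_mult_single
        by (intro keys_add_subset keys_single_subset) auto
    qed simp
    then show ?case using add(3) by (simp add: monoid_alg_mult_add keys_add_subset)
  qed simp
  have assoc: "(p \<otimes>\<^bsub>?A\<^esub> q) \<otimes>\<^bsub>?A\<^esub> s = p \<otimes>\<^bsub>?A\<^esub> (q \<otimes>\<^bsub>?A\<^esub> s)" if "?C p" "?C q" "?C s" for p q s
    using that(1)
  proof (induction p rule: pm_induct)
    case (add x c p)
    have "(Poly_Mapping.single x c \<otimes>\<^bsub>?A\<^esub> q) \<otimes>\<^bsub>?A\<^esub> s = Poly_Mapping.single x c \<otimes>\<^bsub>?A\<^esub> (q \<otimes>\<^bsub>?A\<^esub> s)"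
      using that(2)
    proof (induction q rule: pm_induct)
      case (add y d q)
      have "(Poly_Mapping.single x c \<otimes>\<^bsub>?A\<^esub> Poly_Mapping.single y d) \<otimes>\<^bsub>?A\<^esub> s
          = Poly_Mapping.single x c \<otimes>\<^bsub>?A\<^esub> (Poly_Mapping.single y d \<otimes>\<^bsub>?A\<^esub> s)"
        using that(3)
        by (induction s rule: pm_induct)
           (use \<open>x \<in> carrier M\<close> \<open>y \<in> carrier M\<close> in \<open>auto simp: monoid_alg_mult_add M.m_assoc mult.assoc\<close>)
      then show ?case using add(3) by (simp only: monoid_alg_mult_add)
    qed simp
    then show ?case using add(3) by (simp only: monoid_alg_mult_add)
  qed simp
  have one: "\<one>\<^bsub>?A\<^esub> \<otimes>\<^bsub>?A\<^esub> p = p" "p \<otimes>\<^bsub>?A\<^esub> \<one>\<^bsub>?A\<^esub> = p" if "?C p" for p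
    using that by (induction p rule: pm_induct) (auto simp: monoid_alg_simps monoid_alg_mult_add)
  have sm: "Poly_Mapping.map ((*) c) p \<otimes>\<^bsub>?A\<^esub> q = Poly_Mapping.map ((*) c) (p \<otimes>\<^bsub>?A\<^esub> q)"
    if "?C p" "?C q" for c p q
    using that(1)
  proof (induction p rule: pm_induct)
    case (add x d p)
    have "Poly_Mapping.single x (c * d) \<otimes>\<^bsub>?A\<^esub> q = Poly_Mapping.map ((*) c) (Poly_Mapping.single x d \<otimes>\<^bsub>?A\<^esub> q)"
      using that(2)
    proof (induction q rule: pm_induct)
      case (add y e q) then show ?case by (simp add: monoid_alg_mult_add map_mult_add mult.assoc)
    qed (auto intro: poly_mapping_eqI)
    then show ?case using add(3) by (simp add: monoid_alg_mult_add map_mult_add)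
  qed (auto intro: poly_mapping_eqI)
  have sm': "p \<otimes>\<^bsub>?A\<^esub> Poly_Mapping.map ((*) c) q = Poly_Mapping.map ((*) c) (p \<otimes>\<^bsub>?A\<^esub> q)"
    if "?C p" "?C q" for c p q
    using that(1)
  proof (induction p rule: pm_induct)
    case (add x d p)
    have "Poly_Mapping.single x d \<otimes>\<^bsub>?A\<^esub> Poly_Mapping.map ((*) c) q = Poly_Mapping.map ((*) c) (Poly_Mapping.single x d \<otimes>\<^bsub>?A\<^esub> q)"
      using that(2)
    proof (induction q rule: pm_induct)
      case (add y e q) then show ?case by (simp add: monoid_alg_mult_add map_mult_add mult.left_commute)
    qed (auto intro: poly_mapping_eqI)
    then show ?case using add(3) by (simp add: monoid_alg_mult_add map_mult_add)
  qed (auto intro: poly_mapping_eqI)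
  show ?thesis
  proof (intro ralg.intro ringI)
    show "abelian_group ?A"
    proof (rule abelian_groupI)
      fix p assume "p \<in> carrier ?A"
      then show "\<exists>q\<in>carrier ?A. q \<oplus>\<^bsub>?A\<^esub> p = \<zero>\<^bsub>?A\<^esub>"
        by (intro bexI[of _ "- p"]) (auto simp: monoid_alg_simps)
    qed (simp_all add: monoid_alg_simps keys_add_subset ac_simps)
    show "Group.monoid ?A"
      by (rule monoidI) (simp_all add: monoid_alg_simps(1) closed assoc one, simp add: monoid_alg_simps)
    show "ralg_axioms ?A"
    proof
      fix a b :: "'m \<Rightarrow>\<^sub>0 'r" and c assume ab: "a \<in> carrier ?A" "b \<in> carrier ?A"
      then show "(c \<odot>\<^bsub>?A\<^esub> a) \<otimes>\<^bsub>?A\<^esub> b = c \<odot>\<^bsub>?A\<^esub> (a \<otimes>\<^bsub>?A\<^esub> b)"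
         "a \<otimes>\<^bsub>?A\<^esub> (c \<odot>\<^bsub>?A\<^esub> b) = c \<odot>\<^bsub>?A\<^esub> (a \<otimes>\<^bsub>?A\<^esub> b)"
        by (simp_all add: monoid_alg_simps(1,5) sm sm')
    next
          fix a :: "'m \<Rightarrow>\<^sub>0 'r" and c assume "a \<in> carrier ?A"
      then show "c \<odot>\<^bsub>?A\<^esub> a \<in> carrier ?A" using keys_map_mult[of c a] by (auto simp: monoid_alg_simps)
    qed (simp_all add: monoid_alg_simps poly_mapping_eq_iff fun_eq_iff lookup_add distrib_left distrib_right mult.assoc)
  qed (auto simp: monoid_alg_simps(4) monoid_alg_mult_add)
qed

lemma monoid_alg_minus:
  assumes "Group.monoid M" and "p \<in> carrier (monoid_alg M)" "q \<in> carrier (monoid_alg M)"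
  shows "p \<ominus>\<^bsub>monoid_alg M\<^esub> q = p - (q :: 'm \<Rightarrow>\<^sub>0 'r::comm_ring_1)"
proof -
  interpret ralg "monoid_alg M :: ('r, 'm \<Rightarrow>\<^sub>0 'r) module" by (rule ralg_monoid_alg) fact
  have "\<ominus>\<^bsub>monoid_alg M\<^esub> q = - q" using assms
    by (intro minus_equality) (auto simp: monoid_alg_simps)
  then show ?thesis by (simp add: a_minus_def monoid_alg_simps)
qed

lemma lin_lin_ext:
  assumes "ralg T" and "\<phi> \<in> carrier M \<rightarrow> carrier T"
  shows "lin (monoid_alg M) T (lin_ext T \<phi>)"
proof -
  interpret ralg T by fact
  show ?thesis
    by (rule linI) (use assms(2) in \<open>auto simp: monoid_alg_simps lin_ext_closed lin_ext_add[OF assms(2)] lin_ext_smult[OF assms(2)]\<close>)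
qed

text \<open>Both sides are additive in \<open>p\<close> and in \<open>q\<close>, so it suffices to
  compare them on two monomials, where \<open>\<phi>\<close> is multiplicative and the scalars are
  central in \<open>T\<close>.\<close>

lemma lin_ext_mult:
  assumes "ralg T" and "\<phi> \<in> carrier M \<rightarrow> carrier T" "Group.monoid M"
    and "\<And>x y. x \<in> carrier M \<Longrightarrow> y \<in> carrier M \<Longrightarrow> \<phi> (x \<otimes>\<^bsub>M\<^esub> y) = \<phi> x \<otimes>\<^bsub>T\<^esub> \<phi> y"
    and p: "p \<in> carrier (monoid_alg M)" and q: "q \<in> carrier (monoid_alg M)"
  shows "lin_ext T \<phi> (p \<otimes>\<^bsub>monoid_alg M\<^esub> q) = lin_ext T \<phi> p \<otimes>\<^bsub>T\<^esub> lin_ext T \<phi> q"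
proof -
  interpret T: ralg T by fact
  interpret M: Group.monoid M by fact
  interpret A: ralg "monoid_alg M" by (rule ralg_monoid_alg) fact
  note L = linD[OF lin_lin_ext[OF assms(1,2)], unfolded monoid_alg_simps(1,4), simplified]
  have s: "lin_ext T \<phi> (Poly_Mapping.single x c) = c \<odot>\<^bsub>T\<^esub> \<phi> x" if "x \<in> carrier M" for x c
    using that assms(2) by (intro T.lin_ext_single) auto
  note Ac = A.m_closed[unfolded monoid_alg_simps(1), simplified]
  have sc: "Poly_Mapping.keys (Poly_Mapping.single x c) \<subseteq> carrier M" if "x \<in> carrier M" for x c
    using that by auto
  have p': "Poly_Mapping.keys p \<subseteq> carrier M" and q': "Poly_Mapping.keys q \<subseteq> carrier M"
    using p q by (auto simp: monoid_alg_simps)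
  have \<phi>: "\<phi> x \<in> carrier T" if "x \<in> carrier M" for x using that assms(2) by auto
  show ?thesis using p'
  proof (induction p rule: pm_induct)
    case (add x c p)
    have "lin_ext T \<phi> (Poly_Mapping.single x c \<otimes>\<^bsub>monoid_alg M\<^esub> q)
        = lin_ext T \<phi> (Poly_Mapping.single x c) \<otimes>\<^bsub>T\<^esub> lin_ext T \<phi> q"
      using q'
    proof (induction q rule: pm_induct)
      case (add y d q)
      then show ?case using \<open>x \<in> carrier M\<close> \<phi> L(1)
        by (simp add: monoid_alg_mult_add L(2) sc Ac s assms(4) T.r_distr T.smult_mult_l T.smult_mult_r T.smult_assoc T.smult_commute[of _ d c])
    qed (use \<open>x \<in> carrier M\<close> \<phi> in \<open>simp add: s\<close>)
    then show ?case using add L(1) q' by (simp add: monoid_alg_mult_add L(2) sc Ac T.l_distr)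
  qed (use q' L(1) in simp)
qed

lemma ahom_lin_ext:
  assumes "ralg T" and "\<phi> \<in> carrier M \<rightarrow> carrier T" "Group.monoid M"
    and "\<And>x y. x \<in> carrier M \<Longrightarrow> y \<in> carrier M \<Longrightarrow> \<phi> (x \<otimes>\<^bsub>M\<^esub> y) = \<phi> x \<otimes>\<^bsub>T\<^esub> \<phi> y"
    and "\<phi> \<one>\<^bsub>M\<^esub> = \<one>\<^bsub>T\<^esub>"
  shows "ahom (monoid_alg M) T (lin_ext T \<phi>)"
proof (rule ahomI)
  interpret T: ralg T by fact
  show "lin_ext T \<phi> \<one>\<^bsub>monoid_alg M\<^esub> = \<one>\<^bsub>T\<^esub>"
    using assms(5) by (simp add: monoid_alg_simps T.lin_ext_single)
  show "lin (monoid_alg M) T (lin_ext T \<phi>)" by (rule lin_lin_ext) fact+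
  show "lin_ext T \<phi> (a \<otimes>\<^bsub>monoid_alg M\<^esub> b) = lin_ext T \<phi> a \<otimes>\<^bsub>T\<^esub> lin_ext T \<phi> b"
    if "a \<in> carrier (monoid_alg M)" "b \<in> carrier (monoid_alg M)" for a b
    by (rule lin_ext_mult) fact+
qed

section \<open>Quotients and presentations\<close>

lemma (in ralg) ralg_idealI:
  assumes "I \<subseteq> carrier A" "\<zero> \<in> I" "\<And>a b. a \<in> I \<Longrightarrow> b \<in> I \<Longrightarrow> a \<oplus> b \<in> I"
    and l: "\<And>a x. a \<in> I \<Longrightarrow> x \<in> carrier A \<Longrightarrow> x \<otimes> a \<in> I"
    and r: "\<And>a x. a \<in> I \<Longrightarrow> x \<in> carrier A \<Longrightarrow> a \<otimes> x \<in> I"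
  shows "ideal I A"
proof (rule idealI)
  have "\<ominus> a \<in> I" if "a \<in> I" for a
  proof -
    have a: "a \<in> carrier A" using that assms(1) by auto
    \<comment> \<open>Negation is left multiplication by a scalar multiple of the unit, so closure
      under negatives comes from the ideal property.\<close>
    have "\<ominus> a = ((- 1) \<odot> \<one>) \<otimes> a" using a smult_mult_l[of \<one> a "- 1"] smult_minus_one[OF a] by (simp only: l_one one_closed)
    then show ?thesis using l[OF that] by simp
  qed
  then show "subgroup I (add_monoid A)"
    using assms(1-3) by (intro subgroup.intro) (auto simp: a_inv_def)
qed (use assms ring_axioms in auto)

lemma quot_alg_simps:
  "carrier (quot_alg A I) = a_rcosets\<^bsub>A\<^esub> I" "\<one>\<^bsub>quot_alg A I\<^esub> = I +>\<^bsub>A\<^esub> \<one>\<^bsub>A\<^esub>"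
  "\<zero>\<^bsub>quot_alg A I\<^esub> = I" "a \<otimes>\<^bsub>quot_alg A I\<^esub> b = rcoset_mult A I a b"
  "a \<oplus>\<^bsub>quot_alg A I\<^esub> b = a <+>\<^bsub>A\<^esub> b"
  "c \<odot>\<^bsub>quot_alg A I\<^esub> Y = (\<Union>x\<in>Y. I +>\<^bsub>A\<^esub> (c \<odot>\<^bsub>A\<^esub> x))"
  by (simp_all add: quot_alg_def FactRing_def ring.defs module.defs)

lemma rep_in: "x \<in> Y \<Longrightarrow> rep Y \<in> Y"
  unfolding rep_def by (rule someI)

section \<open>Quotients by two-sided ideals\<close>

locale quotient = ralg A + I: ideal I A for A :: "('r::comm_ring_1, 'a) module" (structure) and I
begin

abbreviation "cl a \<equiv> I +> a"
abbreviation "Q \<equiv> quot_alg A I"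

lemma quot_carrier: "carrier Q = cl ` carrier A"
  by (auto simp: quot_alg_simps A_RCOSETS_def' )

lemma quot_cases: assumes "Y \<in> carrier Q" obtains a where "a \<in> carrier A" "Y = cl a"
  using assms quot_carrier by auto

lemma cl_closed [simp, intro]: "a \<in> carrier A \<Longrightarrow> cl a \<in> carrier Q"
  by (simp add: quot_carrier)

lemma cl_self: "a \<in> carrier A \<Longrightarrow> a \<in> cl a"
  by (rule I.a_rcos_self)

lemma cl_eq_iff: "a \<in> carrier A \<Longrightarrow> b \<in> carrier A \<Longrightarrow> cl a = cl b \<longleftrightarrow> a \<ominus> b \<in> I"
  using quotient_eq_iff_same_a_r_cos[OF I.ideal_axioms] by blast

lemma cl_sub: "a \<in> carrier A \<Longrightarrow> x \<in> cl a \<Longrightarrow> x \<in> carrier A \<and> cl x = cl a"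
  using a_repr_independence[of x I a] I.a_subgroup a_r_coset_subset_G[OF I.a_subset, of a] by blast

lemma rep_mem: assumes "Y \<in> carrier Q" shows "rep Y \<in> Y"
proof -
  obtain a where "a \<in> carrier A" "Y = cl a" using assms by (rule quot_cases)
  then show ?thesis using cl_self by (auto intro: rep_in)
qed

lemma rep_closed: assumes "Y \<in> carrier Q" shows "rep Y \<in> carrier A" and cl_rep: "cl (rep Y) = Y"
proof -
  obtain a where "a \<in> carrier A" "Y = cl a" using assms by (rule quot_cases)
  then show "rep Y \<in> carrier A" "cl (rep Y) = Y" using cl_sub[of a "rep Y"] rep_mem[OF assms] by auto
qed

lemma rep_cl: "a \<in> carrier A \<Longrightarrow> rep (cl a) \<ominus> a \<in> I"
  using cl_eq_iff[of "rep (cl a)" a] cl_rep[of "cl a"] rep_closed[of "cl a"] by simp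

lemma smult_I: "a \<in> I \<Longrightarrow> c \<odot> a \<in> I"
  using I.I_l_closed[of a "c \<odot> \<one>"] I.a_subset by (auto simp: smult_mult_l)

lemma cl_add: "a \<in> carrier A \<Longrightarrow> b \<in> carrier A \<Longrightarrow> cl a \<oplus>\<^bsub>Q\<^esub> cl b = cl (a \<oplus> b)"
  by (simp add: quot_alg_simps I.a_rcos_sum)

lemma cl_mult: "a \<in> carrier A \<Longrightarrow> b \<in> carrier A \<Longrightarrow> cl a \<otimes>\<^bsub>Q\<^esub> cl b = cl (a \<otimes> b)"
  by (simp add: quot_alg_simps I.rcoset_mult_add)

lemma cl_smult: assumes "a \<in> carrier A" shows "c \<odot>\<^bsub>Q\<^esub> cl a = cl (c \<odot> a)"
proof -
  have "cl (c \<odot> x) = cl (c \<odot> a)" if "x \<in> cl a" for x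
  proof -
    have "x \<in> carrier A" "x \<ominus> a \<in> I" using cl_sub[OF assms that] assms cl_eq_iff by auto
    then show ?thesis using assms smult_I[of "x \<ominus> a" c] by (simp add: cl_eq_iff smult_diff_r)
  qed
  then have "(\<Union>x\<in>cl a. cl (c \<odot> x)) = (\<Union>x\<in>cl a. cl (c \<odot> a))" by (rule SUP_cong[OF refl])
  also have "\<dots> = cl (c \<odot> a)" using cl_self[OF assms] by blast
  finally show ?thesis by (simp add: quot_alg_simps)
qed

lemma ralg_quot: "ralg Q"
proof (intro ralg.intro)
  have r: "ring (A Quot I)" by (rule I.quotient_is_ring)
  show "ring Q"
  proof (rule ringI)
    interpret F: ring "A Quot I" by (rule r)
    have simps: "carrier Q = carrier (A Quot I)" "\<And>x y. x \<oplus>\<^bsub>Q\<^esub> y = x \<oplus>\<^bsub>A Quot I\<^esub> y" "\<And>x y. x \<otimes>\<^bsub>Q\<^esub> y = x \<otimes>\<^bsub>A Quot I\<^esub> y"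
      "\<one>\<^bsub>Q\<^esub> = \<one>\<^bsub>A Quot I\<^esub>" "\<zero>\<^bsub>Q\<^esub> = \<zero>\<^bsub>A Quot I\<^esub>"
      by (simp_all add: quot_alg_simps FactRing_def)
    show "abelian_group Q"
    proof (rule abelian_groupI)
      fix x assume "x \<in> carrier Q"
      then show "\<exists>y\<in>carrier Q. y \<oplus>\<^bsub>Q\<^esub> x = \<zero>\<^bsub>Q\<^esub>"
        by (intro bexI[of _ "\<ominus>\<^bsub>A Quot I\<^esub> x"]) (auto simp: simps F.l_neg)
    qed (auto simp: simps F.a_ac)
    show "Group.monoid Q"
      by (rule monoidI) (auto simp: simps F.m_assoc)
  qed (auto simp: quot_carrier cl_add cl_mult l_distr r_distr)
  show "ralg_axioms Q"
    by unfold_locales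
      (auto simp: quot_carrier cl_add cl_mult cl_smult smult_l_distr smult_r_distr smult_assoc smult_mult_l smult_mult_r)
qed

lemma ahom_cl: "ahom A Q cl"
  by (intro ahomI linI) (auto simp: cl_add cl_mult cl_smult quot_alg_simps(2))

text \<open>Maps out of a quotient are evaluated on the representative chosen by \<open>rep\<close>;
  this equation is their well-definedness, and it shields later proofs from the choice.\<close>

lemma quot_lift_eq:
  assumes "ralg T" "lin A T f" "\<And>a. a \<in> I \<Longrightarrow> f a = \<zero>\<^bsub>T\<^esub>" "a \<in> carrier A"
  shows "f (rep (cl a)) = f a"
proof -
  interpret T: ralg T by fact
  have r: "rep (cl a) \<in> carrier A" using assms(4) by (simp add: rep_closed)
  then have "f (rep (cl a)) \<ominus>\<^bsub>T\<^esub> f a = f (rep (cl a) \<ominus> a)"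
    using lin_diff[OF ralg assms(1,2)] assms(4) by simp
  also have "\<dots> = \<zero>\<^bsub>T\<^esub>" using assms(3,4) rep_cl by blast
  finally show ?thesis using r assms(4) linD(1)[OF assms(2)] by (simp add: T.minus_self_eq)
qed

lemma lin_quot_lift:
  assumes "ralg T" "lin A T f" "\<And>a. a \<in> I \<Longrightarrow> f a = \<zero>\<^bsub>T\<^esub>"
  shows "lin Q T (\<lambda>Y. f (rep Y))"
  by (rule linI) (auto simp: quot_carrier quot_lift_eq[OF assms] cl_add cl_smult linD[OF assms(2)])

lemma ahom_quot_lift:
  assumes "ralg T" "ahom A T f" "\<And>a. a \<in> I \<Longrightarrow> f a = \<zero>\<^bsub>T\<^esub>"
  shows "ahom Q T (\<lambda>Y. f (rep Y))"
  using ahomD[OF assms(2)] quot_lift_eq[OF assms(1) ahomD(1)[OF assms(2)] assms(3)]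
  by (intro ahomI lin_quot_lift[OF assms(1) _ assms(3)])
     (auto simp: quot_carrier cl_mult quot_alg_simps(2))

end

lemma ahom_kernel_ideal:
  assumes "ralg A" "ralg B" "ahom A B f" shows "ideal {a \<in> carrier A. f a = \<zero>\<^bsub>B\<^esub>} A"
proof -
  interpret A: ralg A by fact
  interpret B: ralg B by fact
  show ?thesis
    using ahomD[OF assms(3)] lin_zero[OF assms(1,2) ahomD(1)[OF assms(3)]] by (intro A.ralg_idealI) simp_all
qed

section \<open>Free algebras and algebras given by generators and relations\<close>

definition word_monoid :: "'g set \<Rightarrow> 'g list monoid" where
  "word_monoid G = \<lparr>carrier = lists G, mult = (@), one = []\<rparr>"

lemma free_alg_word: "free_alg G = monoid_alg (word_monoid G)"
  by (simp add: free_alg_def word_monoid_def)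

lemma word_monoid_simps [simp]: "carrier (word_monoid G) = lists G" "\<one>\<^bsub>word_monoid G\<^esub> = []"
  "v \<otimes>\<^bsub>word_monoid G\<^esub> w = v @ w"
  by (simp_all add: word_monoid_def)

lemma monoid_word: "Group.monoid (word_monoid G)"
  by (rule monoidI) auto

lemma free_alg_simps:
  "carrier (free_alg G) = {f. Poly_Mapping.keys f \<subseteq> lists G}"
  "\<one>\<^bsub>free_alg G\<^esub> = Poly_Mapping.single [] 1"
  "\<zero>\<^bsub>free_alg G\<^esub> = 0"
  "p \<oplus>\<^bsub>free_alg G\<^esub> q = p + q"
  "c \<odot>\<^bsub>free_alg G\<^esub> p = Poly_Mapping.map ((*) c) p"
  by (simp_all add: free_alg_word monoid_alg_simps)

lemma ralg_free: "ralg (free_alg G)"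
  unfolding free_alg_word by (rule ralg_monoid_alg) (rule monoid_word)

lemma free_alg_mult_single [simp]:
  "Poly_Mapping.single v c \<otimes>\<^bsub>free_alg G\<^esub> Poly_Mapping.single w d = Poly_Mapping.single (v @ w) (c * d)"
  by (simp add: free_alg_word)

lemma single_free: "w \<in> lists G \<Longrightarrow> Poly_Mapping.single w c \<in> carrier (free_alg G)"
  by (auto simp: free_alg_simps)

lemma free_alg_minus: "p \<in> carrier (free_alg G) \<Longrightarrow> q \<in> carrier (free_alg G) \<Longrightarrow> p \<ominus>\<^bsub>free_alg G\<^esub> q = p - q"
  unfolding free_alg_word using monoid_alg_minus[OF monoid_word] by blast

lemma minus_free: "p \<in> carrier (free_alg G) \<Longrightarrow> q \<in> carrier (free_alg G) \<Longrightarrow> p - q \<in> carrier (free_alg G)"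
  by (simp add: free_alg_simps keys_minus_subset)

lemma sum_free: "(\<And>i. i \<in> S \<Longrightarrow> p i \<in> carrier (free_alg G)) \<Longrightarrow> sum p S \<in> carrier (free_alg G)"
proof (induction S rule: infinite_finite_induct)
  case (insert x F)
  then show ?case by (simp add: free_alg_simps keys_add_subset)
qed (simp_all add: free_alg_simps)

definition word_eval :: "('r, 'b) module \<Rightarrow> ('g \<Rightarrow> 'b) \<Rightarrow> 'g list \<Rightarrow> 'b" where
  "word_eval B f w = foldr (\<lambda>g b. f g \<otimes>\<^bsub>B\<^esub> b) w \<one>\<^bsub>B\<^esub>"

definition free_hom :: "('r::comm_ring_1, 'b) module \<Rightarrow> ('g \<Rightarrow> 'b) \<Rightarrow> ('g list \<Rightarrow>\<^sub>0 'r) \<Rightarrow> 'b" where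
  "free_hom B f = lin_ext B (word_eval B f)"

lemma word_eval_simps [simp]: "word_eval B f [] = \<one>\<^bsub>B\<^esub>" "word_eval B f (g # w) = f g \<otimes>\<^bsub>B\<^esub> word_eval B f w"
  by (simp_all add: word_eval_def)

lemma word_eval_closed:
  assumes "ralg B" "f \<in> G \<rightarrow> carrier B" "w \<in> lists G" shows "word_eval B f w \<in> carrier B"
proof -
  interpret B: ralg B by fact
  show ?thesis using assms(3) by (induction w) (use assms(2) in auto)
qed

lemma word_eval_append:
  assumes "ralg B" "f \<in> G \<rightarrow> carrier B" "v \<in> lists G" "w \<in> lists G"
  shows "word_eval B f (v @ w) = word_eval B f v \<otimes>\<^bsub>B\<^esub> word_eval B f w"
proof -
  interpret B: ralg B by fact
  note c = word_eval_closed[OF assms(1,2)]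
  show ?thesis using assms(3)
  proof (induction v)
    case (Cons a v)
    then have "f a \<in> carrier B" using assms(2) by auto
    then show ?case using Cons c assms(4) by (simp add: B.m_assoc)
  qed (use c assms in auto)
qed

lemma ahom_free_hom:
  assumes "ralg B" "f \<in> G \<rightarrow> carrier B" shows "ahom (free_alg G) B (free_hom B f)"
  unfolding free_alg_word free_hom_def
  by (rule ahom_lin_ext) (use assms monoid_word word_eval_closed[OF assms] word_eval_append[OF assms] in auto)

lemma free_hom_single:
  assumes "ralg B" "f \<in> G \<rightarrow> carrier B" "w \<in> lists G"
  shows "free_hom B f (Poly_Mapping.single w c) = c \<odot>\<^bsub>B\<^esub> word_eval B f w"
proof -
  interpret B: ralg B by fact
  show ?thesis unfolding free_hom_def
    using assms by (intro B.lin_ext_single word_eval_closed)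
qed

locale presentation =
  fixes G :: "'g set" and Rel :: "('g list \<Rightarrow>\<^sub>0 'r::comm_ring_1) set"
  assumes Rel: "Rel \<subseteq> carrier (free_alg G)"
begin

sublocale F: ralg "free_alg G" by (rule ralg_free)

sublocale quotient "free_alg G" "Idl\<^bsub>free_alg G\<^esub> Rel"
  by (intro quotient.intro ralg_free F.genideal_ideal Rel)

lemma pres_class_eq: "pres_class G Rel = cl"
  by (simp add: pres_class_def fun_eq_iff)

lemma pres_alg_eq: "pres_alg G Rel = Q"
  by (simp add: pres_alg_def)

lemma ralg_pres: "ralg (pres_alg G Rel)"
  by (simp add: pres_alg_eq ralg_quot)

lemma ahom_pres_class: "ahom (free_alg G) (pres_alg G Rel) (pres_class G Rel)"
  by (simp add: pres_alg_eq pres_class_eq ahom_cl)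

lemma pres_class_Rel: assumes "\<rho> \<in> Rel" shows "pres_class G Rel \<rho> = \<zero>\<^bsub>pres_alg G Rel\<^esub>"
proof -
  have "\<rho> \<in> Idl\<^bsub>free_alg G\<^esub> Rel" using F.genideal_self[OF Rel] assms by auto
  then show ?thesis by (simp add: pres_class_def pres_alg_eq quot_alg_simps I.a_rcos_const)
qed

lemma pres_surj: assumes "Y \<in> carrier (pres_alg G Rel)" obtains p where "p \<in> carrier (free_alg G)" "Y = pres_class G Rel p"
  using assms quot_cases by (auto simp: pres_alg_eq pres_class_eq)

lemma pres_hom_eq: "pres_hom B f Y = free_hom B f (rep Y)"
  by (simp add: pres_hom_def free_hom_def word_eval_def[abs_def])

context
  fixes B :: "('r, 'b) module" and f
  assumes B: "ralg B" and f: "f \<in> G \<rightarrow> carrier B" and rel: "\<And>\<rho>. \<rho> \<in> Rel \<Longrightarrow> free_hom B f \<rho> = \<zero>\<^bsub>B\<^esub>"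
begin

text \<open>The kernel of the evaluation is a two-sided ideal that contains the relations, hence
  contains the ideal that they generate.\<close>

lemma free_hom_ideal: assumes "p \<in> Idl\<^bsub>free_alg G\<^esub> Rel" shows "free_hom B f p = \<zero>\<^bsub>B\<^esub>"
proof -
  have "Idl\<^bsub>free_alg G\<^esub> Rel \<subseteq> {p \<in> carrier (free_alg G). free_hom B f p = \<zero>\<^bsub>B\<^esub>}"
    by (rule F.genideal_minimal[OF ahom_kernel_ideal[OF ralg_free B ahom_free_hom[OF B f]]]) (use Rel rel in auto)
  then show ?thesis using assms by auto
qed

lemma ahom_pres_hom: "ahom (pres_alg G Rel) B (pres_hom B f)"
  unfolding pres_alg_eq pres_hom_eq[abs_def]
  by (rule ahom_quot_lift[OF B ahom_free_hom[OF B f] free_hom_ideal])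

lemma pres_hom_class: "p \<in> carrier (free_alg G) \<Longrightarrow> pres_hom B f (pres_class G Rel p) = free_hom B f p"
  unfolding pres_hom_eq pres_class_eq
  by (rule quot_lift_eq[OF B ahomD(1)[OF ahom_free_hom[OF B f]] free_hom_ideal])

lemma pres_hom_gen: assumes "g \<in> G" shows "pres_hom B f (pres_class G Rel (Poly_Mapping.single [g] 1)) = f g"
proof -
  interpret B: ralg B by (rule B)
  have "f g \<in> carrier B" using assms f by auto
  then show ?thesis using assms pres_hom_class[of "Poly_Mapping.single [g] 1"] free_hom_single[OF B f, of "[g]" 1]
    by (simp add: single_free)
qed

end

text \<open>The classes of words are products of classes of generators, and every class is a linear
  combination of classes of words.\<close>

lemma pres_generated:
  assumes "subalg (pres_alg G Rel) S" "\<And>g. g \<in> G \<Longrightarrow> pres_class G Rel (Poly_Mapping.single [g] 1) \<in> S"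
  shows "carrier (pres_alg G Rel) \<subseteq> S"
proof
  fix Y assume "Y \<in> carrier (pres_alg G Rel)"
  then obtain p where p: "p \<in> carrier (free_alg G)" "Y = pres_class G Rel p" by (rule pres_surj)
  note c = ahomD[OF ahom_pres_class] note S = subalgD[OF assms(1)]
  have w: "pres_class G Rel (Poly_Mapping.single w 1) \<in> S" if "w \<in> lists G" for w
    using that
  proof (induction w)
    case Nil
    then show ?case using S(2) c(2) by (simp add: free_alg_simps)
  next
    case (Cons a w)
    then show ?case using S(5)[OF assms(2)[of a] Cons.IH] c(6)[of "Poly_Mapping.single [a] 1" "Poly_Mapping.single w 1"]
      by (simp add: single_free)
  qed
  have "Poly_Mapping.keys p \<subseteq> lists G" using p by (simp add: free_alg_simps)
  then have "pres_class G Rel p \<in> S"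
  proof (induction p rule: pm_induct)
    case zero
    then show ?case using subalg_zero[OF ralg_pres assms(1)] lin_zero[OF ralg_free ralg_pres c(1)] by (simp add: free_alg_simps)
  next
    case (add w d p)
    have cs: "Poly_Mapping.single w d \<in> carrier (free_alg G)" "p \<in> carrier (free_alg G)" "Poly_Mapping.single w 1 \<in> carrier (free_alg G)"
      using add by (auto simp: free_alg_simps)
    have "pres_class G Rel (Poly_Mapping.single w d) \<in> S"
      using S(3)[OF w[OF add(1)], of d] c(5)[OF cs(3), of d] by (simp add: free_alg_simps)
    then show ?case using S(4) add(3) c(4)[OF cs(1,2)] by (simp add: free_alg_simps)
  qed
  then show "Y \<in> S" using p by simp
qed

end

lemma subalg_gen_induct:
  assumes "ralg A" "S \<subseteq> carrier A" "subalg A U" "S \<subseteq> U"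
  shows "carrier (subalg_gen A S) \<subseteq> U"
proof
  interpret A: ralg A by fact
  fix x assume "x \<in> carrier (subalg_gen A S)"
  then have "x \<in> generate_ring A (range (\<lambda>c. c \<odot>\<^bsub>A\<^esub> \<one>\<^bsub>A\<^esub>) \<union> S)" by (simp add: subalg_gen_def)
  then show "x \<in> U"
    by (induction rule: generate_ring.induct) (use assms(4) in \<open>auto simp: subalgD[OF assms(3)] subalg_minus[OF assms(1,3)]\<close>)
qed

lemma subalg_subalg_gen:
  assumes "ralg A" "S \<subseteq> carrier A" shows "subalg A (carrier (subalg_gen A S))"
proof -
  interpret A: ralg A by fact
  let ?H = "range (\<lambda>c. c \<odot>\<^bsub>A\<^esub> \<one>\<^bsub>A\<^esub>) \<union> S"
  have sub: "generate_ring A ?H \<subseteq> carrier A" by (rule A.generate_ring_incl) (use assms(2) in auto)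
  have "c \<odot>\<^bsub>A\<^esub> a \<in> generate_ring A ?H" if "a \<in> generate_ring A ?H" for c a
  proof -
    \<comment> \<open>\<open>generate_ring\<close> knows no scalars; scalar multiples arise as
      products with the multiples of the unit, which are among the generators.\<close>
    have "(c \<odot>\<^bsub>A\<^esub> \<one>\<^bsub>A\<^esub>) \<otimes>\<^bsub>A\<^esub> a \<in> generate_ring A ?H"
      by (rule generate_ring.eng_mult[OF generate_ring.incl that]) auto
    then show ?thesis using sub that by (auto simp: A.smult_mult_l)
  qed
  then show ?thesis
    using sub by (intro subalgI) (auto simp: subalg_gen_def intro: generate_ring.intros)
qed

lemma subalg_gen_alt: "subalg_gen A S = A\<lparr>carrier := carrier (subalg_gen A S)\<rparr>"
  by (simp add: subalg_gen_def)

lemma subalg_gen_incl: "S \<subseteq> carrier (subalg_gen A S)"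
  by (auto simp: subalg_gen_def intro: generate_ring.incl)

lemma ralg_subalg_gen: "ralg A \<Longrightarrow> S \<subseteq> carrier A \<Longrightarrow> ralg (subalg_gen A S)"
  by (subst subalg_gen_alt) (intro ralg_subalg subalg_subalg_gen)

section \<open>Tensor products\<close>

definition bilin :: "('r, 'a) module \<Rightarrow> ('r, 'b) module \<Rightarrow> ('r, 'c) module \<Rightarrow> ('a \<Rightarrow> 'b \<Rightarrow> 'c) \<Rightarrow> bool" where
  "bilin A B T \<phi> \<longleftrightarrow> (\<forall>a\<in>carrier A. lin B T (\<phi> a)) \<and> (\<forall>b\<in>carrier B. lin A T (\<lambda>a. \<phi> a b))"

text \<open>The linear span of the bilinearity relations, with no multiplication by elements of the
  monoid algebra. It turns out to be \<open>tensor_ideal\<close> itself and gives the latter a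
  workable induction principle.\<close>

inductive_set tensor_span :: "('r::comm_ring_1, 'a) module \<Rightarrow> ('r, 'b) module \<Rightarrow> ('a \<times> 'b \<Rightarrow>\<^sub>0 'r) set"
  for A B where
  zero: "0 \<in> tensor_span A B"
| add: "\<rho> \<in> bilinear_rels A B \<Longrightarrow> p \<in> tensor_span A B \<Longrightarrow> Poly_Mapping.map ((*) c) \<rho> + p \<in> tensor_span A B"

lemma map_mult_one: "Poly_Mapping.map ((*) 1) p = p" for p :: "'m \<Rightarrow>\<^sub>0 'r::comm_ring_1"
  by (rule poly_mapping_eqI) simp

locale tensor = A: ralg A + B: ralg B for A :: "('r::comm_ring_1, 'a) module" and B :: "('r, 'b) module"
begin

lemma monoid_prod: "Group.monoid (A \<times>\<times> B)"
  by (rule DirProd_monoid) (rule A.monoid_axioms, rule B.monoid_axioms)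

abbreviation "F \<equiv> monoid_alg (A \<times>\<times> B) :: ('r, 'a \<times> 'b \<Rightarrow>\<^sub>0 'r) module"
abbreviation "s a b c \<equiv> Poly_Mapping.single (a, b) c :: 'a \<times> 'b \<Rightarrow>\<^sub>0 'r"

lemma F_ralg: "ralg F"
  by (rule ralg_monoid_alg[OF monoid_prod])

sublocale F: ralg F by (rule F_ralg)

lemma F_carrier: "carrier F = {p. Poly_Mapping.keys p \<subseteq> carrier A \<times> carrier B}"
  by (simp add: monoid_alg_simps DirProd_def)

lemma F_minus: "p \<in> carrier F \<Longrightarrow> q \<in> carrier F \<Longrightarrow> p \<ominus>\<^bsub>F\<^esub> q = p - q"
  by (rule monoid_alg_minus[OF monoid_prod])

lemma F_add: "p \<oplus>\<^bsub>F\<^esub> q = p + q" and F_zero: "\<zero>\<^bsub>F\<^esub> = 0"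
  and F_smult: "c \<odot>\<^bsub>F\<^esub> p = Poly_Mapping.map ((*) c) p" and F_one: "\<one>\<^bsub>F\<^esub> = s \<one>\<^bsub>A\<^esub> \<one>\<^bsub>B\<^esub> 1"
  by (simp_all add: monoid_alg_simps DirProd_def)

lemma s_closed [simp, intro]: "a \<in> carrier A \<Longrightarrow> b \<in> carrier B \<Longrightarrow> s a b c \<in> carrier F"
  by (simp add: F_carrier)

lemma minus_closed_F: "p \<in> carrier F \<Longrightarrow> q \<in> carrier F \<Longrightarrow> p - q \<in> carrier F"
  using F.minus_closed[of p q] by (simp add: F_minus)

lemma rels_cases:
  assumes "\<rho> \<in> bilinear_rels A B"
  obtains (l) a a' b where "a \<in> carrier A" "a' \<in> carrier A" "b \<in> carrier B" "\<rho> = s (a \<oplus>\<^bsub>A\<^esub> a') b 1 - s a b 1 - s a' b 1"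
  | (r) a b b' where "a \<in> carrier A" "b \<in> carrier B" "b' \<in> carrier B" "\<rho> = s a (b \<oplus>\<^bsub>B\<^esub> b') 1 - s a b 1 - s a b' 1"
  | (sl) c a b where "a \<in> carrier A" "b \<in> carrier B" "\<rho> = s (c \<odot>\<^bsub>A\<^esub> a) b 1 - s a b c"
  | (sr) c a b where "a \<in> carrier A" "b \<in> carrier B" "\<rho> = s a (c \<odot>\<^bsub>B\<^esub> b) 1 - s a b c"
  using assms unfolding bilinear_rels_def by (elim UnE CollectE exE conjE) (auto intro: l r sl sr)

lemma rels_l: "a \<in> carrier A \<Longrightarrow> a' \<in> carrier A \<Longrightarrow> b \<in> carrier B \<Longrightarrow> s (a \<oplus>\<^bsub>A\<^esub> a') b 1 - s a b 1 - s a' b 1 \<in> bilinear_rels A B"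
  unfolding bilinear_rels_def by (rule UnI1, rule UnI1, rule UnI1, rule CollectI, rule exI[of _ a], rule exI[of _ "a'"], rule exI[of _ b], simp)

lemma rels_r: "a \<in> carrier A \<Longrightarrow> b \<in> carrier B \<Longrightarrow> b' \<in> carrier B \<Longrightarrow> s a (b \<oplus>\<^bsub>B\<^esub> b') 1 - s a b 1 - s a b' 1 \<in> bilinear_rels A B"
  unfolding bilinear_rels_def by (rule UnI1, rule UnI1, rule UnI2, rule CollectI, rule exI[of _ a], rule exI[of _ b], rule exI[of _ "b'"], simp)

lemma rels_sl: "a \<in> carrier A \<Longrightarrow> b \<in> carrier B \<Longrightarrow> s (c \<odot>\<^bsub>A\<^esub> a) b 1 - s a b c \<in> bilinear_rels A B"
  unfolding bilinear_rels_def by (rule UnI1, rule UnI2, rule CollectI, rule exI[of _ c], rule exI[of _ a], rule exI[of _ b], simp)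

lemma rels_sr: "a \<in> carrier A \<Longrightarrow> b \<in> carrier B \<Longrightarrow> s a (c \<odot>\<^bsub>B\<^esub> b) 1 - s a b c \<in> bilinear_rels A B"
  unfolding bilinear_rels_def by (rule UnI2, rule CollectI, rule exI[of _ c], rule exI[of _ a], rule exI[of _ b], simp)

lemma rels_closed: "bilinear_rels A B \<subseteq> carrier F"
proof
  fix \<rho> assume "\<rho> \<in> bilinear_rels A B"
  then show "\<rho> \<in> carrier F" by (cases rule: rels_cases) (auto intro!: minus_closed_F)
qed

lemma mult_diff: "p \<in> carrier F \<Longrightarrow> q \<in> carrier F \<Longrightarrow> q' \<in> carrier F \<Longrightarrow> p \<otimes>\<^bsub>F\<^esub> (q - q') = p \<otimes>\<^bsub>F\<^esub> q - p \<otimes>\<^bsub>F\<^esub> q'"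
  "p \<in> carrier F \<Longrightarrow> q \<in> carrier F \<Longrightarrow> q' \<in> carrier F \<Longrightarrow> (q - q') \<otimes>\<^bsub>F\<^esub> p = q \<otimes>\<^bsub>F\<^esub> p - q' \<otimes>\<^bsub>F\<^esub> p"
  using monoid_alg_mult_add[where M = "A \<times>\<times> B"] by (metis diff_add_cancel add_diff_cancel)+

lemma span_add: "p \<in> tensor_span A B \<Longrightarrow> q \<in> tensor_span A B \<Longrightarrow> p + q \<in> tensor_span A B"
  by (induction rule: tensor_span.induct) (auto simp: add.assoc intro: tensor_span.intros)

lemma span_rel: "\<rho> \<in> bilinear_rels A B \<Longrightarrow> Poly_Mapping.map ((*) c) \<rho> \<in> tensor_span A B"
  using tensor_span.add[OF _ tensor_span.zero, of \<rho> A B c] by simp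

lemma span_subset: "tensor_span A B \<subseteq> carrier F"
proof
  fix p assume "p \<in> tensor_span A B"
  then show "p \<in> carrier F"
  proof (induction rule: tensor_span.induct)
    case (add \<rho> p c)
    then have "c \<odot>\<^bsub>F\<^esub> \<rho> \<oplus>\<^bsub>F\<^esub> p \<in> carrier F" using rels_closed by auto
    then show ?case by (simp add: F_add F_smult)
  qed (simp add: F_carrier)
qed

text \<open>Multiplying by a monomial (x, y) changes only the entries of a relation, not its shape.
  This is why the linear span of the relations is already a two-sided ideal.\<close>

lemma rel_mult_l: assumes "\<rho> \<in> bilinear_rels A B" "x \<in> carrier A" "y \<in> carrier B"
  shows "s x y 1 \<otimes>\<^bsub>F\<^esub> \<rho> \<in> bilinear_rels A B"
  using assms(1)
proof (cases rule: rels_cases)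
  case (l a a' b) then show ?thesis using assms rels_l[of "x \<otimes>\<^bsub>A\<^esub> a" "x \<otimes>\<^bsub>A\<^esub> a'" "y \<otimes>\<^bsub>B\<^esub> b"]
    by (simp add: mult_diff minus_closed_F A.r_distr)
next
  case (r a b b') then show ?thesis using assms rels_r[of "x \<otimes>\<^bsub>A\<^esub> a" "y \<otimes>\<^bsub>B\<^esub> b" "y \<otimes>\<^bsub>B\<^esub> b'"]
    by (simp add: mult_diff minus_closed_F B.r_distr)
next
  case (sl c a b) then show ?thesis using assms rels_sl[of "x \<otimes>\<^bsub>A\<^esub> a" "y \<otimes>\<^bsub>B\<^esub> b" c]
    by (simp add: mult_diff minus_closed_F A.smult_mult_r)
next
  case (sr c a b) then show ?thesis using assms rels_sr[of "x \<otimes>\<^bsub>A\<^esub> a" "y \<otimes>\<^bsub>B\<^esub> b" c]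
    by (simp add: mult_diff minus_closed_F B.smult_mult_r)
qed

lemma rel_mult_r: assumes "\<rho> \<in> bilinear_rels A B" "x \<in> carrier A" "y \<in> carrier B"
  shows "\<rho> \<otimes>\<^bsub>F\<^esub> s x y 1 \<in> bilinear_rels A B"
  using assms(1)
proof (cases rule: rels_cases)
  case (l a a' b) then show ?thesis using assms rels_l[of "a \<otimes>\<^bsub>A\<^esub> x" "a' \<otimes>\<^bsub>A\<^esub> x" "b \<otimes>\<^bsub>B\<^esub> y"]
    by (simp add: mult_diff minus_closed_F A.l_distr)
next
  case (r a b b') then show ?thesis using assms rels_r[of "a \<otimes>\<^bsub>A\<^esub> x" "b \<otimes>\<^bsub>B\<^esub> y" "b' \<otimes>\<^bsub>B\<^esub> y"]
    by (simp add: mult_diff minus_closed_F B.l_distr)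
next
  case (sl c a b) then show ?thesis using assms rels_sl[of "a \<otimes>\<^bsub>A\<^esub> x" "b \<otimes>\<^bsub>B\<^esub> y" c]
    by (simp add: mult_diff minus_closed_F A.smult_mult_l)
next
  case (sr c a b) then show ?thesis using assms rels_sr[of "a \<otimes>\<^bsub>A\<^esub> x" "b \<otimes>\<^bsub>B\<^esub> y" c]
    by (simp add: mult_diff minus_closed_F B.smult_mult_l)
qed

lemma s_smult: "s x y c = c \<odot>\<^bsub>F\<^esub> s x y 1"
  by (simp add: F_smult)

lemma span_mult:
  assumes "p \<in> tensor_span A B" "q \<in> carrier F"
  shows "q \<otimes>\<^bsub>F\<^esub> p \<in> tensor_span A B" "p \<otimes>\<^bsub>F\<^esub> q \<in> tensor_span A B"
proof -
  note add = monoid_alg_mult_add[where M = "A \<times>\<times> B"]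
  have q: "Poly_Mapping.keys q \<subseteq> carrier A \<times> carrier B" using assms(2) by (simp add: F_carrier)
  have 1: "s x y c \<otimes>\<^bsub>F\<^esub> p \<in> tensor_span A B \<and> p \<otimes>\<^bsub>F\<^esub> s x y c \<in> tensor_span A B" if xy: "x \<in> carrier A" "y \<in> carrier B" for x y c
    using assms(1)
  proof (induction rule: tensor_span.induct)
    case (add \<rho> p d)
    have \<rho>: "\<rho> \<in> carrier F" using add rels_closed by auto
    have "s x y c \<otimes>\<^bsub>F\<^esub> (d \<odot>\<^bsub>F\<^esub> \<rho>) = (c * d) \<odot>\<^bsub>F\<^esub> (s x y 1 \<otimes>\<^bsub>F\<^esub> \<rho>)"
       "(d \<odot>\<^bsub>F\<^esub> \<rho>) \<otimes>\<^bsub>F\<^esub> s x y c = (c * d) \<odot>\<^bsub>F\<^esub> (\<rho> \<otimes>\<^bsub>F\<^esub> s x y 1)"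
      using xy \<rho> unfolding s_smult[of x y c]
      by (simp_all add: F.smult_mult_l F.smult_mult_r F.smult_assoc F.smult_commute[of _ c d])
    then show ?case using span_rel[OF rel_mult_l[OF add(1) xy], of "c * d"] span_rel[OF rel_mult_r[OF add(1) xy], of "c * d"] add
      by (simp add: monoid_alg_mult_add span_add F_smult)
  qed (simp add: tensor_span.zero)
  have "q \<otimes>\<^bsub>F\<^esub> p \<in> tensor_span A B \<and> p \<otimes>\<^bsub>F\<^esub> q \<in> tensor_span A B" using q
  proof (induction q rule: pm_induct)
    case (add z c q)
    then show ?case using 1[of "fst z" "snd z" c] by (auto simp: monoid_alg_mult_add intro: span_add)
  qed (simp add: tensor_span.zero)
  then show "q \<otimes>\<^bsub>F\<^esub> p \<in> tensor_span A B" "p \<otimes>\<^bsub>F\<^esub> q \<in> tensor_span A B" by auto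
qed

lemma tensor_ideal_eq: "tensor_ideal A B = tensor_span A B"
proof
  have "ideal (tensor_span A B) F"
    using span_mult span_subset span_add tensor_span.zero by (intro F.ralg_idealI) (auto simp: F_zero F_add)
  then show "tensor_ideal A B \<subseteq> tensor_span A B" unfolding tensor_ideal_def
    using span_rel[of _ 1] by (intro F.genideal_minimal) (auto simp: map_mult_one)
  have I: "ideal (tensor_ideal A B) F" unfolding tensor_ideal_def by (rule F.genideal_ideal[OF rels_closed])
  then interpret quotient F "tensor_ideal A B" by (intro quotient.intro F_ralg)
  show "tensor_span A B \<subseteq> tensor_ideal A B"
  proof
    fix p assume "p \<in> tensor_span A B"
    then show "p \<in> tensor_ideal A B"
    proof (induction rule: tensor_span.induct)
      case zero show ?case using I.zero_closed by (simp add: F_zero)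
    next
      case (add \<rho> p c)
      have "\<rho> \<in> tensor_ideal A B" unfolding tensor_ideal_def using F.genideal_self[OF rels_closed] add by auto
      then show ?case using smult_I[of \<rho> c] I.a_closed[of "Poly_Mapping.map ((*) c) \<rho>" p] add by (simp add: F_smult F_add)
    qed
  qed
qed

lemma tensor_ideal_induct [consumes 1, case_names zero add]:
  assumes "p \<in> tensor_ideal A B" "P 0"
    "\<And>\<rho> c p. \<rho> \<in> bilinear_rels A B \<Longrightarrow> p \<in> carrier F \<Longrightarrow> P p \<Longrightarrow> P (Poly_Mapping.map ((*) c) \<rho> + p)"
  shows "P p"
  using assms(1) unfolding tensor_ideal_eq
  by (induction rule: tensor_span.induct) (use assms span_subset in auto)

sublocale quotient F "tensor_ideal A B"
  unfolding tensor_ideal_def by (intro quotient.intro F_ralg F.genideal_ideal rels_closed)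

abbreviation "T \<equiv> tensor_alg A B"
abbreviation "pt \<equiv> pure_tensor A B"

lemma T_eq: "T = Q" by (simp add: tensor_alg_def)

lemma ralg_tensor: "ralg T" by (simp add: T_eq ralg_quot)

sublocale T: ralg T by (rule ralg_tensor)

lemma pt_eq: "pt a b = cl (s a b 1)" by (simp add: pure_tensor_def)

lemma pt_closed [simp, intro]: "a \<in> carrier A \<Longrightarrow> b \<in> carrier B \<Longrightarrow> pt a b \<in> carrier T"
  by (simp add: pt_eq T_eq cl_closed)

lemma rel_in: "\<rho> \<in> bilinear_rels A B \<Longrightarrow> \<rho> \<in> tensor_ideal A B"
  unfolding tensor_ideal_def using F.genideal_self[OF rels_closed] by auto

lemma pt_add_l: assumes "a \<in> carrier A" "a' \<in> carrier A" "b \<in> carrier B"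
  shows "pt (a \<oplus>\<^bsub>A\<^esub> a') b = pt a b \<oplus>\<^bsub>T\<^esub> pt a' b"
proof -
  have "s (a \<oplus>\<^bsub>A\<^esub> a') b 1 - (s a b 1 + s a' b 1) \<in> tensor_ideal A B"
    using rel_in[OF rels_l[OF assms]] by (simp add: algebra_simps)
  moreover have "s a b 1 + s a' b 1 \<in> carrier F" using assms F.add.m_closed[of "s a b 1" "s a' b 1"] by (simp add: F_add)
  ultimately show ?thesis using assms by (simp add: pt_eq T_eq cl_add cl_eq_iff F_minus F_add)
qed

lemma pt_add_r: assumes "a \<in> carrier A" "b \<in> carrier B" "b' \<in> carrier B"
  shows "pt a (b \<oplus>\<^bsub>B\<^esub> b') = pt a b \<oplus>\<^bsub>T\<^esub> pt a b'"
proof -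
  have "s a (b \<oplus>\<^bsub>B\<^esub> b') 1 - (s a b 1 + s a b' 1) \<in> tensor_ideal A B"
    using rel_in[OF rels_r[OF assms]] by (simp add: algebra_simps)
  moreover have "s a b 1 + s a b' 1 \<in> carrier F" using assms F.add.m_closed[of "s a b 1" "s a b' 1"] by (simp add: F_add)
  ultimately show ?thesis using assms by (simp add: pt_eq T_eq cl_add cl_eq_iff F_minus F_add)
qed

lemma cl_s: "a \<in> carrier A \<Longrightarrow> b \<in> carrier B \<Longrightarrow> cl (s a b c) = c \<odot>\<^bsub>T\<^esub> pt a b"
  by (simp add: pt_eq T_eq cl_smult F_smult)

lemma pt_smult_l: "a \<in> carrier A \<Longrightarrow> b \<in> carrier B \<Longrightarrow> pt (c \<odot>\<^bsub>A\<^esub> a) b = c \<odot>\<^bsub>T\<^esub> pt a b"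
  using rel_in[OF rels_sl] by (simp flip: cl_s) (simp add: pt_eq cl_eq_iff F_minus)

lemma pt_smult_r: "a \<in> carrier A \<Longrightarrow> b \<in> carrier B \<Longrightarrow> pt a (c \<odot>\<^bsub>B\<^esub> b) = c \<odot>\<^bsub>T\<^esub> pt a b"
  using rel_in[OF rels_sr] by (simp flip: cl_s) (simp add: pt_eq cl_eq_iff F_minus)

lemma pt_mult: "a \<in> carrier A \<Longrightarrow> b \<in> carrier B \<Longrightarrow> a' \<in> carrier A \<Longrightarrow> b' \<in> carrier B \<Longrightarrow>
    pt a b \<otimes>\<^bsub>T\<^esub> pt a' b' = pt (a \<otimes>\<^bsub>A\<^esub> a') (b \<otimes>\<^bsub>B\<^esub> b')"
  by (simp add: pt_eq T_eq cl_mult)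

lemma pt_one: "\<one>\<^bsub>T\<^esub> = pt \<one>\<^bsub>A\<^esub> \<one>\<^bsub>B\<^esub>"
  by (simp add: pt_eq T_eq quot_alg_simps F_one)

lemma bilin_pt: "bilin A B T pt"
  unfolding bilin_def
  by (auto intro!: linI simp: pt_add_l pt_add_r pt_smult_l pt_smult_r)

lemma ahom_pt_l: "ahom A T (\<lambda>a. pt a \<one>\<^bsub>B\<^esub>)" and ahom_pt_r: "ahom B T (pt \<one>\<^bsub>A\<^esub>)"
  by (auto intro!: ahomI linI simp: pt_add_l pt_add_r pt_smult_l pt_smult_r pt_mult pt_one)

text \<open>Coefficients are absorbed into the first factor, so sums of pure tensors suffice; the
  zero sum is the pure tensor of two zeros.\<close>

lemma tensor_induct [consumes 1, case_names pure add]: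
  assumes "x \<in> carrier T" "\<And>a b. a \<in> carrier A \<Longrightarrow> b \<in> carrier B \<Longrightarrow> P (pt a b)"
    "\<And>x y. x \<in> carrier T \<Longrightarrow> y \<in> carrier T \<Longrightarrow> P x \<Longrightarrow> P y \<Longrightarrow> P (x \<oplus>\<^bsub>T\<^esub> y)"
  shows "P x"
proof -
  obtain p where p: "p \<in> carrier F" "x = cl p" using assms(1) unfolding T_eq by (rule quot_cases)
  have "Poly_Mapping.keys p \<subseteq> carrier A \<times> carrier B" using p by (simp add: F_carrier)
  then have "P (cl p)"
  proof (induction p rule: pm_induct)
    case zero
    have "cl 0 = pt \<zero>\<^bsub>A\<^esub> \<zero>\<^bsub>B\<^esub>"
      using pt_smult_l[of "\<zero>\<^bsub>A\<^esub>" "\<zero>\<^bsub>B\<^esub>" 0] cl_s[of "\<zero>\<^bsub>A\<^esub>" "\<zero>\<^bsub>B\<^esub>" 0] by simp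
    then show ?case using assms(2) by simp
  next
    case (add z c p)
    then obtain a b where z: "z = (a, b)" "a \<in> carrier A" "b \<in> carrier B" by auto
    have p: "p \<in> carrier F" using add by (simp add: F_carrier)
    have "cl (Poly_Mapping.single z c + p) = pt (c \<odot>\<^bsub>A\<^esub> a) b \<oplus>\<^bsub>T\<^esub> cl p"
      using z p by (simp add: pt_smult_l flip: cl_s) (simp add: T_eq cl_add F_add)
    moreover have "pt (c \<odot>\<^bsub>A\<^esub> a) b \<in> carrier T" "cl p \<in> carrier T" using z p pt_closed[of "c \<odot>\<^bsub>A\<^esub> a" b] by (auto simp: T_eq)
    ultimately show ?case using z add(3) assms(2)[of "c \<odot>\<^bsub>A\<^esub> a" b] assms(3)[of "pt (c \<odot>\<^bsub>A\<^esub> a) b" "cl p"]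
      by simp
  qed
  then show ?thesis using p by simp
qed

context
  fixes U :: "('r, 'c) module" and \<phi>
  assumes U: "ralg U" and bil: "bilin A B U \<phi>"
begin

interpretation U: ralg U by (rule U)

lemma bilinD: "a \<in> carrier A \<Longrightarrow> b \<in> carrier B \<Longrightarrow> \<phi> a b \<in> carrier U"
  "a \<in> carrier A \<Longrightarrow> a' \<in> carrier A \<Longrightarrow> b \<in> carrier B \<Longrightarrow> \<phi> (a \<oplus>\<^bsub>A\<^esub> a') b = \<phi> a b \<oplus>\<^bsub>U\<^esub> \<phi> a' b"
  "a \<in> carrier A \<Longrightarrow> b \<in> carrier B \<Longrightarrow> b' \<in> carrier B \<Longrightarrow> \<phi> a (b \<oplus>\<^bsub>B\<^esub> b') = \<phi> a b \<oplus>\<^bsub>U\<^esub> \<phi> a b'"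
  "a \<in> carrier A \<Longrightarrow> b \<in> carrier B \<Longrightarrow> \<phi> (c \<odot>\<^bsub>A\<^esub> a) b = c \<odot>\<^bsub>U\<^esub> \<phi> a b"
  "a \<in> carrier A \<Longrightarrow> b \<in> carrier B \<Longrightarrow> \<phi> a (c \<odot>\<^bsub>B\<^esub> b) = c \<odot>\<^bsub>U\<^esub> \<phi> a b"
  using bil by (auto simp: bilin_def lin_def)

lemma lin_F: "lin F U (lin_ext U (\<lambda>(a, b). \<phi> a b))"
  by (rule lin_lin_ext[OF U]) (auto simp: DirProd_def bilinD)

lemma lin_ext_s: "a \<in> carrier A \<Longrightarrow> b \<in> carrier B \<Longrightarrow> lin_ext U (\<lambda>(a, b). \<phi> a b) (s a b c) = c \<odot>\<^bsub>U\<^esub> \<phi> a b"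
  using bilinD by (subst U.lin_ext_single) auto

lemma lin_ext_rel: assumes "\<rho> \<in> bilinear_rels A B" shows "lin_ext U (\<lambda>(a, b). \<phi> a b) \<rho> = \<zero>\<^bsub>U\<^esub>"
proof -
  have d: "lin_ext U (\<lambda>(a, b). \<phi> a b) (p - q) = lin_ext U (\<lambda>(a, b). \<phi> a b) p \<ominus>\<^bsub>U\<^esub> lin_ext U (\<lambda>(a, b). \<phi> a b) q"
    if "p \<in> carrier F" "q \<in> carrier F" for p q
    using lin_diff[OF F_ralg U lin_F] that by (simp add: F_minus)
  have z: "x \<oplus>\<^bsub>U\<^esub> y \<oplus>\<^bsub>U\<^esub> \<ominus>\<^bsub>U\<^esub> x \<oplus>\<^bsub>U\<^esub> \<ominus>\<^bsub>U\<^esub> y = \<zero>\<^bsub>U\<^esub>" if "x \<in> carrier U" "y \<in> carrier U" for x y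
    using that by algebra
  show ?thesis using assms
    by (cases rule: rels_cases)
       (simp_all add: d minus_closed_F lin_ext_s bilinD z U.r_neg a_minus_def)
qed

lemma lin_ext_ideal: assumes "p \<in> tensor_ideal A B" shows "lin_ext U (\<lambda>(a, b). \<phi> a b) p = \<zero>\<^bsub>U\<^esub>"
  using assms
proof (induction rule: tensor_ideal_induct)
  case (add \<rho> c p)
  have \<rho>: "\<rho> \<in> carrier F" using add rels_closed by auto
  have "lin_ext U (\<lambda>(a, b). \<phi> a b) (c \<odot>\<^bsub>F\<^esub> \<rho> \<oplus>\<^bsub>F\<^esub> p) = \<zero>\<^bsub>U\<^esub>"
    using linD[OF lin_F] add \<rho> by (simp add: lin_ext_rel)
  then show ?case by (simp add: F_smult F_add)
qed simp

lemma tensor_lift_eq: "tensor_lift U \<phi> Y = lin_ext U (\<lambda>(a, b). \<phi> a b) (rep Y)"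
  by (simp add: tensor_lift_def)

lemma lin_tensor_lift: "lin T U (tensor_lift U \<phi>)"
  unfolding tensor_lift_eq[abs_def] T_eq
  by (rule lin_quot_lift[OF U lin_F lin_ext_ideal])

lemma tensor_lift_pt: "a \<in> carrier A \<Longrightarrow> b \<in> carrier B \<Longrightarrow> tensor_lift U \<phi> (pt a b) = \<phi> a b"
  using quot_lift_eq[OF U lin_F lin_ext_ideal, of "s a b 1"] bilinD
  by (simp add: tensor_lift_eq pt_eq lin_ext_s)

text \<open>Multiplicativity has to be known on pure tensors only, since both sides are additive in
  each argument.\<close>

lemma ahom_tensor_lift:
  assumes one: "\<phi> \<one>\<^bsub>A\<^esub> \<one>\<^bsub>B\<^esub> = \<one>\<^bsub>U\<^esub>"
    and mult: "\<And>a b a' b'. a \<in> carrier A \<Longrightarrow> b \<in> carrier B \<Longrightarrow> a' \<in> carrier A \<Longrightarrow> b' \<in> carrier B \<Longrightarrow>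
      \<phi> (a \<otimes>\<^bsub>A\<^esub> a') (b \<otimes>\<^bsub>B\<^esub> b') = \<phi> a b \<otimes>\<^bsub>U\<^esub> \<phi> a' b'"
  shows "ahom T U (tensor_lift U \<phi>)"
proof (rule ahomI[OF lin_tensor_lift])
  show "tensor_lift U \<phi> \<one>\<^bsub>T\<^esub> = \<one>\<^bsub>U\<^esub>" by (simp add: pt_one tensor_lift_pt one)
  note l = linD[OF lin_tensor_lift]
  fix x y assume xy: "x \<in> carrier T" "y \<in> carrier T"
  show "tensor_lift U \<phi> (x \<otimes>\<^bsub>T\<^esub> y) = tensor_lift U \<phi> x \<otimes>\<^bsub>U\<^esub> tensor_lift U \<phi> y"
    using xy(1)
  proof (induction x rule: tensor_induct)
    case (pure a b)
    show ?case using xy(2)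
    proof (induction y rule: tensor_induct)
      case (add x y)
      then show ?case using pure by (simp add: T.r_distr l U.r_distr)
    qed (use pure in \<open>simp add: pt_mult tensor_lift_pt mult\<close>)
  next
    case (add x y')
    then show ?case using xy(2) by (simp add: T.l_distr l U.l_distr)
  qed
qed

end

end

lemma bilin_comp:
  assumes "bilin C D T \<phi>" "lin A C f" "lin B D g"
  shows "bilin A B T (\<lambda>a b. \<phi> (f a) (g b))"
  using assms unfolding bilin_def lin_def by (auto simp: Pi_iff)

context
  fixes A :: "('r::comm_ring_1, 'a) module" and B :: "('r, 'b) module" and C :: "('r, 'c) module" and D :: "('r, 'd) module"
  assumes A: "ralg A" and B: "ralg B" and C: "ralg C" and D: "ralg D"
begin

interpretation AB: tensor A B using A B by (rule tensor.intro)
interpretation CD: tensor C D using C D by (rule tensor.intro)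

lemma lin_tensor_map: assumes "lin A C f" "lin B D g"
  shows "lin (tensor_alg A B) (tensor_alg C D) (tensor_map C D f g)"
  unfolding tensor_map_def
  by (rule AB.lin_tensor_lift[OF CD.ralg_tensor]) (rule bilin_comp[OF CD.bilin_pt assms])

lemma tensor_map_pure: assumes "lin A C f" "lin B D g" "a \<in> carrier A" "b \<in> carrier B"
  shows "tensor_map C D f g (pure_tensor A B a b) = pure_tensor C D (f a) (g b)"
  unfolding tensor_map_def
  by (rule AB.tensor_lift_pt[OF CD.ralg_tensor bilin_comp[OF CD.bilin_pt assms(1,2)] assms(3,4)])

lemma ahom_tensor_map: assumes "ahom A C f" "ahom B D g"
  shows "ahom (tensor_alg A B) (tensor_alg C D) (tensor_map C D f g)"
  unfolding tensor_map_def
  by (rule AB.ahom_tensor_lift[OF CD.ralg_tensor bilin_comp[OF CD.bilin_pt]])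
     (use ahomD[OF assms(1)] ahomD[OF assms(2)] in \<open>auto simp: CD.pt_one CD.pt_mult\<close>)

end

section \<open>Complete algebras and completions\<close>

context ralg begin

text \<open>The congruence x \<equiv> c 1 modulo h. In the applications c is the value of a counit,
  so that a matrix is congruent to the identity as soon as its entries have the right
  counits.\<close>

definition near :: "'r \<Rightarrow> 'r \<Rightarrow> 'a \<Rightarrow> bool" where
  "near h c x \<longleftrightarrow> (\<exists>y\<in>carrier A. x = c \<odot> \<one> \<oplus> h \<odot> y)"

lemma near_closed: "near h c x \<Longrightarrow> x \<in> carrier A"
  by (auto simp: near_def)

lemma near_add: assumes "near h c x" "near h d y" shows "near h (c + d) (x \<oplus> y)"
proof -
  obtain x' y' where "x' \<in> carrier A" "y' \<in> carrier A" "x = c \<odot> \<one> \<oplus> h \<odot> x'" "y = d \<odot> \<one> \<oplus> h \<odot> y'"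
    using assms by (auto simp: near_def)
  then show ?thesis unfolding near_def
    by (intro bexI[of _ "x' \<oplus> y'"]) (auto simp: smult_l_distr smult_r_distr a_ac)
qed

lemma near_mult: assumes "near h c x" "near h d y" shows "near h (c * d) (x \<otimes> y)"
proof -
  obtain x' y' where xy: "x' \<in> carrier A" "y' \<in> carrier A" "x = c \<odot> \<one> \<oplus> h \<odot> x'" "y = d \<odot> \<one> \<oplus> h \<odot> y'"
    using assms by (auto simp: near_def)
  have y: "y \<in> carrier A" using xy by simp
  have "c \<odot> y = (c * d) \<odot> \<one> \<oplus> h \<odot> (c \<odot> y')"
    using xy by (simp add: smult_r_distr smult_assoc smult_commute[of _ c])
  moreover have "x \<otimes> y = c \<odot> y \<oplus> h \<odot> (x' \<otimes> y)"
    using xy(1) y by (simp add: xy(3) l_distr smult_mult_l)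
  ultimately have "x \<otimes> y = (c * d) \<odot> \<one> \<oplus> h \<odot> (c \<odot> y' \<oplus> x' \<otimes> y)"
    using xy(1,2) y by (simp add: smult_r_distr a_assoc)
  then show ?thesis using xy unfolding near_def by auto
qed

lemma near_zero: "near h 0 \<zero>" and near_one: "near h 1 \<one>"
  unfolding near_def by (rule bexI[of _ \<zero>], simp_all)+

lemma near_finsum: "(\<And>i. i \<in> S \<Longrightarrow> near h (c i) (f i)) \<Longrightarrow> near h (sum c S) (finsum A f S)"
proof (induction S rule: infinite_finite_induct)
  case (insert x F)
  then have "f \<in> F \<rightarrow> carrier A" "f x \<in> carrier A" using near_closed by auto
  then show ?case using insert near_add by simp
qed (simp_all add: near_zero)

text \<open>In contrast to \<open>near_mult\<close>, the second factor need not be congruent to a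
  scalar; it will be the inverse of D_0.\<close>

lemma near_zero_mult: assumes "near h 0 x" "y \<in> carrier A" shows "near h 0 (x \<otimes> y)"
proof -
  obtain x' where "x' \<in> carrier A" "x = h \<odot> x'" using assms(1) unfolding near_def by (metis l_zero one_closed smult_closed smult_zero_l)
  then show ?thesis unfolding near_def using assms(2) by (intro bexI[of _ "x' \<otimes> y"]) (auto simp: smult_mult_l)
qed

lemma near_zeroD: "near h 0 x \<Longrightarrow> \<exists>y\<in>carrier A. x = h \<odot> y"
  unfolding near_def by (metis l_zero one_closed smult_closed smult_zero_l)

lemma near_smult: assumes "near h d x" shows "near h (c * d) (c \<odot> x)"
proof -
  obtain x' where "x' \<in> carrier A" "x = d \<odot> \<one> \<oplus> h \<odot> x'" using assms by (auto simp: near_def)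
  then show ?thesis unfolding near_def
    by (intro bexI[of _ "c \<odot> x'"]) (auto simp: smult_r_distr smult_assoc smult_commute[of _ h])
qed

end

lemma near_hom:
  assumes "ralg A" "ahom A B f" "ralg.near A h c x" "ralg B" shows "ralg.near B h c (f x)"
proof -
  interpret A: ralg A by fact
  interpret B: ralg B by fact
  obtain x' where "x' \<in> carrier A" "x = c \<odot>\<^bsub>A\<^esub> \<one>\<^bsub>A\<^esub> \<oplus>\<^bsub>A\<^esub> h \<odot>\<^bsub>A\<^esub> x'" using assms(3) by (auto simp: A.near_def)
  then show ?thesis unfolding B.near_def using ahomD[OF assms(2)] by (intro bexI[of _ "f x'"]) simp_all
qed

text \<open>Convergence of \<open>\<Sum>i. h^i z i\<close> is expressed through the sequence \<open>s\<close> of its tails, divided by powers of \<open>h\<close>.\<close>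

locale cralg = ralg A for A :: "('r::comm_ring_1, 'b) module" (structure) +
  fixes h :: 'r
  assumes sep: "x \<in> carrier A \<Longrightarrow> (\<And>m. \<exists>y\<in>carrier A. x = h ^ m \<odot> y) \<Longrightarrow> x = \<zero>"
    and conv: "z \<in> UNIV \<rightarrow> carrier A \<Longrightarrow> \<exists>s\<in>UNIV \<rightarrow> carrier A. \<forall>m::nat. s m = z m \<oplus> h \<odot> s (Suc m)"
begin

text \<open>Uniqueness of limits: unrolling gives \<open>d 0 = h ^ m \<odot> d m\<close> for every
  m, and separatedness applies. Two families of tails of the same series differ by such a
  \<open>d\<close>.\<close>

lemma sep_tails:
  assumes "d \<in> UNIV \<rightarrow> carrier A" "\<And>m::nat. d m = h \<odot> d (Suc m)" shows "d 0 = \<zero>"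
proof (rule sep)
  have d: "d m \<in> carrier A" for m using assms(1) by auto
  show "d 0 \<in> carrier A" by (rule d)
  fix m
  have "d 0 = h ^ m \<odot> d m"
  proof (induction m)
    case (Suc m)
    have "d 0 = h ^ m \<odot> (h \<odot> d (Suc m))" using Suc assms(2)[of m] by simp
    then show ?case using d[of "Suc m"] by (simp add: smult_assoc[symmetric] mult.commute)
  qed (simp add: d)
  then show "\<exists>y\<in>carrier A. d 0 = h ^ m \<odot> y" using d by auto
qed

text \<open>Row vector times matrix. The unknowns stand on the left because the matrix to be
  cancelled always occurs as the right factor.\<close>

definition vmul :: "nat set \<Rightarrow> (nat \<Rightarrow> nat \<Rightarrow> 'b) \<Rightarrow> (nat \<Rightarrow> 'b) \<Rightarrow> nat \<Rightarrow> 'b" where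
  "vmul K M v k = (\<Oplus>j\<in>K. v j \<otimes> M j k)"

context
  fixes K :: "nat set" and M :: "nat \<Rightarrow> nat \<Rightarrow> 'b"
  assumes K: "finite K" and M: "\<And>j k. j \<in> K \<Longrightarrow> k \<in> K \<Longrightarrow> M j k \<in> carrier A"
begin

abbreviation (input) "vm \<equiv> vmul K M"

lemma vm_closed: "v \<in> K \<rightarrow> carrier A \<Longrightarrow> k \<in> K \<Longrightarrow> vm v k \<in> carrier A"
  unfolding vmul_def using M by (intro finsum_closed) auto

lemma vm_cong: "v \<in> K \<rightarrow> carrier A \<Longrightarrow> w \<in> K \<rightarrow> carrier A \<Longrightarrow> (\<And>j. j \<in> K \<Longrightarrow> v j = w j) \<Longrightarrow> k \<in> K \<Longrightarrow> vm v k = vm w k"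
  unfolding vmul_def using M by (intro finsum_cong') (auto simp: Pi_iff)

lemma vm_add: assumes "v \<in> K \<rightarrow> carrier A" "w \<in> K \<rightarrow> carrier A" "k \<in> K"
  shows "vm (\<lambda>j. v j \<oplus> w j) k = vm v k \<oplus> vm w k"
proof -
  have "vm (\<lambda>j. v j \<oplus> w j) k = (\<Oplus>j\<in>K. v j \<otimes> M j k \<oplus> w j \<otimes> M j k)"
    unfolding vmul_def using M assms by (intro finsum_cong') (auto simp: l_distr Pi_iff)
  also have "\<dots> = vm v k \<oplus> vm w k"
    unfolding vmul_def using M assms by (intro finsum_addf) (auto simp: Pi_iff)
  finally show ?thesis .
qed

lemma vm_smult: assumes "v \<in> K \<rightarrow> carrier A" "k \<in> K"
  shows "vm (\<lambda>j. c \<odot> v j) k = c \<odot> vm v k"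
proof -
  have "vm (\<lambda>j. c \<odot> v j) k = (\<Oplus>j\<in>K. c \<odot> (v j \<otimes> M j k))"
    unfolding vmul_def using M assms by (intro finsum_cong') (auto simp: smult_mult_l Pi_iff)
  also have "\<dots> = c \<odot> vm v k"
    unfolding vmul_def using M assms by (intro smult_finsum[symmetric]) (auto simp: Pi_iff)
  finally show ?thesis .
qed

text \<open>From x = - h x M, iteration of \<open>N v = - v M\<close> gives N^m x = h N^(m+1) x on
  \<open>K\<close>. Each entry of these vectors is a sequence as in
  \<open>sep_tails\<close>.\<close>

lemma vm_cancel:
  assumes x: "x \<in> K \<rightarrow> carrier A" and eq: "\<And>k. k \<in> K \<Longrightarrow> x k \<oplus> h \<odot> vm x k = \<zero>" and k: "k \<in> K"
  shows "x k = \<zero>"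
proof -
  define N where "N v = (\<lambda>k. (- 1) \<odot> vm v k)" for v
  have Nc: "N v \<in> K \<rightarrow> carrier A" if "v \<in> K \<rightarrow> carrier A" for v
    using vm_closed[OF that] by (auto simp: N_def)
  have xN: "(N ^^ m) x \<in> K \<rightarrow> carrier A" for m
    by (induction m) (use x Nc in auto)
  have step: "\<forall>k\<in>K. (N ^^ m) x k = h \<odot> (N ^^ Suc m) x k" for m
  proof (induction m)
    case 0
    show ?case
    proof
      fix k assume k: "k \<in> K"
      have xk: "x k \<in> carrier A" using x k by auto
      have "x k = \<ominus> (h \<odot> vm x k)"
        using eq[OF k] xk vm_closed[OF x k] by (metis minus_equality smult_closed a_comm minus_minus)
      then show "(N ^^ 0) x k = h \<odot> (N ^^ Suc 0) x k"
        using vm_closed[OF x k] by (simp add: N_def smult_minus_one smult_minus_r)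
    qed
  next
    case (Suc m)
    show ?case
    proof
      fix k assume k: "k \<in> K"
      have "vm ((N ^^ m) x) k = vm (\<lambda>j. h \<odot> (N ^^ Suc m) x j) k"
        using Suc xN[of m] xN[of "Suc m"] k by (intro vm_cong) (auto simp: Pi_iff)
      also have "\<dots> = h \<odot> vm ((N ^^ Suc m) x) k" by (rule vm_smult[OF xN k])
      finally show "(N ^^ Suc m) x k = h \<odot> (N ^^ Suc (Suc m)) x k"
        using vm_closed[OF xN[of "Suc m"] k] by (simp add: N_def smult_commute[of _ h])
    qed
  qed
  have "(\<lambda>m. (N ^^ m) x k) 0 = \<zero>"
    by (rule sep_tails) (use xN k step in \<open>auto simp: Pi_iff\<close>)
  then show ?thesis by simp
qed

text \<open>The solution is the Neumann series \<Sum>m. h^m N^m b with \<open>N v = - v M\<close>.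
  Convergence is available in the algebra, that is entry by entry, so the entries are summed
  separately and the equation is verified through their tails.\<close>

lemma vm_solve:
  assumes b: "b \<in> K \<rightarrow> carrier A"
  shows "\<exists>y\<in>K \<rightarrow> carrier A. \<forall>k\<in>K. y k \<oplus> h \<odot> vm y k = b k"
proof -
  define N where "N v = (\<lambda>k. (- 1) \<odot> vm v k)" for v
  have Nc: "N v \<in> K \<rightarrow> carrier A" if "v \<in> K \<rightarrow> carrier A" for v
    using vm_closed[OF that] by (auto simp: N_def)
  define B where "B m = (N ^^ m) b" for m
  have Bc: "B m \<in> K \<rightarrow> carrier A" for m
    unfolding B_def by (induction m) (use b Nc in auto)
  have "\<forall>k. \<exists>s. k \<in> K \<longrightarrow> s \<in> UNIV \<rightarrow> carrier A \<and> (\<forall>m. s m = B m k \<oplus> h \<odot> s (Suc m))"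
    using conv[of "\<lambda>m. B m _"] Bc by (metis (no_types, lifting) PiE Pi_I)
  then obtain s where s: "\<And>k. k \<in> K \<Longrightarrow> s k \<in> UNIV \<rightarrow> carrier A"
    "\<And>k m. k \<in> K \<Longrightarrow> s k m = B m k \<oplus> h \<odot> s k (Suc m)" by metis
  have sc: "(\<lambda>j. s j m) \<in> K \<rightarrow> carrier A" for m using s(1) by auto
  have vms: "vm (\<lambda>j. s j m) k = vm (B m) k \<oplus> h \<odot> vm (\<lambda>j. s j (Suc m)) k" if k: "k \<in> K" for m k
  proof -
    have "vm (\<lambda>j. s j m) k = vm (\<lambda>j. B m j \<oplus> h \<odot> s j (Suc m)) k"
      using sc[of "Suc m"] Bc[of m] by (intro vm_cong[OF sc _ s(2) k]) (auto simp: Pi_iff)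
    also have "\<dots> = vm (B m) k \<oplus> vm (\<lambda>j. h \<odot> s j (Suc m)) k"
      using sc[of "Suc m"] by (intro vm_add[OF Bc _ k]) auto
    finally show ?thesis by (simp add: vm_smult[OF sc k])
  qed
  \<comment> \<open>The first tail of the series must equal N applied to its sum. The defect
    \<open>d m\<close> at stage m satisfies d m = h d (m+1), so it vanishes.\<close>
  have d: "s k (Suc 0) \<oplus> vm (\<lambda>j. s j 0) k = \<zero>" if k: "k \<in> K" for k
  proof -
    define d where "d m = s k (Suc m) \<oplus> vm (\<lambda>j. s j m) k" for m
    have "d m = h \<odot> d (Suc m)" for m
    proof -
      have c: "s k (Suc (Suc m)) \<in> carrier A" "vm (B m) k \<in> carrier A" "vm (\<lambda>j. s j (Suc m)) k \<in> carrier A"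
        using s(1)[OF k] vm_closed[OF Bc k] vm_closed[OF sc k] by auto
      have "d m = ((- 1) \<odot> vm (B m) k \<oplus> h \<odot> s k (Suc (Suc m))) \<oplus> (vm (B m) k \<oplus> h \<odot> vm (\<lambda>j. s j (Suc m)) k)"
      proof -
        have "B (Suc m) k = (- 1) \<odot> vm (B m) k" by (simp add: B_def N_def)
        then have "s k (Suc m) = (- 1) \<odot> vm (B m) k \<oplus> h \<odot> s k (Suc (Suc m))" using s(2)[OF k, of "Suc m"] by argo
        then show ?thesis using vms[OF k, of m] unfolding d_def by argo
      qed
      also have "\<dots> = h \<odot> s k (Suc (Suc m)) \<oplus> h \<odot> vm (\<lambda>j. s j (Suc m)) k"
      proof -
        have "(\<ominus> u \<oplus> v) \<oplus> (u \<oplus> w) = v \<oplus> w" if "u \<in> carrier A" "v \<in> carrier A" "w \<in> carrier A" for u v w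
          using that by algebra
        then show ?thesis using c by (simp add: smult_minus_one)
      qed
      finally show ?thesis using c by (simp add: d_def smult_r_distr)
    qed
    moreover have "d \<in> UNIV \<rightarrow> carrier A" using s(1)[OF k] vm_closed[OF sc k] by (auto simp: d_def Pi_iff)
    ultimately have "d 0 = \<zero>" by (intro sep_tails)
    then show ?thesis by (simp add: d_def)
  qed
  show ?thesis
  proof (intro bexI[of _ "\<lambda>k. s k 0"] ballI)
    fix k assume k: "k \<in> K"
    have c: "s k (Suc 0) \<in> carrier A" "vm (\<lambda>j. s j 0) k \<in> carrier A" "b k \<in> carrier A"
      using s(1)[OF k] vm_closed[OF sc k] b k by auto
    have "s k 0 \<oplus> h \<odot> vm (\<lambda>j. s j 0) k = b k \<oplus> h \<odot> (s k (Suc 0) \<oplus> vm (\<lambda>j. s j 0) k)"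
      using c by (subst s(2)[OF k]) (simp add: B_def smult_r_distr a_assoc)
    then show "s k 0 \<oplus> h \<odot> vm (\<lambda>j. s j 0) k = b k" using d[OF k] c by simp
  qed (rule sc)
qed

end

lemma finsum_near_delta:
  fixes K :: "nat set"
  assumes "finite K" "v \<in> K \<rightarrow> carrier A" "M \<in> K \<rightarrow> K \<rightarrow> carrier A" "k \<in> K"
    "\<And>j. j \<in> K \<Longrightarrow> c j k = (if j = k then 1 else 0) \<odot> \<one> \<oplus> h \<odot> M j k"
  shows "(\<Oplus>j\<in>K. v j \<otimes> c j k) = v k \<oplus> h \<odot> vmul K M v k"
proof -
  have "(\<Oplus>j\<in>K. v j \<otimes> c j k) = (\<Oplus>j\<in>K. (if k = j then v j else \<zero>) \<oplus> h \<odot> (v j \<otimes> M j k))"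
  proof (rule finsum_cong')
    fix j assume j: "j \<in> K"
    then have "v j \<in> carrier A" "M j k \<in> carrier A" using assms by (auto simp: Pi_iff)
    then show "v j \<otimes> c j k = (if k = j then v j else \<zero>) \<oplus> h \<odot> (v j \<otimes> M j k)"
      using assms(5)[OF j] by (auto simp: r_distr smult_mult_r)
  qed (use assms in \<open>auto simp: Pi_iff\<close>)
  also have "\<dots> = (\<Oplus>j\<in>K. (if k = j then v j else \<zero>)) \<oplus> (\<Oplus>j\<in>K. h \<odot> (v j \<otimes> M j k))"
    using assms by (intro finsum_addf) (auto simp: Pi_iff)
  also have "(\<Oplus>j\<in>K. (if k = j then v j else \<zero>)) = v k"
    using assms by (intro add.finprod_singleton) (auto simp: Pi_iff)
  also have "(\<Oplus>j\<in>K. h \<odot> (v j \<otimes> M j k)) = h \<odot> vmul K M v k"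
    unfolding vmul_def using assms by (intro smult_finsum[symmetric]) (auto simp: Pi_iff)
  finally show ?thesis .
qed

lemma near_one_matrix:
  fixes K :: "nat set"
  assumes "\<And>j k. j \<in> K \<Longrightarrow> k \<in> K \<Longrightarrow> near h (if j = k then 1 else 0) (c j k)"
  obtains M where "M \<in> K \<rightarrow> K \<rightarrow> carrier A"
    "\<And>j k. j \<in> K \<Longrightarrow> k \<in> K \<Longrightarrow> c j k = (if j = k then 1 else 0) \<odot> \<one> \<oplus> h \<odot> M j k"
proof -
  have "\<forall>j k. \<exists>y. j \<in> K \<longrightarrow> k \<in> K \<longrightarrow> y \<in> carrier A \<and> c j k = (if j = k then 1 else 0) \<odot> \<one> \<oplus> h \<odot> y"
    using assms unfolding near_def by meson
  then show ?thesis using that by (metis (no_types, lifting) Pi_I)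
qed

text \<open>Writing c = 1 + h M turns the system into that of \<open>vm_solve\<close>. Together with
  \<open>near_cancel\<close>: right multiplication by a matrix congruent to the identity modulo h is
  bijective on row vectors.\<close>

lemma near_solve:
  fixes K :: "nat set"
  assumes "finite K" "b \<in> K \<rightarrow> carrier A" "\<And>j k. j \<in> K \<Longrightarrow> k \<in> K \<Longrightarrow> near h (if j = k then 1 else 0) (c j k)"
  shows "\<exists>y\<in>K \<rightarrow> carrier A. \<forall>k\<in>K. (\<Oplus>j\<in>K. y j \<otimes> c j k) = b k"
proof -
  obtain M where M: "M \<in> K \<rightarrow> K \<rightarrow> carrier A"
    "\<And>j k. j \<in> K \<Longrightarrow> k \<in> K \<Longrightarrow> c j k = (if j = k then 1 else 0) \<odot> \<one> \<oplus> h \<odot> M j k"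
    using near_one_matrix[OF assms(3)] by blast
  have Mc: "M j k \<in> carrier A" if "j \<in> K" "k \<in> K" for j k using M(1) that by auto
  from vm_solve[of K M b, OF assms(1) Mc assms(2)] obtain y where y: "y \<in> K \<rightarrow> carrier A" "\<And>k. k \<in> K \<Longrightarrow> y k \<oplus> h \<odot> vmul K M y k = b k"
    by blast
  have "(\<Oplus>j\<in>K. y j \<otimes> c j k) = b k" if "k \<in> K" for k
    using finsum_near_delta[where c = c, OF assms(1) y(1) M(1) that M(2)[OF _ that]] y(2)[OF that] by simp
  then show ?thesis using y(1) by blast
qed

lemma near_cancel:
  fixes K :: "nat set"
  assumes "finite K" "x \<in> K \<rightarrow> carrier A" "\<And>j k. j \<in> K \<Longrightarrow> k \<in> K \<Longrightarrow> near h (if j = k then 1 else 0) (c j k)"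
    and "\<And>k. k \<in> K \<Longrightarrow> (\<Oplus>j\<in>K. x j \<otimes> c j k) = \<zero>" "k \<in> K"
  shows "x k = \<zero>"
proof -
  obtain M where M: "M \<in> K \<rightarrow> K \<rightarrow> carrier A"
    "\<And>j k. j \<in> K \<Longrightarrow> k \<in> K \<Longrightarrow> c j k = (if j = k then 1 else 0) \<odot> \<one> \<oplus> h \<odot> M j k"
    using near_one_matrix[OF assms(3)] by blast
  have Mc: "M j k \<in> carrier A" if "j \<in> K" "k \<in> K" for j k using M(1) that by auto
  have "x k \<oplus> h \<odot> vmul K M x k = \<zero>" if "k \<in> K" for k
    using finsum_near_delta[where c = c, OF assms(1,2) M(1) that M(2)[OF _ that]] assms(4)[OF that] by simp
  note eq = this
  show ?thesis
    by (rule vm_cancel[of K M x, OF assms(1) Mc assms(2) eq assms(5)])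
qed

text \<open>The 1 by 1 system yields a left inverse y of x. It is again congruent to 1, so it has a
  left inverse z itself, and z = z (y x) = x makes y two-sided.\<close>

lemma near_one_unit:
  assumes "near h 1 x" shows "x \<in> Units A"
proof -
  have left: "\<exists>y. near h 1 y \<and> y \<otimes> x = \<one>" if nx: "near h 1 x" for x
  proof -
    from nx obtain x' where x': "x' \<in> carrier A" "x = 1 \<odot> \<one> \<oplus> h \<odot> x'" unfolding near_def by (rule bexE)
    then have x': "x' \<in> carrier A" "x = \<one> \<oplus> h \<odot> x'" by simp_all
    have "\<exists>y\<in>{0::nat} \<rightarrow> carrier A. \<forall>k\<in>{0}. (\<Oplus>j\<in>{0::nat}. y j \<otimes> x) = \<one>"
      using near_solve[of "{0}" "\<lambda>_. \<one>" "\<lambda>_ _. x"] nx by simp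
    then obtain y where y: "y \<in> carrier A" "y \<otimes> x = \<one>" using near_closed[OF nx] by auto
    have "\<one> = y \<oplus> h \<odot> (y \<otimes> x')" using y x' by (simp add: r_distr smult_mult_r)
    then have "y = \<one> \<oplus> h \<odot> (\<ominus> (y \<otimes> x'))" using y x' by (simp add: smult_minus_r a_assoc r_neg)
    then have "near h 1 y" unfolding near_def using y x' by (intro bexI[of _ "\<ominus> (y \<otimes> x')"]) auto
    then show ?thesis using y by auto
  qed
  obtain y where y: "near h 1 y" "y \<otimes> x = \<one>" using left[OF assms] by auto
  obtain z where z: "near h 1 z" "z \<otimes> y = \<one>" using left[OF y(1)] by auto
  have c: "x \<in> carrier A" "y \<in> carrier A" "z \<in> carrier A" using assms y z near_closed by auto
  have "z = x" using c y z by (metis l_one m_assoc r_one)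
  then show ?thesis using c y z unfolding Units_def by auto
qed

end

section \<open>The h-adic completion as an inverse limit\<close>

locale completing = ralg A for A :: "('r::comm_ring_1, 'a) module" (structure) +
  fixes h :: 'r
begin

abbreviation "I m \<equiv> scalar_ideal h A m"
abbreviation "Qm m \<equiv> quot_alg A (scalar_ideal h A m)"
abbreviation "C \<equiv> completion h A"
abbreviation "\<iota> \<equiv> to_completion h A"

lemma scalar_ideal_ideal: "ideal (I m) A"
proof (rule ralg_idealI)
  show "\<zero> \<in> I m" unfolding scalar_ideal_def by (rule image_eqI[of _ _ \<zero>]) auto
  show "a \<oplus> b \<in> I m" if "a \<in> I m" "b \<in> I m" for a b
    using that unfolding scalar_ideal_def by (auto simp flip: smult_r_distr)
  show "x \<otimes> a \<in> I m" "a \<otimes> x \<in> I m" if "a \<in> I m" "x \<in> carrier A" for a x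
    using that unfolding scalar_ideal_def by (auto simp: smult_mult_l smult_mult_r)
qed (auto simp: scalar_ideal_def)

lemma quotient_level: "quotient A (I m)"
  by (intro quotient.intro ralg scalar_ideal_ideal)

lemmas Qlev = quotient.ralg_quot[OF quotient_level]

lemma in_I: "a \<in> carrier A \<Longrightarrow> h ^ m \<odot> a \<in> I m"
  by (auto simp: scalar_ideal_def)

lemma I_mono: assumes "m \<le> n" "a \<in> I n" shows "a \<in> I m"
proof -
  obtain b where b: "b \<in> carrier A" "a = h ^ n \<odot> b" using assms(2) by (auto simp: scalar_ideal_def)
  have "h ^ n = h ^ m * h ^ (n - m)" using assms(1) by (simp flip: power_add)
  then have "a = h ^ m \<odot> (h ^ (n - m) \<odot> b)" using b by (simp add: smult_assoc)
  then show ?thesis using b in_I by auto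
qed

abbreviation lev :: "nat \<Rightarrow> 'a \<Rightarrow> 'a set" where "lev m a \<equiv> I m +> a"

lemma lev_eq_iff: "a \<in> carrier A \<Longrightarrow> b \<in> carrier A \<Longrightarrow> lev m a = lev m b \<longleftrightarrow> a \<ominus> b \<in> I m"
  by (rule quotient.cl_eq_iff[OF quotient_level])

lemma lev_mono: assumes "m \<le> n" "a \<in> carrier A" shows "lev n a \<subseteq> lev m a"
proof
  fix x assume x: "x \<in> lev n a"
  have "x \<in> carrier A" "lev n x = lev n a" using quotient.cl_sub[OF quotient_level assms(2) x] by auto
  then have "x \<in> carrier A" "lev m x = lev m a" using assms I_mono by (auto simp: lev_eq_iff)
  then show "x \<in> lev m a" using quotient.cl_self[OF quotient_level] by auto
qed

lemma C_simps: "carrier C = {z. \<forall>m. z m \<in> carrier (Qm m) \<and> z (Suc m) \<subseteq> z m}"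
  "\<one>\<^bsub>C\<^esub> = (\<lambda>m. \<one>\<^bsub>Qm m\<^esub>)" "\<zero>\<^bsub>C\<^esub> = (\<lambda>m. \<zero>\<^bsub>Qm m\<^esub>)" "y \<otimes>\<^bsub>C\<^esub> z = (\<lambda>m. y m \<otimes>\<^bsub>Qm m\<^esub> z m)"
  "y \<oplus>\<^bsub>C\<^esub> z = (\<lambda>m. y m \<oplus>\<^bsub>Qm m\<^esub> z m)" "c \<odot>\<^bsub>C\<^esub> z = (\<lambda>m. c \<odot>\<^bsub>Qm m\<^esub> z m)"
  by (simp_all add: completion_def Let_def)

lemma C_memI:
  assumes "\<And>m. a m \<in> carrier A" "\<And>m. a (Suc m) \<ominus> a m \<in> I m" "\<And>m. z m = lev m (a m)"
  shows "z \<in> carrier C"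
proof -
  have "lev (Suc m) (a (Suc m)) \<subseteq> lev m (a m)" for m
    using lev_mono[of m "Suc m" "a (Suc m)"] assms(1,2) lev_eq_iff[of "a (Suc m)" "a m" m] by auto
  then show ?thesis
    using assms quotient.cl_closed[OF quotient_level] by (auto simp: C_simps)
qed

lemma C_memD:
  assumes "z \<in> carrier C"
  shows "z m \<in> carrier (Qm m)" "rep (z m) \<in> carrier A" "lev m (rep (z m)) = z m" "lev m (rep (z (Suc m))) = z m"
proof -
  show *: "z m \<in> carrier (Qm m)" for m using assms by (auto simp: C_simps)
  show r: "rep (z m) \<in> carrier A" "lev m (rep (z m)) = z m" for m
    using quotient.rep_closed[OF quotient_level *] quotient.cl_rep[OF quotient_level *] by auto
  have "rep (z (Suc m)) \<in> z m" using assms quotient.rep_mem[OF quotient_level *[of "Suc m"]] by (auto simp: C_simps)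
  then have "rep (z (Suc m)) \<in> lev m (rep (z m))" using r by simp
  from quotient.cl_sub[OF quotient_level r(1) this] show "lev m (rep (z (Suc m))) = z m" using r by simp
qed

lemmas lev_hom = quotient.cl_add[OF quotient_level] quotient.cl_mult[OF quotient_level] quotient.cl_smult[OF quotient_level]

lemma C_closed:
  shows "y \<in> carrier C \<Longrightarrow> z \<in> carrier C \<Longrightarrow> y \<oplus>\<^bsub>C\<^esub> z \<in> carrier C"
    and "y \<in> carrier C \<Longrightarrow> z \<in> carrier C \<Longrightarrow> y \<otimes>\<^bsub>C\<^esub> z \<in> carrier C"
    and "z \<in> carrier C \<Longrightarrow> c \<odot>\<^bsub>C\<^esub> z \<in> carrier C" and "a \<in> carrier A \<Longrightarrow> \<iota> a \<in> carrier C"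
proof -
  have key: "\<exists>a. (\<forall>m. a m \<in> carrier A \<and> z m = lev m (a m) \<and> z m = lev m (a (Suc m)))" if "z \<in> carrier C" for z
    using C_memD[OF that] by (intro exI[of _ "\<lambda>m. rep (z m)"]) auto
  show "y \<oplus>\<^bsub>C\<^esub> z \<in> carrier C" "y \<otimes>\<^bsub>C\<^esub> z \<in> carrier C" if yz: "y \<in> carrier C" "z \<in> carrier C"
  proof -
    obtain a b where ab: "\<And>m. a m \<in> carrier A" "\<And>m. y m = lev m (a m)" "\<And>m. y m = lev m (a (Suc m))"
      "\<And>m. b m \<in> carrier A" "\<And>m. z m = lev m (b m)" "\<And>m. z m = lev m (b (Suc m))" using key[OF yz(1)] key[OF yz(2)] by metis
    show "y \<oplus>\<^bsub>C\<^esub> z \<in> carrier C"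
    proof (rule C_memI[of "\<lambda>m. a m \<oplus> b m"])
      fix m show "a (Suc m) \<oplus> b (Suc m) \<ominus> (a m \<oplus> b m) \<in> I m"
        using ab lev_hom(1)[of "a m" "b m" m] lev_hom(1)[of "a (Suc m)" "b (Suc m)" m] by (subst lev_eq_iff[symmetric]) auto
    qed (use ab in \<open>auto simp: C_simps lev_hom\<close>)
    show "y \<otimes>\<^bsub>C\<^esub> z \<in> carrier C"
    proof (rule C_memI[of "\<lambda>m. a m \<otimes> b m"])
      fix m show "a (Suc m) \<otimes> b (Suc m) \<ominus> (a m \<otimes> b m) \<in> I m"
        using ab lev_hom(2)[of "a m" "b m" m] lev_hom(2)[of "a (Suc m)" "b (Suc m)" m] by (subst lev_eq_iff[symmetric]) auto
    qed (use ab in \<open>auto simp: C_simps lev_hom\<close>)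
  qed
  show "c \<odot>\<^bsub>C\<^esub> z \<in> carrier C" if zc: "z \<in> carrier C"
  proof -
    obtain b where ab: "\<And>m. b m \<in> carrier A" "\<And>m. z m = lev m (b m)" "\<And>m. z m = lev m (b (Suc m))" using key[OF zc] by metis
    show ?thesis
    proof (rule C_memI[of "\<lambda>m. c \<odot> b m"])
      fix m show "c \<odot> b (Suc m) \<ominus> (c \<odot> b m) \<in> I m"
        using ab lev_hom(3)[of "b m" m c] lev_hom(3)[of "b (Suc m)" m c] by (subst lev_eq_iff[symmetric]) auto
    qed (use ab in \<open>auto simp: C_simps lev_hom\<close>)
  qed
  assume a: "a \<in> carrier A"
  have "a \<ominus> a \<in> I m" for m using lev_eq_iff[OF a a] by auto
  then show "\<iota> a \<in> carrier C"
    by (intro C_memI[of "\<lambda>m. a"]) (use a in \<open>auto simp: to_completion_def\<close>)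
qed

lemma to_completion_hom:
  assumes "a \<in> carrier A"
  shows "b \<in> carrier A \<Longrightarrow> \<iota> (a \<oplus> b) = \<iota> a \<oplus>\<^bsub>C\<^esub> \<iota> b" "b \<in> carrier A \<Longrightarrow> \<iota> (a \<otimes> b) = \<iota> a \<otimes>\<^bsub>C\<^esub> \<iota> b"
    "\<iota> (c \<odot> a) = c \<odot>\<^bsub>C\<^esub> \<iota> a"
  using assms by (simp_all add: to_completion_def C_simps lev_hom)

lemma to_completion_one: "\<iota> \<one> = \<one>\<^bsub>C\<^esub>" and to_completion_zero: "\<iota> \<zero> = \<zero>\<^bsub>C\<^esub>"
  using ahomD(2)[OF quotient.ahom_cl[OF quotient_level]] lin_zero[OF ralg Qlev ahomD(1)[OF quotient.ahom_cl[OF quotient_level]]]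
  by (simp_all add: to_completion_def C_simps)

lemma ralg_completion: "ralg C"
proof (intro ralg.intro ringI)
  note ring = ralg.axioms(1)[OF Qlev] note L = C_memD(1)
  interpret Q: ralg "Qm m" for m by (rule Qlev)
  show "abelian_group C"
  proof (rule abelian_groupI)
    fix x y z assume "x \<in> carrier C" "y \<in> carrier C" "z \<in> carrier C"
    then show "x \<oplus>\<^bsub>C\<^esub> y \<oplus>\<^bsub>C\<^esub> z = x \<oplus>\<^bsub>C\<^esub> (y \<oplus>\<^bsub>C\<^esub> z)" by (simp add: C_simps Q.a_assoc)
  next
    fix x y assume "x \<in> carrier C" "y \<in> carrier C"
    then show "x \<oplus>\<^bsub>C\<^esub> y = y \<oplus>\<^bsub>C\<^esub> x" by (simp add: C_simps Q.a_comm)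
  next
    fix x assume x: "x \<in> carrier C"
    then show "\<zero>\<^bsub>C\<^esub> \<oplus>\<^bsub>C\<^esub> x = x" by (simp add: C_simps)
    show "\<exists>y\<in>carrier C. y \<oplus>\<^bsub>C\<^esub> x = \<zero>\<^bsub>C\<^esub>"
    proof (rule bexI)
      show "(- 1) \<odot>\<^bsub>C\<^esub> x \<in> carrier C" by (rule C_closed(3)[OF x])
      show "(- 1) \<odot>\<^bsub>C\<^esub> x \<oplus>\<^bsub>C\<^esub> x = \<zero>\<^bsub>C\<^esub>" using Q.smult_minus_one[OF L[OF x]] Q.l_neg[OF L[OF x]] by (simp add: C_simps(3,5,6))
    qed
  next
    show "\<zero>\<^bsub>C\<^esub> \<in> carrier C" using C_closed(4)[OF zero_closed] by (simp add: to_completion_zero)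
  qed (use C_closed(1) in auto)
  show "Group.monoid C"
  proof (rule monoidI)
    show "\<one>\<^bsub>C\<^esub> \<in> carrier C" using C_closed(4)[OF one_closed] by (simp add: to_completion_one)
  next
    fix x y z assume "x \<in> carrier C" "y \<in> carrier C" "z \<in> carrier C"
    then show "x \<otimes>\<^bsub>C\<^esub> y \<otimes>\<^bsub>C\<^esub> z = x \<otimes>\<^bsub>C\<^esub> (y \<otimes>\<^bsub>C\<^esub> z)" by (simp add: C_simps Q.m_assoc)
  qed (use C_closed(2) in \<open>auto simp: C_simps\<close>)
  show "ralg_axioms C"
  proof
    fix a c assume "a \<in> carrier C" then show "c \<odot>\<^bsub>C\<^esub> a \<in> carrier C" by (rule C_closed(3))
  qed (simp_all add: C_simps Q.smult_l_distr Q.smult_r_distr Q.smult_assoc Q.smult_mult_l Q.smult_mult_r)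
next
  interpret Q: ralg "Qm m" for m by (rule Qlev)
  fix x y z assume "x \<in> carrier C" "y \<in> carrier C" "z \<in> carrier C"
  then show "(x \<oplus>\<^bsub>C\<^esub> y) \<otimes>\<^bsub>C\<^esub> z = x \<otimes>\<^bsub>C\<^esub> z \<oplus>\<^bsub>C\<^esub> y \<otimes>\<^bsub>C\<^esub> z"
    "z \<otimes>\<^bsub>C\<^esub> (x \<oplus>\<^bsub>C\<^esub> y) = z \<otimes>\<^bsub>C\<^esub> x \<oplus>\<^bsub>C\<^esub> z \<otimes>\<^bsub>C\<^esub> y"
    by (simp_all add: C_simps Q.l_distr Q.r_distr)
qed

lemma ahom_to_completion: "ahom A C \<iota>"
  by (intro ahomI linI) (auto simp: C_closed to_completion_hom to_completion_one)

lemma smult_power_level: assumes "Y \<in> carrier (Qm m)" shows "h ^ m \<odot>\<^bsub>Qm m\<^esub> Y = \<zero>\<^bsub>Qm m\<^esub>"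
proof -
  interpret quotient A "I m" by (rule quotient_level)
  obtain a where a: "a \<in> carrier A" "Y = lev m a" using assms by (rule quot_cases)
  have "lev m (h ^ m \<odot> a) = lev m \<zero>" using a in_I[OF a(1), of m] by (subst cl_eq_iff) (auto simp: a_minus_def)
  then show ?thesis using a cl_smult lin_zero[OF ralg ralg_quot ahomD(1)[OF ahom_cl]] by simp
qed

sublocale C: ralg C by (rule ralg_completion)

lemma cralg_completion: "cralg C h"
proof
  fix x assume x: "x \<in> carrier C" and d: "\<And>m. \<exists>y\<in>carrier C. x = h ^ m \<odot>\<^bsub>C\<^esub> y"
  have "x m = \<zero>\<^bsub>Qm m\<^esub>" for m
  proof -
    obtain y where "y \<in> carrier C" "x = h ^ m \<odot>\<^bsub>C\<^esub> y" using d by auto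
    then show ?thesis using smult_power_level[OF C_memD(1)[of y m]] by (simp add: C_simps(6))
  qed
  then show "x = \<zero>\<^bsub>C\<^esub>" by (simp add: C_simps(3) fun_eq_iff)
next
  fix z :: "nat \<Rightarrow> nat \<Rightarrow> 'a set" assume "z \<in> UNIV \<rightarrow> carrier C"
  then have z: "z i \<in> carrier C" for i by auto
  \<comment> \<open>\<open>S m n\<close> is the sum of the first n terms of the series that starts
    at index m. At level n all later terms vanish, being multiples of \<open>h ^ n\<close>, so the
    diagonal values \<open>S m n n\<close> form the limit \<open>s m\<close>.\<close>
  define S where "S m n = (\<Oplus>\<^bsub>C\<^esub>i\<in>{..<n}. h ^ i \<odot>\<^bsub>C\<^esub> z (m + i))" for m n
  define s where "s m = (\<lambda>n. S m n n)" for m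
  have Sc: "S m n \<in> carrier C" for m n unfolding S_def using z by (intro C.finsum_closed) auto
  have S_Suc: "S m (Suc n) = S m n \<oplus>\<^bsub>C\<^esub> h ^ n \<odot>\<^bsub>C\<^esub> z (m + n)" for m n
    unfolding S_def lessThan_Suc using z by (subst C.finsum_insert) (auto simp: C.a_comm)
  have S_Suc': "S m (Suc n) = z m \<oplus>\<^bsub>C\<^esub> h \<odot>\<^bsub>C\<^esub> S (Suc m) n" for m n
  proof (induction n)
    case 0
    have "S m 0 = \<zero>\<^bsub>C\<^esub>" "S (Suc m) 0 = \<zero>\<^bsub>C\<^esub>" by (auto simp: S_def)
    then show ?case using z by (simp add: S_Suc)
  next
    case (Suc n)
    have "S m (Suc (Suc n)) = S m (Suc n) \<oplus>\<^bsub>C\<^esub> h ^ Suc n \<odot>\<^bsub>C\<^esub> z (m + Suc n)" by (rule S_Suc)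
    also have "\<dots> = z m \<oplus>\<^bsub>C\<^esub> h \<odot>\<^bsub>C\<^esub> (S (Suc m) n \<oplus>\<^bsub>C\<^esub> h ^ n \<odot>\<^bsub>C\<^esub> z (Suc m + n))"
      using z Sc Suc by (simp add: C.smult_r_distr C.smult_assoc C.a_assoc)
    finally show ?case by (simp only: S_Suc)
  qed
  have lev: "S m (Suc n) n = S m n n" for m n
  proof -
    interpret Q: ralg "Qm n" by (rule Qlev)
    show ?thesis using C_memD(1)[OF Sc[of m n], of n] C_memD(1)[OF z] smult_power_level[OF C_memD(1)[OF z]]
      by (simp add: S_Suc C_simps(5,6))
  qed
  have sc: "s m \<in> carrier C" for m
  proof (rule C_memI)
    fix n
    show "rep (S m n n) \<in> carrier A" "s m n = lev n (rep (S m n n))" using C_memD[OF Sc] by (auto simp: s_def)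
    have "lev n (rep (S m (Suc n) (Suc n))) = S m (Suc n) n" by (rule C_memD(4)[OF Sc])
    also have "\<dots> = lev n (rep (S m n n))" using C_memD(3)[OF Sc] by (simp add: lev)
    finally show "rep (S m (Suc n) (Suc n)) \<ominus> rep (S m n n) \<in> I n"
      using C_memD(2)[OF Sc] by (simp add: lev_eq_iff)
  qed
  have "s m = z m \<oplus>\<^bsub>C\<^esub> h \<odot>\<^bsub>C\<^esub> s (Suc m)" for m
  proof
    fix n
    have "s m n = S m (Suc n) n" by (simp add: s_def lev)
    also have "\<dots> = z m n \<oplus>\<^bsub>Qm n\<^esub> h \<odot>\<^bsub>Qm n\<^esub> S (Suc m) n n" by (simp add: S_Suc' C_simps(5,6))
    finally show "s m n = (z m \<oplus>\<^bsub>C\<^esub> h \<odot>\<^bsub>C\<^esub> s (Suc m)) n" by (simp add: C_simps(5,6) s_def)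
  qed
  then show "\<exists>s\<in>UNIV \<rightarrow> carrier C. \<forall>m. s m = z m \<oplus>\<^bsub>C\<^esub> h \<odot>\<^bsub>C\<^esub> s (Suc m)"
    using sc by (intro bexI[of _ s] allI Pi_I)
qed

sublocale C: cralg C h by (rule cralg_completion)

text \<open>Successive representatives of z differ by \<open>h ^ m \<odot> c m\<close>, so z is the
  sum of a series with coefficients in \<open>A\<close> itself. The tails \<open>s\<close> are part
  of the result because limits are compared through tails.\<close>

lemma completion_expansion:
  assumes z: "z \<in> carrier C"
  obtains c s where "\<And>m. c m \<in> carrier A" "\<And>m. s m \<in> carrier C" "s 0 = z"
    "\<And>m::nat. s m = \<iota> (c m) \<oplus>\<^bsub>C\<^esub> h \<odot>\<^bsub>C\<^esub> s (Suc m)"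
proof -
  note D = C_memD[OF z]
  \<comment> \<open>Level 0 is the zero ring, so zero is a legitimate representative there; it makes
    the telescoping sum start at zero.\<close>
  define a where "a m = (if m = 0 then \<zero> else rep (z m))" for m
  have a: "a m \<in> carrier A" for m using D(2) by (simp add: a_def)
  have I0: "I 0 = carrier A" by (auto simp: scalar_ideal_def image_iff)
  have la: "lev m (a m) = z m" for m
  proof (cases "m = 0")
    case True
    have "lev 0 \<zero> = lev 0 (rep (z 0))" using D(2)[of 0] by (subst lev_eq_iff) (auto simp: I0)
    then show ?thesis using True D(3)[of 0] by (simp add: a_def)
  next
    case False then show ?thesis using D(3)[of m] by (simp add: a_def)
  qed
  have "a (Suc m) \<ominus> a m \<in> I m" for m
    using D(4)[of m] la[of m] a[of m] D(2)[of "Suc m"] lev_eq_iff[of "a (Suc m)" "a m" m] by (simp add: a_def)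
  then have "\<exists>b\<in>carrier A. a (Suc m) \<ominus> a m = h ^ m \<odot> b" for m by (auto simp: scalar_ideal_def)
  then obtain c where c: "\<And>m. c m \<in> carrier A" "\<And>m. a (Suc m) \<ominus> a m = h ^ m \<odot> c m" by metis
  have aS: "a (Suc m) = a m \<oplus> h ^ m \<odot> c m" for m
  proof -
    have "a (Suc m) = a m \<oplus> (a (Suc m) \<ominus> a m)" using a[of m] a[of "Suc m"] by algebra
    then show ?thesis by (simp add: c)
  qed
  have "(\<lambda>m. \<iota> (c m)) \<in> UNIV \<rightarrow> carrier C" using c(1) ahomD(3)[OF ahom_to_completion] by auto
  from C.conv[OF this] obtain s where s': "s \<in> UNIV \<rightarrow> carrier C" "\<forall>m. s m = \<iota> (c m) \<oplus>\<^bsub>C\<^esub> h \<odot>\<^bsub>C\<^esub> s (Suc m)" by (rule bexE)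
  have s: "s m \<in> carrier C" for m
    using s'(1) by auto
  note s = this s'(2)[rule_format]
  have "s 0 = \<iota> (a m) \<oplus>\<^bsub>C\<^esub> h ^ m \<odot>\<^bsub>C\<^esub> s m" for m
  proof (induction m)
    case 0 show ?case using s(1)[of 0] by (simp add: a_def to_completion_zero)
  next
    case (Suc m)
    have ic: "\<iota> (a m) \<in> carrier C" "\<iota> (c m) \<in> carrier C" using a c ahomD(3)[OF ahom_to_completion] by auto
    have "s 0 = \<iota> (a m) \<oplus>\<^bsub>C\<^esub> h ^ m \<odot>\<^bsub>C\<^esub> (\<iota> (c m) \<oplus>\<^bsub>C\<^esub> h \<odot>\<^bsub>C\<^esub> s (Suc m))" using Suc s(2)[of m] by simp
    also have "\<dots> = (\<iota> (a m) \<oplus>\<^bsub>C\<^esub> h ^ m \<odot>\<^bsub>C\<^esub> \<iota> (c m)) \<oplus>\<^bsub>C\<^esub> h ^ Suc m \<odot>\<^bsub>C\<^esub> s (Suc m)"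
      using ic s(1)[of "Suc m"] by (simp add: C.smult_r_distr C.a_assoc C.smult_assoc C.smult_commute[of _ h])
    also have "\<iota> (a m) \<oplus>\<^bsub>C\<^esub> h ^ m \<odot>\<^bsub>C\<^esub> \<iota> (c m) = \<iota> (a (Suc m))"
      using a c by (simp add: aS to_completion_hom)
    finally show ?case .
  qed
  then have "s 0 m = z m" for m
  proof -
    interpret Q: ralg "Qm m" by (rule Qlev)
    have "s 0 m = lev m (a m) \<oplus>\<^bsub>Qm m\<^esub> h ^ m \<odot>\<^bsub>Qm m\<^esub> s m m"
      by (subst \<open>\<And>m. s 0 = \<iota> (a m) \<oplus>\<^bsub>C\<^esub> h ^ m \<odot>\<^bsub>C\<^esub> s m\<close>[of m]) (simp add: C_simps(5,6) to_completion_def)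
    then show ?thesis using la[of m] D(1)[of m] smult_power_level[OF C_memD(1)[OF s(1)]] by simp
  qed
  then have "s 0 = z" by auto
  then show ?thesis using that c(1) s by blast
qed

text \<open>One level is lost: if a represents z at level n + 1, then h a lies in h^(n+1) A, so a
  lies in h^n A after cancelling h, and z vanishes at level n.\<close>

lemma completion_torsion_free:
  assumes tf: "\<And>a. a \<in> carrier A \<Longrightarrow> h \<odot> a = \<zero> \<Longrightarrow> a = \<zero>" and z: "z \<in> carrier C" "h \<odot>\<^bsub>C\<^esub> z = \<zero>\<^bsub>C\<^esub>"
  shows "z = \<zero>\<^bsub>C\<^esub>"
proof -
  have "z n = \<zero>\<^bsub>Qm n\<^esub>" for n
  proof -
    note D = C_memD[OF z(1)]
    let ?a = "rep (z (Suc n))"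
    have "lev (Suc n) (h \<odot> ?a) = h \<odot>\<^bsub>Qm (Suc n)\<^esub> z (Suc n)" using D(2,3)[of "Suc n"] lev_hom(3)[of ?a "Suc n" h] by simp
    also have "\<dots> = \<zero>\<^bsub>Qm (Suc n)\<^esub>" using z(2) by (simp add: C_simps(3,6) fun_eq_iff)
    also have "\<dots> = lev (Suc n) \<zero>" using to_completion_zero by (simp add: to_completion_def C_simps(3) fun_eq_iff)
    finally have "h \<odot> ?a \<ominus> \<zero> \<in> I (Suc n)" using D(2)[of "Suc n"] by (simp add: lev_eq_iff)
    then obtain b where b: "b \<in> carrier A" "h \<odot> ?a = h ^ Suc n \<odot> b" using D(2)[of "Suc n"] by (auto simp: scalar_ideal_def a_minus_def)
    then have "h \<odot> ?a = h \<odot> (h ^ n \<odot> b)" by (simp add: smult_assoc)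
    then have e: "h \<odot> (?a \<ominus> h ^ n \<odot> b) = \<zero>" using D(2)[of "Suc n"] b by (simp add: smult_diff_r minus_self_eq)
    have "?a \<ominus> h ^ n \<odot> b = \<zero>" by (rule tf[OF _ e]) (use b D(2)[of "Suc n"] in auto)
    then have "?a = h ^ n \<odot> b" using b D(2)[of "Suc n"] by (simp add: minus_self_eq)
    then have "?a \<ominus> \<zero> \<in> I n" using b in_I[OF b(1), of n] by (simp add: a_minus_def)
    then have "lev n ?a = lev n \<zero>" using D(2)[of "Suc n"] by (simp add: lev_eq_iff)
    then show ?thesis using D(4)[of n] to_completion_zero by (simp add: to_completion_def C_simps(3) fun_eq_iff)
  qed
  then show ?thesis by (simp add: C_simps(3) fun_eq_iff)
qed

end

section \<open>Continuous extension of linear maps to completions\<close>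

locale hat_extension = A: completing A h + B: completing B h
  for A :: "('r::comm_ring_1, 'a) module" and B :: "('r, 'b) module" and h +
  fixes f
  assumes lin: "lin A (completion h B) f"
begin

text \<open>Linearity over the scalars already implies continuity: a difference
  \<open>h ^ m \<odot> b\<close> is sent to a multiple of \<open>h ^ m\<close>, which is zero at
  level m.\<close>

lemma f_level:
  assumes "a \<in> carrier A" "a' \<in> carrier A" "A.lev m a = A.lev m a'" shows "f a m = f a' m"
proof -
  interpret Q: ralg "B.Qm m" by (rule B.Qlev)
  have "a \<ominus>\<^bsub>A\<^esub> a' \<in> A.I m" using assms A.lev_eq_iff by auto
  then obtain b where b: "b \<in> carrier A" "a \<ominus>\<^bsub>A\<^esub> a' = h ^ m \<odot>\<^bsub>A\<^esub> b" by (auto simp: scalar_ideal_def)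
  have "a = a' \<oplus>\<^bsub>A\<^esub> (a \<ominus>\<^bsub>A\<^esub> a')" using assms by algebra
  then have "f a = f (a' \<oplus>\<^bsub>A\<^esub> h ^ m \<odot>\<^bsub>A\<^esub> b)" using b by simp
  then have "f a = f a' \<oplus>\<^bsub>B.C\<^esub> h ^ m \<odot>\<^bsub>B.C\<^esub> f b" using b assms linD(2,3)[OF lin] by simp
  then show ?thesis using B.smult_power_level[OF B.C_memD(1)[OF linD(1)[OF lin b(1)]], of m]
      B.C_memD(1)[OF linD(1)[OF lin assms(2)], of m] by (simp add: B.C_simps(5,6))
qed

lemma hat_ext_level:
  assumes "z \<in> carrier A.C" "a \<in> carrier A" "A.lev m a = z m" shows "hat_ext f z m = f a m"
  unfolding hat_ext_def using A.C_memD(2,3)[OF assms(1)] assms by (intro f_level) auto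

lemma hat_ext_to_completion: "a \<in> carrier A \<Longrightarrow> hat_ext f (to_completion h A a) = f a"
  using hat_ext_level[of "to_completion h A a" a] A.C_closed(4)[of a] by (auto simp: to_completion_def fun_eq_iff)

lemma lin_hat_ext: "lin A.C B.C (hat_ext f)"
proof (rule linI)
  fix z assume z: "z \<in> carrier A.C"
  note D = A.C_memD[OF z]
  show "hat_ext f z \<in> carrier B.C"
  proof (rule B.C_memI)
    fix m
    have fc: "f (rep (z m)) \<in> carrier B.C" for m using linD(1)[OF lin D(2)] .
    show "rep (f (rep (z m)) m) \<in> carrier B" "hat_ext f z m = B.lev m (rep (f (rep (z m)) m))"
      using B.C_memD(2,3)[OF fc] by (auto simp: hat_ext_def)
    have "B.lev m (rep (f (rep (z (Suc m))) (Suc m))) = f (rep (z (Suc m))) m" by (rule B.C_memD(4)[OF fc])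
    also have "\<dots> = f (rep (z m)) m" using D by (intro f_level) auto
    also have "\<dots> = B.lev m (rep (f (rep (z m)) m))" using B.C_memD(3)[OF fc] by simp
    finally show "rep (f (rep (z (Suc m))) (Suc m)) \<ominus>\<^bsub>B\<^esub> rep (f (rep (z m)) m) \<in> B.I m"
      using B.C_memD(2)[OF fc] B.lev_eq_iff by auto
  qed
next
  fix y z assume yz: "y \<in> carrier A.C" "z \<in> carrier A.C"
  show "hat_ext f (y \<oplus>\<^bsub>A.C\<^esub> z) = hat_ext f y \<oplus>\<^bsub>B.C\<^esub> hat_ext f z"
  proof
    fix m
    have "hat_ext f (y \<oplus>\<^bsub>A.C\<^esub> z) m = f (rep (y m) \<oplus>\<^bsub>A\<^esub> rep (z m)) m"
      using A.C_memD(2,3)[OF yz(1)] A.C_memD(2,3)[OF yz(2)]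
      by (intro hat_ext_level[OF A.C_closed(1)[OF yz]]) (auto simp: A.C_simps(5) A.lev_hom(1)[symmetric])
    then show "hat_ext f (y \<oplus>\<^bsub>A.C\<^esub> z) m = (hat_ext f y \<oplus>\<^bsub>B.C\<^esub> hat_ext f z) m"
      using yz A.C_memD(2) linD(2)[OF lin] by (simp add: B.C_simps(5) hat_ext_def)
  qed
next
  fix c z assume z: "z \<in> carrier A.C"
  show "hat_ext f (c \<odot>\<^bsub>A.C\<^esub> z) = c \<odot>\<^bsub>B.C\<^esub> hat_ext f z"
  proof
    fix m
    have "hat_ext f (c \<odot>\<^bsub>A.C\<^esub> z) m = f (c \<odot>\<^bsub>A\<^esub> rep (z m)) m"
      using A.C_memD(2,3)[OF z]
      by (intro hat_ext_level[OF A.C_closed(3)[OF z]]) (auto simp: A.C_simps(6) A.lev_hom(3)[symmetric])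
    then show "hat_ext f (c \<odot>\<^bsub>A.C\<^esub> z) m = (c \<odot>\<^bsub>B.C\<^esub> hat_ext f z) m"
      using z A.C_memD(2) linD(3)[OF lin] by (simp add: B.C_simps(6) hat_ext_def)
  qed
qed

lemma ahom_hat_ext: assumes "ahom A B.C f" shows "ahom A.C B.C (hat_ext f)"
proof (rule ahomI[OF lin_hat_ext])
  show "hat_ext f \<one>\<^bsub>A.C\<^esub> = \<one>\<^bsub>B.C\<^esub>"
    using hat_ext_to_completion[OF A.one_closed] ahomD(2)[OF assms] by (simp add: A.to_completion_one)
  fix y z assume yz: "y \<in> carrier A.C" "z \<in> carrier A.C"
  show "hat_ext f (y \<otimes>\<^bsub>A.C\<^esub> z) = hat_ext f y \<otimes>\<^bsub>B.C\<^esub> hat_ext f z"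
  proof
    fix m
    have "hat_ext f (y \<otimes>\<^bsub>A.C\<^esub> z) m = f (rep (y m) \<otimes>\<^bsub>A\<^esub> rep (z m)) m"
      using A.C_memD(2,3)[OF yz(1)] A.C_memD(2,3)[OF yz(2)]
      by (intro hat_ext_level[OF A.C_closed(2)[OF yz]]) (auto simp: A.C_simps(4) A.lev_hom(2)[symmetric])
    then show "hat_ext f (y \<otimes>\<^bsub>A.C\<^esub> z) m = (hat_ext f y \<otimes>\<^bsub>B.C\<^esub> hat_ext f z) m"
      using yz A.C_memD(2) ahomD(6)[OF assms] by (simp add: B.C_simps(4) hat_ext_def)
  qed
qed

end

section \<open>Torsion\<close>

definition torsion_free :: "'r \<Rightarrow> ('r, 'a) module \<Rightarrow> bool" where
  "torsion_free h A \<longleftrightarrow> (\<forall>a\<in>carrier A. h \<odot>\<^bsub>A\<^esub> a = \<zero>\<^bsub>A\<^esub> \<longrightarrow> a = \<zero>\<^bsub>A\<^esub>)"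

lemma (in ralg) add_minus_left: "x \<in> carrier A \<Longrightarrow> y \<in> carrier A \<Longrightarrow> x \<oplus> y \<ominus> x = y"
  by algebra

lemma torsion_freeD: "torsion_free h A \<Longrightarrow> a \<in> carrier A \<Longrightarrow> h \<odot>\<^bsub>A\<^esub> a = \<zero>\<^bsub>A\<^esub> \<Longrightarrow> a = \<zero>\<^bsub>A\<^esub>"
  by (auto simp: torsion_free_def)

lemma torsion_free_power:
  assumes "ralg A" "torsion_free h A" "a \<in> carrier A" "h ^ m \<odot>\<^bsub>A\<^esub> a = \<zero>\<^bsub>A\<^esub>" shows "a = \<zero>\<^bsub>A\<^esub>"
proof -
  interpret A: ralg A by fact
  show ?thesis using assms(4)
  proof (induction m)
    case (Suc m)
    then show ?case using assms(3) torsion_freeD[OF assms(2), of "h ^ m \<odot>\<^bsub>A\<^esub> a"] by (simp add: A.smult_assoc)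
  qed (use assms in simp)
qed

text \<open>
  Equational criterion: \<open>\<Sum> a \<otimes> b\<close> vanishes iff the function sending \<open>b\<close> to the sum of the coefficients \<open>a\<close> in
  front of \<open>b\<close> is of the form \<open>\<Sum>i. a\<^sub>i \<kappa>\<^sub>i\<close> with linear relations \<open>\<kappa>\<^sub>i\<close> between the elements \<open>b\<close>.
  The lists below represent such sums.
\<close>

context tensor begin

definition relation :: "('b \<Rightarrow>\<^sub>0 'r) \<Rightarrow> bool" where
  "relation \<kappa> \<longleftrightarrow> Poly_Mapping.keys \<kappa> \<subseteq> carrier B \<and> lin_ext B (\<lambda>b. b) \<kappa> = \<zero>\<^bsub>B\<^esub>"

definition valid :: "('a \<times> ('b \<Rightarrow>\<^sub>0 'r)) list \<Rightarrow> bool" where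
  "valid L \<longleftrightarrow> (\<forall>(a, \<kappa>)\<in>set L. a \<in> carrier A \<and> relation \<kappa>)"

fun comb :: "('a \<times> ('b \<Rightarrow>\<^sub>0 'r)) list \<Rightarrow> 'b \<Rightarrow> 'a" where
  "comb [] b = \<zero>\<^bsub>A\<^esub>"
| "comb ((a, \<kappa>) # L) b = Poly_Mapping.lookup \<kappa> b \<odot>\<^bsub>A\<^esub> a \<oplus>\<^bsub>A\<^esub> comb L b"

lemma valid_simps [simp]: "valid []" "valid ((a, \<kappa>) # L) \<longleftrightarrow> a \<in> carrier A \<and> relation \<kappa> \<and> valid L"
  "valid (L @ L') \<longleftrightarrow> valid L \<and> valid L'"
  by (auto simp: valid_def)

lemma comb_closed [simp]: "valid L \<Longrightarrow> comb L b \<in> carrier A"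
  by (induction L b rule: comb.induct) auto

lemma comb_append: "valid L \<Longrightarrow> valid L' \<Longrightarrow> comb (L @ L') b = comb L b \<oplus>\<^bsub>A\<^esub> comb L' b"
  by (induction L b rule: comb.induct) (auto simp: A.a_assoc)

lemma id_carrier: "(\<lambda>b. b) \<in> carrier B \<rightarrow> carrier B" by auto

lemma relation_add: "relation \<kappa> \<Longrightarrow> relation \<kappa>' \<Longrightarrow> relation (\<kappa> + \<kappa>')"
  unfolding relation_def by (auto simp: B.lin_ext_add[OF id_carrier] keys_add_subset intro: keys_add_subset[THEN subsetD])

lemma relation_smult: assumes "relation \<kappa>" shows "relation (Poly_Mapping.map ((*) c) \<kappa>)"
proof -
  have "Poly_Mapping.keys (Poly_Mapping.map ((*) c) \<kappa>) \<subseteq> carrier B"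
    using assms keys_map_mult[of c \<kappa>] by (auto simp: relation_def)
  then show ?thesis using assms by (auto simp: relation_def B.lin_ext_smult[OF id_carrier])
qed

lemma comb_smult: "valid L \<Longrightarrow> \<exists>L'. valid L' \<and> (\<forall>b. comb L' b = c \<odot>\<^bsub>A\<^esub> comb L b)"
proof (induction L)
  case (Cons x L)
  obtain a \<kappa> where x: "x = (a, \<kappa>)" by (cases x)
  obtain L' where "valid L'" "\<forall>b. comb L' b = c \<odot>\<^bsub>A\<^esub> comb L b" using Cons x by auto
  then show ?case using Cons.prems x
    by (intro exI[of _ "(c \<odot>\<^bsub>A\<^esub> a, \<kappa>) # L'"]) (auto simp: A.smult_r_distr A.smult_commute[of _ c])
qed (auto intro!: exI[of _ "[]"])

text \<open>After division of the coefficients the value of the combination is killed by h, and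
  \<open>B\<close> has no h-torsion.\<close>

lemma relation_divide:
  assumes tf: "torsion_free h B" and "relation \<kappa>" and "\<And>b. h dvd Poly_Mapping.lookup \<kappa> b"
  shows "\<exists>\<kappa>'. relation \<kappa>' \<and> (\<forall>b. Poly_Mapping.lookup \<kappa> b = h * Poly_Mapping.lookup \<kappa>' b)"
proof -
  \<comment> \<open>The quotient is chosen to be 0 wherever the coefficient is 0, so that finite
    support is kept.\<close>
  have "\<forall>b. \<exists>d. Poly_Mapping.lookup \<kappa> b = h * d \<and> (Poly_Mapping.lookup \<kappa> b = 0 \<longrightarrow> d = 0)"
  proof
    fix b show "\<exists>d. Poly_Mapping.lookup \<kappa> b = h * d \<and> (Poly_Mapping.lookup \<kappa> b = 0 \<longrightarrow> d = 0)"
    proof (cases "Poly_Mapping.lookup \<kappa> b = 0")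
      case False
      obtain d where "Poly_Mapping.lookup \<kappa> b = h * d" using assms(3)[of b] by (rule dvdE)
      then show ?thesis using False by blast
    qed simp
  qed
  then obtain d where d: "\<And>b. Poly_Mapping.lookup \<kappa> b = h * d b" "\<And>b. Poly_Mapping.lookup \<kappa> b = 0 \<Longrightarrow> d b = 0" by metis
  have sub: "{b. d b \<noteq> 0} \<subseteq> Poly_Mapping.keys \<kappa>" using d(2) by (auto simp: in_keys_iff)
  then have fin: "finite {b. d b \<noteq> 0}" by (rule finite_subset) simp
  define \<kappa>' where "\<kappa>' = Abs_poly_mapping d"
  have lk: "Poly_Mapping.lookup \<kappa>' b = d b" for b by (simp add: \<kappa>'_def fin)
  have keys: "Poly_Mapping.keys \<kappa>' \<subseteq> carrier B" using assms(2) sub by (auto simp: relation_def in_keys_iff[of _ \<kappa>'] lk)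
  have "\<kappa> = Poly_Mapping.map ((*) h) \<kappa>'" by (rule poly_mapping_eqI) (simp add: lk d(1))
  then have "h \<odot>\<^bsub>B\<^esub> lin_ext B (\<lambda>b. b) \<kappa>' = \<zero>\<^bsub>B\<^esub>" using assms(2) B.lin_ext_smult[OF id_carrier keys, of h] by (simp add: relation_def)
  then have "relation \<kappa>'" using torsion_freeD[OF tf B.lin_ext_closed[OF id_carrier keys]] keys by (auto simp: relation_def)
  then show ?thesis using lk d(1) by auto
qed

lemma comb_divide:
  assumes tf: "torsion_free h B"
  shows "valid L \<Longrightarrow> (\<And>a \<kappa> b. (a, \<kappa>) \<in> set L \<Longrightarrow> h dvd Poly_Mapping.lookup \<kappa> b) \<Longrightarrow>
    \<exists>L'. valid L' \<and> (\<forall>b. comb L b = h \<odot>\<^bsub>A\<^esub> comb L' b)"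
proof (induction L)
  case (Cons x L)
  obtain a \<kappa> where x: "x = (a, \<kappa>)" by (cases x)
  obtain L' where L': "valid L'" "\<forall>b. comb L b = h \<odot>\<^bsub>A\<^esub> comb L' b" using Cons x by fastforce
  have \<kappa>: "relation \<kappa>" "\<And>b. h dvd Poly_Mapping.lookup \<kappa> b" using Cons.prems x by auto
  from relation_divide[OF tf this] obtain \<kappa>' where "relation \<kappa>'" "\<forall>b. Poly_Mapping.lookup \<kappa> b = h * Poly_Mapping.lookup \<kappa>' b" by blast
  then show ?case using Cons.prems x L'
    by (intro exI[of _ "(a, \<kappa>') # L'"]) (auto simp: A.smult_r_distr A.smult_assoc)
qed (auto intro!: exI[of _ "[]"])

text \<open>Every relation \<mu> in the list is replaced by \<mu> - u \<mu>(b0) \<kappa>, which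
  would clear the coefficient at \<open>b0\<close> if u were inverse to \<kappa>(b0). The unchanged
  length serves the induction on the number of terms.\<close>

lemma comb_shear:
  assumes "relation \<kappa>"
  shows "valid L \<Longrightarrow> \<exists>L'. valid L' \<and> length L' = length L \<and>
    (\<forall>b. comb L' b = comb L b \<ominus>\<^bsub>A\<^esub> (u * Poly_Mapping.lookup \<kappa> b) \<odot>\<^bsub>A\<^esub> comb L b0)"
proof (induction L)
  case (Cons x L)
  obtain a \<mu> where x: "x = (a, \<mu>)" by (cases x)
  obtain L' where L': "valid L'" "length L' = length L"
    "\<forall>b. comb L' b = comb L b \<ominus>\<^bsub>A\<^esub> (u * Poly_Mapping.lookup \<kappa> b) \<odot>\<^bsub>A\<^esub> comb L b0" using Cons x by auto
  have xs: "a \<in> carrier A" "relation \<mu>" "valid L" using Cons.prems x by auto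
  let ?\<mu> = "\<mu> + Poly_Mapping.map ((*) (- (u * Poly_Mapping.lookup \<mu> b0))) \<kappa>"
  have v: "valid ((a, ?\<mu>) # L')" using xs L' relation_add relation_smult assms by auto
  have "comb ((a, ?\<mu>) # L') b = comb (x # L) b \<ominus>\<^bsub>A\<^esub> (u * Poly_Mapping.lookup \<kappa> b) \<odot>\<^bsub>A\<^esub> comb (x # L) b0" for b
  proof -
    have *: "(p \<oplus>\<^bsub>A\<^esub> \<ominus>\<^bsub>A\<^esub> q) \<oplus>\<^bsub>A\<^esub> (r \<ominus>\<^bsub>A\<^esub> s) = (p \<oplus>\<^bsub>A\<^esub> r) \<ominus>\<^bsub>A\<^esub> (q \<oplus>\<^bsub>A\<^esub> s)"
      if "p \<in> carrier A" "q \<in> carrier A" "r \<in> carrier A" "s \<in> carrier A" for p q r s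
      using that by algebra
    have "(u * Poly_Mapping.lookup \<kappa> b) \<odot>\<^bsub>A\<^esub> (Poly_Mapping.lookup \<mu> b0 \<odot>\<^bsub>A\<^esub> a) = (u * Poly_Mapping.lookup \<mu> b0 * Poly_Mapping.lookup \<kappa> b) \<odot>\<^bsub>A\<^esub> a"
      using xs by (simp add: mult_ac flip: A.smult_assoc)
    moreover have "(Poly_Mapping.lookup \<mu> b + - (u * Poly_Mapping.lookup \<mu> b0) * Poly_Mapping.lookup \<kappa> b) \<odot>\<^bsub>A\<^esub> a
        = Poly_Mapping.lookup \<mu> b \<odot>\<^bsub>A\<^esub> a \<oplus>\<^bsub>A\<^esub> \<ominus>\<^bsub>A\<^esub> ((u * Poly_Mapping.lookup \<mu> b0 * Poly_Mapping.lookup \<kappa> b) \<odot>\<^bsub>A\<^esub> a)"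
      using xs by (simp only: A.smult_l_distr mult_minus_left A.smult_minus_l)
    ultimately show ?thesis using xs L'(1) L'(3) *
      by (simp only: x comb.simps lookup_add lookup_map_mult A.smult_r_distr comb_closed A.smult_closed)
  qed
  then show ?case using v L' by (intro exI[of _ "(a, ?\<mu>) # L'"]) auto
qed (auto intro!: exI[of _ "[]"] simp: a_minus_def)

lemma comb_remove: "valid (L1 @ (a, \<kappa>) # L2) \<Longrightarrow>
    comb (L1 @ (a, \<kappa>) # L2) b = Poly_Mapping.lookup \<kappa> b \<odot>\<^bsub>A\<^esub> a \<oplus>\<^bsub>A\<^esub> comb (L1 @ L2) b"
  by (simp add: comb_append A.a_lcomm)

text \<open>
  If some coefficient of some \<open>\<kappa>\<^sub>i\<close> is a unit modulo \<open>h\<close>, then \<open>a\<^sub>i\<close> is a combination of the other \<open>a\<^sub>j\<close> modulo \<open>h\<close>,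
  and the number of terms can be lowered; otherwise all \<open>\<kappa>\<^sub>i\<close> can be divided by \<open>h\<close>.
\<close>

lemma comb_torsion_free:
  assumes tfA: "torsion_free h A" and tfB: "torsion_free h B"
    and residue: "\<And>c. h dvd c \<or> (\<exists>u d. c * u = 1 + h * d)"
  shows "length L = n \<Longrightarrow> valid L \<Longrightarrow> (\<And>b. f b \<in> carrier A) \<Longrightarrow> (\<And>b. h \<odot>\<^bsub>A\<^esub> f b = comb L b)
    \<Longrightarrow> \<exists>L'. valid L' \<and> (\<forall>b. f b = comb L' b)"
proof (induction n arbitrary: L f)
  case 0
  have "f b = \<zero>\<^bsub>A\<^esub>" for b by (rule torsion_freeD[OF tfA]) (use 0 in auto)
  then show ?case by (intro exI[of _ "[]"]) simp
next
  case (Suc n)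
  note f = Suc.prems(3)
  show ?case
  proof (cases "\<forall>(a, \<kappa>)\<in>set L. \<forall>b. h dvd Poly_Mapping.lookup \<kappa> b")
    case True
    then obtain L' where L': "valid L'" "\<forall>b. comb L b = h \<odot>\<^bsub>A\<^esub> comb L' b" using comb_divide[OF tfB Suc.prems(2)] by blast
    have "f b = comb L' b" for b
    proof -
      have "h \<odot>\<^bsub>A\<^esub> (f b \<ominus>\<^bsub>A\<^esub> comb L' b) = \<zero>\<^bsub>A\<^esub>" using L' f Suc.prems(4)[of b] by (simp add: A.smult_diff_r A.minus_self_eq)
      from torsion_freeD[OF tfA _ this] show ?thesis using L' f by (simp add: A.minus_self_eq)
    qed
    then show ?thesis using L'(1) by blast
  next
    case False
    then obtain a \<kappa> b0 where *: "(a, \<kappa>) \<in> set L" "\<not> h dvd Poly_Mapping.lookup \<kappa> b0" by blast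
    then obtain u d where ud: "Poly_Mapping.lookup \<kappa> b0 * u = 1 + h * d" using residue by blast
    obtain L1 L2 where L: "L = L1 @ (a, \<kappa>) # L2" using *(1) by (meson split_list)
    let ?L0 = "L1 @ L2"
    have v: "valid ?L0" "a \<in> carrier A" "relation \<kappa>" using Suc.prems(2) L by auto
    \<comment> \<open>Multiplying h f(b0) = \<kappa>(b0) a + \<open>comb ?L0 b0\<close> by u
      isolates a up to a multiple of h. The element \<open>a'\<close> satisfies h a' = a + u
      \<open>comb ?L0 b0\<close>, so subtracting \<kappa> a' from f removes the term of a and leaves
      a shear of the other terms.\<close>
    define a' where "a' = u \<odot>\<^bsub>A\<^esub> f b0 \<ominus>\<^bsub>A\<^esub> d \<odot>\<^bsub>A\<^esub> a"
    have a': "a' \<in> carrier A" using f v by (simp add: a'_def)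
    have cL: "comb L b = Poly_Mapping.lookup \<kappa> b \<odot>\<^bsub>A\<^esub> a \<oplus>\<^bsub>A\<^esub> comb ?L0 b" for b
      unfolding L by (rule comb_remove) (use Suc.prems(2) L in simp)
    have "u \<odot>\<^bsub>A\<^esub> (h \<odot>\<^bsub>A\<^esub> f b0) = (1 + h * d) \<odot>\<^bsub>A\<^esub> a \<oplus>\<^bsub>A\<^esub> u \<odot>\<^bsub>A\<^esub> comb ?L0 b0"
      using v Suc.prems(4)[of b0] cL[of b0] by (simp add: A.smult_r_distr ud[symmetric] mult.commute[of _ u] A.smult_assoc)
    then have e1: "h \<odot>\<^bsub>A\<^esub> (u \<odot>\<^bsub>A\<^esub> f b0) = a \<oplus>\<^bsub>A\<^esub> h \<odot>\<^bsub>A\<^esub> (d \<odot>\<^bsub>A\<^esub> a) \<oplus>\<^bsub>A\<^esub> u \<odot>\<^bsub>A\<^esub> comb ?L0 b0"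
      using v f by (simp add: A.smult_l_distr A.smult_assoc A.smult_commute[of _ u])
    have alg: "x \<oplus>\<^bsub>A\<^esub> y \<oplus>\<^bsub>A\<^esub> z \<ominus>\<^bsub>A\<^esub> y = x \<oplus>\<^bsub>A\<^esub> z" if "x \<in> carrier A" "y \<in> carrier A" "z \<in> carrier A" for x y z
      using that by algebra
    have ha': "h \<odot>\<^bsub>A\<^esub> a' = a \<oplus>\<^bsub>A\<^esub> u \<odot>\<^bsub>A\<^esub> comb ?L0 b0"
      unfolding a'_def using v f by (simp add: A.smult_diff_r e1 alg)
    obtain L0' where L0': "valid L0'" "length L0' = length ?L0"
      "\<forall>b. comb L0' b = comb ?L0 b \<ominus>\<^bsub>A\<^esub> (u * Poly_Mapping.lookup \<kappa> b) \<odot>\<^bsub>A\<^esub> comb ?L0 b0"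
      using comb_shear[OF v(3,1)] by blast
    define f' where "f' b = f b \<ominus>\<^bsub>A\<^esub> Poly_Mapping.lookup \<kappa> b \<odot>\<^bsub>A\<^esub> a'" for b
    have "\<exists>L'. valid L' \<and> (\<forall>b. f' b = comb L' b)"
    proof (rule Suc.IH[OF _ L0'(1)])
      show "length L0' = n" using L0'(2) Suc.prems(1) L by simp
      show "f' b \<in> carrier A" for b using f a' by (simp add: f'_def)
      fix b
      have alg2: "x \<oplus>\<^bsub>A\<^esub> y \<ominus>\<^bsub>A\<^esub> (x \<oplus>\<^bsub>A\<^esub> z) = y \<ominus>\<^bsub>A\<^esub> z" if "x \<in> carrier A" "y \<in> carrier A" "z \<in> carrier A" for x y z
        using that by algebra
      have "h \<odot>\<^bsub>A\<^esub> f' b = comb L b \<ominus>\<^bsub>A\<^esub> Poly_Mapping.lookup \<kappa> b \<odot>\<^bsub>A\<^esub> (h \<odot>\<^bsub>A\<^esub> a')"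
        using f a' Suc.prems(4)[of b] by (simp add: f'_def A.smult_diff_r A.smult_commute[of _ h])
      also have "\<dots> = comb L0' b" using v L0'(3)
        by (simp add: cL ha' A.smult_r_distr alg2 mult.commute[of u] A.smult_assoc)
      finally show "h \<odot>\<^bsub>A\<^esub> f' b = comb L0' b" .
    qed
    then obtain L' where L': "valid L'" "\<forall>b. f' b = comb L' b" by blast
    have "f b = comb ((a', \<kappa>) # L') b" for b
    proof -
      have "x = y \<oplus>\<^bsub>A\<^esub> (x \<ominus>\<^bsub>A\<^esub> y)" if "x \<in> carrier A" "y \<in> carrier A" for x y using that by algebra
      from this[of "f b" "Poly_Mapping.lookup \<kappa> b \<odot>\<^bsub>A\<^esub> a'"] show ?thesis using f a' L'(2) by (simp add: f'_def[symmetric])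
    qed
    then show ?thesis using v a' L'(1) by (intro exI[of _ "(a', \<kappa>) # L'"]) auto
  qed
qed

text \<open>The second entries serve as mere labels here: the map lives on the free module and does
  not descend to the tensor product. What is determined there is the function of b up to
  combinations of linear relations between the labels.\<close>

definition coef :: "'b \<Rightarrow> ('a \<times> 'b \<Rightarrow>\<^sub>0 'r) \<Rightarrow> 'a" where
  "coef b = lin_ext A (\<lambda>(a, b'). if b' = b then a else \<zero>\<^bsub>A\<^esub>)"

lemma lin_coef: "lin F A (coef b)"
  unfolding coef_def by (rule lin_lin_ext[OF A.ralg]) (auto simp: DirProd_def)

lemma coef_s: "a \<in> carrier A \<Longrightarrow> coef b (s a b' c) = (if b' = b then c \<odot>\<^bsub>A\<^esub> a else \<zero>\<^bsub>A\<^esub>)"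
  unfolding coef_def by (subst A.lin_ext_single) auto

lemma coef_diff: "p \<in> carrier F \<Longrightarrow> q \<in> carrier F \<Longrightarrow> coef b (p - q) = coef b p \<ominus>\<^bsub>A\<^esub> coef b q"
  using lin_diff[OF F_ralg A.ralg lin_coef] by (simp add: F_minus)

lemma lin_id_diff: "Poly_Mapping.keys p \<subseteq> carrier B \<Longrightarrow> Poly_Mapping.keys q \<subseteq> carrier B \<Longrightarrow>
    lin_ext B (\<lambda>b. b) (p - q) = lin_ext B (\<lambda>b. b) p \<ominus>\<^bsub>B\<^esub> lin_ext B (\<lambda>b. b) q"
proof -
  assume *: "Poly_Mapping.keys p \<subseteq> carrier B" "Poly_Mapping.keys q \<subseteq> carrier B"
  then have d: "Poly_Mapping.keys (p - q) \<subseteq> carrier B" by (rule keys_minus_subset)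
  note c = B.lin_ext_closed[OF id_carrier]
  have "lin_ext B (\<lambda>b. b) p = lin_ext B (\<lambda>b. b) (p - q) \<oplus>\<^bsub>B\<^esub> lin_ext B (\<lambda>b. b) q"
    using B.lin_ext_add[OF id_carrier d *(2)] by simp
  then show ?thesis using c[OF d] c[OF *(2)] by (simp add: a_minus_def B.a_assoc B.r_neg)
qed

text \<open>Relations in the first argument keep the label and cancel in \<open>A\<close>, so their
  coefficient functions vanish. Relations in the second argument distribute one element a over
  several labels along a linear relation \<kappa>.\<close>

lemma rel_comb: assumes "\<rho> \<in> bilinear_rels A B" shows "\<exists>L. valid L \<and> (\<forall>b. coef b \<rho> = comb L b)"
  using assms
proof (cases rule: rels_cases)
  case (l a a' b)
  have "x \<oplus>\<^bsub>A\<^esub> y \<ominus>\<^bsub>A\<^esub> x \<ominus>\<^bsub>A\<^esub> y = \<zero>\<^bsub>A\<^esub>" if "x \<in> carrier A" "y \<in> carrier A" for x y using that by algebra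
  then show ?thesis using l
    by (intro exI[of _ "[]"]) (simp add: coef_diff minus_closed_F coef_s a_minus_def)
next
  case (r a b b')
  let ?\<kappa> = "Poly_Mapping.single (b \<oplus>\<^bsub>B\<^esub> b') 1 - Poly_Mapping.single b 1 - Poly_Mapping.single b' (1::'r)"
  have "x \<oplus>\<^bsub>B\<^esub> y \<ominus>\<^bsub>B\<^esub> x \<ominus>\<^bsub>B\<^esub> y = \<zero>\<^bsub>B\<^esub>" if "x \<in> carrier B" "y \<in> carrier B" for x y using that by algebra
  then have "relation ?\<kappa>" using r by (simp add: relation_def lin_id_diff keys_minus_subset B.lin_ext_single)
  then show ?thesis using r
    by (intro exI[of _ "[(a, ?\<kappa>)]"]) (auto simp: coef_diff minus_closed_F coef_s lookup_minus lookup_single when_def A.smult_diff_l)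
next
  case (sl c a b)
  then show ?thesis
    by (intro exI[of _ "[]"]) (simp add: coef_diff coef_s A.r_neg a_minus_def)
next
  case (sr c a b)
  let ?\<kappa> = "Poly_Mapping.single (c \<odot>\<^bsub>B\<^esub> b) 1 - Poly_Mapping.single b c"
  have "relation ?\<kappa>" using sr keys_minus_subset[of "Poly_Mapping.single (c \<odot>\<^bsub>B\<^esub> b) 1" "carrier B" "Poly_Mapping.single b c"]
    by (auto simp: relation_def lin_id_diff B.lin_ext_single B.r_neg a_minus_def)
  then show ?thesis using sr
    by (intro exI[of _ "[(a, ?\<kappa>)]"]) (auto simp: coef_diff coef_s lookup_minus lookup_single when_def A.smult_diff_l)
qed

lemma ideal_comb: assumes "p \<in> tensor_ideal A B" shows "\<exists>L. valid L \<and> (\<forall>b. coef b p = comb L b)"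
  using assms
proof (induction rule: tensor_ideal_induct)
  case zero
  then show ?case by (intro exI[of _ "[]"]) (simp add: coef_def)
next
  case (add \<rho> c p)
  obtain L where L: "valid L" "\<forall>b. coef b p = comb L b" using add by blast
  obtain L1 where L1: "valid L1" "\<forall>b. coef b \<rho> = comb L1 b" using rel_comb[OF add(1)] by blast
  obtain L2 where L2: "valid L2" "\<forall>b. comb L2 b = c \<odot>\<^bsub>A\<^esub> comb L1 b" using comb_smult[OF L1(1)] by blast
  have \<rho>: "\<rho> \<in> carrier F" using add(1) rels_closed by auto
  have "coef b (c \<odot>\<^bsub>F\<^esub> \<rho> \<oplus>\<^bsub>F\<^esub> p) = comb (L2 @ L) b" for b
    using linD[OF lin_coef] \<rho> add(2) L L1 L2 by (simp add: comb_append)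
  then show ?case using L L2 by (intro exI[of _ "L2 @ L"]) (simp add: F_add F_smult)
qed

definition gsum :: "'b set \<Rightarrow> ('b \<Rightarrow> 'a) \<Rightarrow> ('r, 'a, 'b) tensor" where
  "gsum S f = (\<Oplus>\<^bsub>T\<^esub>b\<in>S. pt (f b) b)"

lemma gsum_add:
  assumes "S \<subseteq> carrier B" "\<And>b. f b \<in> carrier A" "\<And>b. g b \<in> carrier A"
  shows "gsum S (\<lambda>b. f b \<oplus>\<^bsub>A\<^esub> g b) = gsum S f \<oplus>\<^bsub>T\<^esub> gsum S g"
proof -
  have "gsum S (\<lambda>b. f b \<oplus>\<^bsub>A\<^esub> g b) = (\<Oplus>\<^bsub>T\<^esub>b\<in>S. pt (f b) b \<oplus>\<^bsub>T\<^esub> pt (g b) b)"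
    unfolding gsum_def using assms by (intro T.finsum_cong' refl Pi_I T.add.m_closed pt_closed) (simp_all add: pt_add_l subsetD)
  also have "\<dots> = gsum S f \<oplus>\<^bsub>T\<^esub> gsum S g"
    unfolding gsum_def using assms by (intro T.finsum_addf Pi_I pt_closed) auto
  finally show ?thesis .
qed

lemma pt_zero_l: "b \<in> carrier B \<Longrightarrow> pt \<zero>\<^bsub>A\<^esub> b = \<zero>\<^bsub>T\<^esub>"
  using pt_smult_l[of "\<zero>\<^bsub>A\<^esub>" b 0] by simp

lemma gsum_zero: "S \<subseteq> carrier B \<Longrightarrow> gsum S (\<lambda>b. \<zero>\<^bsub>A\<^esub>) = \<zero>\<^bsub>T\<^esub>"
  unfolding gsum_def by (rule T.add.finprod_one_eqI) (simp add: pt_zero_l subsetD)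

lemma pt_zero_r: "a \<in> carrier A \<Longrightarrow> pt a \<zero>\<^bsub>B\<^esub> = \<zero>\<^bsub>T\<^esub>"
  using pt_smult_r[of a "\<zero>\<^bsub>B\<^esub>" 0] by simp

lemma pt_finsum_r: "a \<in> carrier A \<Longrightarrow> f \<in> S \<rightarrow> carrier B \<Longrightarrow> pt a (finsum B f S) = (\<Oplus>\<^bsub>T\<^esub>b\<in>S. pt a (f b))"
  using bilin_pt by (intro lin_finsum[OF B.ralg T.ralg]) (auto simp: bilin_def)

text \<open>The converse direction of the criterion: \<Sum> \<kappa>(b) a \<otimes> b equals a
  \<otimes> \<Sum> \<kappa>(b) b, which is zero.\<close>

lemma gsum_relation:
  assumes "finite S" "S \<subseteq> carrier B" "a \<in> carrier A" "relation \<kappa>" "Poly_Mapping.keys \<kappa> \<subseteq> S"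
  shows "gsum S (\<lambda>b. Poly_Mapping.lookup \<kappa> b \<odot>\<^bsub>A\<^esub> a) = \<zero>\<^bsub>T\<^esub>"
proof -
  have "gsum S (\<lambda>b. Poly_Mapping.lookup \<kappa> b \<odot>\<^bsub>A\<^esub> a) = (\<Oplus>\<^bsub>T\<^esub>b\<in>S. pt a (Poly_Mapping.lookup \<kappa> b \<odot>\<^bsub>B\<^esub> b))"
    unfolding gsum_def using assms by (intro T.finsum_cong') (auto simp: pt_smult_l pt_smult_r subset_iff)
  also have "\<dots> = pt a (\<Oplus>\<^bsub>B\<^esub>b\<in>S. Poly_Mapping.lookup \<kappa> b \<odot>\<^bsub>B\<^esub> b)"
    using assms by (intro pt_finsum_r[symmetric]) auto
  also have "(\<Oplus>\<^bsub>B\<^esub>b\<in>S. Poly_Mapping.lookup \<kappa> b \<odot>\<^bsub>B\<^esub> b) = lin_ext B (\<lambda>b. b) \<kappa>"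
    by (rule B.lin_ext_superset[OF id_carrier assms(1,5,2), symmetric])
  finally show ?thesis using assms by (simp add: relation_def pt_zero_r)
qed

lemma gsum_comb:
  "finite S \<Longrightarrow> S \<subseteq> carrier B \<Longrightarrow> valid L \<Longrightarrow> (\<And>a \<kappa>. (a, \<kappa>) \<in> set L \<Longrightarrow> Poly_Mapping.keys \<kappa> \<subseteq> S) \<Longrightarrow> gsum S (comb L) = \<zero>\<^bsub>T\<^esub>"
proof (induction L)
  case Nil
  have "comb [] = (\<lambda>b. \<zero>\<^bsub>A\<^esub>)" by (rule ext) simp
  then show ?case using gsum_zero[OF Nil(2)] by simp
next
  case (Cons x L)
  obtain a \<kappa> where x: "x = (a, \<kappa>)" by (cases x)
  have "comb (x # L) = (\<lambda>b. Poly_Mapping.lookup \<kappa> b \<odot>\<^bsub>A\<^esub> a \<oplus>\<^bsub>A\<^esub> comb L b)" by (rule ext) (simp add: x)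
  moreover have "gsum S (\<lambda>b. Poly_Mapping.lookup \<kappa> b \<odot>\<^bsub>A\<^esub> a) = \<zero>\<^bsub>T\<^esub>"
    using Cons.prems x by (intro gsum_relation) auto
  moreover have "gsum S (comb L) = \<zero>\<^bsub>T\<^esub>" using Cons x by auto
  ultimately show ?case using Cons.prems x by (simp add: gsum_add)
qed

text \<open>The terms of \<open>p\<close> with equal second entry are collected.\<close>

lemma cl_gsum:
  assumes "finite S" "S \<subseteq> carrier B" "Poly_Mapping.keys p \<subseteq> carrier A \<times> S"
  shows "cl p = gsum S (\<lambda>b. coef b p)"
  using assms(3)
proof (induction p rule: pm_induct)
  case zero
  have "cl 0 = \<zero>\<^bsub>T\<^esub>" using lin_zero[OF F_ralg ralg_quot ahomD(1)[OF ahom_cl]] by (simp add: T_eq F_zero)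
  then show ?case using gsum_zero[OF assms(2)] by (simp add: coef_def)
next
  case (add z c p)
  obtain a b where z: "z = (a, b)" "a \<in> carrier A" "b \<in> S" using add(1) by auto
  have p: "p \<in> carrier F" using add(2) assms(2) by (auto simp: F_carrier)
  have b: "b \<in> carrier B" using z assms by auto
  have sp: "s a b c \<in> carrier F" using z b by auto
  have "gsum S (\<lambda>b'. coef b' (s a b c)) = (\<Oplus>\<^bsub>T\<^esub>b'\<in>S. if b = b' then pt (c \<odot>\<^bsub>A\<^esub> a) b' else \<zero>\<^bsub>T\<^esub>)"
    unfolding gsum_def using assms z pt_smult_l[of "\<zero>\<^bsub>A\<^esub>" _ 0] by (intro T.finsum_cong') (auto simp: coef_s subset_iff)
  also have "\<dots> = pt (c \<odot>\<^bsub>A\<^esub> a) b" using assms z by (intro T.add.finprod_singleton) (auto simp: subset_iff)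
  finally have 1: "gsum S (\<lambda>b'. coef b' (s a b c)) = cl (s a b c)" using z b by (simp add: cl_s pt_smult_l)
  have "cl (s a b c + p) = cl (s a b c) \<oplus>\<^bsub>T\<^esub> cl p" using sp p by (simp add: T_eq cl_add F_add)
  also have "\<dots> = gsum S (\<lambda>b'. coef b' (s a b c) \<oplus>\<^bsub>A\<^esub> coef b' p)"
    using linD(1)[OF lin_coef] sp p assms(2) add(3) 1 by (simp add: gsum_add)
  also have "(\<lambda>b'. coef b' (s a b c) \<oplus>\<^bsub>A\<^esub> coef b' p) = (\<lambda>b'. coef b' (s a b c + p))"
    using linD(2)[OF lin_coef sp p] by (simp add: F_add)
  finally show ?case by (simp add: z)
qed

text \<open>If h p lies in the span of the relations, its coefficient function is a combination of
  linear relations; \<open>comb_torsion_free\<close> divides this combination by h, and read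
  backwards the result shows that p is zero in the tensor product. The hypothesis
  \<open>residue\<close> says that the scalars modulo h form a field or the zero ring.\<close>

theorem torsion_free_tensor:
  assumes tfA: "torsion_free h A" and tfB: "torsion_free h B"
    and residue: "\<And>c. h dvd c \<or> (\<exists>u d. c * u = 1 + h * d)"
  shows "torsion_free h T"
  unfolding torsion_free_def
proof (intro ballI impI)
  fix u assume u: "u \<in> carrier T" "h \<odot>\<^bsub>T\<^esub> u = \<zero>\<^bsub>T\<^esub>"
  obtain p where p: "p \<in> carrier F" "u = cl p" using u(1) unfolding T_eq by (rule quot_cases)
  have "cl (h \<odot>\<^bsub>F\<^esub> p) = cl \<zero>\<^bsub>F\<^esub>"
    using u p cl_smult[of p h] lin_zero[OF F_ralg ralg_quot ahomD(1)[OF ahom_cl]] by (simp add: T_eq)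
  then have "h \<odot>\<^bsub>F\<^esub> p \<in> tensor_ideal A B" using p(1) by (subst (asm) cl_eq_iff) (auto simp: a_minus_def)
  then obtain L where L: "valid L" "\<forall>b. coef b (h \<odot>\<^bsub>F\<^esub> p) = comb L b" using ideal_comb by blast
  have "\<exists>L'. valid L' \<and> (\<forall>b. coef b p = comb L' b)"
    by (rule comb_torsion_free[OF tfA tfB residue refl L(1)])
       (use linD(1,3)[OF lin_coef] p(1) L(2) in auto)
  then obtain L' where L': "valid L'" "\<forall>b. coef b p = comb L' b" by blast
  define S where "S = snd ` Poly_Mapping.keys p \<union> (\<Union>(a, \<kappa>)\<in>set L'. Poly_Mapping.keys \<kappa>)"
  have S: "finite S" "S \<subseteq> carrier B" using p(1) L'(1) by (auto simp: S_def F_carrier valid_def relation_def split: prod.splits)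
  have "Poly_Mapping.keys p \<subseteq> carrier A \<times> S" using p(1) by (force simp: S_def F_carrier)
  then have "cl p = gsum S (\<lambda>b. coef b p)" by (rule cl_gsum[OF S])
  also have "(\<lambda>b. coef b p) = comb L'" using L'(2) by auto
  also have "gsum S (comb L') = \<zero>\<^bsub>T\<^esub>" by (rule gsum_comb[OF S L'(1)]) (auto simp: S_def)
  finally show "u = \<zero>\<^bsub>T\<^esub>" using p by simp
qed

end

text \<open>The idea is to clear denominators in the bilinearity relations.\<close>

lemma tensor_sub_kernel:
  fixes A :: "('r::idom, 'a) module" and B :: "('r, 'b) module"
  assumes A: "ralg A" and B: "ralg B" and M: "subalg A M" and N: "subalg B N"
    and denM: "\<And>a. a \<in> carrier A \<Longrightarrow> \<exists>d. d \<noteq> 0 \<and> d \<odot>\<^bsub>A\<^esub> a \<in> M"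
    and denN: "\<And>b. b \<in> carrier B \<Longrightarrow> \<exists>d. d \<noteq> 0 \<and> d \<odot>\<^bsub>B\<^esub> b \<in> N"
    and w: "w \<in> carrier (tensor_alg (A\<lparr>carrier := M\<rparr>) (B\<lparr>carrier := N\<rparr>))"
    and 0: "tensor_map A B (\<lambda>x. x) (\<lambda>x. x) w = \<zero>\<^bsub>tensor_alg A B\<^esub>"
  shows "\<exists>d. d \<noteq> 0 \<and> d \<odot>\<^bsub>tensor_alg (A\<lparr>carrier := M\<rparr>) (B\<lparr>carrier := N\<rparr>)\<^esub> w = \<zero>\<^bsub>tensor_alg (A\<lparr>carrier := M\<rparr>) (B\<lparr>carrier := N\<rparr>)\<^esub>"
proof -
  let ?A = "A\<lparr>carrier := M\<rparr>" and ?B = "B\<lparr>carrier := N\<rparr>"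
  interpret AB: tensor A B using A B by (rule tensor.intro)
  interpret MN: tensor ?A ?B using ralg_subalg[OF A M] ralg_subalg[OF B N] by (rule tensor.intro)
  note Ms = subalgD[OF M] and Ns = subalgD[OF N]
  \<comment> \<open>A partial inverse of the inclusion, up to one factor \<open>D\<close> in each
    tensor factor. The default value 0 is never met when \<open>D\<close> is a multiple of the
    denominators of all entries in the relations used, of which there are finitely many.\<close>
  define \<theta> where "\<theta> D = (\<lambda>(a, b). if D \<odot>\<^bsub>A\<^esub> a \<in> M \<and> D \<odot>\<^bsub>B\<^esub> b \<in> N then MN.pt (D \<odot>\<^bsub>A\<^esub> a) (D \<odot>\<^bsub>B\<^esub> b) else \<zero>\<^bsub>MN.T\<^esub>)" for D
  have \<theta>c: "\<theta> D z \<in> carrier MN.T" for D z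
    by (cases z) (simp add: \<theta>_def MN.pt_closed)
  define \<Theta> where "\<Theta> D = lin_ext MN.T (\<theta> D)" for D
  have lin\<Theta>: "lin AB.F MN.T (\<Theta> D)" for D
    unfolding \<Theta>_def by (rule lin_lin_ext[OF MN.ralg_tensor]) (use \<theta>c in auto)
  have \<Theta>s: "\<Theta> D (Poly_Mapping.single z c) = c \<odot>\<^bsub>MN.T\<^esub> \<theta> D z" for D z c
    unfolding \<Theta>_def using \<theta>c by (intro MN.T.lin_ext_single)
  have \<Theta>d: "\<Theta> D (p - q) = \<Theta> D p \<ominus>\<^bsub>MN.T\<^esub> \<Theta> D q" if "p \<in> carrier AB.F" "q \<in> carrier AB.F" for D p q
    using lin_diff[OF AB.F_ralg MN.ralg_tensor lin\<Theta>] that by (simp add: AB.F_minus)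
  have inM: "D \<odot>\<^bsub>A\<^esub> a \<in> M" if "d \<odot>\<^bsub>A\<^esub> a \<in> M" "d dvd D" "a \<in> carrier A" for d D a
  proof -
    obtain e where "D = e * d" using \<open>d dvd D\<close> by (metis dvdE mult.commute)
    then show ?thesis using that Ms(3)[of "d \<odot>\<^bsub>A\<^esub> a" e] by (simp add: AB.A.smult_assoc)
  qed
  have inN: "D \<odot>\<^bsub>B\<^esub> a \<in> N" if "d \<odot>\<^bsub>B\<^esub> a \<in> N" "d dvd D" "a \<in> carrier B" for d D a
  proof -
    obtain e where "D = e * d" using \<open>d dvd D\<close> by (metis dvdE mult.commute)
    then show ?thesis using that Ns(3)[of "d \<odot>\<^bsub>B\<^esub> a" e] by (simp add: AB.B.smult_assoc)
  qed
  note alg = MN.T.add_minus_left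
  have rel: "\<exists>d. d \<noteq> 0 \<and> (\<forall>D. d dvd D \<longrightarrow> \<Theta> D \<rho> = \<zero>\<^bsub>MN.T\<^esub>)" if \<rho>: "\<rho> \<in> bilinear_rels A B" for \<rho>
    using \<rho>
  proof (cases rule: AB.rels_cases)
    case (l a a' b)
    obtain d1 d2 d3 where d: "d1 \<noteq> 0" "d1 \<odot>\<^bsub>A\<^esub> a \<in> M" "d2 \<noteq> 0" "d2 \<odot>\<^bsub>A\<^esub> a' \<in> M" "d3 \<noteq> 0" "d3 \<odot>\<^bsub>B\<^esub> b \<in> N"
      using denM[OF l(1)] denM[OF l(2)] denN[OF l(3)] by blast
    show ?thesis
    proof (intro exI[of _ "d1 * d2 * d3"] conjI allI impI)
      fix D assume D: "d1 * d2 * d3 dvd D"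
      then have dv: "d1 dvd D" "d2 dvd D" "d3 dvd D" by (auto elim: dvd_mult_left dvd_mult_right)
      then have m: "D \<odot>\<^bsub>A\<^esub> a \<in> M" "D \<odot>\<^bsub>A\<^esub> a' \<in> M" "D \<odot>\<^bsub>B\<^esub> b \<in> N" using inM inN d l by auto
      then show "\<Theta> D \<rho> = \<zero>\<^bsub>MN.T\<^esub>" using l Ms(4)[OF m(1,2)] MN.pt_add_l[of "D \<odot>\<^bsub>A\<^esub> a" "D \<odot>\<^bsub>A\<^esub> a'" "D \<odot>\<^bsub>B\<^esub> b"]
        by (simp add: \<Theta>d AB.minus_closed_F \<Theta>s \<theta>c) (simp add: \<theta>_def AB.A.smult_r_distr alg MN.pt_closed)
    qed (use d in auto)
  next
    case (r a b b')
    obtain d1 d2 d3 where d: "d1 \<noteq> 0" "d1 \<odot>\<^bsub>A\<^esub> a \<in> M" "d2 \<noteq> 0" "d2 \<odot>\<^bsub>B\<^esub> b \<in> N" "d3 \<noteq> 0" "d3 \<odot>\<^bsub>B\<^esub> b' \<in> N"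
      using denM[OF r(1)] denN[OF r(2)] denN[OF r(3)] by blast
    show ?thesis
    proof (intro exI[of _ "d1 * d2 * d3"] conjI allI impI)
      fix D assume D: "d1 * d2 * d3 dvd D"
      then have dv: "d1 dvd D" "d2 dvd D" "d3 dvd D" by (auto elim: dvd_mult_left dvd_mult_right)
      then have m: "D \<odot>\<^bsub>A\<^esub> a \<in> M" "D \<odot>\<^bsub>B\<^esub> b \<in> N" "D \<odot>\<^bsub>B\<^esub> b' \<in> N" using inM inN d r by auto
      then show "\<Theta> D \<rho> = \<zero>\<^bsub>MN.T\<^esub>" using r Ns(4)[OF m(2,3)] MN.pt_add_r[of "D \<odot>\<^bsub>A\<^esub> a" "D \<odot>\<^bsub>B\<^esub> b" "D \<odot>\<^bsub>B\<^esub> b'"]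
        by (simp add: \<Theta>d AB.minus_closed_F \<Theta>s \<theta>c) (simp add: \<theta>_def AB.B.smult_r_distr alg MN.pt_closed)
    qed (use d in auto)
  next
    case (sl c a b)
    obtain d1 d3 where d: "d1 \<noteq> 0" "d1 \<odot>\<^bsub>A\<^esub> a \<in> M" "d3 \<noteq> 0" "d3 \<odot>\<^bsub>B\<^esub> b \<in> N"
      using denM[OF sl(1)] denN[OF sl(2)] by blast
    show ?thesis
    proof (intro exI[of _ "d1 * d3"] conjI allI impI)
      fix D assume D: "d1 * d3 dvd D"
      then have dv: "d1 dvd D" "d3 dvd D" by (auto elim: dvd_mult_left dvd_mult_right)
      then have m: "D \<odot>\<^bsub>A\<^esub> a \<in> M" "D \<odot>\<^bsub>B\<^esub> b \<in> N" using inM inN d sl by auto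
      then show "\<Theta> D \<rho> = \<zero>\<^bsub>MN.T\<^esub>" using sl Ms(3)[OF m(1), of c] MN.pt_smult_l[of "D \<odot>\<^bsub>A\<^esub> a" "D \<odot>\<^bsub>B\<^esub> b" c]
        by (simp add: \<Theta>d \<Theta>s \<theta>c) (simp add: \<theta>_def AB.A.smult_commute[of _ D c] MN.T.minus_self_eq MN.pt_closed)
    qed (use d in auto)
  next
    case (sr c a b)
    obtain d1 d3 where d: "d1 \<noteq> 0" "d1 \<odot>\<^bsub>A\<^esub> a \<in> M" "d3 \<noteq> 0" "d3 \<odot>\<^bsub>B\<^esub> b \<in> N"
      using denM[OF sr(1)] denN[OF sr(2)] by blast
    show ?thesis
    proof (intro exI[of _ "d1 * d3"] conjI allI impI)
      fix D assume D: "d1 * d3 dvd D"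
      then have dv: "d1 dvd D" "d3 dvd D" by (auto elim: dvd_mult_left dvd_mult_right)
      then have m: "D \<odot>\<^bsub>A\<^esub> a \<in> M" "D \<odot>\<^bsub>B\<^esub> b \<in> N" using inM inN d sr by auto
      then show "\<Theta> D \<rho> = \<zero>\<^bsub>MN.T\<^esub>" using sr Ns(3)[OF m(2), of c] MN.pt_smult_r[of "D \<odot>\<^bsub>A\<^esub> a" "D \<odot>\<^bsub>B\<^esub> b" c]
        by (simp add: \<Theta>d \<Theta>s \<theta>c) (simp add: \<theta>_def AB.B.smult_commute[of _ D c] MN.T.minus_self_eq MN.pt_closed)
    qed (use d in auto)
  qed
  have ide: "\<exists>d. d \<noteq> 0 \<and> (\<forall>D. d dvd D \<longrightarrow> \<Theta> D p = \<zero>\<^bsub>MN.T\<^esub>)" if "p \<in> tensor_ideal A B" for p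
    using that
  proof (induction rule: AB.tensor_ideal_induct)
    case zero
    then show ?case by (auto simp: \<Theta>_def intro!: exI[of _ 1])
  next
    case (add \<rho> c p)
    obtain d where d: "d \<noteq> 0" "\<And>D. d dvd D \<Longrightarrow> \<Theta> D p = \<zero>\<^bsub>MN.T\<^esub>" using add by blast
    obtain e where e: "e \<noteq> 0" "\<And>D. e dvd D \<Longrightarrow> \<Theta> D \<rho> = \<zero>\<^bsub>MN.T\<^esub>" using rel[OF add(1)] by blast
    have \<rho>: "\<rho> \<in> carrier AB.F" using add(1) AB.rels_closed by auto
    have "\<Theta> D (c \<odot>\<^bsub>AB.F\<^esub> \<rho> \<oplus>\<^bsub>AB.F\<^esub> p) = \<zero>\<^bsub>MN.T\<^esub>" if "d * e dvd D" for D
      using linD[OF lin\<Theta>] \<rho> add(2) d(2)[of D] e(2)[of D] that dvd_mult_left[OF that] dvd_mult_right[OF that] by simp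
    then show ?case using d(1) e(1) by (intro exI[of _ "d * e"]) (auto simp: AB.F_add AB.F_smult)
  qed
  obtain p where p: "p \<in> carrier MN.F" "w = MN.cl p" using w unfolding MN.T_eq by (rule MN.quot_cases)
  have kp: "Poly_Mapping.keys p \<subseteq> M \<times> N" using p(1) by (simp add: MN.F_carrier)
  have inc: "lin ?A A (\<lambda>x. x)" "lin ?B B (\<lambda>x. x)" using Ms(1) Ns(1) by (auto simp: lin_def)
  have linmap: "lin MN.T AB.T (tensor_map A B (\<lambda>x. x) (\<lambda>x. x))"
    by (rule lin_tensor_map[OF MN.A.ralg MN.B.ralg A B inc])
  note 1 = linD[OF linmap] and Mcl = ahomD[OF MN.ahom_cl] and Acl = ahomD[OF AB.ahom_cl]
  have MF: "Poly_Mapping.keys x \<subseteq> M \<times> N \<Longrightarrow> x \<in> carrier MN.F \<and> x \<in> carrier AB.F" for x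
    using Ms(1) Ns(1) by (auto simp: MN.F_carrier AB.F_carrier)
  have "tensor_map A B (\<lambda>x. x) (\<lambda>x. x) (MN.cl p) = AB.cl p \<and> \<Theta> D p = (D * D) \<odot>\<^bsub>MN.T\<^esub> MN.cl p" for D
    using kp
  proof (induction p rule: pm_induct)
    case zero
    have "MN.cl 0 = \<zero>\<^bsub>MN.T\<^esub>" using lin_zero[OF MN.F_ralg MN.ralg_quot Mcl(1)] by (simp add: MN.T_eq MN.F_zero)
    moreover have "AB.cl 0 = \<zero>\<^bsub>AB.T\<^esub>" using lin_zero[OF AB.F_ralg AB.ralg_quot Acl(1)] by (simp add: AB.T_eq AB.F_zero)
    ultimately show ?case using lin_zero[OF MN.ralg_tensor AB.ralg_tensor linmap] by (simp add: \<Theta>_def)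
  next
    case (add z c p)
    obtain a b where z: "z = (a, b)" "a \<in> M" "b \<in> N" using add(1) by auto
    have zs: "a \<in> carrier A" "b \<in> carrier B" "D \<odot>\<^bsub>A\<^esub> a \<in> M" "D \<odot>\<^bsub>B\<^esub> b \<in> N" using z Ms Ns by auto
    have c: "MN.s a b c \<in> carrier MN.F" "MN.s a b c \<in> carrier AB.F" "p \<in> carrier MN.F" "p \<in> carrier AB.F"
      using MF[of p] MF[of "MN.s a b c"] add(2) z by auto
    have t: "MN.cl (MN.s a b c) = c \<odot>\<^bsub>MN.T\<^esub> MN.pt a b" "AB.cl (MN.s a b c) = c \<odot>\<^bsub>AB.T\<^esub> AB.pt a b"
      using MN.cl_s[of a b c] AB.cl_s[of a b c] z zs by auto
    have ptc: "MN.pt a b \<in> carrier MN.T" using z by auto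
    have clc: "MN.cl p \<in> carrier MN.T" "MN.cl (MN.s a b c) \<in> carrier MN.T" using Mcl(3) c by (auto simp: MN.T_eq)
    have "tensor_map A B (\<lambda>x. x) (\<lambda>x. x) (MN.cl (MN.s a b c)) = AB.cl (MN.s a b c)"
      using ptc 1(3)[of "MN.pt a b" c] tensor_map_pure[OF MN.A.ralg MN.B.ralg A B inc, of a b] z by (simp add: t)
    moreover have "\<Theta> D (MN.s a b c) = (D * D) \<odot>\<^bsub>MN.T\<^esub> MN.cl (MN.s a b c)"
    proof -
      have "\<theta> D (a, b) = (D * D) \<odot>\<^bsub>MN.T\<^esub> MN.pt a b" using zs z ptc MN.pt_smult_l[of a "D \<odot>\<^bsub>B\<^esub> b" D] MN.pt_smult_r[of a b D]
        by (simp add: \<theta>_def MN.T.smult_assoc)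
      then show ?thesis using ptc by (simp add: \<Theta>s t MN.T.smult_commute[of _ c])
    qed
    moreover have "MN.cl (MN.s a b c + p) = MN.cl (MN.s a b c) \<oplus>\<^bsub>MN.T\<^esub> MN.cl p" using Mcl(4)[OF c(1,3)] by (simp add: MN.F_add MN.T_eq)
    moreover have "AB.cl (MN.s a b c + p) = AB.cl (MN.s a b c) \<oplus>\<^bsub>AB.T\<^esub> AB.cl p" using Acl(4)[OF c(2,4)] by (simp add: AB.F_add AB.T_eq)
    moreover have "\<Theta> D (MN.s a b c + p) = \<Theta> D (MN.s a b c) \<oplus>\<^bsub>MN.T\<^esub> \<Theta> D p" using linD(2)[OF lin\<Theta> c(2,4)] by (simp add: AB.F_add)
    ultimately show ?case using add(3) clc 1(2) by (simp add: z MN.T.smult_r_distr)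
  qed
  note key = this
  have "AB.cl p = AB.cl \<zero>\<^bsub>AB.F\<^esub>" using key 0 p lin_zero[OF AB.F_ralg AB.ralg_quot Acl(1)] by (simp add: AB.T_eq)
  then have "p \<in> tensor_ideal A B" using MF[OF kp] by (subst (asm) AB.cl_eq_iff) (auto simp: a_minus_def)
  from ide[OF this] obtain d where d: "d \<noteq> 0 \<and> (\<forall>D. d dvd D \<longrightarrow> \<Theta> D p = \<zero>\<^bsub>MN.T\<^esub>)" by (rule exE)
  then have "d \<noteq> 0" "\<Theta> d p = \<zero>\<^bsub>MN.T\<^esub>" by simp_all
  \<comment> \<open>On tensors coming from \<open>M\<close> and \<open>N\<close>,
    \<open>\<Theta> d\<close> is multiplication by the square of d.\<close>
  then show ?thesis using key p by (intro exI[of _ "d * d"]) auto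
qed

subsection \<open>Laurent polynomials\<close>

text \<open>Evaluation at q = 1: each q^i - 1 is divisible by q - 1, so modulo q - 1 a Laurent
  polynomial is the sum e of its coefficients.\<close>

lemma laurent_mod_h: "\<exists>d. c = Poly_Mapping.single 0 e + q1 * d" if "e = (\<Sum>i\<in>Poly_Mapping.keys c. Poly_Mapping.lookup c i)" for c :: "'k::field laurent"
proof -
  have pow: "(q1 :: 'k laurent) dvd Poly_Mapping.single (int n) 1 - 1" for n
  proof -
    have "Poly_Mapping.single (int n) (1::'k) = qq ^ n"
    proof (induction n)
      case (Suc n)
      have "qq ^ Suc n = Poly_Mapping.single 1 1 * Poly_Mapping.single (int n) (1::'k)" by (simp only: power_Suc Suc) (simp only: qq_def)
      then show ?case by (simp only: mult_single) simp
    qed simp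
    then show ?thesis using dvd_triv_left[of "q1 :: 'k laurent" "\<Sum>i<n. qq ^ i"] by (simp only: power_diff_1_eq)
  qed
  have q: "(q1 :: 'k laurent) dvd Poly_Mapping.single i 1 - 1" for i
  proof (cases "i \<ge> 0")
    case True then show ?thesis using pow[of "nat i"] by simp
  next
    case False
    have "Poly_Mapping.single i (1::'k) - 1 = - (Poly_Mapping.single i 1 * (Poly_Mapping.single (int (nat (- i))) 1 - 1))"
      using False by (simp add: algebra_simps mult_single)
    then show ?thesis using pow[of "nat (- i)"] by (metis dvd_minus_iff dvd_mult)
  qed
  have "(q1 :: 'k laurent) dvd p - Poly_Mapping.single 0 (\<Sum>i\<in>S. Poly_Mapping.lookup p i)"
    if "Poly_Mapping.keys p \<subseteq> S" "finite S" for p :: "'k laurent" and S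
    using that(1)
  proof (induction p rule: pm_induct)
    case (add i e p)
    have "(\<Sum>j\<in>S. Poly_Mapping.lookup (Poly_Mapping.single i e + p) j) = e + (\<Sum>j\<in>S. Poly_Mapping.lookup p j)"
      using add(1) that(2) by (simp add: lookup_add lookup_single sum.distrib when_def)
    moreover have "Poly_Mapping.single i e - Poly_Mapping.single 0 e = Poly_Mapping.single 0 e * (Poly_Mapping.single i 1 - 1)"
      by (simp add: algebra_simps mult_single)
    ultimately have "Poly_Mapping.single i e + p - Poly_Mapping.single 0 (\<Sum>j\<in>S. Poly_Mapping.lookup (Poly_Mapping.single i e + p) j)
       = Poly_Mapping.single 0 e * (Poly_Mapping.single i 1 - 1) + (p - Poly_Mapping.single 0 (\<Sum>j\<in>S. Poly_Mapping.lookup p j))"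
      by (simp add: single_add algebra_simps)
    then show ?case using q[of i] add(3) by (metis dvd_add dvd_mult)
  qed simp
  from this[of c "Poly_Mapping.keys c"] have "q1 dvd c - Poly_Mapping.single 0 e" using that by simp
  then obtain d where "c - Poly_Mapping.single 0 e = q1 * d" by (rule dvdE)
  then show ?thesis by (intro exI[of _ d]) (simp add: algebra_simps)
qed

lemma laurent_residue: "(q1 :: 'k::field laurent) dvd c \<or> (\<exists>u d. c * u = 1 + q1 * d)"
proof -
  obtain e d where c: "c = Poly_Mapping.single 0 e + q1 * d" using laurent_mod_h by blast
  show ?thesis
  proof (cases "e = 0")
    case True then show ?thesis using c by simp
  next
    case False
    then have "c * Poly_Mapping.single 0 (1 / e) = 1 + q1 * (d * Poly_Mapping.single 0 (1 / e))"
      unfolding c by (simp add: algebra_simps mult_single)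
    then show ?thesis by blast
  qed
qed

lemma lookup_q1_mult: "Poly_Mapping.lookup (q1 * d) i = Poly_Mapping.lookup d (i - 1) - Poly_Mapping.lookup d (i :: int)"
  for d :: "'k::field laurent"
proof -
  have "Poly_Mapping.lookup (qq * d) i = Poly_Mapping.lookup d (i - 1)"
    using subset_UNIV[of "Poly_Mapping.keys d"]
    by (induction d rule: pm_induct) (auto simp: qq_def distrib_left lookup_add mult_single lookup_single when_def)
  then show ?thesis by (simp add: left_diff_distrib lookup_minus)
qed

text \<open>The extreme coefficients cannot cancel. The width of the support therefore bounds the
  power of q - 1 that divides a nonzero Laurent polynomial.\<close>

lemma q1_mult_degree:
  fixes d :: "'k::field laurent" assumes "d \<noteq> 0"
  shows "Max (Poly_Mapping.keys (q1 * d)) = Max (Poly_Mapping.keys d) + 1 \<and> Min (Poly_Mapping.keys (q1 * d)) = Min (Poly_Mapping.keys d) \<and> q1 * d \<noteq> 0"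
proof -
  let ?K = "Poly_Mapping.keys d" and ?L = "Poly_Mapping.keys (q1 * d)"
  have K: "finite ?K" "?K \<noteq> {}" using assms by auto
  have ub: "i \<le> Max ?K" and lb: "Min ?K \<le> i" if "Poly_Mapping.lookup d i \<noteq> 0" for i
    using K that by (auto simp: in_keys_iff)
  have M: "Poly_Mapping.lookup d (Max ?K) \<noteq> 0" "Poly_Mapping.lookup d (Min ?K) \<noteq> 0"
    using Max_in[OF K] Min_in[OF K] by (auto simp: in_keys_iff)
  have z: "Poly_Mapping.lookup d (Max ?K + 1) = 0" "Poly_Mapping.lookup d (Min ?K - 1) = 0"
    using ub[of "Max ?K + 1"] lb[of "Min ?K - 1"] by auto
  have in1: "Max ?K + 1 \<in> ?L" "Min ?K \<in> ?L" using M z by (auto simp: in_keys_iff lookup_q1_mult)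
  have bd: "Min ?K \<le> i \<and> i \<le> Max ?K + 1" if "i \<in> ?L" for i
  proof -
    have "Poly_Mapping.lookup d (i - 1) \<noteq> 0 \<or> Poly_Mapping.lookup d i \<noteq> 0" using that by (auto simp: in_keys_iff lookup_q1_mult)
    then show ?thesis using ub[of "i - 1"] ub[of i] lb[of "i - 1"] lb[of i] by auto
  qed
  have "Max ?L = Max ?K + 1" using in1 bd by (intro Max_eqI) auto
  moreover have "Min ?L = Min ?K" using in1 bd by (intro Min_eqI) auto
  ultimately show ?thesis using in1 by auto
qed

lemma q1_power_dvd_bound:
  fixes c :: "'k::field laurent" assumes "c \<noteq> 0" "q1 ^ m dvd c"
  shows "int m \<le> Max (Poly_Mapping.keys c) - Min (Poly_Mapping.keys c)"
proof -
  obtain d where c: "c = q1 ^ m * d" using assms(2) by (rule dvdE)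
  then have d: "d \<noteq> 0" using assms(1) by auto
  have *: "Max (Poly_Mapping.keys (q1 ^ m * d)) = Max (Poly_Mapping.keys d) + int m \<and> Min (Poly_Mapping.keys (q1 ^ m * d)) = Min (Poly_Mapping.keys d) \<and> q1 ^ m * d \<noteq> 0"
    by (induction m) (use d q1_mult_degree[of "q1 ^ _ * d"] in \<open>auto simp: mult.assoc\<close>)
  have "Min (Poly_Mapping.keys d) \<le> Max (Poly_Mapping.keys d)" using d by (simp add: Min_le_iff)
  then show ?thesis using * unfolding c by linarith
qed

text \<open>Write c = (q-1)^a c' with a maximal. Then c' is a unit modulo q - 1, hence modulo every
  power of it by a finite geometric series; multiplying by (q-1)^a gives the identity, with one
  exponent a for all m.\<close>

lemma laurent_torsion:
  fixes c :: "'k::field laurent" assumes "c \<noteq> 0"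
  obtains a where "\<And>m. \<exists>s t. q1 ^ a = c * s + q1 ^ (a + m) * t"
proof -
  have "finite {m. q1 ^ m dvd c}"

  proof (rule finite_subset)
    show "{m. q1 ^ m dvd c} \<subseteq> {..nat (Max (Poly_Mapping.keys c) - Min (Poly_Mapping.keys c))}"
    proof
      fix m assume "m \<in> {m. q1 ^ m dvd c}"
      then show "m \<in> {..nat (Max (Poly_Mapping.keys c) - Min (Poly_Mapping.keys c))}"
        using q1_power_dvd_bound[OF assms, of m] by simp
    qed
  qed simp
  moreover have "{m. q1 ^ m dvd c} \<noteq> {}" by (auto intro!: exI[of _ 0])
  ultimately have a: "Max {m. q1 ^ m dvd c} \<in> {m. q1 ^ m dvd c}" "Suc (Max {m. q1 ^ m dvd c}) \<notin> {m. q1 ^ m dvd c}"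
    using Max_in[of "{m. q1 ^ m dvd c}"] Max_ge[of "{m. q1 ^ m dvd c}" "Suc (Max {m. q1 ^ m dvd c})"] by (blast, linarith)
  define a where "a = Max {m. q1 ^ m dvd c}"
  obtain c' where c': "c = q1 ^ a * c'" using a(1) by (auto simp: a_def)
  have "\<not> q1 dvd c'"
  proof
    assume "q1 dvd c'"
    then obtain e where "c' = q1 * e" by (rule dvdE)
    then have "c = q1 ^ Suc a * e" using c' by (simp add: mult_ac)
    then have "q1 ^ Suc a dvd c" by (rule dvdI)
    then show False using a(2) unfolding a_def mem_Collect_eq by blast
  qed
  then obtain u d where ud: "c' * u = 1 + q1 * d" using laurent_residue by blast
  have "\<exists>s t. q1 ^ a = c * s + q1 ^ (a + m) * t" for m
  proof -
    have "1 - (- (q1 * d)) ^ m = (1 - (- (q1 * d))) * (\<Sum>i<m. (- (q1 * d)) ^ i)" by (rule one_diff_power_eq)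
    also have "1 - (- (q1 * d)) = c' * u" using ud by simp
    finally have "1 = c' * (u * (\<Sum>i<m. (- (q1 * d)) ^ i)) + q1 ^ m * (- d) ^ m"
      by (simp add: algebra_simps power_mult_distrib[symmetric])
    then have "q1 ^ a = q1 ^ a * (c' * (u * (\<Sum>i<m. (- (q1 * d)) ^ i)) + q1 ^ m * (- d) ^ m)" by simp
    also have "\<dots> = c * (u * (\<Sum>i<m. (- (q1 * d)) ^ i)) + q1 ^ (a + m) * (- d) ^ m"
      unfolding c' power_add by (simp only: distrib_left mult.assoc)
    finally show ?thesis by blast
  qed
  then show ?thesis using that by blast
qed

text \<open>The identity of \<open>laurent_torsion\<close> turns c x = 0 into (q-1)^a x =
  (q-1)^(a+m) t x, and (q-1)^a can be cancelled.\<close>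

lemma torsion_divisible:
  fixes A :: "('k::field laurent, 'a) module"
  assumes "ralg A" "torsion_free q1 A" "x \<in> carrier A" "c \<noteq> 0" "c \<odot>\<^bsub>A\<^esub> x = \<zero>\<^bsub>A\<^esub>"
  shows "\<exists>y\<in>carrier A. x = q1 ^ m \<odot>\<^bsub>A\<^esub> y"
proof -
  interpret A: ralg A by fact
  obtain a where "\<And>m. \<exists>s t. q1 ^ a = c * s + q1 ^ (a + m) * t" using laurent_torsion[OF assms(4)] by blast
  then obtain s t where st: "q1 ^ a = c * s + q1 ^ (a + m) * t" by blast
  have "q1 ^ a \<odot>\<^bsub>A\<^esub> x = s \<odot>\<^bsub>A\<^esub> (c \<odot>\<^bsub>A\<^esub> x) \<oplus>\<^bsub>A\<^esub> q1 ^ a \<odot>\<^bsub>A\<^esub> (q1 ^ m \<odot>\<^bsub>A\<^esub> (t \<odot>\<^bsub>A\<^esub> x))"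
    using assms(3) by (subst st) (simp add: A.smult_l_distr A.smult_assoc power_add A.smult_commute[of _ c s])
  then have "q1 ^ a \<odot>\<^bsub>A\<^esub> (x \<ominus>\<^bsub>A\<^esub> q1 ^ m \<odot>\<^bsub>A\<^esub> (t \<odot>\<^bsub>A\<^esub> x)) = \<zero>\<^bsub>A\<^esub>"
    using assms(3,5) by (simp add: A.smult_diff_r A.minus_self_eq)
  then have "x \<ominus>\<^bsub>A\<^esub> q1 ^ m \<odot>\<^bsub>A\<^esub> (t \<odot>\<^bsub>A\<^esub> x) = \<zero>\<^bsub>A\<^esub>"
    by (rule torsion_free_power[OF assms(1,2), rotated]) (use assms(3) in simp)
  then show ?thesis using assms(3) by (intro bexI[of _ "t \<odot>\<^bsub>A\<^esub> x"]) (auto simp: A.minus_self_eq)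
qed

section \<open>Fractions and the functor \<open>\<or>\<close>\<close>

lemma scalar_alg_simps [simp]: "carrier scalar_alg = UNIV" "\<one>\<^bsub>scalar_alg\<^esub> = 1" "\<zero>\<^bsub>scalar_alg\<^esub> = 0"
  "a \<oplus>\<^bsub>scalar_alg\<^esub> b = a + b" "a \<otimes>\<^bsub>scalar_alg\<^esub> b = a * b" "c \<odot>\<^bsub>scalar_alg\<^esub> b = c * b"
  by (simp_all add: scalar_alg_def)

lemma ralg_scalar: "ralg (scalar_alg :: ('r::comm_ring_1, 'r) module)"
proof (intro ralg.intro ringI)
  show "abelian_group (scalar_alg :: ('r, 'r) module)"
  proof (rule abelian_groupI)
    fix x
    show "\<exists>y\<in>carrier (scalar_alg :: ('r, 'r) module). y \<oplus>\<^bsub>scalar_alg\<^esub> x = \<zero>\<^bsub>scalar_alg\<^esub>"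
      by (intro bexI[of _ "- x"]) simp_all
  qed (simp_all add: ac_simps)
  show "Group.monoid (scalar_alg :: ('r, 'r) module)" by (rule monoidI) (auto simp: mult.assoc)
  show "ralg_axioms (scalar_alg :: ('r, 'r) module)"
    by unfold_locales (auto simp: algebra_simps)
qed (auto simp: algebra_simps)

abbreviation fr :: "'r::idom \<Rightarrow> 'r fract" where "fr c \<equiv> Fraction_Field.Fract c 1"

lemma fract_alg_simps [simp]: "carrier fract_alg = UNIV" "\<one>\<^bsub>fract_alg\<^esub> = 1" "\<zero>\<^bsub>fract_alg\<^esub> = 0"
  "a \<oplus>\<^bsub>fract_alg\<^esub> b = a + b" "a \<otimes>\<^bsub>fract_alg\<^esub> b = a * b" "c \<odot>\<^bsub>fract_alg\<^esub> x = fr c * x"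
  by (simp_all add: fract_alg_def)

lemma fr_hom: "fr (a + b) = fr a + fr b" "fr (a * b) = fr a * fr b" "fr 1 = 1" "fr 0 = 0"
  by (simp_all add: One_fract_def Zero_fract_def)

lemma fr_inverse: "c \<noteq> 0 \<Longrightarrow> fr c * Fraction_Field.Fract a (c * d) = Fraction_Field.Fract a d"
  by (simp add: eq_fract(1) Fraction_Field.mult_fract_cancel)

lemma fr_inverse': "c \<noteq> 0 \<Longrightarrow> fr c * Fraction_Field.Fract a c = fr a"
  by (simp add: Fraction_Field.mult_fract_cancel eq_fract(1))

lemma ralg_fract: "ralg (fract_alg :: ('r::idom, 'r fract) module)"
proof (intro ralg.intro ringI)
  show "abelian_group (fract_alg :: ('r, 'r fract) module)"
  proof (rule abelian_groupI)
    fix x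
    show "\<exists>y\<in>carrier (fract_alg :: ('r, 'r fract) module). y \<oplus>\<^bsub>fract_alg\<^esub> x = \<zero>\<^bsub>fract_alg\<^esub>"
      by (intro bexI[of _ "- x"]) simp_all
  qed (simp_all add: ac_simps)
  show "Group.monoid (fract_alg :: ('r, 'r fract) module)" by (rule monoidI) (auto simp: mult.assoc)
  show "ralg_axioms (fract_alg :: ('r, 'r fract) module)"
    by unfold_locales (simp_all only: fract_alg_simps fr_hom distrib_left distrib_right mult_ac mult_1_left mult_1_right UNIV_I)
qed (auto simp: algebra_simps)

lemma subalg_carrier: "ralg A \<Longrightarrow> subalg A (carrier A)"
proof -
  assume "ralg A"
  then interpret ralg A .
  show ?thesis by (rule subalgI) auto
qed

text \<open>Denominators are cleared for the image of \<open>fr\<close> inside the fraction field: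
  some d \<noteq> 0 kills b \<otimes> 1 already in the tensor product of \<open>A\<close> with that
  image, and this product maps to \<open>A\<close> by multiplication with the numerator
  \<open>num\<close>.\<close>

lemma fract_tensor_kernel:
  fixes A :: "('r::idom, 'a) module"
  assumes A: "ralg A" and b: "b \<in> carrier A" and 0: "pure_tensor A fract_alg b 1 = \<zero>\<^bsub>tensor_alg A fract_alg\<^esub>"
  shows "\<exists>d. d \<noteq> 0 \<and> d \<odot>\<^bsub>A\<^esub> b = \<zero>\<^bsub>A\<^esub>"
proof -
  interpret A: ralg A by (rule A)
  let ?N = "range (fr :: 'r \<Rightarrow> 'r fract)"
  let ?B = "fract_alg\<lparr>carrier := ?N\<rparr> :: ('r, 'r fract) module"
  have N: "subalg fract_alg ?N"
    by (rule subalgI) (auto simp flip: fr_hom simp: fr_hom(3)[symmetric] del: Fraction_Field.mult_fract Fraction_Field.add_fract)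
  have AA: "A\<lparr>carrier := carrier A\<rparr> = A" by simp
  interpret AN: tensor A ?B using A ralg_subalg[OF ralg_fract N] by (rule tensor.intro)
  have 1: "(1::'r fract) \<in> ?N" using fr_hom(3) by (metis rangeI)
  have inc: "lin ?B fract_alg (\<lambda>x. x)" "lin A A (\<lambda>x. x)" by (auto simp: lin_def)
  have w: "AN.pt b 1 \<in> carrier AN.T" using b 1 by auto
  have map: "tensor_map A fract_alg (\<lambda>x. x) (\<lambda>x. x) (AN.pt b 1) = pure_tensor A fract_alg b 1"
    using tensor_map_pure[OF A AN.B.ralg A ralg_fract inc(2,1), of b 1] b 1 by simp
  have den: "\<exists>d. d \<noteq> 0 \<and> d \<odot>\<^bsub>fract_alg\<^esub> x \<in> ?N" for x :: "'r fract"
  proof (cases x rule: Fract_cases)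
    case (Fract a c)
    then show ?thesis by (intro exI[of _ c]) (simp del: Fraction_Field.mult_fract add: fr_inverse')
  qed
  have denA: "\<exists>d. d \<noteq> 0 \<and> d \<odot>\<^bsub>A\<^esub> a \<in> carrier A" if "a \<in> carrier A" for a
    using that by (intro exI[of _ 1]) auto
  obtain d where d: "d \<noteq> 0" "d \<odot>\<^bsub>AN.T\<^esub> AN.pt b 1 = \<zero>\<^bsub>AN.T\<^esub>"
    using tensor_sub_kernel[OF A ralg_fract subalg_carrier[OF A] N denA den, unfolded AA, OF _ w] map 0 by auto
  define num where "num y = (THE c. fr c = y)" for y :: "'r fract"
  have num: "num (fr c) = c" for c unfolding num_def by (rule the_equality) (auto simp: eq_fract)
  have num_hom: "num (x + y) = num x + num y" "num (fr c * x) = c * num x" if "x \<in> ?N" "y \<in> ?N" for x y c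
    using that num by (auto simp flip: fr_hom simp del: Fraction_Field.mult_fract Fraction_Field.add_fract)
  have bil: "bilin A ?B A (\<lambda>a y. num y \<odot>\<^bsub>A\<^esub> a)"
    unfolding bilin_def by (auto intro!: linI simp: num_hom A.smult_l_distr A.smult_r_distr A.smult_assoc A.smult_commute del: imageE simp del: Fraction_Field.mult_fract Fraction_Field.add_fract)
  note L = linD[OF AN.lin_tensor_lift[OF A bil]]
  have "d \<odot>\<^bsub>A\<^esub> b = tensor_lift A (\<lambda>a y. num y \<odot>\<^bsub>A\<^esub> a) (d \<odot>\<^bsub>AN.T\<^esub> AN.pt b 1)"
    using L(3)[OF w] AN.tensor_lift_pt[OF A bil b, of 1] 1 b num[of 1] by (simp add: fr_hom(3))
  also have "\<dots> = \<zero>\<^bsub>A\<^esub>" using lin_zero[OF AN.ralg_tensor A AN.lin_tensor_lift[OF A bil]] d by simp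
  finally show ?thesis using d(1) by blast
qed

section \<open>Augmented algebras and the functor \<open>\<or>\<close>\<close>

locale augmented = A: ralg A for A :: "('r::idom, 'a) module" +
  fixes \<epsilon> :: "'a \<Rightarrow> 'r" and h :: 'r
  assumes eps: "ahom A scalar_alg \<epsilon>" and h: "h \<noteq> 0"
begin

abbreviation "J \<equiv> a_kernel A scalar_alg \<epsilon>"

lemma J_eq: "J = {a \<in> carrier A. \<epsilon> a = 0}"
  by (simp add: a_kernel_def kernel_def)

lemma eps_hom: "a \<in> carrier A \<Longrightarrow> b \<in> carrier A \<Longrightarrow> \<epsilon> (a \<oplus>\<^bsub>A\<^esub> b) = \<epsilon> a + \<epsilon> b"
  "a \<in> carrier A \<Longrightarrow> b \<in> carrier A \<Longrightarrow> \<epsilon> (a \<otimes>\<^bsub>A\<^esub> b) = \<epsilon> a * \<epsilon> b"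
  "a \<in> carrier A \<Longrightarrow> \<epsilon> (c \<odot>\<^bsub>A\<^esub> a) = c * \<epsilon> a" "\<epsilon> \<one>\<^bsub>A\<^esub> = 1"
  using ahomD[OF eps] by auto

lemma J_ideal: "ideal J A"
  using ahom_kernel_ideal[OF A.ralg ralg_scalar eps] by (simp add: J_eq)

lemma Jm_ideal: "ideal (ideal_pow A J m) A"
  by (induction m) (auto intro: A.oneideal A.ideal_prod_is_ideal J_ideal)

lemma Jm_carrier: "j \<in> ideal_pow A J m \<Longrightarrow> j \<in> carrier A"
  by (rule ideal.Icarr[OF Jm_ideal])

lemma Jm_smult: assumes "j \<in> ideal_pow A J m" shows "c \<odot>\<^bsub>A\<^esub> j \<in> ideal_pow A J m"
  using ideal.I_l_closed[OF Jm_ideal assms, of "c \<odot>\<^bsub>A\<^esub> \<one>\<^bsub>A\<^esub>"] Jm_carrier[OF assms] by (simp add: A.smult_mult_l)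

lemma Jm_add: "i \<in> ideal_pow A J m \<Longrightarrow> j \<in> ideal_pow A J m \<Longrightarrow> i \<oplus>\<^bsub>A\<^esub> j \<in> ideal_pow A J m"
  using additive_subgroup.a_closed[OF ideal.axioms(1)[OF Jm_ideal]] by blast

text \<open>\<open>ideal_pow\<close> multiplies by \<open>J\<close> from the left, so the induction
  runs over the left exponent and reassociates products.\<close>

lemma Jm_mult: "i \<in> ideal_pow A J m \<Longrightarrow> j \<in> ideal_pow A J l \<Longrightarrow> i \<otimes>\<^bsub>A\<^esub> j \<in> ideal_pow A J (m + l)"
proof (induction m arbitrary: i)
  case 0 then show ?case using ideal.I_l_closed[OF Jm_ideal] by simp
next
  case (Suc m)
  from Suc.prems(1) have "i \<in> ideal_prod A J (ideal_pow A J m)" by simp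
  then show ?case
  proof (induction i rule: ideal_prod.induct)
    case (prod x y)
    have c: "x \<in> carrier A" "y \<in> carrier A" "j \<in> carrier A" using prod Suc.prems(2) Jm_carrier J_eq by auto
    have "x \<otimes>\<^bsub>A\<^esub> (y \<otimes>\<^bsub>A\<^esub> j) \<in> ideal_prod A J (ideal_pow A J (m + l))"
      by (rule ideal_prod.prod[OF prod(1) Suc.IH[OF prod(2) Suc.prems(2)]])
    then show ?case using c by (simp add: A.m_assoc)
  next
    case (sum s1 s2)
    have "s1 \<in> carrier A" "s2 \<in> carrier A" using sum(1,2) Jm_carrier[of _ "Suc m"] by auto
    then show ?case using sum(3,4) Jm_carrier[OF Suc.prems(2)] Jm_add[of _ "Suc m + l"] by (simp add: A.l_distr)
  qed
qed

sublocale K: tensor A fract_alg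
  by (intro tensor.intro A.ralg ralg_fract)

abbreviation "AK \<equiv> tensor_alg A fract_alg"
abbreviation "V \<equiv> vee_alg h A J"
abbreviation "ph m \<equiv> Fraction_Field.Fract 1 (h ^ m) :: 'r fract"
abbreviation vee_gens ("\<G>") where "\<G> \<equiv> {K.pt j (ph m) | j m. j \<in> ideal_pow A J m}"

lemma ph_simps: "ph 0 = 1" "ph m * ph l = ph (m + l)" "fr h * ph (Suc m) = ph m" "ph m \<in> carrier fract_alg"
proof -
  show "fr h * ph (Suc m) = ph m" unfolding power_Suc by (rule fr_inverse[OF h])
qed (simp_all add: One_fract_def power_add)

lemma gens_carrier: "\<G> \<subseteq> carrier AK"
  using Jm_carrier by auto

lemma V_eq: "V = AK\<lparr>carrier := carrier V\<rparr>"
  by (simp add: vee_alg_def)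

lemma V_carrier: "carrier V = generate (add_monoid AK) \<G>"
  by (simp add: vee_alg_def)

lemma gens_smult: "g \<in> \<G> \<Longrightarrow> c \<odot>\<^bsub>AK\<^esub> g \<in> \<G>"
proof -
  assume "g \<in> \<G>"
  then obtain j m where g: "g = K.pt j (ph m)" "j \<in> ideal_pow A J m" by auto
  have "c \<odot>\<^bsub>AK\<^esub> g = K.pt (c \<odot>\<^bsub>A\<^esub> j) (ph m)" using g Jm_carrier by (simp add: K.pt_smult_l)
  then show ?thesis using g Jm_smult by blast
qed

lemma gens_mult: "g \<in> \<G> \<Longrightarrow> g' \<in> \<G> \<Longrightarrow> g \<otimes>\<^bsub>AK\<^esub> g' \<in> \<G>"
proof -
  assume "g \<in> \<G>" "g' \<in> \<G>"
  then obtain j m j' m' where g: "g = K.pt j (ph m)" "j \<in> ideal_pow A J m" "g' = K.pt j' (ph m')" "j' \<in> ideal_pow A J m'" by auto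
  have "g \<otimes>\<^bsub>AK\<^esub> g' = K.pt (j \<otimes>\<^bsub>A\<^esub> j') (ph m * ph m')" using g Jm_carrier by (simp add: K.pt_mult)
  then have "g \<otimes>\<^bsub>AK\<^esub> g' = K.pt (j \<otimes>\<^bsub>A\<^esub> j') (ph (m + m'))" by (simp only: ph_simps)
  then show ?thesis using g Jm_mult by blast
qed

text \<open>The generating set is closed under multiplication by -1, so inverses in the generated
  additive group are generators again and need no case of their own.\<close>

lemma V_induct [consumes 1, case_names zero gen add]:
  assumes "v \<in> carrier V" "P \<zero>\<^bsub>AK\<^esub>" "\<And>g. g \<in> \<G> \<Longrightarrow> P g"
    "\<And>v w. v \<in> carrier V \<Longrightarrow> w \<in> carrier V \<Longrightarrow> P v \<Longrightarrow> P w \<Longrightarrow> P (v \<oplus>\<^bsub>AK\<^esub> w)"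
  shows "P v"
proof -
  have "v \<in> generate (add_monoid AK) \<G>" using assms(1) V_carrier by simp
  then show ?thesis
  proof (induction rule: generate.induct)
    case one then show ?case using assms(2) by simp
  next
    case (incl g) then show ?case using assms(3) by simp
  next
    case (inv g)
    have "inv\<^bsub>add_monoid AK\<^esub> g = (- 1) \<odot>\<^bsub>AK\<^esub> g"
      using subsetD[OF gens_carrier inv] K.T.smult_minus_one[of g] by (simp add: a_inv_def)
    then show ?case using assms(3) gens_smult[OF inv] by simp
  next
    case (eng v w) then show ?case using assms(4) V_carrier by simp
  qed
qed

lemma V_sub: "carrier V \<subseteq> carrier AK"
proof
  fix v assume "v \<in> carrier V" then show "v \<in> carrier AK"
    by (induction rule: V_induct) (use gens_carrier in auto)
qed

lemma V_gen: "g \<in> \<G> \<Longrightarrow> g \<in> carrier V"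
  by (simp add: V_carrier generate.incl)

lemma V_add: "v \<in> carrier V \<Longrightarrow> w \<in> carrier V \<Longrightarrow> v \<oplus>\<^bsub>AK\<^esub> w \<in> carrier V"
  using generate.eng[of v "add_monoid AK" \<G> w] by (simp add: V_carrier)

lemma V_zero: "\<zero>\<^bsub>AK\<^esub> \<in> carrier V"
  using generate.one[of "add_monoid AK" \<G>] by (simp add: V_carrier)

lemma V_mult: assumes "v \<in> carrier V" "w \<in> carrier V" shows "v \<otimes>\<^bsub>AK\<^esub> w \<in> carrier V"
proof -
  have g: "g \<otimes>\<^bsub>AK\<^esub> w \<in> carrier V" if "g \<in> \<G>" for g
    using assms(2)
  proof (induction rule: V_induct)
    case zero then show ?case using subsetD[OF gens_carrier that] V_zero by simp
  next
    case (gen g') then show ?case using gens_mult[OF that gen] V_gen by blast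
  next
    case (add v w) then show ?case using subsetD[OF gens_carrier that] subsetD[OF V_sub] V_add by (simp add: K.T.r_distr)
  qed
  show ?thesis using assms(1)
  proof (induction rule: V_induct)
    case zero then show ?case using subsetD[OF V_sub assms(2)] V_zero by auto
  next
    case (add v w') then show ?case using subsetD[OF V_sub] V_add assms(2) by (simp add: K.T.l_distr)
  qed (rule g)
qed

lemma V_smult: assumes "v \<in> carrier V" shows "c \<odot>\<^bsub>AK\<^esub> v \<in> carrier V"
  using assms
proof (induction rule: V_induct)
  case (gen g) then show ?case using V_gen gens_smult by blast
next
  case (add v w) then show ?case using subsetD[OF V_sub] V_add by (simp add: K.T.smult_r_distr)
qed (use V_zero in auto)

lemma V_base: "a \<in> carrier A \<Longrightarrow> K.pt a 1 \<in> carrier V"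
proof (rule V_gen)
  assume "a \<in> carrier A"
  then have "a \<in> ideal_pow A J 0" "K.pt a 1 = K.pt a (ph 0)" by (simp_all only: ideal_pow.simps ph_simps)
  then show "K.pt a 1 \<in> \<G>" by blast
qed

lemma subalg_V: "subalg AK (carrier V)"
proof (rule subalgI)
  show "\<one>\<^bsub>AK\<^esub> \<in> carrier V" using V_base[OF A.one_closed] by (simp add: K.pt_one)
qed (use V_sub V_add V_mult V_smult in auto)

lemma ralg_V: "ralg V"
  by (subst V_eq) (rule ralg_subalg[OF K.ralg_tensor subalg_V])

lemma V_ops: "\<one>\<^bsub>V\<^esub> = \<one>\<^bsub>AK\<^esub>" "\<zero>\<^bsub>V\<^esub> = \<zero>\<^bsub>AK\<^esub>" "v \<oplus>\<^bsub>V\<^esub> w = v \<oplus>\<^bsub>AK\<^esub> w" "v \<otimes>\<^bsub>V\<^esub> w = v \<otimes>\<^bsub>AK\<^esub> w" "c \<odot>\<^bsub>V\<^esub> v = c \<odot>\<^bsub>AK\<^esub> v"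
  by (simp_all add: vee_alg_def)

lemma ahom_V_inc: "ahom V AK (\<lambda>x. x)"
  using V_sub by (auto intro!: ahomI linI simp: V_ops)

text \<open>The quotient (a - \<epsilon>(a)) / h. It is linear in a and obeys the twisted Leibniz
  rule dq(ab) = dq(a) b + \<epsilon>(a) dq(b), which carries the generation argument below.\<close>

definition dq :: "'a \<Rightarrow> ('r, 'a, 'r fract) tensor" where
  "dq a = K.pt (a \<ominus>\<^bsub>A\<^esub> \<epsilon> a \<odot>\<^bsub>A\<^esub> \<one>\<^bsub>A\<^esub>) (ph 1)"

lemma dq_gen: assumes "a \<in> carrier A" shows "dq a \<in> carrier V"
proof (rule V_gen)
  have "\<epsilon> (a \<ominus>\<^bsub>A\<^esub> \<epsilon> a \<odot>\<^bsub>A\<^esub> \<one>\<^bsub>A\<^esub>) = 0"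
    using assms by (simp add: eps_hom a_minus_def flip: A.smult_minus_l)
  then have "(a \<ominus>\<^bsub>A\<^esub> \<epsilon> a \<odot>\<^bsub>A\<^esub> \<one>\<^bsub>A\<^esub>) \<otimes>\<^bsub>A\<^esub> \<one>\<^bsub>A\<^esub> \<in> ideal_prod A J (ideal_pow A J 0)"
    using assms by (intro ideal_prod.prod) (auto simp: J_eq)
  then have "a \<ominus>\<^bsub>A\<^esub> \<epsilon> a \<odot>\<^bsub>A\<^esub> \<one>\<^bsub>A\<^esub> \<in> ideal_pow A J 1" using assms by simp
  then show "dq a \<in> \<G>" unfolding dq_def by blast
qed

lemma dq_closed: "a \<in> carrier A \<Longrightarrow> dq a \<in> carrier AK"
  using dq_gen V_sub by blast

lemma pt_dq: assumes "a \<in> carrier A" shows "K.pt a 1 = \<epsilon> a \<odot>\<^bsub>AK\<^esub> \<one>\<^bsub>AK\<^esub> \<oplus>\<^bsub>AK\<^esub> h \<odot>\<^bsub>AK\<^esub> dq a"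
proof -
  have "h \<odot>\<^bsub>AK\<^esub> dq a = K.pt (a \<ominus>\<^bsub>A\<^esub> \<epsilon> a \<odot>\<^bsub>A\<^esub> \<one>\<^bsub>A\<^esub>) (h \<odot>\<^bsub>fract_alg\<^esub> ph 1)"
    unfolding dq_def using assms by (subst K.pt_smult_r) auto
  also have "h \<odot>\<^bsub>fract_alg\<^esub> ph 1 = 1" using ph_simps(3)[of 0] ph_simps(1) by simp
  finally have 1: "h \<odot>\<^bsub>AK\<^esub> dq a = K.pt (a \<ominus>\<^bsub>A\<^esub> \<epsilon> a \<odot>\<^bsub>A\<^esub> \<one>\<^bsub>A\<^esub>) 1" .
  have 2: "\<epsilon> a \<odot>\<^bsub>AK\<^esub> \<one>\<^bsub>AK\<^esub> = K.pt (\<epsilon> a \<odot>\<^bsub>A\<^esub> \<one>\<^bsub>A\<^esub>) 1" by (simp add: K.pt_one K.pt_smult_l)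
  have "\<epsilon> a \<odot>\<^bsub>A\<^esub> \<one>\<^bsub>A\<^esub> \<oplus>\<^bsub>A\<^esub> (a \<ominus>\<^bsub>A\<^esub> \<epsilon> a \<odot>\<^bsub>A\<^esub> \<one>\<^bsub>A\<^esub>) = a"
  proof -
    have "y \<oplus>\<^bsub>A\<^esub> (x \<ominus>\<^bsub>A\<^esub> y) = x" if "x \<in> carrier A" "y \<in> carrier A" for x y using that by algebra
    then show ?thesis using assms by auto
  qed
  then show ?thesis using assms unfolding 1 2 by (subst K.pt_add_l[symmetric]) auto
qed

text \<open>By the Leibniz rule the elements a with \<open>dq a\<close> in \<open>S\<close> form a
  subalgebra, so it is enough to test generators of \<open>A\<close>. This covers h^{-1} J, and the
  elements of h^{-m} J^m are sums of products of such elements.\<close>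

lemma V_generated:
  assumes S: "subalg AK S" and gens: "Gs \<subseteq> carrier A"
    and gen: "\<And>Q. subalg A Q \<Longrightarrow> Gs \<subseteq> Q \<Longrightarrow> carrier A \<subseteq> Q"
    and inS: "\<And>g. g \<in> Gs \<Longrightarrow> dq g \<in> S"
  shows "carrier V \<subseteq> S"
proof -
  note S' = subalgD[OF S]
  have base: "K.pt a 1 \<in> S" if "a \<in> carrier A" "dq a \<in> S" for a
    using S' that by (simp add: pt_dq)
  have lin: "dq (a \<oplus>\<^bsub>A\<^esub> b) = dq a \<oplus>\<^bsub>AK\<^esub> dq b" "dq (c \<odot>\<^bsub>A\<^esub> a) = c \<odot>\<^bsub>AK\<^esub> dq a" if "a \<in> carrier A" "b \<in> carrier A" for a b c
  proof -
    have *: "a \<oplus>\<^bsub>A\<^esub> b \<ominus>\<^bsub>A\<^esub> (x \<oplus>\<^bsub>A\<^esub> y) = (a \<ominus>\<^bsub>A\<^esub> x) \<oplus>\<^bsub>A\<^esub> (b \<ominus>\<^bsub>A\<^esub> y)" if "x \<in> carrier A" "y \<in> carrier A" for x y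
      using that \<open>a \<in> carrier A\<close> \<open>b \<in> carrier A\<close> by algebra
    show "dq (a \<oplus>\<^bsub>A\<^esub> b) = dq a \<oplus>\<^bsub>AK\<^esub> dq b" using that
      by (simp add: dq_def eps_hom A.smult_l_distr * K.pt_add_l)
    show "dq (c \<odot>\<^bsub>A\<^esub> a) = c \<odot>\<^bsub>AK\<^esub> dq a" using that
      by (simp add: dq_def eps_hom A.smult_assoc K.pt_smult_l flip: A.smult_diff_r)
  qed
  have prod: "dq (a \<otimes>\<^bsub>A\<^esub> b) = dq a \<otimes>\<^bsub>AK\<^esub> K.pt b 1 \<oplus>\<^bsub>AK\<^esub> \<epsilon> a \<odot>\<^bsub>AK\<^esub> dq b" if ab: "a \<in> carrier A" "b \<in> carrier A" for a b
  proof -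
    have "x \<oplus>\<^bsub>A\<^esub> \<ominus>\<^bsub>A\<^esub> z = (x \<oplus>\<^bsub>A\<^esub> \<ominus>\<^bsub>A\<^esub> y) \<oplus>\<^bsub>A\<^esub> (y \<oplus>\<^bsub>A\<^esub> \<ominus>\<^bsub>A\<^esub> z)" if "x \<in> carrier A" "y \<in> carrier A" "z \<in> carrier A" for x y z
      using that by algebra
    from this[of "a \<otimes>\<^bsub>A\<^esub> b" "\<epsilon> a \<odot>\<^bsub>A\<^esub> b" "(\<epsilon> a * \<epsilon> b) \<odot>\<^bsub>A\<^esub> \<one>\<^bsub>A\<^esub>"]
    have "a \<otimes>\<^bsub>A\<^esub> b \<ominus>\<^bsub>A\<^esub> (\<epsilon> a * \<epsilon> b) \<odot>\<^bsub>A\<^esub> \<one>\<^bsub>A\<^esub>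
      = (a \<ominus>\<^bsub>A\<^esub> \<epsilon> a \<odot>\<^bsub>A\<^esub> \<one>\<^bsub>A\<^esub>) \<otimes>\<^bsub>A\<^esub> b \<oplus>\<^bsub>A\<^esub> \<epsilon> a \<odot>\<^bsub>A\<^esub> (b \<ominus>\<^bsub>A\<^esub> \<epsilon> b \<odot>\<^bsub>A\<^esub> \<one>\<^bsub>A\<^esub>)"
      using ab by (simp add: a_minus_def A.l_distr A.l_minus A.smult_r_distr A.smult_mult_l A.smult_assoc A.smult_minus_r)
    then show ?thesis using ab by (simp add: dq_def eps_hom K.pt_add_l K.pt_smult_l K.pt_mult)
  qed
  have one: "dq \<one>\<^bsub>A\<^esub> \<in> S"
    using subalg_zero[OF K.ralg_tensor S] K.pt_zero_l[of "ph 1"] by (simp add: dq_def eps_hom A.r_neg a_minus_def)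
  have "subalg A {a \<in> carrier A. dq a \<in> S}"
    using base one S' by (intro subalgI) (auto simp: lin prod)
  then have all: "dq a \<in> S" if "a \<in> carrier A" for a using gen[of "{a \<in> carrier A. dq a \<in> S}"] gens inS that by blast
  have J: "K.pt j (ph 1) \<in> S" if "j \<in> J" for j
  proof -
    have "dq j = K.pt j (ph 1)" using that by (simp add: dq_def J_eq a_minus_def)
    then show ?thesis using all[of j] that by (simp add: J_eq)
  qed
  have Jm: "K.pt j (ph m) \<in> S" if "j \<in> ideal_pow A J m" for j m
    using that
  proof (induction m arbitrary: j)
    case 0 then show ?case using base all ph_simps(1) by simp
  next
    case (Suc m)
    then have "j \<in> ideal_prod A J (ideal_pow A J m)" by simp
    then show ?case
    proof (induction j rule: ideal_prod.induct)
      case (prod x y)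
      have "x \<in> carrier A" "y \<in> carrier A" using prod Jm_carrier J_eq by auto
      then have "K.pt (x \<otimes>\<^bsub>A\<^esub> y) (ph 1 * ph m) = K.pt x (ph 1) \<otimes>\<^bsub>AK\<^esub> K.pt y (ph m)" by (simp add: K.pt_mult)
      then show ?case using S'(5)[OF J[OF prod(1)] Suc.IH[OF prod(2)]] by (simp only: ph_simps(2) plus_1_eq_Suc)
    next
      case (sum s1 s2)
      have "s1 \<in> carrier A" "s2 \<in> carrier A" using sum(1,2) Jm_carrier[of _ "Suc m"] by auto
      then show ?case using sum S'(4) by (simp add: K.pt_add_l)
    qed
  qed
  show ?thesis
  proof
    fix v assume "v \<in> carrier V" then show "v \<in> S"
      by (induction rule: V_induct) (use Jm S' subalg_zero[OF K.ralg_tensor S] in auto)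
  qed
qed

text \<open>Multiplication by 1 \<otimes> 1/c undoes multiplication by c.\<close>

lemma AK_torsion_free: assumes "c \<noteq> 0" shows "torsion_free c AK"
  unfolding torsion_free_def
proof (intro ballI impI)
  fix x assume x: "x \<in> carrier AK" "c \<odot>\<^bsub>AK\<^esub> x = \<zero>\<^bsub>AK\<^esub>"
  let ?u = "K.pt \<one>\<^bsub>A\<^esub> (Fraction_Field.Fract 1 c)"
  have u: "?u \<in> carrier AK" by auto
  have "?u \<otimes>\<^bsub>AK\<^esub> (c \<odot>\<^bsub>AK\<^esub> x) = x" using x(1)
  proof (induction x rule: K.tensor_induct)
    case (pure a b)
    have "fr c * b * Fraction_Field.Fract 1 c = b * (fr c * Fraction_Field.Fract 1 c)" by (simp only: mult_ac)
    also have "\<dots> = b" by (simp only: fr_inverse'[OF assms] fr_hom(3) mult_1_right)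
    finally have e: "Fraction_Field.Fract 1 c * (fr c * b) = b" by (simp only: mult_ac)
    have "?u \<otimes>\<^bsub>AK\<^esub> (c \<odot>\<^bsub>AK\<^esub> K.pt a b) = K.pt a (Fraction_Field.Fract 1 c * (fr c * b))"
      using pure by (simp add: K.pt_mult flip: K.pt_smult_r)
    then show ?case by (simp only: e)
  next
    case (add x y) then show ?case using u by (simp add: K.T.smult_r_distr K.T.r_distr)
  qed
  then show "x = \<zero>\<^bsub>AK\<^esub>" using x(2) u by simp
qed

lemma V_torsion_free: "c \<noteq> 0 \<Longrightarrow> torsion_free c V"
  using AK_torsion_free V_sub by (auto simp: torsion_free_def V_ops)

text \<open>Clearing the denominator of the second tensor factor already leads into the image of
  \<open>A\<close>. This provides the denominators asked for by
  \<open>tensor_sub_kernel\<close>.\<close>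

lemma V_denominators: assumes "x \<in> carrier AK" shows "\<exists>d. d \<noteq> 0 \<and> d \<odot>\<^bsub>AK\<^esub> x \<in> carrier V"
  using assms
proof (induction x rule: K.tensor_induct)
  case (pure a b)
  obtain n d where b: "b = Fraction_Field.Fract n d" "d \<noteq> 0" by (cases b rule: Fract_cases)
  have "d \<odot>\<^bsub>AK\<^esub> K.pt a b = K.pt a (fr d * b)" using pure K.pt_smult_r[of a b d] by simp
  also have "fr d * b = n \<odot>\<^bsub>fract_alg\<^esub> 1" using b fr_inverse'[of d n] by simp
  also have "K.pt a (n \<odot>\<^bsub>fract_alg\<^esub> 1) = n \<odot>\<^bsub>AK\<^esub> K.pt a 1" using pure by (intro K.pt_smult_r) auto
  finally show ?case using V_smult[OF V_base[OF pure(1)]] b(2) by metis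
next
  case (add x y)
  then obtain d e where d: "d \<noteq> 0" "d \<odot>\<^bsub>AK\<^esub> x \<in> carrier V" "e \<noteq> 0" "e \<odot>\<^bsub>AK\<^esub> y \<in> carrier V" by blast
  have "(d * e) \<odot>\<^bsub>AK\<^esub> (x \<oplus>\<^bsub>AK\<^esub> y) = e \<odot>\<^bsub>AK\<^esub> (d \<odot>\<^bsub>AK\<^esub> x) \<oplus>\<^bsub>AK\<^esub> d \<odot>\<^bsub>AK\<^esub> (e \<odot>\<^bsub>AK\<^esub> y)"
    using add by (simp add: K.T.smult_r_distr K.T.smult_assoc K.T.smult_commute[of _ d e])
  then have "(d * e) \<odot>\<^bsub>AK\<^esub> (x \<oplus>\<^bsub>AK\<^esub> y) \<in> carrier V" using V_add[OF V_smult[OF d(2), of e] V_smult[OF d(4), of d]] by simp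
  then show ?case using d by (intro exI[of _ "d * e"]) simp
qed

end

section \<open>Quantum minors\<close>

text \<open>The number of inversions; for a list that enumerates a permutation this is the length of
  the permutation.\<close>

fun linv :: "nat list \<Rightarrow> nat" where
  "linv [] = 0"
| "linv (x # xs) = length (filter (\<lambda>y. y < x) xs) + linv xs"

lemma linv_swap: "a < b \<Longrightarrow> linv (us @ b # a # vs) = Suc (linv (us @ a # b # vs))"
  by (induction us) auto

text \<open>Permutations in one-line notation. Lists allow exchanging neighbours and splitting off
  the first entry, on which the expansions below rest.\<close>

definition PL :: "nat \<Rightarrow> nat list set" where
  "PL n = {js. distinct js \<and> set js = {1..n}}"

lemma PL_length: "js \<in> PL n \<Longrightarrow> length js = n"
  using distinct_card by (fastforce simp: PL_def)

lemma finite_PL: "finite (PL n)"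
  by (rule finite_subset[of _ "{xs. set xs \<subseteq> {1..n} \<and> length xs = n}"])
     (use PL_length in \<open>auto simp: PL_def finite_lists_length_eq\<close>)

lemma not_sorted_adjacent:
  "\<not> sorted_wrt (<) (xs :: nat list) \<Longrightarrow> \<exists>us a b vs. xs = us @ a # b # vs \<and> b \<le> a"
proof (induction xs)
  case (Cons x xs)
  show ?case
  proof (cases "sorted_wrt (<) xs")
    case False
    then obtain us a b vs where "xs = us @ a # b # vs" "b \<le> a" using Cons.IH by blast
    then show ?thesis by (intro exI[of _ "x # us"]) auto
  next
    case True
    then obtain y ys where xs: "xs = y # ys" using Cons.prems by (cases xs) auto
    then have "y \<le> x" using True Cons.prems by fastforce
    then show ?thesis using xs by (intro exI[of _ "[]"]) auto
  qed
qed simp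

text \<open>The axioms \<open>alt\<close> and \<open>null\<close> are the facts about 2 by 2 minors
  from which those about larger minors follow: exchanging the rows costs the factor p, and a
  repeated row gives zero. The columns are 1, ..., n while the rows come from any set
  \<open>R\<close>, so that minors on the first columns of a larger matrix are covered.\<close>

locale row_alternating = ralg A for A :: "('r::comm_ring_1, 'b) module" (structure) +
  fixes x :: "nat \<Rightarrow> nat \<Rightarrow> 'b" and p :: 'r and R :: "nat set" and n :: nat
  assumes x_closed [simp]: "i \<in> R \<Longrightarrow> j \<in> {1..n} \<Longrightarrow> x i j \<in> carrier A"
    and alt: "i \<in> R \<Longrightarrow> k \<in> R \<Longrightarrow> i < k \<Longrightarrow> j \<in> {1..n} \<Longrightarrow> l \<in> {1..n} \<Longrightarrow> j < l \<Longrightarrow>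
      x k j \<otimes> x i l \<oplus> p \<odot> (x k l \<otimes> x i j) = p \<odot> (x i j \<otimes> x k l \<oplus> p \<odot> (x i l \<otimes> x k j))"
    and null: "i \<in> R \<Longrightarrow> j \<in> {1..n} \<Longrightarrow> l \<in> {1..n} \<Longrightarrow> j < l \<Longrightarrow> x i j \<otimes> x i l \<oplus> p \<odot> (x i l \<otimes> x i j) = \<zero>"
begin

fun xprod :: "nat list \<Rightarrow> nat list \<Rightarrow> 'b" where
  "xprod (i # is) (j # js) = x i j \<otimes> xprod is js"
| "xprod _ _ = \<one>"

lemma xprod_closed [simp]: "set is \<subseteq> R \<Longrightarrow> set js \<subseteq> {1..n} \<Longrightarrow> xprod is js \<in> carrier A"
  by (induction "is" js rule: xprod.induct) auto

lemma xprod_append: "length is = length js \<Longrightarrow> set is \<subseteq> R \<Longrightarrow> set js \<subseteq> {1..n} \<Longrightarrow> set is' \<subseteq> R \<Longrightarrow> set js' \<subseteq> {1..n} \<Longrightarrow>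
    xprod (is @ is') (js @ js') = xprod is js \<otimes> xprod is' js'"
  by (induction "is" js rule: list_induct2) (auto simp: m_assoc)

text \<open>The list of rows may be unsorted and may contain repetitions. Such lists arise when a
  row is put in front of a minor and when the determinant of a product of matrices is
  expanded.\<close>

definition qdet :: "nat list \<Rightarrow> 'b" where
  "qdet is = (\<Oplus>js\<in>PL n. p ^ linv js \<odot> xprod is js)"

lemma PL_sub: "js \<in> PL n \<Longrightarrow> set js \<subseteq> {1..n}"
  by (simp add: PL_def)

lemma qdet_closed [simp]: "set is \<subseteq> R \<Longrightarrow> qdet is \<in> carrier A"
  unfolding qdet_def by (intro finsum_closed) (auto dest: PL_sub)

text \<open>\<open>Asc m\<close> and \<open>Desc m\<close> split the column words by whether they
  rise or fall between positions m and m + 1, counted from 0; \<open>swp m\<close> exchanges these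
  two entries and matches the two classes.\<close>

definition Asc :: "nat \<Rightarrow> nat list set" where
  "Asc m = {ps @ a # b # qs | ps a b qs. ps @ a # b # qs \<in> PL n \<and> length ps = m \<and> a < b}"

definition Desc :: "nat \<Rightarrow> nat list set" where
  "Desc m = {ps @ b # a # qs | ps a b qs. ps @ b # a # qs \<in> PL n \<and> length ps = m \<and> a < b}"

definition swp :: "nat \<Rightarrow> nat list \<Rightarrow> nat list" where
  "swp m js = take m js @ (js ! Suc m) # (js ! m) # drop (Suc (Suc m)) js"

lemma swp_eq: "length ps = m \<Longrightarrow> swp m (ps @ a # b # qs) = ps @ b # a # qs"
  by (simp add: swp_def nth_append)

lemma PL_split: "Suc m < n \<Longrightarrow> PL n = Asc m \<union> Desc m"
proof
  assume m: "Suc m < n"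
  show "PL n \<subseteq> Asc m \<union> Desc m"
  proof
    fix js assume js: "js \<in> PL n"
    then have l: "length js = n" by (rule PL_length)
    define a b where "a = js ! m" and "b = js ! Suc m"
    have e: "js = take m js @ a # b # drop (Suc (Suc m)) js"
      using m l by (simp add: a_def b_def Cons_nth_drop_Suc)
    have "a \<noteq> b" using js m l by (simp add: PL_def a_def b_def nth_eq_iff_index_eq)
    then consider "a < b" | "b < a" by linarith
    then show "js \<in> Asc m \<union> Desc m"
    proof cases
      case 1
      then have "js \<in> Asc m" unfolding Asc_def using e js m l
        by (intro CollectI exI[of _ "take m js"] exI[of _ a] exI[of _ b] exI[of _ "drop (Suc (Suc m)) js"]) simp
      then show ?thesis by simp
    next
      case 2
      then have "js \<in> Desc m" unfolding Desc_def using e js m l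
        by (intro CollectI exI[of _ "take m js"] exI[of _ b] exI[of _ a] exI[of _ "drop (Suc (Suc m)) js"]) simp
      then show ?thesis by simp
    qed
  qed
qed (auto simp: Asc_def Desc_def)

lemma PL_swap: "ps @ a # b # qs \<in> PL n \<longleftrightarrow> ps @ b # a # qs \<in> PL n"
  by (auto simp: PL_def)

lemma swp_bij: "swp m ` Asc m = Desc m" "inj_on (swp m) (Asc m)"
proof -
  show "swp m ` Asc m = Desc m"
  proof (intro subset_antisym subsetI)
    fix js assume "js \<in> swp m ` Asc m"
    then obtain ps a b qs where "ps @ a # b # qs \<in> PL n" "length ps = m" "a < b" "js = swp m (ps @ a # b # qs)"
      by (auto simp: Asc_def)
    then show "js \<in> Desc m" unfolding Desc_def using PL_swap by (auto simp: swp_eq)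
  next
    fix js assume "js \<in> Desc m"
    then obtain ps a b qs where *: "ps @ b # a # qs \<in> PL n" "length ps = m" "a < b" "js = ps @ b # a # qs"
      by (auto simp: Desc_def)
    then have "ps @ a # b # qs \<in> Asc m" unfolding Asc_def using PL_swap by blast
    then show "js \<in> swp m ` Asc m" using * by (metis image_eqI swp_eq)
  qed
  show "inj_on (swp m) (Asc m)"
  proof (rule inj_on_inverseI[of _ "swp m"])
    fix js assume "js \<in> Asc m"
    then show "swp m (swp m js) = js" by (auto simp: Asc_def swp_eq)
  qed
qed

lemma Asc_sub: "js \<in> Asc m \<Longrightarrow> set js \<subseteq> {1..n}" "js \<in> Asc m \<Longrightarrow> set (swp m js) \<subseteq> {1..n}"
  and Desc_sub: "js \<in> Desc m \<Longrightarrow> set js \<subseteq> {1..n}"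
proof -
  have *: "Asc m \<subseteq> PL n" "Desc m \<subseteq> PL n" by (auto simp: Asc_def Desc_def)
  then show "js \<in> Asc m \<Longrightarrow> set js \<subseteq> {1..n}" "js \<in> Desc m \<Longrightarrow> set js \<subseteq> {1..n}" using PL_sub by blast+
  assume "js \<in> Asc m"
  then have "swp m js \<in> PL n" using swp_bij(1)[of m] *(2) by blast
  then show "set (swp m js) \<subseteq> {1..n}" by (rule PL_sub)
qed

text \<open>Each column word with an ascent at m is paired with its exchange, which has one
  inversion more. By \<open>xprod_two\<close> the bracket is then a product whose middle factor is a
  2 by 2 minor in two neighbouring rows.\<close>

lemma qdet_split:
  assumes "set is \<subseteq> R" "Suc m < n"
  shows "qdet is = (\<Oplus>js\<in>Asc m. p ^ linv js \<odot> (xprod is js \<oplus> p \<odot> xprod is (swp m js)))"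
proof -
  have sub: "Asc m \<subseteq> PL n" "Desc m \<subseteq> PL n" by (auto simp: Asc_def Desc_def)
  have fin: "finite (Asc m)" "finite (Desc m)" using sub finite_PL finite_subset by blast+
  have "js ! m < js ! Suc m" if "js \<in> Asc m" for js using that by (auto simp: Asc_def nth_append)
  moreover have "js ! Suc m < js ! m" if "js \<in> Desc m" for js using that by (auto simp: Desc_def nth_append)
  ultimately have "Asc m \<inter> Desc m = {}" by (meson disjoint_iff less_asym)
  then have "qdet is = (\<Oplus>js\<in>Asc m. p ^ linv js \<odot> xprod is js) \<oplus> (\<Oplus>js\<in>Desc m. p ^ linv js \<odot> xprod is js)"
    unfolding qdet_def PL_split[OF assms(2)] using fin assms(1) Asc_sub(1) Desc_sub
    by (intro finsum_Un_disjoint Pi_I smult_closed xprod_closed) simp_all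
  also have "(\<Oplus>js\<in>Desc m. p ^ linv js \<odot> xprod is js) = (\<Oplus>js\<in>Asc m. p ^ linv (swp m js) \<odot> xprod is (swp m js))"
    unfolding swp_bij(1)[symmetric]
    using assms(1) Desc_sub unfolding swp_bij(1)[symmetric]
    by (intro add.finprod_reindex[OF _ swp_bij(2)] Pi_I) (simp add: smult_closed)
  also have "(\<Oplus>js\<in>Asc m. p ^ linv js \<odot> xprod is js) \<oplus> \<dots>
      = (\<Oplus>js\<in>Asc m. p ^ linv js \<odot> xprod is js \<oplus> p ^ linv (swp m js) \<odot> xprod is (swp m js))"
    using assms(1) Asc_sub by (intro finsum_addf[symmetric] Pi_I smult_closed xprod_closed) simp_all
  also have "\<dots> = (\<Oplus>js\<in>Asc m. p ^ linv js \<odot> (xprod is js \<oplus> p \<odot> xprod is (swp m js)))"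
  proof (rule finsum_cong')
    fix js assume js: "js \<in> Asc m"
    then have "linv (swp m js) = Suc (linv js)" by (auto simp: Asc_def swp_eq linv_swap)
    moreover have "xprod is js \<in> carrier A" "xprod is (swp m js) \<in> carrier A"
      using Asc_sub[OF js] assms(1) by simp_all
    ultimately show "p ^ linv js \<odot> xprod is js \<oplus> p ^ linv (swp m js) \<odot> xprod is (swp m js)
        = p ^ linv js \<odot> (xprod is js \<oplus> p \<odot> xprod is (swp m js))"
      by (simp add: smult_r_distr smult_assoc smult_commute[of _ p])
  next
    show "(\<lambda>js. p ^ linv js \<odot> (xprod is js \<oplus> p \<odot> xprod is (swp m js))) \<in> Asc m \<rightarrow> carrier A"
      using assms(1) Asc_sub by (intro Pi_I smult_closed add.m_closed xprod_closed) simp_all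
  qed simp
  finally show ?thesis .
qed

lemma xprod_pair:
  assumes "set (us @ i # k # vs) \<subseteq> R" "set (ps @ a # b # qs) \<subseteq> {1..n}" "length us = length ps"
  shows "xprod (us @ i # k # vs) (ps @ a # b # qs) = xprod us ps \<otimes> (x i a \<otimes> x k b) \<otimes> xprod vs qs"
  using assms xprod_append[of us ps "i # k # vs" "a # b # qs"] by (simp add: m_assoc)

lemma xprod_two:
  assumes "set (us @ i # k # vs) \<subseteq> R" "set (ps @ a # b # qs) \<subseteq> {1..n}" "length us = length ps"
  shows "xprod (us @ i # k # vs) (ps @ a # b # qs) \<oplus> p \<odot> xprod (us @ i # k # vs) (ps @ b # a # qs)
    = xprod us ps \<otimes> (x i a \<otimes> x k b \<oplus> p \<odot> (x i b \<otimes> x k a)) \<otimes> xprod vs qs"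
proof -
  have c: "x i a \<in> carrier A" "x k b \<in> carrier A" "x i b \<in> carrier A" "x k a \<in> carrier A"
    "xprod us ps \<in> carrier A" "xprod vs qs \<in> carrier A" using assms by auto
  have s: "set (ps @ b # a # qs) \<subseteq> {1..n}" using assms by auto
  show ?thesis unfolding xprod_pair[OF assms] xprod_pair[OF assms(1) s assms(3)]
    using c by (simp add: r_distr l_distr smult_mult_r smult_mult_l)
qed

lemma qdet_null:
  assumes "set (us @ i # i # vs) \<subseteq> R" "length (us @ i # i # vs) = n"
  shows "qdet (us @ i # i # vs) = \<zero>"
proof -
  have "qdet (us @ i # i # vs) = (\<Oplus>js\<in>Asc (length us). p ^ linv js \<odot> (xprod (us @ i # i # vs) js \<oplus> p \<odot> xprod (us @ i # i # vs) (swp (length us) js)))"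
    using assms by (intro qdet_split) auto
  also have "\<dots> = \<zero>"
  proof (rule add.finprod_one_eqI)
    fix js assume "js \<in> Asc (length us)"
    then obtain ps a b qs where js: "js = ps @ a # b # qs" "js \<in> PL n" "length ps = length us" "a < b" by (auto simp: Asc_def)
    have s: "set (ps @ a # b # qs) \<subseteq> {1..n}" using PL_sub[OF js(2)] unfolding js(1) .
    have "xprod us ps \<in> carrier A" "xprod vs qs \<in> carrier A" using s assms by auto
    then show "p ^ linv js \<odot> (xprod (us @ i # i # vs) js \<oplus> p \<odot> xprod (us @ i # i # vs) (swp (length us) js)) = \<zero>"
      using xprod_two[OF assms(1) s] js null[of i a b] s assms by (simp add: swp_eq)
  qed
  finally show ?thesis by simp
qed

lemma qdet_swap:
  assumes "set (us @ k # i # vs) \<subseteq> R" "length (us @ k # i # vs) = n" "i < k"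
  shows "qdet (us @ k # i # vs) = p \<odot> qdet (us @ i # k # vs)"
proof -
  have s': "set (us @ i # k # vs) \<subseteq> R" using assms by auto
  have m: "Suc (length us) < n" using assms by auto
  have sub: "Asc (length us) \<subseteq> PL n" "Desc (length us) \<subseteq> PL n" by (auto simp: Asc_def Desc_def)
  have "qdet (us @ k # i # vs) = (\<Oplus>js\<in>Asc (length us). p ^ linv js \<odot> (xprod (us @ k # i # vs) js \<oplus> p \<odot> xprod (us @ k # i # vs) (swp (length us) js)))"
    by (rule qdet_split[OF assms(1) m])
  also have "\<dots> = (\<Oplus>js\<in>Asc (length us). p \<odot> (p ^ linv js \<odot> (xprod (us @ i # k # vs) js \<oplus> p \<odot> xprod (us @ i # k # vs) (swp (length us) js))))"
  proof (rule finsum_cong')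
    fix js assume "js \<in> Asc (length us)"
    then obtain ps a b qs where js: "js = ps @ a # b # qs" "js \<in> PL n" "length ps = length us" "a < b" by (auto simp: Asc_def)
    have s: "set (ps @ a # b # qs) \<subseteq> {1..n}" using PL_sub[OF js(2)] unfolding js(1) .
    have c: "x i a \<in> carrier A" "x k b \<in> carrier A" "x i b \<in> carrier A" "x k a \<in> carrier A"
      "xprod us ps \<in> carrier A" "xprod vs qs \<in> carrier A" using assms s by auto
    have "x k a \<otimes> x i b \<oplus> p \<odot> (x k b \<otimes> x i a) = p \<odot> (x i a \<otimes> x k b \<oplus> p \<odot> (x i b \<otimes> x k a))"
      using s assms js(4) by (intro alt) auto
    then show "p ^ linv js \<odot> (xprod (us @ k # i # vs) js \<oplus> p \<odot> xprod (us @ k # i # vs) (swp (length us) js))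
      = p \<odot> (p ^ linv js \<odot> (xprod (us @ i # k # vs) js \<oplus> p \<odot> xprod (us @ i # k # vs) (swp (length us) js)))"
      using c xprod_two[OF assms(1) s] xprod_two[OF s' s] js(3)
      by (simp add: js(1) swp_eq smult_mult_r smult_mult_l smult_commute[of _ p])
  next
    show "(\<lambda>js. p \<odot> (p ^ linv js \<odot> (xprod (us @ i # k # vs) js \<oplus> p \<odot> xprod (us @ i # k # vs) (swp (length us) js)))) \<in> Asc (length us) \<rightarrow> carrier A"
      using s' Asc_sub by (intro Pi_I smult_closed add.m_closed xprod_closed) simp_all
  qed simp
  also have "\<dots> = p \<odot> qdet (us @ i # k # vs)"
    unfolding qdet_split[OF s' m] using s' Asc_sub
    by (intro smult_finsum[symmetric] Pi_I smult_closed add.m_closed xprod_closed) simp_all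
  finally show ?thesis .
qed

text \<open>Bubble sort: a neighbouring descent is exchanged at the cost of p, which lowers the
  number of inversions, and equal neighbours give zero. A list with repetitions must meet equal
  neighbours, since it can never become strictly increasing.\<close>

lemma qdet_sort:
  "set is \<subseteq> R \<Longrightarrow> length is = n \<Longrightarrow> qdet is = (if distinct is then p ^ linv is \<odot> qdet (sort is) else \<zero>)"
proof (induction "linv is" arbitrary: "is" rule: less_induct)
  case less
  show ?case
  proof (cases "sorted_wrt (<) is")
    case True
    then have "distinct is" "sorted is" by (auto simp: strict_sorted_iff)
    moreover have "linv is = 0" using True by (induction "is") (auto simp: filter_empty_conv)
    ultimately show ?thesis using less.prems by (simp add: sorted_sort_id)
  next
    case False
    then obtain us a b vs where e: "is = us @ a # b # vs" "b \<le> a" using not_sorted_adjacent by blast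
    show ?thesis
    proof (cases "a = b")
      case True
      then show ?thesis using qdet_null[of us a vs] less.prems e by simp
    next
      case False
      then have ba: "b < a" using e by simp
      let ?js = "us @ b # a # vs"
      have lin: "linv is = Suc (linv ?js)" using linv_swap[OF ba] e by simp
      have "mset is = mset ?js" using e by simp
      then have so: "sort is = sort ?js" by (metis properties_for_sort mset_sort sorted_sort)
      have di: "distinct is \<longleftrightarrow> distinct ?js" using e by auto
      have "qdet is = p \<odot> qdet ?js" using qdet_swap[of us a b vs] less.prems e ba by simp
      also have "qdet ?js = (if distinct ?js then p ^ linv ?js \<odot> qdet (sort ?js) else \<zero>)"
        using less.prems e lin by (intro less.hyps) auto
      finally have *: "qdet is = p \<odot> (if distinct ?js then p ^ linv ?js \<odot> qdet (sort ?js) else \<zero>)" .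
      have "set (sort ?js) \<subseteq> R" using less.prems(1) e by auto
      then have "qdet (sort ?js) \<in> carrier A" by (rule qdet_closed)
      then show ?thesis unfolding * lin so di by (simp add: smult_assoc)
    qed
  qed
qed

text \<open>The cofactor of column c in an expansion along a row put in front of \<open>is\<close>.
  It involves the remaining rows only, so any row can be put in front of the same cofactors; the
  exponent counts the inversions of the full column word.\<close>

definition cof :: "nat list \<Rightarrow> nat \<Rightarrow> 'b" where
  "cof is c = (\<Oplus>js\<in>{js \<in> PL n. hd js = c}. p ^ linv js \<odot> xprod is (tl js))"

lemma cof_closed [simp]: assumes "set is \<subseteq> R" shows "cof is c \<in> carrier A"
proof -
  have "set (tl js) \<subseteq> {1..n}" if "js \<in> PL n" for js
    using PL_sub[OF that] by (cases js) auto
  then show ?thesis unfolding cof_def using assms by (intro finsum_closed Pi_I smult_closed xprod_closed) auto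
qed

lemma qdet_expand:
  assumes "l \<in> R" "set is \<subseteq> R" "0 < n"
  shows "qdet (l # is) = (\<Oplus>c\<in>{1..n}. x l c \<otimes> cof is c)"
proof -
  let ?P = "\<lambda>c. {js \<in> PL n. hd js = c}"
  have tl: "set (tl js) \<subseteq> {1..n}" "js = hd js # tl js" "hd js \<in> {1..n}" if "js \<in> PL n" for js
  proof -
    have "js \<noteq> []" using PL_length[OF that] assms by auto
    then show "set (tl js) \<subseteq> {1..n}" "js = hd js # tl js" "hd js \<in> {1..n}" using PL_sub[OF that] by (cases js, auto)+
  qed
  have U: "PL n = (\<Union>c\<in>{1..n}. ?P c)" using tl(3) by auto
  have "qdet (l # is) = (\<Oplus>c\<in>{1..n}. \<Oplus>js\<in>?P c. p ^ linv js \<odot> xprod (l # is) js)"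
    unfolding qdet_def
    by (subst U, rule add.finprod_UN_disjoint) (use finite_PL assms in \<open>auto simp: pairwise_def disjnt_def simp del: One_nat_def dest!: PL_sub\<close>)
  also have "\<dots> = (\<Oplus>c\<in>{1..n}. x l c \<otimes> cof is c)"
  proof (rule finsum_cong')
    fix c assume c: "c \<in> {1..n}"
    have "(\<Oplus>js\<in>?P c. p ^ linv js \<odot> xprod (l # is) js) = (\<Oplus>js\<in>?P c. x l c \<otimes> (p ^ linv js \<odot> xprod is (tl js)))"
    proof (rule finsum_cong')
      fix js assume js: "js \<in> ?P c"
      then have "js = c # tl js" using tl(2)[of js] by auto
      then have "xprod (l # is) js = x l c \<otimes> xprod is (tl js)" by (metis xprod.simps(1))
      then show "p ^ linv js \<odot> xprod (l # is) js = x l c \<otimes> (p ^ linv js \<odot> xprod is (tl js))"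
        using js tl(1) assms c by (simp add: smult_mult_r)
    qed (use tl(1) assms c in auto)
    also have "\<dots> = x l c \<otimes> cof is c" unfolding cof_def
      using finite_PL tl(1) assms c by (intro finsum_rdistr[symmetric]) auto
    finally show "(\<Oplus>js\<in>?P c. p ^ linv js \<odot> xprod (l # is) js) = x l c \<otimes> cof is c" .
  qed (use assms in auto)
  finally show ?thesis .
qed

end

lemma perm_length_linv:
  "linv (map \<sigma> [1..<Suc m]) = perm_length m \<sigma>"
proof -
  \<comment> \<open>Generalized to an arbitrary interval, because the recursion of
    \<open>linv\<close> removes the first entry.\<close>
  have gen: "linv (map \<sigma> [a..<b]) = card {(i, j). a \<le> i \<and> i < j \<and> j < b \<and> \<sigma> j < \<sigma> i}" for a b
  proof (induction "b - a" arbitrary: a)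
    case 0
    then have e: "{(i, j). a \<le> i \<and> i < j \<and> j < b \<and> \<sigma> j < \<sigma> i} = {}" by auto
    show ?case unfolding e using 0 by simp
  next
    case (Suc d)
    then have ab: "a < b" by simp
    have fin: "finite {(i, j). Suc a \<le> i \<and> i < j \<and> j < b \<and> \<sigma> j < \<sigma> i}"
      by (rule finite_subset[of _ "{..<b} \<times> {..<b}"]) auto
    have e: "{(i, j). a \<le> i \<and> i < j \<and> j < b \<and> \<sigma> j < \<sigma> i}
      = Pair a ` {j \<in> {Suc a..<b}. \<sigma> j < \<sigma> a} \<union> {(i, j). Suc a \<le> i \<and> i < j \<and> j < b \<and> \<sigma> j < \<sigma> i}"
      by (auto simp: Suc_le_eq le_less)
    have "card {(i, j). a \<le> i \<and> i < j \<and> j < b \<and> \<sigma> j < \<sigma> i}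
      = card (Pair a ` {j \<in> {Suc a..<b}. \<sigma> j < \<sigma> a}) + card {(i, j). Suc a \<le> i \<and> i < j \<and> j < b \<and> \<sigma> j < \<sigma> i}"
      unfolding e using fin by (intro card_Un_disjoint) auto
    also have "card (Pair a ` {j \<in> {Suc a..<b}. \<sigma> j < \<sigma> a}) = card {j \<in> {Suc a..<b}. \<sigma> j < \<sigma> a}"
      by (rule card_image) (auto simp: inj_on_def)
    also have "card {j \<in> {Suc a..<b}. \<sigma> j < \<sigma> a} = length (filter (\<lambda>y. y < \<sigma> a) (map \<sigma> [Suc a..<b]))"
      by (subst filter_map, subst length_map, subst distinct_card[symmetric]) (auto intro!: arg_cong[where f = card])
    also have "card {(i, j). Suc a \<le> i \<and> i < j \<and> j < b \<and> \<sigma> j < \<sigma> i} = linv (map \<sigma> [Suc a..<b])"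
      using Suc.hyps(1)[of "Suc a"] Suc.hyps(2) by simp
    finally show ?case using ab by (simp add: upt_conv_Cons)
  qed
  have "{(i, j). 1 \<le> i \<and> i < j \<and> j < Suc m \<and> \<sigma> j < \<sigma> i} = {(i, j). 1 \<le> i \<and> i < j \<and> j \<le> m \<and> \<sigma> i > \<sigma> j}" by auto
  then show ?thesis using gen[of 1 "Suc m"] by (simp add: perm_length_def)
qed

lemma permutes_PL: "bij_betw (\<lambda>\<sigma>. map \<sigma> [1..<Suc m]) {\<sigma>. \<sigma> permutes {1..m}} (PL m)"
proof (rule bij_betwI')
  fix \<sigma> \<tau> assume *: "\<sigma> \<in> {\<sigma>. \<sigma> permutes {1..m}}" "\<tau> \<in> {\<sigma>. \<sigma> permutes {1..m}}"
  show "(map \<sigma> [1..<Suc m] = map \<tau> [1..<Suc m]) = (\<sigma> = \<tau>)"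
  proof
    assume "map \<sigma> [1..<Suc m] = map \<tau> [1..<Suc m]"
    then have "\<forall>i\<in>set [1..<Suc m]. \<sigma> i = \<tau> i" by (simp only: map_eq_conv)
    moreover have "set [1..<Suc m] = {1..m}" by auto
    ultimately have "\<sigma> i = \<tau> i" if "i \<in> {1..m}" for i using that by blast
    moreover have "\<sigma> i = \<tau> i" if "i \<notin> {1..m}" for i
      using * that by (metis mem_Collect_eq permutes_not_in)
    ultimately show "\<sigma> = \<tau>" by blast
  qed simp
next
  fix \<sigma> assume "\<sigma> \<in> {\<sigma>. \<sigma> permutes {1..m}}"
  then have p: "\<sigma> permutes {1..m}" by simp
  have "set [1..<Suc m] = {1..m}" by auto
  then show "map \<sigma> [1..<Suc m] \<in> PL m"
    using permutes_image[OF p] permutes_inj_on[OF p, of "set [1..<Suc m]"] by (simp add: PL_def distinct_map del: upt_Suc)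
next
  fix js assume js: "js \<in> PL m"
  have l: "length js = m" by (rule PL_length[OF js])
  define \<sigma> where "\<sigma> k = (if k \<in> {1..m} then js ! (k - 1) else k)" for k
  have m: "map \<sigma> [1..<Suc m] = js"
    by (rule nth_equalityI) (use l in \<open>auto simp: \<sigma>_def simp del: upt_Suc\<close>)
  have "bij_betw \<sigma> {1..m} {1..m}"
  proof -
    have s: "set [1..<Suc m] = {1..m}" by auto
    have d: "distinct (map \<sigma> [1..<Suc m])" "set (map \<sigma> [1..<Suc m]) = {1..m}" using js unfolding m PL_def by auto
    have "inj_on \<sigma> {1..m}" using d(1) unfolding distinct_map s by blast
    moreover have "\<sigma> ` {1..m} = {1..m}" using d(2) unfolding set_map s .
    ultimately show ?thesis by (simp add: bij_betw_def)
  qed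
  then have "\<sigma> permutes {1..m}" by (rule bij_imp_permutes) (auto simp: \<sigma>_def)
  then show "\<exists>\<sigma>\<in>{\<sigma>. \<sigma> permutes {1..m}}. js = map \<sigma> [1..<Suc m]" using m by auto
qed

section \<open>Quantum matrices\<close>

context ralg begin

definition dsum :: "'i set \<Rightarrow> ('i \<Rightarrow> 'i \<Rightarrow> 'a) \<Rightarrow> 'a" where
  "dsum S F = (\<Oplus>a\<in>S. \<Oplus>b\<in>S. F a b)"

end

lemma (in ralg) finsum_swap:
  assumes "finite S" "finite S'" "\<And>a b. a \<in> S \<Longrightarrow> b \<in> S' \<Longrightarrow> F a b \<in> carrier A"
  shows "(\<Oplus>a\<in>S. \<Oplus>b\<in>S'. F a b) = (\<Oplus>b\<in>S'. \<Oplus>a\<in>S. F a b)"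
  using assms(1,3)
proof (induction S rule: finite_induct)
  case empty
  show ?case by (simp add: assms(2))
next
  case (insert x S)
  have c: "(\<lambda>b. F x b) \<in> S' \<rightarrow> carrier A" "(\<lambda>b. \<Oplus>a\<in>S. F a b) \<in> S' \<rightarrow> carrier A"
    "(\<lambda>a. \<Oplus>b\<in>S'. F a b) \<in> S \<rightarrow> carrier A"
    using insert.prems by (auto intro!: finsum_closed)
  have "(\<Oplus>b\<in>S'. \<Oplus>a\<in>insert x S. F a b) = (\<Oplus>b\<in>S'. F x b \<oplus> (\<Oplus>a\<in>S. F a b))"
    using insert c by (intro finsum_cong') (auto simp: Pi_iff intro!: finsum_insert)
  also have "\<dots> = (\<Oplus>b\<in>S'. F x b) \<oplus> (\<Oplus>b\<in>S'. \<Oplus>a\<in>S. F a b)"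
    by (rule finsum_addf[OF c(1,2)])
  finally show ?case using insert c by simp
qed

lemma (in ralg) finsum_mult:
  assumes "finite S" "finite S'" "f \<in> S \<rightarrow> carrier A" "g \<in> S' \<rightarrow> carrier A"
  shows "(\<Oplus>a\<in>S. f a) \<otimes> (\<Oplus>b\<in>S'. g b) = (\<Oplus>a\<in>S. \<Oplus>b\<in>S'. f a \<otimes> g b)"
proof -
  have "(\<Oplus>a\<in>S. f a) \<otimes> (\<Oplus>b\<in>S'. g b) = (\<Oplus>a\<in>S. f a \<otimes> (\<Oplus>b\<in>S'. g b))"
    using assms by (intro finsum_ldistr) auto
  also have "\<dots> = (\<Oplus>a\<in>S. \<Oplus>b\<in>S'. f a \<otimes> g b)"
    using assms by (intro finsum_cong' finsum_rdistr) (auto intro!: finsum_closed simp: Pi_iff)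
  finally show ?thesis .
qed

lemma (in ralg) dsum_cong:
  "(\<And>a b. a \<in> S \<Longrightarrow> b \<in> S \<Longrightarrow> G a b \<in> carrier A) \<Longrightarrow> (\<And>a b. a \<in> S \<Longrightarrow> b \<in> S \<Longrightarrow> F a b = G a b) \<Longrightarrow> dsum S F = dsum S G"
  unfolding dsum_def by (intro finsum_cong' finsum_closed Pi_I refl) auto

lemma (in ralg) dsum_add:
  assumes "\<And>a b. a \<in> S \<Longrightarrow> b \<in> S \<Longrightarrow> F a b \<in> carrier A" "\<And>a b. a \<in> S \<Longrightarrow> b \<in> S \<Longrightarrow> G a b \<in> carrier A"
  shows "dsum S (\<lambda>a b. F a b \<oplus> G a b) = dsum S F \<oplus> dsum S G"
proof -
  have "dsum S (\<lambda>a b. F a b \<oplus> G a b) = (\<Oplus>a\<in>S. (\<Oplus>b\<in>S. F a b) \<oplus> (\<Oplus>b\<in>S. G a b))"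
    unfolding dsum_def using assms by (intro finsum_cong' finsum_addf Pi_I finsum_closed add.m_closed refl) auto
  then show ?thesis unfolding dsum_def using assms by (simp add: finsum_addf finsum_closed Pi_iff)
qed

lemma (in ralg) dsum_smult:
  assumes "\<And>a b. a \<in> S \<Longrightarrow> b \<in> S \<Longrightarrow> F a b \<in> carrier A"
  shows "dsum S (\<lambda>a b. c \<odot> F a b) = c \<odot> dsum S F"
proof -
  have "dsum S (\<lambda>a b. c \<odot> F a b) = (\<Oplus>a\<in>S. c \<odot> (\<Oplus>b\<in>S. F a b))"
    unfolding dsum_def using assms by (intro finsum_cong' smult_finsum[symmetric] Pi_I finsum_closed smult_closed refl) auto
  then show ?thesis unfolding dsum_def using assms by (simp add: smult_finsum finsum_closed Pi_iff)
qed

lemma (in ralg) dsum_lin: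
  assumes "\<And>a b. a \<in> S \<Longrightarrow> b \<in> S \<Longrightarrow> F a b \<in> carrier A" "\<And>a b. a \<in> S \<Longrightarrow> b \<in> S \<Longrightarrow> G a b \<in> carrier A"
  shows "dsum S (\<lambda>a b. c \<odot> F a b \<oplus> d \<odot> G a b) = c \<odot> dsum S F \<oplus> d \<odot> dsum S G"
  using dsum_add[of S "\<lambda>a b. c \<odot> F a b" "\<lambda>a b. d \<odot> G a b"] dsum_smult[OF assms(1), of S] dsum_smult[OF assms(2), of S] assms
  by simp

lemma (in ralg) dsum_swap:
  assumes "finite S" "\<And>a b. a \<in> S \<Longrightarrow> b \<in> S \<Longrightarrow> F a b \<in> carrier A"
  shows "dsum S F = dsum S (\<lambda>a b. F b a)"
  unfolding dsum_def by (rule finsum_swap) (use assms in auto)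

text \<open>Together with \<open>rb\<close>, the diagonal and off-diagonal entries of the R-matrix
  of type A. With them all families of defining relations, in all relative positions of two matrix
  entries, become one equation.\<close>

definition ra :: "nat \<Rightarrow> nat \<Rightarrow> 'k::field laurent" where "ra i k = (if i = k then qq else 1)"
definition rb :: "nat \<Rightarrow> nat \<Rightarrow> 'k::field laurent" where "rb i k = (if k < i then qq - qq_inv else 0)"

text \<open>The defining relations of quantum matrices in the form \<open>R X\<^sub>1 X\<^sub>2 = X\<^sub>2 X\<^sub>1 R\<close>.\<close>

definition qmat :: "('k::field laurent, 'a) module \<Rightarrow> nat \<Rightarrow> (nat \<Rightarrow> nat \<Rightarrow> 'a) \<Rightarrow> bool" where
  "qmat B n x \<longleftrightarrow> (\<forall>i\<in>{1..n}. \<forall>j\<in>{1..n}. x i j \<in> carrier B) \<and>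
    (\<forall>i\<in>{1..n}. \<forall>k\<in>{1..n}. \<forall>j\<in>{1..n}. \<forall>l\<in>{1..n}.
      ra i k \<odot>\<^bsub>B\<^esub> (x i j \<otimes>\<^bsub>B\<^esub> x k l) \<oplus>\<^bsub>B\<^esub> rb i k \<odot>\<^bsub>B\<^esub> (x k j \<otimes>\<^bsub>B\<^esub> x i l)
      = ra j l \<odot>\<^bsub>B\<^esub> (x k l \<otimes>\<^bsub>B\<^esub> x i j) \<oplus>\<^bsub>B\<^esub> rb l j \<odot>\<^bsub>B\<^esub> (x k j \<otimes>\<^bsub>B\<^esub> x i l))"

lemma qmatD:
  assumes "qmat B n x" "i \<in> {1..n}" "j \<in> {1..n}"
  shows "x i j \<in> carrier B" and "k \<in> {1..n} \<Longrightarrow> l \<in> {1..n} \<Longrightarrow>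
     ra i k \<odot>\<^bsub>B\<^esub> (x i j \<otimes>\<^bsub>B\<^esub> x k l) \<oplus>\<^bsub>B\<^esub> rb i k \<odot>\<^bsub>B\<^esub> (x k j \<otimes>\<^bsub>B\<^esub> x i l)
      = ra j l \<odot>\<^bsub>B\<^esub> (x k l \<otimes>\<^bsub>B\<^esub> x i j) \<oplus>\<^bsub>B\<^esub> rb l j \<odot>\<^bsub>B\<^esub> (x k j \<otimes>\<^bsub>B\<^esub> x i l)"
  using assms unfolding qmat_def by blast+

lemma qmat_hom:
  assumes "qmat B n x" "ralg B" "ahom B C g" shows "qmat C n (\<lambda>i j. g (x i j))"
proof -
  interpret B: ralg B by fact
  note g = ahomD[OF assms(3)] note q = qmatD[OF assms(1)]
  show ?thesis unfolding qmat_def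
  proof (intro conjI ballI)
    fix i k j l assume *: "i \<in> {1..n}" "k \<in> {1..n}" "j \<in> {1..n}" "l \<in> {1..n}"
    then have c: "x i j \<in> carrier B" "x k l \<in> carrier B" "x k j \<in> carrier B" "x i l \<in> carrier B" using q(1) by auto
    show "ra i k \<odot>\<^bsub>C\<^esub> (g (x i j) \<otimes>\<^bsub>C\<^esub> g (x k l)) \<oplus>\<^bsub>C\<^esub> rb i k \<odot>\<^bsub>C\<^esub> (g (x k j) \<otimes>\<^bsub>C\<^esub> g (x i l))
      = ra j l \<odot>\<^bsub>C\<^esub> (g (x k l) \<otimes>\<^bsub>C\<^esub> g (x i j)) \<oplus>\<^bsub>C\<^esub> rb l j \<odot>\<^bsub>C\<^esub> (g (x k j) \<otimes>\<^bsub>C\<^esub> g (x i l))"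
      using arg_cong[OF q(2)[OF *(1,3,2,4)], of g] c
      by (simp only: g B.smult_closed B.m_closed B.add.m_closed)
  qed (use q(1) g(3) in auto)
qed

lemma qq_qq_inv: "qq * qq_inv = (1 :: 'k::field laurent)" "qq_inv * qq = (1 :: 'k::field laurent)"
  by (simp_all add: qq_def qq_inv_def mult_single)

text \<open>For i < k and j < l one has x_ij x_kl = x_kl x_ij + (q - 1/q) x_kj x_il and x_il x_kj =
  x_kj x_il; with p = -q the exchange law reduces to -q (q - 1/q) + q^2 = 1. Restricting to the
  first \<open>m\<close> columns makes smaller minors available.\<close>

lemma qmat_row_alternating:
  fixes B :: "('k::field laurent, 'a) module"
  assumes "qmat B n x" "ralg B" "m \<le> n"
  shows "row_alternating B x (- qq) {1..n} m"
proof -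
  interpret B: ralg B by fact
  note q = qmatD[OF assms(1)]
  show ?thesis
  proof
    fix i j assume "i \<in> {1..n}" "j \<in> {1..m}"
    then show "x i j \<in> carrier B" using q(1) assms(3) by auto
  next
    fix i k j l assume *: "i \<in> {1..n}" "k \<in> {1..n}" "i < k" "j \<in> {1..m}" "l \<in> {1..m}" "j < l"
    then have **: "j \<in> {1..n}" "l \<in> {1..n}" using assms(3) by auto
    have c: "x i j \<in> carrier B" "x k l \<in> carrier B" "x k j \<in> carrier B" "x i l \<in> carrier B" using * ** q(1) by auto
    have e1: "x i j \<otimes>\<^bsub>B\<^esub> x k l = x k l \<otimes>\<^bsub>B\<^esub> x i j \<oplus>\<^bsub>B\<^esub> (qq - qq_inv) \<odot>\<^bsub>B\<^esub> (x k j \<otimes>\<^bsub>B\<^esub> x i l)"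
      using q(2)[of i j k l] * ** c by (simp add: ra_def rb_def)
    have e2: "x i l \<otimes>\<^bsub>B\<^esub> x k j = x k j \<otimes>\<^bsub>B\<^esub> x i l"
      using q(2)[of i l k j] * ** c by (simp add: ra_def rb_def)
    let ?u = "x k l \<otimes>\<^bsub>B\<^esub> x i j" and ?v = "x k j \<otimes>\<^bsub>B\<^esub> x i l"
    have uv: "?u \<in> carrier B" "?v \<in> carrier B" using c by auto
    have "(- qq) \<odot>\<^bsub>B\<^esub> ((?u \<oplus>\<^bsub>B\<^esub> (qq - qq_inv) \<odot>\<^bsub>B\<^esub> ?v) \<oplus>\<^bsub>B\<^esub> (- qq) \<odot>\<^bsub>B\<^esub> ?v)
      = (- qq) \<odot>\<^bsub>B\<^esub> ?u \<oplus>\<^bsub>B\<^esub> ((- qq) * (qq - qq_inv) + (- qq) * (- qq)) \<odot>\<^bsub>B\<^esub> ?v"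
      using uv by (simp only: B.smult_r_distr B.smult_l_distr B.smult_assoc B.smult_closed B.add.m_closed B.a_assoc)
    also have "(- qq) * (qq - qq_inv) + (- qq) * (- qq) = (1 :: 'k laurent)"
      using qq_qq_inv(1)[where 'k = 'k] by (simp add: algebra_simps)
    finally show "?v \<oplus>\<^bsub>B\<^esub> (- qq) \<odot>\<^bsub>B\<^esub> ?u = (- qq) \<odot>\<^bsub>B\<^esub> (x i j \<otimes>\<^bsub>B\<^esub> x k l \<oplus>\<^bsub>B\<^esub> (- qq) \<odot>\<^bsub>B\<^esub> (x i l \<otimes>\<^bsub>B\<^esub> x k j))"
      using uv unfolding e1 e2 by (simp add: B.a_comm)
  next
    fix i j l assume *: "i \<in> {1..n}" "j \<in> {1..m}" "l \<in> {1..m}" "j < l"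
    then have **: "j \<in> {1..n}" "l \<in> {1..n}" using assms(3) by auto
    have c: "x i j \<in> carrier B" "x i l \<in> carrier B" using * ** q(1) by auto
    have "qq \<odot>\<^bsub>B\<^esub> (x i l \<otimes>\<^bsub>B\<^esub> x i j) = x i j \<otimes>\<^bsub>B\<^esub> x i l"
      using q(2)[of i l i j] * ** c by (simp add: ra_def rb_def)
    then show "x i j \<otimes>\<^bsub>B\<^esub> x i l \<oplus>\<^bsub>B\<^esub> (- qq) \<odot>\<^bsub>B\<^esub> (x i l \<otimes>\<^bsub>B\<^esub> x i j) = \<zero>\<^bsub>B\<^esub>"
      using c by (simp add: B.smult_minus_l B.r_neg)
  qed
qed

text \<open>In matrix form R X1 X2 = X2 X1 R is used once in each tensor factor: R moves past the
  left factors of the product matrix and then past the right ones.\<close>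

lemma qmat_tensor:
  assumes "qmat B n x" "ralg B"
  shows "qmat (tensor_alg B B) n (\<lambda>i j. \<Oplus>\<^bsub>tensor_alg B B\<^esub>k\<in>{1..n}. pure_tensor B B (x i k) (x k j))"
proof -
  interpret BB: tensor B B using assms(2) by (intro tensor.intro)
  note q = qmatD[OF assms(1)]
  let ?N = "{1..n}"
  define y where "y i j = (\<Oplus>\<^bsub>BB.T\<^esub>k\<in>?N. BB.pt (x i k) (x k j))" for i j
  define P where "P i k a b = x i a \<otimes>\<^bsub>B\<^esub> x k b" for i k a b
  have P: "P i k a b \<in> carrier B" if "i \<in> ?N" "k \<in> ?N" "a \<in> ?N" "b \<in> ?N" for i k a b
    using that q(1) by (auto simp: P_def)
  have y: "y i j \<in> carrier BB.T" if "i \<in> ?N" "j \<in> ?N" for i j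
    unfolding y_def using that q(1) by (intro BB.T.finsum_closed) auto
  have yy: "y i j \<otimes>\<^bsub>BB.T\<^esub> y k l = BB.T.dsum ?N (\<lambda>a b. BB.pt (P i k a b) (P a b j l))"
    if "i \<in> ?N" "j \<in> ?N" "k \<in> ?N" "l \<in> ?N" for i j k l
  proof -
    have "y i j \<otimes>\<^bsub>BB.T\<^esub> y k l = BB.T.dsum ?N (\<lambda>a b. BB.pt (x i a) (x a j) \<otimes>\<^bsub>BB.T\<^esub> BB.pt (x k b) (x b l))"
      unfolding y_def BB.T.dsum_def using that q(1) by (intro BB.T.finsum_mult) auto
    also have "\<dots> = BB.T.dsum ?N (\<lambda>a b. BB.pt (P i k a b) (P a b j l))"
      using that q(1) P by (intro BB.T.dsum_cong) (auto simp: P_def BB.pt_mult)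
    finally show ?thesis .
  qed
  have E: "ra i k \<odot>\<^bsub>B\<^esub> P i k j l \<oplus>\<^bsub>B\<^esub> rb i k \<odot>\<^bsub>B\<^esub> P k i j l = ra j l \<odot>\<^bsub>B\<^esub> P k i l j \<oplus>\<^bsub>B\<^esub> rb l j \<odot>\<^bsub>B\<^esub> P k i j l"
    if "i \<in> ?N" "k \<in> ?N" "j \<in> ?N" "l \<in> ?N" for i k j l
    unfolding P_def using that q(2) by blast
  show ?thesis unfolding qmat_def y_def[symmetric]
  proof (intro conjI ballI)
    fix i k j l assume *: "i \<in> ?N" "k \<in> ?N" "j \<in> ?N" "l \<in> ?N"
    have "ra i k \<odot>\<^bsub>BB.T\<^esub> (y i j \<otimes>\<^bsub>BB.T\<^esub> y k l) \<oplus>\<^bsub>BB.T\<^esub> rb i k \<odot>\<^bsub>BB.T\<^esub> (y k j \<otimes>\<^bsub>BB.T\<^esub> y i l)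
      = BB.T.dsum ?N (\<lambda>a b. ra i k \<odot>\<^bsub>BB.T\<^esub> BB.pt (P i k a b) (P a b j l) \<oplus>\<^bsub>BB.T\<^esub> rb i k \<odot>\<^bsub>BB.T\<^esub> BB.pt (P k i a b) (P a b j l))"
      unfolding yy[OF *(1,3,2,4)] yy[OF *(2,3,1,4)] by (rule BB.T.dsum_lin[symmetric]) (use * P in auto)
    also have "\<dots> = BB.T.dsum ?N (\<lambda>a b. ra a b \<odot>\<^bsub>BB.T\<^esub> BB.pt (P k i b a) (P a b j l) \<oplus>\<^bsub>BB.T\<^esub> rb b a \<odot>\<^bsub>BB.T\<^esub> BB.pt (P k i a b) (P a b j l))"
    proof (rule BB.T.dsum_cong)
      fix a b assume ab: "a \<in> ?N" "b \<in> ?N"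
      show "ra a b \<odot>\<^bsub>BB.T\<^esub> BB.pt (P k i b a) (P a b j l) \<oplus>\<^bsub>BB.T\<^esub> rb b a \<odot>\<^bsub>BB.T\<^esub> BB.pt (P k i a b) (P a b j l) \<in> carrier BB.T"
        using * ab P by auto
      have "BB.pt (ra i k \<odot>\<^bsub>B\<^esub> P i k a b \<oplus>\<^bsub>B\<^esub> rb i k \<odot>\<^bsub>B\<^esub> P k i a b) (P a b j l)
        = BB.pt (ra a b \<odot>\<^bsub>B\<^esub> P k i b a \<oplus>\<^bsub>B\<^esub> rb b a \<odot>\<^bsub>B\<^esub> P k i a b) (P a b j l)"
        using E[of i k a b] * ab by simp
      then show "ra i k \<odot>\<^bsub>BB.T\<^esub> BB.pt (P i k a b) (P a b j l) \<oplus>\<^bsub>BB.T\<^esub> rb i k \<odot>\<^bsub>BB.T\<^esub> BB.pt (P k i a b) (P a b j l)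
        = ra a b \<odot>\<^bsub>BB.T\<^esub> BB.pt (P k i b a) (P a b j l) \<oplus>\<^bsub>BB.T\<^esub> rb b a \<odot>\<^bsub>BB.T\<^esub> BB.pt (P k i a b) (P a b j l)"
        using * ab P by (simp add: BB.pt_add_l BB.pt_smult_l)
    qed
    also have "\<dots> = BB.T.dsum ?N (\<lambda>a b. ra a b \<odot>\<^bsub>BB.T\<^esub> BB.pt (P k i b a) (P a b j l))
        \<oplus>\<^bsub>BB.T\<^esub> BB.T.dsum ?N (\<lambda>a b. rb b a \<odot>\<^bsub>BB.T\<^esub> BB.pt (P k i a b) (P a b j l))"
      using * P by (intro BB.T.dsum_add) auto
    \<comment> \<open>Renaming the summation indices in the off-diagonal part only gives both sums
      the common left factor \<open>P k i b a\<close>; the relation then applies to the right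
      factors.\<close>
    also have "BB.T.dsum ?N (\<lambda>a b. rb b a \<odot>\<^bsub>BB.T\<^esub> BB.pt (P k i a b) (P a b j l))
      = BB.T.dsum ?N (\<lambda>a b. rb a b \<odot>\<^bsub>BB.T\<^esub> BB.pt (P k i b a) (P b a j l))"
      using * P by (intro BB.T.dsum_swap) auto
    also have "BB.T.dsum ?N (\<lambda>a b. ra a b \<odot>\<^bsub>BB.T\<^esub> BB.pt (P k i b a) (P a b j l)) \<oplus>\<^bsub>BB.T\<^esub> \<dots>
      = BB.T.dsum ?N (\<lambda>a b. ra a b \<odot>\<^bsub>BB.T\<^esub> BB.pt (P k i b a) (P a b j l) \<oplus>\<^bsub>BB.T\<^esub> rb a b \<odot>\<^bsub>BB.T\<^esub> BB.pt (P k i b a) (P b a j l))"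
      using * P by (intro BB.T.dsum_add[symmetric]) auto
    also have "\<dots> = BB.T.dsum ?N (\<lambda>a b. ra j l \<odot>\<^bsub>BB.T\<^esub> BB.pt (P k i b a) (P b a l j) \<oplus>\<^bsub>BB.T\<^esub> rb l j \<odot>\<^bsub>BB.T\<^esub> BB.pt (P k i b a) (P b a j l))"
    proof (rule BB.T.dsum_cong)
      fix a b assume ab: "a \<in> ?N" "b \<in> ?N"
      show "ra j l \<odot>\<^bsub>BB.T\<^esub> BB.pt (P k i b a) (P b a l j) \<oplus>\<^bsub>BB.T\<^esub> rb l j \<odot>\<^bsub>BB.T\<^esub> BB.pt (P k i b a) (P b a j l) \<in> carrier BB.T"
        using * ab P by auto
      have "BB.pt (P k i b a) (ra a b \<odot>\<^bsub>B\<^esub> P a b j l \<oplus>\<^bsub>B\<^esub> rb a b \<odot>\<^bsub>B\<^esub> P b a j l)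
        = BB.pt (P k i b a) (ra j l \<odot>\<^bsub>B\<^esub> P b a l j \<oplus>\<^bsub>B\<^esub> rb l j \<odot>\<^bsub>B\<^esub> P b a j l)"
        using E[of a b j l] * ab by simp
      then show "ra a b \<odot>\<^bsub>BB.T\<^esub> BB.pt (P k i b a) (P a b j l) \<oplus>\<^bsub>BB.T\<^esub> rb a b \<odot>\<^bsub>BB.T\<^esub> BB.pt (P k i b a) (P b a j l)
        = ra j l \<odot>\<^bsub>BB.T\<^esub> BB.pt (P k i b a) (P b a l j) \<oplus>\<^bsub>BB.T\<^esub> rb l j \<odot>\<^bsub>BB.T\<^esub> BB.pt (P k i b a) (P b a j l)"
        using * ab P by (simp add: BB.pt_add_r BB.pt_smult_r)
    qed
    also have "\<dots> = BB.T.dsum ?N (\<lambda>a b. ra j l \<odot>\<^bsub>BB.T\<^esub> BB.pt (P k i a b) (P a b l j) \<oplus>\<^bsub>BB.T\<^esub> rb l j \<odot>\<^bsub>BB.T\<^esub> BB.pt (P k i a b) (P a b j l))"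
      using * P by (intro BB.T.dsum_swap) auto
    also have "\<dots> = ra j l \<odot>\<^bsub>BB.T\<^esub> (y k l \<otimes>\<^bsub>BB.T\<^esub> y i j) \<oplus>\<^bsub>BB.T\<^esub> rb l j \<odot>\<^bsub>BB.T\<^esub> (y k j \<otimes>\<^bsub>BB.T\<^esub> y i l)"
      unfolding yy[OF *(2,4,1,3)] yy[OF *(2,3,1,4)] by (rule BB.T.dsum_lin) (use * P in auto)
    finally show "ra i k \<odot>\<^bsub>BB.T\<^esub> (y i j \<otimes>\<^bsub>BB.T\<^esub> y k l) \<oplus>\<^bsub>BB.T\<^esub> rb i k \<odot>\<^bsub>BB.T\<^esub> (y k j \<otimes>\<^bsub>BB.T\<^esub> y i l)
      = ra j l \<odot>\<^bsub>BB.T\<^esub> (y k l \<otimes>\<^bsub>BB.T\<^esub> y i j) \<oplus>\<^bsub>BB.T\<^esub> rb l j \<odot>\<^bsub>BB.T\<^esub> (y k j \<otimes>\<^bsub>BB.T\<^esub> y i l)" .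
  qed (use y in auto)
qed

text \<open>All index words and not only permutations: the intermediate indices of a product of two
  matrices run independently in every row.\<close>

definition NL :: "nat \<Rightarrow> nat \<Rightarrow> nat list set" where
  "NL n m = {ks. set ks \<subseteq> {1..n} \<and> length ks = m}"

lemma finite_NL: "finite (NL n m)"
  by (simp add: NL_def finite_lists_length_eq)

lemma (in ralg) finsum_NL_Suc:
  assumes "F \<in> NL n (Suc m) \<rightarrow> carrier A"
  shows "(\<Oplus>k\<in>{1..n}. \<Oplus>ks\<in>NL n m. F (k # ks)) = (\<Oplus>ks\<in>NL n (Suc m). F ks)"
proof -
  have e: "NL n (Suc m) = (\<Union>k\<in>{1..n}. (#) k ` NL n m)"
    by (auto simp: NL_def length_Suc_conv image_iff)
  have c: "F (k # ks) \<in> carrier A" if "k \<in> {1..n}" "ks \<in> NL n m" for k ks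
    using assms that e by blast
  have "(\<Oplus>ks\<in>NL n (Suc m). F ks) = (\<Oplus>k\<in>{1..n}. \<Oplus>ks\<in>(#) k ` NL n m. F ks)"
    unfolding e using finite_NL c
    by (intro add.finprod_UN_disjoint) (auto simp: pairwise_def disjnt_def)
  also have "\<dots> = (\<Oplus>k\<in>{1..n}. \<Oplus>ks\<in>NL n m. F (k # ks))"
  proof (rule finsum_cong')
    fix k assume k: "k \<in> {1..n}"
    show "(\<Oplus>ks\<in>(#) k ` NL n m. F ks) = (\<Oplus>ks\<in>NL n m. F (k # ks))"
      by (rule add.finprod_reindex) (use c k in \<open>auto simp: inj_on_def\<close>)
  qed (use c in \<open>auto intro!: finsum_closed\<close>)
  finally show ?thesis by simp
qed

text \<open>Multiplied out, the determinant of the product matrix is the sum over index words ks of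
  the monomial with rows 1, ..., n and columns ks, tensored with \<open>X.qdet ks\<close>. Words
  with a repetition drop out by \<open>X.qdet_sort\<close>; for the others it extracts the power of
  -q that completes the left factor to a determinant.\<close>

theorem qdet_grouplike:
  assumes "qmat B n x" "ralg B"
  defines "y \<equiv> \<lambda>i j. \<Oplus>\<^bsub>tensor_alg B B\<^esub>k\<in>{1..n}. pure_tensor B B (x i k) (x k j)"
  shows "row_alternating.qdet (tensor_alg B B) y (- qq) n [1..<Suc n]
    = pure_tensor B B (row_alternating.qdet B x (- qq) n [1..<Suc n]) (row_alternating.qdet B x (- qq) n [1..<Suc n])"
proof -
  interpret BB: tensor B B using assms(2) by (intro tensor.intro)
  interpret X: row_alternating B x "- qq" "{1..n}" n by (rule qmat_row_alternating[OF assms(1,2)]) simp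
  have "qmat BB.T n y" unfolding y_def by (rule qmat_tensor[OF assms(1,2)])
  then interpret Y: row_alternating BB.T y "- qq" "{1..n}" n by (intro qmat_row_alternating[OF _ BB.ralg_tensor]) simp_all
  let ?I = "[1..<Suc n]"
  have I: "set ?I = {1..n}" by auto
  have xc: "x i j \<in> carrier B" if "i \<in> {1..n}" "j \<in> {1..n}" for i j using that by simp
  have yprod: "Y.xprod is js = (\<Oplus>\<^bsub>BB.T\<^esub>ks\<in>NL n (length is). BB.pt (X.xprod is ks) (X.xprod ks js))"
    if "length is = length js" "set is \<subseteq> {1..n}" "set js \<subseteq> {1..n}" for "is" js
    using that
  proof (induction "is" js rule: list_induct2)
    case Nil
    have "NL n 0 = {[]}" by (auto simp: NL_def)
    then show ?case by (simp add: BB.pt_one)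
  next
    case (Cons i "is" j js)
    have c: "X.xprod is ks \<in> carrier B" "X.xprod ks js \<in> carrier B" if "ks \<in> NL n (length is)" for ks
      using that Cons.prems by (auto simp: NL_def)
    have "Y.xprod (i # is) (j # js) = (\<Oplus>\<^bsub>BB.T\<^esub>k\<in>{1..n}. \<Oplus>\<^bsub>BB.T\<^esub>ks\<in>NL n (length is). BB.pt (x i k) (x k j) \<otimes>\<^bsub>BB.T\<^esub> BB.pt (X.xprod is ks) (X.xprod ks js))"
    proof -
      have ij: "i \<in> {1..n}" "j \<in> {1..n}" "set is \<subseteq> {1..n}" "set js \<subseteq> {1..n}" using Cons.prems by auto
      have "Y.xprod (i # is) (j # js) = y i j \<otimes>\<^bsub>BB.T\<^esub> (\<Oplus>\<^bsub>BB.T\<^esub>ks\<in>NL n (length is). BB.pt (X.xprod is ks) (X.xprod ks js))"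
        using Cons.IH[OF ij(3,4)] by simp
      also have "\<dots> = (\<Oplus>\<^bsub>BB.T\<^esub>k\<in>{1..n}. \<Oplus>\<^bsub>BB.T\<^esub>ks\<in>NL n (length is). BB.pt (x i k) (x k j) \<otimes>\<^bsub>BB.T\<^esub> BB.pt (X.xprod is ks) (X.xprod ks js))"
        unfolding y_def using ij c finite_NL by (intro BB.T.finsum_mult) auto
      finally show ?thesis .
    qed
    also have "\<dots> = (\<Oplus>\<^bsub>BB.T\<^esub>k\<in>{1..n}. \<Oplus>\<^bsub>BB.T\<^esub>ks\<in>NL n (length is). BB.pt (X.xprod (i # is) (k # ks)) (X.xprod (k # ks) (j # js)))"
      using Cons.prems c by (intro BB.T.finsum_cong' BB.T.finsum_closed Pi_I refl) (auto simp: BB.pt_mult)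
    also have "\<dots> = (\<Oplus>\<^bsub>BB.T\<^esub>ks\<in>NL n (Suc (length is)). BB.pt (X.xprod (i # is) ks) (X.xprod ks (j # js)))"
      by (rule BB.T.finsum_NL_Suc) (use Cons.prems in \<open>auto simp: NL_def\<close>)
    finally show ?case by simp
  qed
  have len: "length js = length ?I" "set js \<subseteq> {1..n}" if "js \<in> PL n" for js
    using PL_length[OF that] that by (auto simp: PL_def)
  have pc: "X.xprod ?I ks \<in> carrier B" "X.xprod ks js \<in> carrier B" if "ks \<in> NL n n" "js \<in> PL n" for ks js
    using that len(2)[OF that(2)] I by (auto simp: NL_def simp del: upt_Suc intro!: X.xprod_closed)
  have pc1: "X.xprod ?I ks \<in> carrier B" if "ks \<in> NL n n" for ks
    using that I by (auto simp: NL_def simp del: upt_Suc intro!: X.xprod_closed)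
  have qc: "X.qdet ks \<in> carrier B" if "ks \<in> NL n n" for ks using that by (simp add: NL_def)
  have "Y.qdet ?I = (\<Oplus>\<^bsub>BB.T\<^esub>js\<in>PL n. (- qq) ^ linv js \<odot>\<^bsub>BB.T\<^esub> (\<Oplus>\<^bsub>BB.T\<^esub>ks\<in>NL n n. BB.pt (X.xprod ?I ks) (X.xprod ks js)))"
    unfolding Y.qdet_def
  proof (rule BB.T.finsum_cong')
    fix js assume js: "js \<in> PL n"
    show "(- qq) ^ linv js \<odot>\<^bsub>BB.T\<^esub> Y.xprod ?I js = (- qq) ^ linv js \<odot>\<^bsub>BB.T\<^esub> (\<Oplus>\<^bsub>BB.T\<^esub>ks\<in>NL n n. BB.pt (X.xprod ?I ks) (X.xprod ks js))"
      using yprod[OF len(1)[OF js, symmetric] _ len(2)[OF js]] I by (simp del: upt_Suc)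
  qed (use pc in \<open>auto intro!: BB.T.finsum_closed BB.T.smult_closed\<close>)
  also have "\<dots> = (\<Oplus>\<^bsub>BB.T\<^esub>js\<in>PL n. \<Oplus>\<^bsub>BB.T\<^esub>ks\<in>NL n n. BB.pt (X.xprod ?I ks) ((- qq) ^ linv js \<odot>\<^bsub>B\<^esub> X.xprod ks js))"
  proof (rule BB.T.finsum_cong')
    fix js assume js: "js \<in> PL n"
    have "(- qq) ^ linv js \<odot>\<^bsub>BB.T\<^esub> (\<Oplus>\<^bsub>BB.T\<^esub>ks\<in>NL n n. BB.pt (X.xprod ?I ks) (X.xprod ks js))
      = (\<Oplus>\<^bsub>BB.T\<^esub>ks\<in>NL n n. (- qq) ^ linv js \<odot>\<^bsub>BB.T\<^esub> BB.pt (X.xprod ?I ks) (X.xprod ks js))"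
      by (rule BB.T.smult_finsum) (use pc js in auto)
    also have "\<dots> = (\<Oplus>\<^bsub>BB.T\<^esub>ks\<in>NL n n. BB.pt (X.xprod ?I ks) ((- qq) ^ linv js \<odot>\<^bsub>B\<^esub> X.xprod ks js))"
      by (rule BB.T.finsum_cong') (use pc js in \<open>auto simp: BB.pt_smult_r\<close>)
    finally show "(- qq) ^ linv js \<odot>\<^bsub>BB.T\<^esub> (\<Oplus>\<^bsub>BB.T\<^esub>ks\<in>NL n n. BB.pt (X.xprod ?I ks) (X.xprod ks js))
      = (\<Oplus>\<^bsub>BB.T\<^esub>ks\<in>NL n n. BB.pt (X.xprod ?I ks) ((- qq) ^ linv js \<odot>\<^bsub>B\<^esub> X.xprod ks js))" .
  qed (use pc in \<open>auto intro!: BB.T.finsum_closed\<close>)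
  also have "\<dots> = (\<Oplus>\<^bsub>BB.T\<^esub>ks\<in>NL n n. \<Oplus>\<^bsub>BB.T\<^esub>js\<in>PL n. BB.pt (X.xprod ?I ks) ((- qq) ^ linv js \<odot>\<^bsub>B\<^esub> X.xprod ks js))"
    by (rule BB.T.finsum_swap) (use pc finite_NL finite_PL in auto)
  also have "\<dots> = (\<Oplus>\<^bsub>BB.T\<^esub>ks\<in>NL n n. BB.pt (X.xprod ?I ks) (X.qdet ks))"
  proof (rule BB.T.finsum_cong')
    fix ks assume ks: "ks \<in> NL n n"
    show "(\<Oplus>\<^bsub>BB.T\<^esub>js\<in>PL n. BB.pt (X.xprod ?I ks) ((- qq) ^ linv js \<odot>\<^bsub>B\<^esub> X.xprod ks js)) = BB.pt (X.xprod ?I ks) (X.qdet ks)"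
      unfolding X.qdet_def by (rule BB.pt_finsum_r[symmetric]) (use pc pc1 ks in auto)
  qed (use pc1 qc in auto)
  also have "\<dots> = (\<Oplus>\<^bsub>BB.T\<^esub>ks\<in>PL n. BB.pt (X.xprod ?I ks) ((- qq) ^ linv ks \<odot>\<^bsub>B\<^esub> X.qdet ?I))"
  proof (rule BB.T.add.finprod_mono_neutral_cong_right)
    show "PL n \<subseteq> NL n n" using len by (auto simp: NL_def)
    fix ks assume ks: "ks \<in> NL n n - PL n"
    have "\<not> distinct ks"
    proof
      assume d: "distinct ks"
      then have "card (set ks) = n" using ks distinct_card[OF d] by (simp add: NL_def)
      then have "set ks = {1..n}" using ks by (intro card_subset_eq) (auto simp: NL_def)
      then show False using d ks by (simp add: PL_def)
    qed
    then show "BB.pt (X.xprod ?I ks) (X.qdet ks) = \<zero>\<^bsub>BB.T\<^esub>"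
      using X.qdet_sort[of ks] ks pc1[of ks] by (simp add: NL_def BB.pt_zero_r del: upt_Suc)
  next
    fix ks assume ks: "ks \<in> PL n"
    have "sort ks = ?I" using ks I by (intro sorted_distinct_set_unique) (auto simp: PL_def simp del: upt_Suc)
    then show "BB.pt (X.xprod ?I ks) (X.qdet ks) = BB.pt (X.xprod ?I ks) ((- qq) ^ linv ks \<odot>\<^bsub>B\<^esub> X.qdet ?I)"
      using X.qdet_sort[of ks] ks PL_length[OF ks] by (simp add: PL_def del: upt_Suc)
  qed (use finite_NL pc1 qc in auto)
  also have "\<dots> = (\<Oplus>\<^bsub>BB.T\<^esub>ks\<in>PL n. BB.pt ((- qq) ^ linv ks \<odot>\<^bsub>B\<^esub> X.xprod ?I ks) (X.qdet ?I))"
  proof (rule BB.T.finsum_cong')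
    fix ks assume ks: "ks \<in> PL n"
    have "X.xprod ?I ks \<in> carrier B" "X.qdet ?I \<in> carrier B" using len(2)[OF ks] I by (auto simp del: upt_Suc)
    then show "BB.pt (X.xprod ?I ks) ((- qq) ^ linv ks \<odot>\<^bsub>B\<^esub> X.qdet ?I) = BB.pt ((- qq) ^ linv ks \<odot>\<^bsub>B\<^esub> X.xprod ?I ks) (X.qdet ?I)"
      by (simp only: BB.pt_smult_l BB.pt_smult_r)
  qed (use len(2) I in \<open>auto simp del: upt_Suc\<close>)
  also have "\<dots> = BB.pt (X.qdet ?I) (X.qdet ?I)"
  proof -
    have D: "X.qdet ?I \<in> carrier B" using I by (intro X.qdet_closed) simp
    have "lin B BB.T (\<lambda>a. BB.pt a (X.qdet ?I))" using BB.bilin_pt D by (simp add: bilin_def)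
    from lin_finsum[OF assms(2) BB.ralg_tensor this, of "\<lambda>ks. (- qq) ^ linv ks \<odot>\<^bsub>B\<^esub> X.xprod ?I ks" "PL n", folded X.qdet_def]
    have "(\<lambda>ks. (- qq) ^ linv ks \<odot>\<^bsub>B\<^esub> X.xprod ?I ks) \<in> PL n \<rightarrow> carrier B \<Longrightarrow> ?thesis" by (rule sym)
    then show ?thesis using len(2) I by (auto simp del: upt_Suc)
  qed
  finally show ?thesis .
qed

section \<open>The quantum general linear group\<close>

declare One_nat_def [simp del]

section \<open>The defining relations and their equivalence with \<open>qmat\<close>\<close>

lemma mat_rels_intro:
  fixes n :: nat
  shows "{i, j, k} \<subseteq> {1..n} \<Longrightarrow> j < k \<Longrightarrow> Poly_Mapping.single [X i j, X i k] 1 - Poly_Mapping.single [X i k, X i j] qq \<in> (mat_rels n :: 'k::field word_poly set)"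
    and "{i, j, k} \<subseteq> {1..n} \<Longrightarrow> j < k \<Longrightarrow> Poly_Mapping.single [X j i, X k i] 1 - Poly_Mapping.single [X k i, X j i] qq \<in> (mat_rels n :: 'k::field word_poly set)"
    and "{i, j, k, l} \<subseteq> {1..n} \<Longrightarrow> i < k \<and> j > l \<or> i > k \<and> j < l \<Longrightarrow> Poly_Mapping.single [X i j, X k l] 1 - Poly_Mapping.single [X k l, X i j] 1 \<in> (mat_rels n :: 'k::field word_poly set)"
    and "{i, j, k, l} \<subseteq> {1..n} \<Longrightarrow> i < k \<Longrightarrow> j < l \<Longrightarrow> Poly_Mapping.single [X i j, X k l] 1 - Poly_Mapping.single [X k l, X i j] 1 - Poly_Mapping.single [X k j, X i l] (qq - qq_inv) \<in> (mat_rels n :: 'k::field word_poly set)"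
  subgoal unfolding mat_rels_def Let_def by (rule UnI1, rule UnI1, rule UnI1, rule CollectI, rule exI[of _ i], rule exI[of _ j], rule exI[of _ k]) simp
  subgoal unfolding mat_rels_def Let_def by (rule UnI1, rule UnI1, rule UnI2, rule CollectI, rule exI[of _ i], rule exI[of _ j], rule exI[of _ k]) simp
  subgoal unfolding mat_rels_def Let_def by (rule UnI1, rule UnI2, rule CollectI, rule exI[of _ i], rule exI[of _ j], rule exI[of _ k], rule exI[of _ l]) simp
  subgoal unfolding mat_rels_def Let_def by (rule UnI2, rule CollectI, rule exI[of _ i], rule exI[of _ j], rule exI[of _ k], rule exI[of _ l]) simp
  done

lemma mat_rels_cases:
  assumes "\<rho> \<in> (mat_rels n :: 'k::field word_poly set)"
  obtains (a) i j k where "i \<in> {1..n}" "j \<in> {1..n}" "k \<in> {1..n}" "j < k" "\<rho> = Poly_Mapping.single [X i j, X i k] 1 - Poly_Mapping.single [X i k, X i j] qq"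
  | (b) i j k where "i \<in> {1..n}" "j \<in> {1..n}" "k \<in> {1..n}" "j < k" "\<rho> = Poly_Mapping.single [X j i, X k i] 1 - Poly_Mapping.single [X k i, X j i] qq"
  | (c) i j k l where "i \<in> {1..n}" "j \<in> {1..n}" "k \<in> {1..n}" "l \<in> {1..n}" "i < k \<and> j > l \<or> i > k \<and> j < l" "\<rho> = Poly_Mapping.single [X i j, X k l] 1 - Poly_Mapping.single [X k l, X i j] 1"
  | (d) i j k l where "i \<in> {1..n}" "j \<in> {1..n}" "k \<in> {1..n}" "l \<in> {1..n}" "i < k" "j < l" "\<rho> = Poly_Mapping.single [X i j, X k l] 1 - Poly_Mapping.single [X k l, X i j] 1 - Poly_Mapping.single [X k j, X i l] (qq - qq_inv)"
  using assms unfolding mat_rels_def Let_def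
  apply (elim UnE CollectE exE conjE)
  subgoal by (erule a[rotated 4]) (simp_all only: insert_subset)
  subgoal by (erule b[rotated 4]) (simp_all only: insert_subset)
  subgoal by (erule c[rotated 5]) (simp_all only: insert_subset)
  subgoal by (erule d[rotated 6]) (simp_all only: insert_subset)
  done

lemma mat_rels_free:
  assumes "\<And>i j. i \<in> {1..n} \<Longrightarrow> j \<in> {1..n} \<Longrightarrow> X i j \<in> G"
  shows "mat_rels n \<subseteq> carrier (free_alg G :: ('k::field laurent, _) module)"
proof
  fix \<rho> :: "'k word_poly" assume "\<rho> \<in> mat_rels n"
  then show "\<rho> \<in> carrier (free_alg G)"
    by (cases rule: mat_rels_cases) (auto intro!: minus_free single_free assms)
qed

context
  fixes B :: "('k::field laurent, 'b) module" and f :: "gen \<Rightarrow> 'b" and G and n :: nat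
  assumes B: "ralg B" and f: "f \<in> G \<rightarrow> carrier B" and G: "\<And>i j. i \<in> {1..n} \<Longrightarrow> j \<in> {1..n} \<Longrightarrow> X i j \<in> G"
begin

interpretation B: ralg B by (rule B)

lemma free_hom_pair: "g \<in> G \<Longrightarrow> g' \<in> G \<Longrightarrow> free_hom B f (Poly_Mapping.single [g, g'] c) = c \<odot>\<^bsub>B\<^esub> (f g \<otimes>\<^bsub>B\<^esub> f g')"
  using f by (subst free_hom_single[OF B f]) (auto simp: Pi_iff)

lemma free_hom_minus: "p \<in> carrier (free_alg G) \<Longrightarrow> q \<in> carrier (free_alg G) \<Longrightarrow>
   free_hom B f (p - q) = free_hom B f p \<ominus>\<^bsub>B\<^esub> free_hom B f q"
  using lin_diff[OF ralg_free B ahomD(1)[OF ahom_free_hom[OF B f]]] free_alg_minus by metis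

lemma free_hom_pair_minus: "g \<in> G \<Longrightarrow> g' \<in> G \<Longrightarrow> h \<in> G \<Longrightarrow> h' \<in> G \<Longrightarrow>
  free_hom B f (Poly_Mapping.single [g, g'] c - Poly_Mapping.single [h, h'] d) = c \<odot>\<^bsub>B\<^esub> (f g \<otimes>\<^bsub>B\<^esub> f g') \<ominus>\<^bsub>B\<^esub> d \<odot>\<^bsub>B\<^esub> (f h \<otimes>\<^bsub>B\<^esub> f h')"
  by (subst free_hom_minus) (auto intro!: single_free simp: free_hom_pair)

lemma free_hom_triple_minus: "g \<in> G \<Longrightarrow> g' \<in> G \<Longrightarrow> h \<in> G \<Longrightarrow> h' \<in> G \<Longrightarrow> e \<in> G \<Longrightarrow> e' \<in> G \<Longrightarrow>
  free_hom B f (Poly_Mapping.single [g, g'] 1 - Poly_Mapping.single [h, h'] 1 - Poly_Mapping.single [e, e'] d)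
    = f g \<otimes>\<^bsub>B\<^esub> f g' \<ominus>\<^bsub>B\<^esub> f h \<otimes>\<^bsub>B\<^esub> f h' \<ominus>\<^bsub>B\<^esub> d \<odot>\<^bsub>B\<^esub> (f e \<otimes>\<^bsub>B\<^esub> f e')"
  using f by (subst free_hom_minus) (auto intro!: single_free minus_free simp: free_hom_pair free_hom_pair_minus Pi_iff)

lemma fX: "i \<in> {1..n} \<Longrightarrow> j \<in> {1..n} \<Longrightarrow> f (X i j) \<in> carrier B"
  using f G by auto

text \<open>Nine relative positions of the entries (i, j) and (k, l) have to be reduced to the
  orders in which the relations are stated.\<close>

lemma qmat_of_rels:
  assumes rels: "\<And>\<rho>. \<rho> \<in> mat_rels n \<Longrightarrow> free_hom B f \<rho> = \<zero>\<^bsub>B\<^esub>"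
  shows "qmat B n (\<lambda>i j. f (X i j))"
proof -
  define x where "x i j = f (X i j)" for i j
  have c: "x i j \<in> carrier B" if "i \<in> {1..n}" "j \<in> {1..n}" for i j using fX that by (simp add: x_def)
  have r1: "x i j \<otimes>\<^bsub>B\<^esub> x i k = qq \<odot>\<^bsub>B\<^esub> (x i k \<otimes>\<^bsub>B\<^esub> x i j)" if "i \<in> {1..n}" "j \<in> {1..n}" "k \<in> {1..n}" "j < k" for i j k
    using rels[OF mat_rels_intro(1)[of i j k n]] that c unfolding x_def by (simp add: free_hom_pair_minus G B.minus_self_eq)
  have r2: "x j i \<otimes>\<^bsub>B\<^esub> x k i = qq \<odot>\<^bsub>B\<^esub> (x k i \<otimes>\<^bsub>B\<^esub> x j i)" if "i \<in> {1..n}" "j \<in> {1..n}" "k \<in> {1..n}" "j < k" for i j k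
    using rels[OF mat_rels_intro(2)[of i j k n]] that c unfolding x_def by (simp add: free_hom_pair_minus G B.minus_self_eq)
  have r3: "x i j \<otimes>\<^bsub>B\<^esub> x k l = x k l \<otimes>\<^bsub>B\<^esub> x i j"
    if "i \<in> {1..n}" "j \<in> {1..n}" "k \<in> {1..n}" "l \<in> {1..n}" "i < k \<and> j > l \<or> i > k \<and> j < l" for i j k l
    using rels[OF mat_rels_intro(3)[of i j k l n]] that c unfolding x_def by (simp add: free_hom_pair_minus G B.minus_self_eq)
  have r4: "x i j \<otimes>\<^bsub>B\<^esub> x k l = x k l \<otimes>\<^bsub>B\<^esub> x i j \<oplus>\<^bsub>B\<^esub> (qq - qq_inv) \<odot>\<^bsub>B\<^esub> (x k j \<otimes>\<^bsub>B\<^esub> x i l)"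
    if "i \<in> {1..n}" "j \<in> {1..n}" "k \<in> {1..n}" "l \<in> {1..n}" "i < k" "j < l" for i j k l
  proof -
    have e: "x i j \<otimes>\<^bsub>B\<^esub> x k l \<ominus>\<^bsub>B\<^esub> x k l \<otimes>\<^bsub>B\<^esub> x i j \<ominus>\<^bsub>B\<^esub> (qq - qq_inv) \<odot>\<^bsub>B\<^esub> (x k j \<otimes>\<^bsub>B\<^esub> x i l) = \<zero>\<^bsub>B\<^esub>"
      using rels[OF mat_rels_intro(4)[of i j k l n]] that unfolding x_def by (simp add: free_hom_triple_minus G)
    have lem: "u = v \<oplus>\<^bsub>B\<^esub> w" if "u \<ominus>\<^bsub>B\<^esub> v \<ominus>\<^bsub>B\<^esub> w = \<zero>\<^bsub>B\<^esub>" "u \<in> carrier B" "v \<in> carrier B" "w \<in> carrier B" for u v w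
    proof -
      have "u = (u \<ominus>\<^bsub>B\<^esub> v \<ominus>\<^bsub>B\<^esub> w) \<oplus>\<^bsub>B\<^esub> (v \<oplus>\<^bsub>B\<^esub> w)" using that(2-4) by algebra
      then show ?thesis using that by simp
    qed
    show ?thesis by (rule lem[OF e]) (use that c in auto)
  qed
  have l1: "(qq - qq_inv) * qq + 1 = (qq * qq :: 'k laurent)"
    using qq_qq_inv(2)[where 'k = 'k] by (simp add: algebra_simps)
  show ?thesis unfolding qmat_def x_def[symmetric]
  proof (intro conjI ballI)
    fix i k j l assume *: "i \<in> {1..n}" "k \<in> {1..n}" "j \<in> {1..n}" "l \<in> {1..n}"
    let ?E = "ra i k \<odot>\<^bsub>B\<^esub> (x i j \<otimes>\<^bsub>B\<^esub> x k l) \<oplus>\<^bsub>B\<^esub> rb i k \<odot>\<^bsub>B\<^esub> (x k j \<otimes>\<^bsub>B\<^esub> x i l)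
      = ra j l \<odot>\<^bsub>B\<^esub> (x k l \<otimes>\<^bsub>B\<^esub> x i j) \<oplus>\<^bsub>B\<^esub> rb l j \<odot>\<^bsub>B\<^esub> (x k j \<otimes>\<^bsub>B\<^esub> x i l)"
    have cc: "x i j \<in> carrier B" "x k l \<in> carrier B" "x k j \<in> carrier B" "x i l \<in> carrier B" using c * by auto
    have cc2: "x k l \<otimes>\<^bsub>B\<^esub> x i j \<in> carrier B" "x i j \<otimes>\<^bsub>B\<^esub> x k l \<in> carrier B" "x k j \<otimes>\<^bsub>B\<^esub> x i l \<in> carrier B" using cc by auto
    \<comment> \<open>The identity q^2 = 1 + (q - 1/q) q. It is needed when the two entries share a
      row or a column and stand in the order in which the off-diagonal term survives.\<close>
    have key: "qq \<odot>\<^bsub>B\<^esub> (qq \<odot>\<^bsub>B\<^esub> u) = u \<oplus>\<^bsub>B\<^esub> (qq - qq_inv) \<odot>\<^bsub>B\<^esub> (qq \<odot>\<^bsub>B\<^esub> u)" if "u \<in> carrier B" for u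
    proof -
      have "qq \<odot>\<^bsub>B\<^esub> (qq \<odot>\<^bsub>B\<^esub> u) = ((qq - qq_inv) * qq + 1) \<odot>\<^bsub>B\<^esub> u" unfolding l1 using that by (simp add: B.smult_assoc)
      then show ?thesis using that by (simp add: B.smult_l_distr B.smult_assoc B.a_comm)
    qed
    consider "i < k" "j < l" | "i < k" "j = l" | "i < k" "l < j" | "i = k" "j < l" | "i = k" "j = l" | "i = k" "l < j"
      | "k < i" "j < l" | "k < i" "j = l" | "k < i" "l < j"
      using less_linear[of i k] less_linear[of j l] by blast
    then show ?E
    proof cases
      case 1 then show ?thesis using r4[OF *(1,3,2,4)] cc by (simp add: ra_def rb_def)
    next
      case 2 then show ?thesis using r2[OF *(3,1,2)] cc by (simp add: ra_def rb_def)
    next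
      case 3 then show ?thesis using r3[OF *(1,3,2,4)] cc by (simp add: ra_def rb_def)
    next
      case 4 then show ?thesis using r1[OF *(1,3,4)] cc key[of "x i l \<otimes>\<^bsub>B\<^esub> x i j"] by (simp add: ra_def rb_def)
    next
      case 5 then show ?thesis using cc by (simp add: ra_def rb_def)
    next
      case 6 then show ?thesis using r1[OF *(1,4,3)] cc by (simp add: ra_def rb_def)
    next
      case 7 then show ?thesis using r3[OF *(1,3,2,4)] cc by (simp add: ra_def rb_def)
    next
      case 8 then show ?thesis using r2[OF *(3,2,1)] cc key[of "x i j \<otimes>\<^bsub>B\<^esub> x k j"] by (simp add: ra_def rb_def)
    next
      case 9 then show ?thesis using r4[OF *(2,4,1,3)] r3[OF *(1,4,2,3)] cc by (simp add: ra_def rb_def)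
    qed
  qed (use c in auto)
qed

lemma rels_of_qmat:
  assumes q: "qmat B n (\<lambda>i j. f (X i j))" and "\<rho> \<in> mat_rels n"
  shows "free_hom B f \<rho> = \<zero>\<^bsub>B\<^esub>"
  using assms(2)
proof (cases rule: mat_rels_cases)
  case (a i j k)
  then show ?thesis using qmatD(2)[OF q, of i k i j] fX[of i j] fX[of i k] by (simp add: free_hom_pair_minus G ra_def rb_def B.minus_self_eq)
next
  case (b i j k)
  then show ?thesis using qmatD(2)[OF q, of j i k i] fX[of j i] fX[of k i] by (simp add: free_hom_pair_minus G ra_def rb_def B.minus_self_eq)
next
  case (c i j k l)
  have cc: "f (X i j) \<in> carrier B" "f (X k l) \<in> carrier B" "f (X k j) \<in> carrier B" "f (X i l) \<in> carrier B" using c fX by auto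
  from c(5) show ?thesis
  proof
    assume "i < k \<and> j > l"
    then show ?thesis using c cc qmatD(2)[OF q, of i j k l] by (simp add: free_hom_pair_minus G ra_def rb_def B.minus_self_eq)
  next
    assume "i > k \<and> j < l"
    then show ?thesis using c cc qmatD(2)[OF q, of i j k l] by (simp add: free_hom_pair_minus G ra_def rb_def B.minus_self_eq)
  qed
next
  case (d i j k l)
  have cc: "f (X i j) \<in> carrier B" "f (X k l) \<in> carrier B" "f (X k j) \<in> carrier B" "f (X i l) \<in> carrier B" using d fX by auto
  have e: "f (X i j) \<otimes>\<^bsub>B\<^esub> f (X k l) = f (X k l) \<otimes>\<^bsub>B\<^esub> f (X i j) \<oplus>\<^bsub>B\<^esub> (qq - qq_inv) \<odot>\<^bsub>B\<^esub> (f (X k j) \<otimes>\<^bsub>B\<^esub> f (X i l))"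
    using d cc qmatD(2)[OF q, of i j k l] by (simp add: ra_def rb_def)
  show ?thesis using d cc by (simp add: free_hom_triple_minus G e B.add_minus_left)
qed

lemma free_hom_sum: "(\<And>s. s \<in> S \<Longrightarrow> p s \<in> carrier (free_alg G)) \<Longrightarrow>
  free_hom B f (\<Sum>s\<in>S. p s) = (\<Oplus>\<^bsub>B\<^esub>s\<in>S. free_hom B f (p s))"
proof (induction S rule: infinite_finite_induct)
  case (insert s S)
  note F = ahomD[OF ahom_free_hom[OF B f]]
  have "free_hom B f (p s + sum p S) = free_hom B f (p s) \<oplus>\<^bsub>B\<^esub> free_hom B f (sum p S)"
    using F(4)[of "p s" "sum p S"] insert.prems sum_free[of S p G] by (simp add: free_alg_simps)
  then show ?case using insert F(3) by (simp add: Pi_iff)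
qed (simp_all add: free_hom_def)

lemma qminor_free:
  assumes "finite I" "I \<subseteq> {1..n}"
  shows "qminor I \<in> carrier (free_alg G)"
proof -
  have "card I \<le> n" using card_mono[OF _ assms(2)] by simp
  have w: "map (\<lambda>k. X (sorted_list_of_set I ! (k - 1)) (\<sigma> k)) [1..<Suc (card I)] \<in> lists G" if s: "\<sigma> permutes {1..card I}" for \<sigma>
  proof -
    have "X (sorted_list_of_set I ! (k - 1)) (\<sigma> k) \<in> G" if k: "k \<in> set [1..<Suc (card I)]" for k
    proof (rule G)
      have "sorted_list_of_set I ! (k - 1) \<in> set (sorted_list_of_set I)" using k assms by (intro nth_mem) auto
      then show "sorted_list_of_set I ! (k - 1) \<in> {1..n}" using assms by auto
      have "k \<in> {1..card I}" using k by auto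
      then have "\<sigma> k \<in> {1..card I}" using permutes_in_image[OF s] by blast
      then show "\<sigma> k \<in> {1..n}" using \<open>card I \<le> n\<close> by auto
    qed
    then show ?thesis by (auto simp del: upt_Suc)
  qed
  show ?thesis unfolding qminor_def by (intro sum_free single_free w) auto
qed

text \<open>The permutations in \<open>qminor\<close> become column words in one-line notation;
  zipped with the sorted rows they spell the monomials of \<open>qdet\<close>.\<close>

lemma free_hom_qminor:
  assumes ra: "row_alternating B (\<lambda>i j. f (X i j)) (- qq) {1..n} m" and I: "finite I" "I \<subseteq> {1..n}" "card I = m"
  shows "free_hom B f (qminor I) = row_alternating.qdet B (\<lambda>i j. f (X i j)) (- qq) m (sorted_list_of_set I)"
proof -
  interpret R: row_alternating B "\<lambda>i j. f (X i j)" "- qq" "{1..n}" m by (rule ra)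
  have mn: "m \<le> n" using card_mono[OF _ I(2)] I(3) by simp
  let ?L = "sorted_list_of_set I"
  have L: "set ?L = I" "length ?L = m" using I by auto
  define w where "w \<sigma> = map (\<lambda>k. X (?L ! (k - 1)) (\<sigma> k)) [1..<Suc m]" for \<sigma>
  have we: "word_eval B f (map (\<lambda>(i, j). X i j) (zip is js)) = R.xprod is js" if "length is = length js" for "is" js
    using that by (induction "is" js rule: list_induct2) auto
  have wz: "w \<sigma> = map (\<lambda>(i, j). X i j) (zip ?L (map \<sigma> [1..<Suc m]))" for \<sigma>
    unfolding w_def by (rule nth_equalityI) (use L in \<open>auto simp del: upt_Suc\<close>)
  have wl: "w \<sigma> \<in> lists G" if s: "\<sigma> permutes {1..m}" for \<sigma>
  proof -
    have "map \<sigma> [1..<Suc m] \<in> PL m" using permutes_PL[of m] s by (auto simp: bij_betw_def simp del: upt_Suc)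
    then have sub: "set (map \<sigma> [1..<Suc m]) \<subseteq> {1..m}" by (rule R.PL_sub)
    have "X i j \<in> G" if "(i, j) \<in> set (zip ?L (map \<sigma> [1..<Suc m]))" for i j
    proof (rule G)
      show "i \<in> {1..n}" using set_zip_leftD[OF that] L I by auto
      show "j \<in> {1..n}" using subsetD[OF sub set_zip_rightD[OF that]] mn by simp
    qed
    then show ?thesis unfolding wz by (auto simp del: upt_Suc)
  qed
  have fw: "free_hom B f (Poly_Mapping.single (w \<sigma>) ((- qq) ^ perm_length m \<sigma>)) = (- qq) ^ linv (map \<sigma> [1..<Suc m]) \<odot>\<^bsub>B\<^esub> R.xprod ?L (map \<sigma> [1..<Suc m])"
    if "\<sigma> permutes {1..m}" for \<sigma>
    using L by (subst free_hom_single[OF B f wl[OF that]]) (simp add: wz we perm_length_linv del: upt_Suc)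
  have xc: "R.xprod ?L js \<in> carrier B" if "js \<in> PL m" for js
    using R.PL_sub[OF that] L I by (intro R.xprod_closed) auto
  have "free_hom B f (qminor I) = (\<Oplus>\<^bsub>B\<^esub>\<sigma>\<in>{\<sigma>. \<sigma> permutes {1..m}}. free_hom B f (Poly_Mapping.single (w \<sigma>) ((- qq) ^ perm_length m \<sigma>)))"
    unfolding qminor_def I(3) w_def[symmetric] by (rule free_hom_sum) (rule single_free, rule wl, simp)
  also have "\<dots> = (\<Oplus>\<^bsub>B\<^esub>\<sigma>\<in>{\<sigma>. \<sigma> permutes {1..m}}. (- qq) ^ linv (map \<sigma> [1..<Suc m]) \<odot>\<^bsub>B\<^esub> R.xprod ?L (map \<sigma> [1..<Suc m]))"
    using permutes_PL[of m] xc by (intro B.finsum_cong' refl) (auto simp: fw bij_betw_def simp del: upt_Suc)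
  also have "\<dots> = (\<Oplus>\<^bsub>B\<^esub>js\<in>(\<lambda>\<sigma>. map \<sigma> [1..<Suc m]) ` {\<sigma>. \<sigma> permutes {1..m}}. (- qq) ^ linv js \<odot>\<^bsub>B\<^esub> R.xprod ?L js)"
    using permutes_PL[of m] xc by (intro B.add.finprod_reindex[symmetric]) (auto simp: bij_betw_def simp del: upt_Suc)
  also have "(\<lambda>\<sigma>. map \<sigma> [1..<Suc m]) ` {\<sigma>. \<sigma> permutes {1..m}} = PL m" using permutes_PL[of m] by (simp add: bij_betw_def del: upt_Suc)
  finally show ?thesis unfolding R.qdet_def .
qed

lemma free_hom_inverse_rels:
  assumes "p \<in> carrier (free_alg G)" "g \<in> G" and "free_hom B f p \<otimes>\<^bsub>B\<^esub> f g = \<one>\<^bsub>B\<^esub>" "f g \<otimes>\<^bsub>B\<^esub> free_hom B f p = \<one>\<^bsub>B\<^esub>"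
    and "\<rho> \<in> inverse_rels G p g"
  shows "free_hom B f \<rho> = \<zero>\<^bsub>B\<^esub>"
proof -
  interpret F: ralg "free_alg G :: ('k laurent, _) module" by (rule ralg_free)
  note F = ahomD[OF ahom_free_hom[OF B f]]
  have g: "Poly_Mapping.single [g] 1 \<in> carrier (free_alg G :: ('k laurent, _) module)" using assms by (intro single_free) auto
  have "f g \<in> carrier B" using assms f by auto
  then have "free_hom B f (Poly_Mapping.single [g] 1) = f g" using free_hom_single[OF B f, of "[g]" 1] assms by simp
  then have "free_hom B f (p \<otimes>\<^bsub>free_alg G\<^esub> Poly_Mapping.single [g] 1) = \<one>\<^bsub>B\<^esub>" "free_hom B f (Poly_Mapping.single [g] 1 \<otimes>\<^bsub>free_alg G\<^esub> p) = \<one>\<^bsub>B\<^esub>"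
    using F(6) g assms by auto
  then show ?thesis using assms(5,1) g F(2) unfolding inverse_rels_def by (auto simp: free_hom_minus B.r_neg a_minus_def)
qed

end

lemma inverse_rels_free:
  assumes "p \<in> carrier (free_alg G)" "g \<in> G" shows "inverse_rels G p g \<subseteq> carrier (free_alg G)"
proof -
  interpret F: ralg "free_alg G" by (rule ralg_free)
  have "Poly_Mapping.single [g] 1 \<in> carrier (free_alg G)" using assms by (intro single_free) auto
  then show ?thesis unfolding inverse_rels_def using assms by (auto intro!: minus_free)
qed

lemma GL_gens_X: "i \<in> {1..n} \<Longrightarrow> j \<in> {1..n} \<Longrightarrow> X i j \<in> GL_gens n"
  and GL_gens_Dinv: "Dinv \<in> GL_gens n" and loc_gens_D0inv: "D0inv \<in> loc_gens n"
  and GL_loc_gens: "g \<in> GL_gens n \<Longrightarrow> g \<in> loc_gens n"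
  by (auto simp: GL_gens_def loc_gens_def)

text \<open>The target algebra and the map of the preceding context do not occur in the conclusion;
  the scalars and the zero map serve as witnesses for them.\<close>

lemma qminor_free': "finite I \<Longrightarrow> I \<subseteq> {1..n} \<Longrightarrow> (\<And>i j. i \<in> {1..n} \<Longrightarrow> j \<in> {1..n} \<Longrightarrow> X i j \<in> G) \<Longrightarrow> qminor I \<in> carrier (free_alg G)"
  using qminor_free[OF ralg_scalar, of "\<lambda>_. 0" G n I] by simp

lemma GL_pres: "presentation (GL_gens n) (GL_rels n :: 'k::field word_poly set)"
proof
  show "GL_rels n \<subseteq> carrier (free_alg (GL_gens n) :: ('k laurent, _) module)"
    unfolding GL_rels_def using mat_rels_free[of n "GL_gens n"] inverse_rels_free[OF qminor_free'[of "{1..n}" n "GL_gens n"] GL_gens_Dinv] GL_gens_X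
    by auto
qed

lemma free_mono: "G \<subseteq> H \<Longrightarrow> p \<in> carrier (free_alg G) \<Longrightarrow> p \<in> carrier (free_alg H)"
  unfolding free_alg_simps using lists_mono[of G H] by auto

lemma GL_rels_loc: "GL_rels n \<subseteq> carrier (free_alg (loc_gens n))"
  using presentation.Rel[OF GL_pres[of n]] free_mono[of "GL_gens n" "loc_gens n"] GL_loc_gens by blast

lemma presentation_loc: "r \<le> n \<Longrightarrow> presentation (loc_gens n) (loc_rels n r :: 'k::field word_poly set)"
proof
  assume "r \<le> n"
  then have "qminor {1..r} \<in> carrier (free_alg (loc_gens n) :: ('k laurent, _) module)"
    by (intro qminor_free'[of _ n] GL_loc_gens GL_gens_X) auto
  then show "loc_rels n r \<subseteq> carrier (free_alg (loc_gens n) :: ('k laurent, _) module)"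
    unfolding loc_rels_def using GL_rels_loc[of n] inverse_rels_free[OF _ loc_gens_D0inv] by blast
qed

section \<open>The quantum general linear group and its universal property\<close>

lemma OG_eq: "OG n = pres_alg (GL_gens n) (GL_rels n)" "OG_class n = pres_class (GL_gens n) (GL_rels n)"
  by (simp_all add: OG_def OG_class_def)

lemma ralg_OG: "ralg (OG n)"
  unfolding OG_eq by (rule presentation.ralg_pres[OF GL_pres])

lemma ahom_OG_class: "ahom (free_alg (GL_gens n)) (OG n) (OG_class n)"
  unfolding OG_eq by (rule presentation.ahom_pres_class[OF GL_pres])

text \<open>A homomorphism is determined on words by its values on letters. This evaluates the class
  of a minor under any homomorphism.\<close>

lemma free_hom_unique:
  assumes C: "ralg C" and h: "ahom (free_alg G) C h" and p: "p \<in> carrier (free_alg G)"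
  shows "h p = free_hom C (\<lambda>g. h (Poly_Mapping.single [g] 1)) p"
proof -
  interpret C: ralg C by fact
  note hh = ahomD[OF h]
  let ?f = "\<lambda>g. h (Poly_Mapping.single [g] 1)"
  have f: "?f \<in> G \<rightarrow> carrier C" by (rule Pi_I, rule hh(3), rule single_free) simp
  note 2 = ahomD[OF ahom_free_hom[OF C f]]
  have w: "h (Poly_Mapping.single w 1) = word_eval C ?f w" if "w \<in> lists G" for w
    using that
  proof (induction w)
    case Nil then show ?case using hh(2) by (simp add: free_alg_simps)
  next
    case (Cons a w)
    then show ?case using hh(6)[of "Poly_Mapping.single [a] 1" "Poly_Mapping.single w 1"] by (simp add: single_free)
  qed
  have "Poly_Mapping.keys p \<subseteq> lists G" using p by (simp add: free_alg_simps)
  then show ?thesis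
  proof (induction p rule: pm_induct)
    case zero show ?case using lin_zero[OF ralg_free C hh(1)] by (simp add: free_hom_def free_alg_simps)
  next
    case (add w c p)
    have cs: "Poly_Mapping.single w c \<in> carrier (free_alg G)" "p \<in> carrier (free_alg G)" "Poly_Mapping.single w 1 \<in> carrier (free_alg G)"
      using add by (auto simp: free_alg_simps)
    have "h (Poly_Mapping.single w c) = c \<odot>\<^bsub>C\<^esub> word_eval C ?f w"
      using hh(5)[OF cs(3), of c] w[OF add(1)] by (simp add: free_alg_simps)
    then show ?case using hh(4)[OF cs(1,2)] 2(4)[OF cs(1,2)] add(3) by (simp add: free_alg_simps free_hom_single[OF C f add(1)])
  qed
qed

lemma OG_hom_class:
  assumes "ralg C" "ahom (OG n) C h" "p \<in> carrier (free_alg (GL_gens n))"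
  shows "h (OG_class n p) = free_hom C (\<lambda>g. h (OG_gen n g)) p"
  using free_hom_unique[OF assms(1) ahom_comp[OF ahom_OG_class assms(2)] assms(3)] .

lemma OG_gen_closed: "g \<in> GL_gens n \<Longrightarrow> OG_gen n g \<in> carrier (OG n)"
  by (rule ahomD(3)[OF ahom_OG_class]) (rule single_free, simp)

lemma OG_class_closed: "p \<in> carrier (free_alg (GL_gens n)) \<Longrightarrow> OG_class n p \<in> carrier (OG n)"
  using ahomD(3)[OF ahom_OG_class] .

lemma OG_class_free: "p \<in> carrier (free_alg (GL_gens n)) \<Longrightarrow> free_hom (OG n) (OG_gen n) p = OG_class n p"
  using free_hom_unique[OF ralg_OG ahom_OG_class] by metis

lemma OG_rel: "\<rho> \<in> GL_rels n \<Longrightarrow> free_hom (OG n) (OG_gen n) \<rho> = \<zero>\<^bsub>OG n\<^esub>"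
  using OG_class_free[of \<rho> n] presentation.Rel[OF GL_pres[of n]] presentation.pres_class_Rel[OF GL_pres[of n], of \<rho>] by (auto simp: OG_eq)

lemma qmat_OG: "qmat (OG n :: ('k::field laurent, _) module) n (\<lambda>i j. OG_gen n (X i j))"
proof (rule qmat_of_rels[where G = "GL_gens n", OF ralg_OG])
  show "OG_gen n \<in> GL_gens n \<rightarrow> carrier (OG n)" by (rule Pi_I) (rule OG_gen_closed)
  show "free_hom (OG n) (OG_gen n) \<rho> = \<zero>\<^bsub>OG n\<^esub>" if "\<rho> \<in> mat_rels n" for \<rho> :: "'k word_poly"
    using that by (intro OG_rel) (simp add: GL_rels_def)
qed (rule GL_gens_X)

text \<open>The number of columns is read off from the list of rows, so minors of all sizes on the
  leading columns share one notation.\<close>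

abbreviation qdet_of :: "('k::field laurent, 'b) module \<Rightarrow> (nat \<Rightarrow> nat \<Rightarrow> 'b) \<Rightarrow> nat list \<Rightarrow> 'b" where
  "qdet_of B x is \<equiv> row_alternating.qdet B x (- qq) (length is) is"

lemma sorted_interval: "sorted_list_of_set {1..m} = [1..<Suc m]"
  by (intro sorted_distinct_set_unique) (auto simp del: upt_Suc)

lemma free_hom_qminor':
  fixes B :: "('k::field laurent, 'b) module"
  assumes "ralg B" "f \<in> G \<rightarrow> carrier B" "\<And>i j. i \<in> {1..n} \<Longrightarrow> j \<in> {1..n} \<Longrightarrow> X i j \<in> G" "qmat B n (\<lambda>i j. f (X i j))"
    "I \<subseteq> {1..n}"
  shows "free_hom B f (qminor I) = qdet_of B (\<lambda>i j. f (X i j)) (sorted_list_of_set I)"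
proof -
  have fin: "finite I" using assms(5) finite_subset by auto
  then have "card I \<le> n" using card_mono[OF _ assms(5)] by simp
  then have "row_alternating B (\<lambda>i j. f (X i j)) (- qq) {1..n} (card I)"
    using assms by (intro qmat_row_alternating) auto
  from free_hom_qminor[OF assms(1-3) this fin assms(5) refl] show ?thesis using fin by simp
qed

text \<open>Universal property: a quantum matrix together with an inverse of its determinant defines
  a homomorphism. The coproduct and the counit are instances.\<close>

lemma OG_hom:
  fixes B :: "('k::field laurent, 'b) module"
  assumes B: "ralg B" and f: "f \<in> GL_gens n \<rightarrow> carrier B" and qm: "qmat B n (\<lambda>i j. f (X i j))"
    and inv: "qdet_of B (\<lambda>i j. f (X i j)) [1..<Suc n] \<otimes>\<^bsub>B\<^esub> f Dinv = \<one>\<^bsub>B\<^esub>"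
      "f Dinv \<otimes>\<^bsub>B\<^esub> qdet_of B (\<lambda>i j. f (X i j)) [1..<Suc n] = \<one>\<^bsub>B\<^esub>"
  shows "ahom (OG n) B (pres_hom B f)"
    and "p \<in> carrier (free_alg (GL_gens n)) \<Longrightarrow> pres_hom B f (OG_class n p) = free_hom B f p"
    and "g \<in> GL_gens n \<Longrightarrow> pres_hom B f (OG_gen n g) = f g"
proof -
  have D: "free_hom B f (qminor {1..n}) = qdet_of B (\<lambda>i j. f (X i j)) [1..<Suc n]"
    using free_hom_qminor'[OF B f GL_gens_X qm, of "{1..n}"] by (simp add: sorted_interval del: upt_Suc)
  have q: "qminor {1..n} \<in> carrier (free_alg (GL_gens n) :: ('k laurent, _) module)" by (intro qminor_free' GL_gens_X) auto
  have rel: "free_hom B f \<rho> = \<zero>\<^bsub>B\<^esub>" if "\<rho> \<in> GL_rels n" for \<rho>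
    using that unfolding GL_rels_def
  proof
    assume "\<rho> \<in> mat_rels n" then show ?thesis by (intro rels_of_qmat[OF B f GL_gens_X qm])
  next
    assume "\<rho> \<in> inverse_rels (GL_gens n) (qminor {1..n}) Dinv"
    then show ?thesis
      by (intro free_hom_inverse_rels[OF B f GL_gens_X q GL_gens_Dinv inv[folded D]])
  qed
  show "ahom (OG n) B (pres_hom B f)" unfolding OG_eq by (rule presentation.ahom_pres_hom[OF GL_pres B f rel])
  show "p \<in> carrier (free_alg (GL_gens n)) \<Longrightarrow> pres_hom B f (OG_class n p) = free_hom B f p"
    unfolding OG_eq by (rule presentation.pres_hom_class[OF GL_pres B f rel])
  show "g \<in> GL_gens n \<Longrightarrow> pres_hom B f (OG_gen n g) = f g"
    unfolding OG_eq by (rule presentation.pres_hom_gen[OF GL_pres B f rel])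
qed

lemma OG_D_inverse:
  fixes n :: nat
  defines "D \<equiv> qdet_of (OG n :: ('k::field laurent, _) module) (\<lambda>i j. OG_gen n (X i j)) [1..<Suc n]"
  shows "D \<in> carrier (OG n)" "D \<otimes>\<^bsub>OG n\<^esub> OG_gen n Dinv = \<one>\<^bsub>OG n\<^esub>" "OG_gen n Dinv \<otimes>\<^bsub>OG n\<^esub> D = \<one>\<^bsub>OG n\<^esub>"
    "OG_class n (qminor {1..n}) = D"
proof -
  interpret OG: ralg "OG n :: ('k laurent, _) module" by (rule ralg_OG)
  interpret F: ralg "free_alg (GL_gens n) :: ('k laurent, _) module" by (rule ralg_free)
  note c = ahomD[OF ahom_OG_class[of n]]
  have q: "qminor {1..n} \<in> carrier (free_alg (GL_gens n) :: ('k laurent, _) module)" by (intro qminor_free' GL_gens_X) auto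
  have g: "Poly_Mapping.single [Dinv] 1 \<in> carrier (free_alg (GL_gens n) :: ('k laurent, _) module)" by (intro single_free) (auto simp: GL_gens_Dinv)
  have gen: "OG_gen n \<in> GL_gens n \<rightarrow> carrier (OG n :: ('k laurent, _) module)" using OG_gen_closed by auto
  have "free_hom (OG n) (OG_gen n) (qminor {1..n}) = D"
    unfolding D_def using free_hom_qminor'[OF ralg_OG gen GL_gens_X qmat_OG, of "{1..n}"] by (simp add: sorted_interval del: upt_Suc)
  then show D: "OG_class n (qminor {1..n}) = D" using OG_class_free[OF q] by simp
  then show "D \<in> carrier (OG n)" using OG_class_closed[OF q] by simp
  have z: "OG_class n \<rho> = \<zero>\<^bsub>OG n\<^esub>" if "\<rho> \<in> GL_rels n" for \<rho> :: "'k word_poly" using presentation.pres_class_Rel[OF GL_pres that] by (simp add: OG_eq)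
  have e1: "OG_class n ((qminor {1..n} :: 'k word_poly) \<otimes>\<^bsub>free_alg (GL_gens n)\<^esub> Poly_Mapping.single [Dinv] 1 - \<one>\<^bsub>free_alg (GL_gens n)\<^esub>) = \<zero>\<^bsub>OG n\<^esub>"
    by (rule z, simp add: GL_rels_def inverse_rels_def)
  have e2: "OG_class n (Poly_Mapping.single [Dinv] 1 \<otimes>\<^bsub>free_alg (GL_gens n)\<^esub> (qminor {1..n} :: 'k word_poly) - \<one>\<^bsub>free_alg (GL_gens n)\<^esub>) = \<zero>\<^bsub>OG n\<^esub>"
    by (rule z, simp add: GL_rels_def inverse_rels_def)
  have d: "OG_class n (a - b) = OG_class n a \<ominus>\<^bsub>OG n\<^esub> OG_class n b"
    if "a \<in> carrier (free_alg (GL_gens n))" "b \<in> carrier (free_alg (GL_gens n))" for a b :: "'k word_poly"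
    using lin_diff[OF ralg_free ralg_OG c(1) that] free_alg_minus[OF that] by simp
  have 1: "OG_class n (qminor {1..n} \<otimes>\<^bsub>free_alg (GL_gens n)\<^esub> Poly_Mapping.single [Dinv] (1 :: 'k laurent)) \<ominus>\<^bsub>OG n\<^esub> OG_class n \<one>\<^bsub>free_alg (GL_gens n)\<^esub> = \<zero>\<^bsub>OG n\<^esub>"
    using e1 d[OF F.m_closed[OF q g] F.one_closed] by simp
  have 2: "OG_class n (Poly_Mapping.single [Dinv] (1 :: 'k laurent) \<otimes>\<^bsub>free_alg (GL_gens n)\<^esub> qminor {1..n}) \<ominus>\<^bsub>OG n\<^esub> OG_class n \<one>\<^bsub>free_alg (GL_gens n)\<^esub> = \<zero>\<^bsub>OG n\<^esub>"
    using e2 d[OF F.m_closed[OF g q] F.one_closed] by simp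
  have Dc: "D \<in> carrier (OG n)" "OG_gen n Dinv \<in> carrier (OG n :: ('k laurent, _) module)"
    using D OG_class_closed[OF q] c(3)[OF g] by simp_all
  show "D \<otimes>\<^bsub>OG n\<^esub> OG_gen n Dinv = \<one>\<^bsub>OG n\<^esub>" "OG_gen n Dinv \<otimes>\<^bsub>OG n\<^esub> D = \<one>\<^bsub>OG n\<^esub>"
    using 1 2 Dc unfolding c(6)[OF q g] c(6)[OF g q] c(2) D by (simp_all add: OG.minus_self_eq)
qed

section \<open>Coproduct and counit\<close>

definition Delta_gen :: "nat \<Rightarrow> gen \<Rightarrow> ('k::field laurent, 'k word_poly set, 'k word_poly set) tensor" where
  "Delta_gen n g = (case g of
       X i j \<Rightarrow> \<Oplus>\<^bsub>tensor_alg (OG n) (OG n)\<^esub>k\<in>{1..n}.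
                  pure_tensor (OG n) (OG n) (OG_gen n (X i k)) (OG_gen n (X k j))
     | Dinv \<Rightarrow> pure_tensor (OG n) (OG n) (OG_gen n Dinv) (OG_gen n Dinv)
     | D0inv \<Rightarrow> undefined)"

lemma OG_Delta_eq: "OG_Delta n = pres_hom (tensor_alg (OG n) (OG n)) (Delta_gen n)"
  unfolding OG_Delta_def Delta_gen_def[abs_def] ..

lemma tensor_OG: "tensor (OG n) (OG n)"
  by (intro tensor.intro ralg_OG)

text \<open>The product matrix is a quantum matrix by \<open>qmat_tensor\<close>, and its
  determinant is D_q \<otimes> D_q by \<open>qdet_grouplike\<close>, so the image prescribed for
  \<open>Dinv\<close> is inverse to it.\<close>

lemma ahom_OG_Delta: "ahom (OG n) (tensor_alg (OG n) (OG n)) (OG_Delta n :: 'k::field word_poly set \<Rightarrow> _)"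
  and OG_Delta_gen: "g \<in> GL_gens n \<Longrightarrow> OG_Delta n (OG_gen n g :: 'k::field word_poly set) = Delta_gen n g"
proof -
  interpret T: tensor "OG n :: ('k laurent, _) module" "OG n" by (rule tensor_OG)
  let ?f = "Delta_gen n :: gen \<Rightarrow> ('k laurent, _, _) tensor"
  have f: "?f \<in> GL_gens n \<rightarrow> carrier T.T"
    by (auto simp: Delta_gen_def GL_gens_def intro!: T.T.finsum_closed T.pt_closed OG_gen_closed)
  have q: "qmat T.T n (\<lambda>i j. ?f (X i j))"
    using qmat_tensor[OF qmat_OG ralg_OG] by (simp add: Delta_gen_def)
  let ?D = "qdet_of (OG n :: ('k laurent, _) module) (\<lambda>i j. OG_gen n (X i j)) [1..<Suc n]"
  have D: "qdet_of T.T (\<lambda>i j. ?f (X i j)) [1..<Suc n] = T.pt ?D ?D"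
    using qdet_grouplike[OF qmat_OG ralg_OG, of n] by (simp add: Delta_gen_def del: upt_Suc)
  have inv: "qdet_of T.T (\<lambda>i j. ?f (X i j)) [1..<Suc n] \<otimes>\<^bsub>T.T\<^esub> ?f Dinv = \<one>\<^bsub>T.T\<^esub>"
    "?f Dinv \<otimes>\<^bsub>T.T\<^esub> qdet_of T.T (\<lambda>i j. ?f (X i j)) [1..<Suc n] = \<one>\<^bsub>T.T\<^esub>"
    unfolding D
    by (simp_all only: Delta_gen_def gen.case T.pt_mult[OF OG_D_inverse(1)[of n] OG_D_inverse(1)[of n] OG_gen_closed[OF GL_gens_Dinv] OG_gen_closed[OF GL_gens_Dinv]]
      T.pt_mult[OF OG_gen_closed[OF GL_gens_Dinv] OG_gen_closed[OF GL_gens_Dinv] OG_D_inverse(1)[of n] OG_D_inverse(1)[of n]] OG_D_inverse(2,3) T.pt_one)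
  show "ahom (OG n) T.T (OG_Delta n)" unfolding OG_Delta_eq by (rule OG_hom(1)[OF T.ralg_tensor f q inv])
  show "g \<in> GL_gens n \<Longrightarrow> OG_Delta n (OG_gen n g) = ?f g" unfolding OG_Delta_eq by (rule OG_hom(3)[OF T.ralg_tensor f q inv])
qed

definition counit_gen :: "gen \<Rightarrow> 'k::field laurent" where
  "counit_gen g = (case g of X i j \<Rightarrow> if i = j then 1 else 0 | _ \<Rightarrow> 1)"

lemma counit_eq: "counit = pres_hom scalar_alg counit_gen"
  unfolding counit_def counit_gen_def[abs_def] ..

lemma qmat_counit: "qmat (scalar_alg :: ('k::field laurent, _) module) n (\<lambda>i j. counit_gen (X i j))"
  unfolding qmat_def by (auto simp: counit_gen_def)

text \<open>For the identity matrix a monomial is nonzero only if its column word equals the row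
  list, and that list occurs among the column words exactly when it enumerates an initial
  interval.\<close>

lemma qdet_counit:
  fixes ms :: "nat list"
  assumes "set ms \<subseteq> {1..n}" "length ms \<le> n" "distinct ms"
  shows "qdet_of (scalar_alg :: ('k::field laurent, _) module) (\<lambda>i j. counit_gen (X i j)) ms = (if set ms = {1..length ms} then (- qq) ^ linv ms else 0)"
proof -
  obtain x where x_def: "x = (\<lambda>i j. counit_gen (X i j) :: 'k laurent)" and xd: "\<And>i. x i i = 1" "\<And>i j. i \<noteq> j \<Longrightarrow> x i j = 0"
    by (simp add: counit_gen_def)
  interpret R: row_alternating "scalar_alg :: ('k laurent, _) module" x "- qq" "{1..n}" "length ms"
    unfolding x_def by (rule qmat_row_alternating[OF qmat_counit ralg_scalar assms(2)])
  have xp: "R.xprod is js = (if is = js then 1 else 0)" if "length is = length js" for "is" js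
    using that by (induction "is" js rule: list_induct2) (auto simp: xd)
  have "R.qdet ms = (\<Oplus>\<^bsub>scalar_alg\<^esub>js\<in>PL (length ms). if ms = js then (- qq) ^ linv js else \<zero>\<^bsub>scalar_alg\<^esub>)"
    unfolding R.qdet_def using PL_length xp by (intro R.finsum_cong') auto
  also have "\<dots> = (if set ms = {1..length ms} then (- qq) ^ linv ms else 0)"
  proof (cases "set ms = {1..length ms}")
    case True
    then have "ms \<in> PL (length ms)" using assms by (simp add: PL_def)
    then show ?thesis using True finite_PL by (subst R.add.finprod_singleton) auto
  next
    case False
    then have "ms \<notin> PL (length ms)" by (simp add: PL_def)
    then show ?thesis using False by (subst R.add.finprod_one_eqI) auto
  qed
  finally show ?thesis by (simp add: x_def)
qed

lemma linv_upt: "linv [a..<b] = 0"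
proof (induction "b - a" arbitrary: a)
  case (Suc d)
  then show ?case by (simp add: upt_conv_Cons filter_empty_conv)
qed simp

lemma qdet_counit_one: "m \<le> n \<Longrightarrow> qdet_of (scalar_alg :: ('k::field laurent, _) module) (\<lambda>i j. counit_gen (X i j)) [1..<Suc m] = 1"
  using qdet_counit[of "[1..<Suc m]" n] linv_upt[of 1 "Suc m"] by (simp add: atLeastLessThanSuc_atLeastAtMost del: upt_Suc)

lemma ahom_counit_OG: "ahom (OG n :: ('k::field laurent, _) module) scalar_alg counit"
  and counit_OG_class: "p \<in> carrier (free_alg (GL_gens n)) \<Longrightarrow> counit (OG_class n p :: 'k::field word_poly set) = free_hom scalar_alg counit_gen p"
  and counit_OG_gen: "g \<in> GL_gens n \<Longrightarrow> counit (OG_gen n g :: 'k::field word_poly set) = counit_gen g"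
proof -
  let ?S = "scalar_alg :: ('k laurent, _) module"
  have f: "counit_gen \<in> GL_gens n \<rightarrow> carrier ?S" by simp
  have inv: "qdet_of ?S (\<lambda>i j. counit_gen (X i j)) [1..<Suc n] \<otimes>\<^bsub>?S\<^esub> counit_gen Dinv = \<one>\<^bsub>?S\<^esub>"
    "counit_gen Dinv \<otimes>\<^bsub>?S\<^esub> qdet_of ?S (\<lambda>i j. counit_gen (X i j)) [1..<Suc n] = \<one>\<^bsub>?S\<^esub>"
    by (simp_all only: qdet_counit_one[OF order_refl] scalar_alg_simps) (simp_all add: counit_gen_def)
  note H = OG_hom[OF ralg_scalar f qmat_counit inv]
  show "ahom (OG n) ?S counit" unfolding counit_eq by (rule H(1))
  show "p \<in> carrier (free_alg (GL_gens n)) \<Longrightarrow> counit (OG_class n p :: 'k word_poly set) = free_hom scalar_alg counit_gen p"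
    unfolding counit_eq by (rule H(2))
  show "g \<in> GL_gens n \<Longrightarrow> counit (OG_gen n g :: 'k word_poly set) = counit_gen g"
    unfolding counit_eq by (rule H(3))
qed

section \<open>Linear systems and the big cell coordinates\<close>

lemma q1_nonzero: "(q1 :: 'k::field laurent) \<noteq> 0"
  using q1_mult_degree[of "1 :: 'k laurent"] by simp

lemma subalg_trans: "subalg A Q \<Longrightarrow> subalg (A\<lparr>carrier := Q\<rparr>) S \<Longrightarrow> subalg A S"
  unfolding subalg_def by auto

lemma ahom_restrict: "subalg A Q \<Longrightarrow> ahom A B f \<Longrightarrow> ahom (A\<lparr>carrier := Q\<rparr>) B f"
  unfolding ahom_def lin_def subalg_def by (auto simp: Pi_iff subset_iff)

lemma (in augmented) ahom_base_V: "ahom A V (\<lambda>a. K.pt a 1)"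
  using K.ahom_pt_l V_base unfolding ahom_def lin_def by (auto simp: V_ops)

lemma (in augmented) near_base: assumes "a \<in> carrier A" shows "ralg.near V h (\<epsilon> a) (K.pt a 1)"
  unfolding ralg.near_def[OF ralg_V] V_ops using pt_dq[OF assms] dq_gen[OF assms] by blast

text \<open>By \<open>torsion_divisible\<close> an element killed by a nonzero scalar is divisible
  by every power of q - 1, and a separated algebra contains no such element except 0.\<close>

lemma cralg_torsion_free:
  fixes A :: "('k::field laurent, 'a) module"
  assumes "cralg A q1" "torsion_free q1 A" "c \<noteq> 0" shows "torsion_free c A"
  unfolding torsion_free_def
proof (intro ballI impI)
  interpret cralg A q1 by fact
  fix x assume "x \<in> carrier A" "c \<odot>\<^bsub>A\<^esub> x = \<zero>\<^bsub>A\<^esub>"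
  then show "x = \<zero>\<^bsub>A\<^esub>" using torsion_divisible[OF ralg assms(2) _ assms(3)] sep by blast
qed

lemma (in ralg) add_minus_add_left:
  "a \<in> carrier A \<Longrightarrow> b \<in> carrier A \<Longrightarrow> c \<in> carrier A \<Longrightarrow> (a \<oplus> b) \<ominus> (a \<oplus> c) = b \<ominus> c"
  by (simp add: minus_eq minus_add a_comm[of a b] a_assoc r_neg2)

text \<open>Successive approximation: if \<open>z = c\<^sub>0 + h c\<^sub>1 + \<dots>\<close> and \<open>G c\<^sub>m = F w\<^sub>m\<close>, then \<open>G z = F (w\<^sub>0 + h w\<^sub>1 + \<dots>)\<close>.\<close>

lemma (in completing) image_subset_of_dense:
  assumes S: "cralg S h" and U: "cralg U h" and G: "lin C U G" and F: "lin S U F"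
    and dense: "\<And>a. a \<in> carrier A \<Longrightarrow> G (\<iota> a) \<in> F ` carrier S" and z: "z \<in> carrier C"
  shows "G z \<in> F ` carrier S"
proof -
  interpret S: cralg S h by fact
  interpret U: cralg U h by fact
  from completion_expansion[OF z] obtain c s where c: "\<And>m. c m \<in> carrier A" and s: "\<And>m. s m \<in> carrier C" "s 0 = z"
    and e: "\<And>m::nat. s m = \<iota> (c m) \<oplus>\<^bsub>C\<^esub> h \<odot>\<^bsub>C\<^esub> s (Suc m)" by metis
  have "\<forall>m. \<exists>w\<in>carrier S. F w = G (\<iota> (c m))" using dense[OF c] by (metis imageE)
  then obtain w where w: "\<And>m. w m \<in> carrier S" "\<And>m. F (w m) = G (\<iota> (c m))" by metis
  from S.conv[of w] w obtain t where t: "\<And>m. t m \<in> carrier S" and te: "\<And>m. t m = w m \<oplus>\<^bsub>S\<^esub> h \<odot>\<^bsub>S\<^esub> t (Suc m)" by blast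
  define d where "d m = F (t m) \<ominus>\<^bsub>U\<^esub> G (s m)" for m
  have cl [simp]: "F (t m) \<in> carrier U" "G (s m) \<in> carrier U" "F (w m) \<in> carrier U" for m
    using linD(1)[OF F] linD(1)[OF G] t(1) s(1) w(1) by auto
  have Ft: "F (t m) = F (w m) \<oplus>\<^bsub>U\<^esub> h \<odot>\<^bsub>U\<^esub> F (t (Suc m))" for m
    using te[of m] linD(2,3)[OF F] t w S.smult_closed by metis
  have Gs: "G (s m) = F (w m) \<oplus>\<^bsub>U\<^esub> h \<odot>\<^bsub>U\<^esub> G (s (Suc m))" for m
    using e[of m] linD(2,3)[OF G] c s w C_closed by metis
  have "d m = h \<odot>\<^bsub>U\<^esub> d (Suc m)" for m
  proof -
    have "d m = (F (w m) \<oplus>\<^bsub>U\<^esub> h \<odot>\<^bsub>U\<^esub> F (t (Suc m))) \<ominus>\<^bsub>U\<^esub> (F (w m) \<oplus>\<^bsub>U\<^esub> h \<odot>\<^bsub>U\<^esub> G (s (Suc m)))"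
      unfolding d_def by (subst Ft, subst Gs) (rule refl)
    also have "\<dots> = h \<odot>\<^bsub>U\<^esub> F (t (Suc m)) \<ominus>\<^bsub>U\<^esub> h \<odot>\<^bsub>U\<^esub> G (s (Suc m))"
      by (rule U.add_minus_add_left) auto
    also have "\<dots> = h \<odot>\<^bsub>U\<^esub> d (Suc m)" unfolding d_def by (rule U.smult_diff_r[symmetric]) auto
    finally show ?thesis .
  qed
  moreover have "d \<in> UNIV \<rightarrow> carrier U" by (simp add: d_def)
  ultimately have "d 0 = \<zero>\<^bsub>U\<^esub>" by (intro U.sep_tails)
  then have "F (t 0) = G (s 0)" unfolding d_def using U.minus_self_eq[OF cl(1) cl(2)] by blast
  then show ?thesis using t[of 0] s(2) by (metis imageI)
qed

text \<open>The linear algebra of the main step. It will be applied with T_l the coproducts of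
  (q-1)^{-1} t_il, with \<open>c\<close> and \<open>b\<close> the upper block and one lower row of
  the matrix C, and with \<open>z\<close> the matrix 1 \<otimes> x. Cancelling \<open>z\<close> in
  \<open>U\<close> leaves \<Sum> h T_l F(c_lt) = F(b_t), which is compared with the image of a
  solution found in \<open>S\<close>.\<close>

lemma coordinate_divisible:
  fixes S :: "('r::comm_ring_1, 's) module" and U :: "('r, 'u) module" and K :: "nat set"
  assumes S: "cralg S h" and U: "cralg U h" and F: "ahom S U F" and tf: "torsion_free h U" and K: "finite K"
    and c: "\<And>l t. l \<in> K \<Longrightarrow> t \<in> K \<Longrightarrow> ralg.near S h (if l = t then 1 else 0) (c l t)"
    and b: "\<And>t. t \<in> K \<Longrightarrow> ralg.near S h 0 (b t)"
    and z: "\<And>t m. t \<in> K \<Longrightarrow> m \<in> K \<Longrightarrow> ralg.near U h (if t = m then 1 else 0) (z t m)"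
    and T: "\<And>s. s \<in> K \<Longrightarrow> T s \<in> carrier U"
    and eq: "\<And>m. m \<in> K \<Longrightarrow> (\<Oplus>\<^bsub>U\<^esub>l\<in>K. h \<odot>\<^bsub>U\<^esub> T l \<otimes>\<^bsub>U\<^esub> (\<Oplus>\<^bsub>U\<^esub>t\<in>K. F (c l t) \<otimes>\<^bsub>U\<^esub> z t m))
      = (\<Oplus>\<^bsub>U\<^esub>t\<in>K. F (b t) \<otimes>\<^bsub>U\<^esub> z t m)"
    and s: "s \<in> K"
  shows "T s \<in> F ` carrier S"
proof -
  interpret S: cralg S h by fact
  interpret U: cralg U h by fact
  have cc: "c l t \<in> carrier S" if "l \<in> K" "t \<in> K" for l t using S.near_closed c[OF that] by blast
  have zc: "z l t \<in> carrier U" if "l \<in> K" "t \<in> K" for l t using U.near_closed z[OF that] by blast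
  have bc: "b t \<in> carrier S" if "t \<in> K" for t using S.near_closed b[OF that] by blast
  have Fc: "a \<in> carrier S \<Longrightarrow> F a \<in> carrier U" for a by (rule ahomD(3)[OF F])
  have "\<forall>t\<in>K. \<exists>y\<in>carrier S. b t = h \<odot>\<^bsub>S\<^esub> y" using S.near_zeroD b by blast
  then obtain b' where b': "\<And>t. t \<in> K \<Longrightarrow> b' t \<in> carrier S" "\<And>t. t \<in> K \<Longrightarrow> b t = h \<odot>\<^bsub>S\<^esub> b' t" by metis
  \<comment> \<open>The system is solved in the source \<open>S\<close>, with the right-hand side
    already divided by h.\<close>
  from S.near_solve[OF K, of b' c] b'(1) c obtain y where y: "\<And>k. k \<in> K \<Longrightarrow> y k \<in> carrier S"
    and ye: "\<And>k. k \<in> K \<Longrightarrow> (\<Oplus>\<^bsub>S\<^esub>j\<in>K. y j \<otimes>\<^bsub>S\<^esub> c j k) = b' k" by blast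
  \<comment> \<open>What stands to the left of \<open>z\<close> after the two sums have been
    exchanged.\<close>
  define D where "D t = (\<Oplus>\<^bsub>U\<^esub>l\<in>K. h \<odot>\<^bsub>U\<^esub> T l \<otimes>\<^bsub>U\<^esub> F (c l t))" for t
  have Dc: "D t \<in> carrier U" if "t \<in> K" for t unfolding D_def using that T cc Fc by (intro U.finsum_closed) auto
  have "(\<Oplus>\<^bsub>U\<^esub>t\<in>K. D t \<otimes>\<^bsub>U\<^esub> z t m) = (\<Oplus>\<^bsub>U\<^esub>t\<in>K. F (b t) \<otimes>\<^bsub>U\<^esub> z t m)" if m: "m \<in> K" for m
  proof -
    have "(\<Oplus>\<^bsub>U\<^esub>t\<in>K. D t \<otimes>\<^bsub>U\<^esub> z t m) = (\<Oplus>\<^bsub>U\<^esub>t\<in>K. \<Oplus>\<^bsub>U\<^esub>l\<in>K. h \<odot>\<^bsub>U\<^esub> T l \<otimes>\<^bsub>U\<^esub> F (c l t) \<otimes>\<^bsub>U\<^esub> z t m)"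
      unfolding D_def using T cc Fc zc m K
      by (intro U.finsum_cong' U.finsum_ldistr Pi_I U.finsum_closed U.m_closed refl) auto
    also have "\<dots> = (\<Oplus>\<^bsub>U\<^esub>l\<in>K. \<Oplus>\<^bsub>U\<^esub>t\<in>K. h \<odot>\<^bsub>U\<^esub> T l \<otimes>\<^bsub>U\<^esub> F (c l t) \<otimes>\<^bsub>U\<^esub> z t m)"
      using T cc Fc zc m K by (intro U.finsum_swap) auto
    also have "\<dots> = (\<Oplus>\<^bsub>U\<^esub>l\<in>K. h \<odot>\<^bsub>U\<^esub> T l \<otimes>\<^bsub>U\<^esub> (\<Oplus>\<^bsub>U\<^esub>t\<in>K. F (c l t) \<otimes>\<^bsub>U\<^esub> z t m))"
    proof (intro U.finsum_cong' refl Pi_I)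
      fix l assume l: "l \<in> K"
      show "h \<odot>\<^bsub>U\<^esub> T l \<otimes>\<^bsub>U\<^esub> (\<Oplus>\<^bsub>U\<^esub>t\<in>K. F (c l t) \<otimes>\<^bsub>U\<^esub> z t m) \<in> carrier U"
        using T cc Fc zc m l by (intro U.m_closed U.finsum_closed) auto
      have "h \<odot>\<^bsub>U\<^esub> T l \<otimes>\<^bsub>U\<^esub> (\<Oplus>\<^bsub>U\<^esub>t\<in>K. F (c l t) \<otimes>\<^bsub>U\<^esub> z t m) = (\<Oplus>\<^bsub>U\<^esub>t\<in>K. h \<odot>\<^bsub>U\<^esub> T l \<otimes>\<^bsub>U\<^esub> (F (c l t) \<otimes>\<^bsub>U\<^esub> z t m))"
        using T cc Fc zc m l K by (intro U.finsum_rdistr) auto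
      also have "\<dots> = (\<Oplus>\<^bsub>U\<^esub>t\<in>K. h \<odot>\<^bsub>U\<^esub> T l \<otimes>\<^bsub>U\<^esub> F (c l t) \<otimes>\<^bsub>U\<^esub> z t m)"
        using T cc Fc zc m l by (intro U.finsum_cong' refl Pi_I) (auto simp: U.m_assoc)
      finally show "(\<Oplus>\<^bsub>U\<^esub>t\<in>K. h \<odot>\<^bsub>U\<^esub> T l \<otimes>\<^bsub>U\<^esub> F (c l t) \<otimes>\<^bsub>U\<^esub> z t m) = h \<odot>\<^bsub>U\<^esub> T l \<otimes>\<^bsub>U\<^esub> (\<Oplus>\<^bsub>U\<^esub>t\<in>K. F (c l t) \<otimes>\<^bsub>U\<^esub> z t m)"
        by (rule sym)
    qed
    finally show ?thesis using eq[OF m] by simp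
  qed
  moreover have diff: "(\<Oplus>\<^bsub>U\<^esub>t\<in>K. (f t \<ominus>\<^bsub>U\<^esub> g t) \<otimes>\<^bsub>U\<^esub> w t) = (\<Oplus>\<^bsub>U\<^esub>t\<in>K. f t \<otimes>\<^bsub>U\<^esub> w t) \<ominus>\<^bsub>U\<^esub> (\<Oplus>\<^bsub>U\<^esub>t\<in>K. g t \<otimes>\<^bsub>U\<^esub> w t)"
    if "f \<in> K \<rightarrow> carrier U" "g \<in> K \<rightarrow> carrier U" "w \<in> K \<rightarrow> carrier U" for f g w
  proof -
    have "(\<Oplus>\<^bsub>U\<^esub>t\<in>K. (f t \<ominus>\<^bsub>U\<^esub> g t) \<otimes>\<^bsub>U\<^esub> w t) = (\<Oplus>\<^bsub>U\<^esub>t\<in>K. f t \<otimes>\<^bsub>U\<^esub> w t \<oplus>\<^bsub>U\<^esub> (- 1) \<odot>\<^bsub>U\<^esub> (g t \<otimes>\<^bsub>U\<^esub> w t))"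
      using that by (intro U.finsum_cong' refl Pi_I) (auto simp: U.minus_eq U.l_distr U.l_minus U.smult_minus_one Pi_iff)
    also have "\<dots> = (\<Oplus>\<^bsub>U\<^esub>t\<in>K. f t \<otimes>\<^bsub>U\<^esub> w t) \<oplus>\<^bsub>U\<^esub> (\<Oplus>\<^bsub>U\<^esub>t\<in>K. (- 1) \<odot>\<^bsub>U\<^esub> (g t \<otimes>\<^bsub>U\<^esub> w t))"
      using that by (intro U.finsum_addf) (auto simp: Pi_iff)
    also have "(\<Oplus>\<^bsub>U\<^esub>t\<in>K. (- 1) \<odot>\<^bsub>U\<^esub> (g t \<otimes>\<^bsub>U\<^esub> w t)) = (- 1) \<odot>\<^bsub>U\<^esub> (\<Oplus>\<^bsub>U\<^esub>t\<in>K. g t \<otimes>\<^bsub>U\<^esub> w t)"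
      using that by (intro U.smult_finsum[symmetric]) (auto simp: Pi_iff)
    also have "\<dots> = \<ominus>\<^bsub>U\<^esub> (\<Oplus>\<^bsub>U\<^esub>t\<in>K. g t \<otimes>\<^bsub>U\<^esub> w t)"
      using that by (intro U.smult_minus_one U.finsum_closed) (auto simp: Pi_iff)
    finally show ?thesis by (simp add: U.minus_eq)
  qed
  ultimately have "(\<Oplus>\<^bsub>U\<^esub>t\<in>K. (D t \<ominus>\<^bsub>U\<^esub> F (b t)) \<otimes>\<^bsub>U\<^esub> z t m) = \<zero>\<^bsub>U\<^esub>" if "m \<in> K" for m
    using that Dc Fc bc zc by (subst diff) (auto intro!: U.finsum_closed U.r_right_minus_eq[THEN iffD2])
  then have "D t \<ominus>\<^bsub>U\<^esub> F (b t) = \<zero>\<^bsub>U\<^esub>" if "t \<in> K" for t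
    using that Dc Fc bc z by (intro U.near_cancel[OF K, of "\<lambda>t. D t \<ominus>\<^bsub>U\<^esub> F (b t)" z]) auto
  then have DF: "D t = F (b t)" if "t \<in> K" for t using U.minus_self_eq Dc Fc bc that by blast
  have hy: "F (b t) = (\<Oplus>\<^bsub>U\<^esub>l\<in>K. h \<odot>\<^bsub>U\<^esub> F (y l) \<otimes>\<^bsub>U\<^esub> F (c l t))" if t: "t \<in> K" for t
  proof -
    have "F (b t) = h \<odot>\<^bsub>U\<^esub> F (\<Oplus>\<^bsub>S\<^esub>j\<in>K. y j \<otimes>\<^bsub>S\<^esub> c j t)" using b' ye t by (simp add: ahomD(5)[OF F])
    also have "\<dots> = h \<odot>\<^bsub>U\<^esub> (\<Oplus>\<^bsub>U\<^esub>j\<in>K. F (y j \<otimes>\<^bsub>S\<^esub> c j t))"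
      by (subst lin_finsum[OF S.ralg U.ralg ahomD(1)[OF F]]) (use t y cc in auto)
    also have "\<dots> = (\<Oplus>\<^bsub>U\<^esub>j\<in>K. h \<odot>\<^bsub>U\<^esub> F (y j \<otimes>\<^bsub>S\<^esub> c j t))"
      by (intro U.smult_finsum) (use t y cc Fc in auto)
    also have "\<dots> = (\<Oplus>\<^bsub>U\<^esub>l\<in>K. h \<odot>\<^bsub>U\<^esub> F (y l) \<otimes>\<^bsub>U\<^esub> F (c l t))"
      by (intro U.finsum_cong' refl Pi_I) (use t y cc Fc in \<open>auto simp: ahomD(6)[OF F] U.smult_mult_l\<close>)
    finally show ?thesis .
  qed
  \<comment> \<open>Both h T and h F(y) solve the same system in \<open>U\<close>, so they agree;
    absence of h-torsion gives T = F(y).\<close>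
  have "(\<Oplus>\<^bsub>U\<^esub>l\<in>K. (h \<odot>\<^bsub>U\<^esub> T l \<ominus>\<^bsub>U\<^esub> h \<odot>\<^bsub>U\<^esub> F (y l)) \<otimes>\<^bsub>U\<^esub> F (c l t)) = \<zero>\<^bsub>U\<^esub>" if t: "t \<in> K" for t
    using DF[OF t] hy[OF t] t T y cc Fc
    by (subst diff) (auto simp: D_def intro!: U.finsum_closed U.r_right_minus_eq[THEN iffD2])
  then have "h \<odot>\<^bsub>U\<^esub> T s \<ominus>\<^bsub>U\<^esub> h \<odot>\<^bsub>U\<^esub> F (y s) = \<zero>\<^bsub>U\<^esub>"
    using s T y Fc near_hom[OF S.ralg F c U.ralg]
    by (intro U.near_cancel[OF K, of "\<lambda>l. h \<odot>\<^bsub>U\<^esub> T l \<ominus>\<^bsub>U\<^esub> h \<odot>\<^bsub>U\<^esub> F (y l)" "\<lambda>l t. F (c l t)"]) auto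
  then have "h \<odot>\<^bsub>U\<^esub> (T s \<ominus>\<^bsub>U\<^esub> F (y s)) = \<zero>\<^bsub>U\<^esub>" using U.smult_diff_r T y Fc s by simp
  then have "T s \<ominus>\<^bsub>U\<^esub> F (y s) = \<zero>\<^bsub>U\<^esub>" using torsion_freeD[OF tf] T y Fc s by simp
  then have "T s = F (y s)" using U.minus_self_eq T y Fc s by blast
  then show ?thesis using y s by blast
qed

lemma neg_qq_inverse: "(- qq) ^ m * (- qq_inv) ^ m = (1 :: 'k::field laurent)"
  by (simp add: power_mult_distrib[symmetric] qq_qq_inv)

text \<open>
  Multiplying \<open>\<Sum>\<^sub>l y\<^sub>l x\<^sub>l\<^sub>c = x\<^sub>i\<^sub>c\<close> from the right by the complementary minors
  identifies the solution \<open>y\<close> with the coordinates of the big cell.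
\<close>

lemma cell_factorization:
  fixes B :: "('k::field laurent, 'b) module" and x :: "nat \<Rightarrow> nat \<Rightarrow> 'b"
  assumes B: "cralg B q1" and x: "qmat B n x" and r: "0 < r" "r < n"
    and near: "\<And>i j. i \<in> {1..n} \<Longrightarrow> j \<in> {1..n} \<Longrightarrow> ralg.near B q1 (if i = j then 1 else 0) (x i j)"
    and u: "qdet_of B x [1..<Suc r] \<in> Units B" and i: "i \<in> {r<..n}" and c: "c \<in> {1..r}"
  shows "x i c = (\<Oplus>\<^bsub>B\<^esub>s\<in>{1..r}. (- qq) ^ (r - s) \<odot>\<^bsub>B\<^esub>
    (qdet_of B x (sorted_list_of_set (insert i ({1..r} - {s}))) \<otimes>\<^bsub>B\<^esub> inv\<^bsub>B\<^esub> qdet_of B x [1..<Suc r]) \<otimes>\<^bsub>B\<^esub> x s c)"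
proof -
  interpret B: cralg B q1 by fact
  interpret R: row_alternating B x "- qq" "{1..n}" r using r by (intro qmat_row_alternating[OF x B.ralg]) auto
  define d where "d = R.qdet [1..<Suc r]"
  have dU: "d \<in> Units B" and d: "d \<in> carrier B" and di: "inv\<^bsub>B\<^esub> d \<in> carrier B" "d \<otimes>\<^bsub>B\<^esub> inv\<^bsub>B\<^esub> d = \<one>\<^bsub>B\<^esub>"
    using u B.Units_closed B.Units_inv_closed B.Units_r_inv by (auto simp: d_def simp del: upt_Suc)
  \<comment> \<open>The rows 1, ..., r without s. With another row in front they give D_0, zero, or
    one of the minors in the coordinates.\<close>
  define ks where "ks s = [1..<s] @ [Suc s..<Suc r]" for s
  define m where "m s = R.qdet (sorted_list_of_set (insert i ({1..r} - {s})))" for s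
  have xc [simp]: "x a b \<in> carrier B" if "a \<in> {1..n}" "b \<in> {1..n}" for a b using qmatD(1)[OF x that] .
  have len: "length (sorted_list_of_set (insert i ({1..r} - {s}))) = r" if "s \<in> {1..r}" for s
    using that i by (auto simp: card_insert_if)
  have ksR: "set (ks s) \<subseteq> {1..n}" "set (ks s) = {1..r} - {s}" "distinct (ks s)" "length (ks s) = r - 1" "sorted (ks s)" if "s \<in> {1..r}" for s
    using that r by (auto simp: ks_def sorted_append)
  have mc: "m s \<in> carrier B" if "s \<in> {1..r}" for s unfolding m_def using that i r by (intro R.qdet_closed, subst set_sorted_list_of_set) auto
  \<comment> \<open>For fixed s the scaled cofactors form a column whose product with row l \<le> r
    of x is \<open>d\<close> for l = s and 0 otherwise. The factor (-1/q)^(s-1) compensates for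
    moving row s past the s - 1 smaller rows.\<close>
  have adj: "(\<Oplus>\<^bsub>B\<^esub>c\<in>{1..r}. x l c \<otimes>\<^bsub>B\<^esub> ((- qq_inv) ^ (s - 1) \<odot>\<^bsub>B\<^esub> R.cof (ks s) c))
      = (- qq_inv) ^ (s - 1) \<odot>\<^bsub>B\<^esub> R.qdet (l # ks s)" if s: "s \<in> {1..r}" and l: "l \<in> {1..n}" for l s
  proof -
    have "(- qq_inv) ^ (s - 1) \<odot>\<^bsub>B\<^esub> R.qdet (l # ks s) = (- qq_inv) ^ (s - 1) \<odot>\<^bsub>B\<^esub> (\<Oplus>\<^bsub>B\<^esub>c\<in>{1..r}. x l c \<otimes>\<^bsub>B\<^esub> R.cof (ks s) c)"
      using R.qdet_expand[OF l ksR(1)[OF s] r(1)] by simp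
    also have "\<dots> = (\<Oplus>\<^bsub>B\<^esub>c\<in>{1..r}. (- qq_inv) ^ (s - 1) \<odot>\<^bsub>B\<^esub> (x l c \<otimes>\<^bsub>B\<^esub> R.cof (ks s) c))"
      using l r ksR(1)[OF s] by (intro B.smult_finsum Pi_I B.m_closed xc R.cof_closed) auto
    also have "\<dots> = (\<Oplus>\<^bsub>B\<^esub>c\<in>{1..r}. x l c \<otimes>\<^bsub>B\<^esub> ((- qq_inv) ^ (s - 1) \<odot>\<^bsub>B\<^esub> R.cof (ks s) c))"
      using l r ksR(1)[OF s] by (intro B.finsum_cong' refl Pi_I B.m_closed xc B.smult_closed R.cof_closed B.smult_mult_r[symmetric]) auto
    finally show ?thesis by simp
  qed
  have lsort: "linv xs = 0" if "sorted xs" for xs using that by (induction xs) (auto simp: filter_empty_conv)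
  have diag: "(- qq_inv) ^ (s - 1) \<odot>\<^bsub>B\<^esub> R.qdet (l # ks s) = (if l = s then d else \<zero>\<^bsub>B\<^esub>)" if s: "s \<in> {1..r}" and l: "l \<in> {1..r}" for l s
  proof -
    have q: "R.qdet (l # ks s) = (if distinct (l # ks s) then (- qq) ^ linv (l # ks s) \<odot>\<^bsub>B\<^esub> R.qdet (sort (l # ks s)) else \<zero>\<^bsub>B\<^esub>)"
      using s l r ksR[OF s] by (intro R.qdet_sort) auto
    show ?thesis
    proof (cases "l = s")
      case True
      have "distinct (s # ks s)" using ksR[OF s] by simp
      then have "sort (s # ks s) = sorted_list_of_set (set (s # ks s))"
        unfolding sorted_list_of_set_sort_remdups by (simp only: distinct_remdups_id)
      moreover have "set (s # ks s) = {1..r}" unfolding list.set ksR(2)[OF s] using s by blast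
      ultimately have "sort (s # ks s) = [1..<Suc r]" by (simp only: sorted_interval)
      moreover have "filter (\<lambda>y. y < s) (ks s) = [1..<s]" unfolding ks_def using s
        by (simp del: upt_Suc add: filter_id_conv filter_empty_conv)
      then have "linv (s # ks s) = s - 1" using lsort[OF ksR(5)[OF s]] by simp
      ultimately have "R.qdet (s # ks s) = (- qq) ^ (s - 1) \<odot>\<^bsub>B\<^esub> d" using q True ksR[OF s] by (simp add: d_def del: upt_Suc)
      then have "(- qq_inv) ^ (s - 1) \<odot>\<^bsub>B\<^esub> R.qdet (s # ks s) = ((- qq) ^ (s - 1) * (- qq_inv) ^ (s - 1)) \<odot>\<^bsub>B\<^esub> d"
        using d by (simp add: B.smult_assoc B.smult_commute)
      then show ?thesis using True d by (simp add: neg_qq_inverse)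
    next
      case False
      then show ?thesis using q ksR(2)[OF s] l by simp
    qed
  qed
  have low: "(- qq_inv) ^ (s - 1) \<odot>\<^bsub>B\<^esub> R.qdet (i # ks s) = (- qq) ^ (r - s) \<odot>\<^bsub>B\<^esub> m s" if s: "s \<in> {1..r}" for s
  proof -
    have dis: "distinct (i # ks s)" using ksR[OF s] i by auto
    have "sort (i # ks s) = sorted_list_of_set (set (i # ks s))"
      unfolding sorted_list_of_set_sort_remdups distinct_remdups_id[OF dis] ..
    then have "sort (i # ks s) = sorted_list_of_set (insert i ({1..r} - {s}))"
      unfolding list.set ksR(2)[OF s] .
    moreover have "filter (\<lambda>y. y < i) (ks s) = ks s" using ksR(2)[OF s] i by (auto simp: filter_id_conv)
    \<comment> \<open>Row i exceeds all r - 1 others. Of this exponent, s - 1 is cancelled by the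
      scaling of the cofactors, and the remaining r - s is the power of -q in the definition of
      t_is.\<close>
    then have "linv (i # ks s) = (r - s) + (s - 1)" using lsort[OF ksR(5)[OF s]] ksR(4)[OF s] s by simp
    ultimately have "R.qdet (i # ks s) = (- qq) ^ ((r - s) + (s - 1)) \<odot>\<^bsub>B\<^esub> m s"
      using R.qdet_sort[of "i # ks s"] dis ksR[OF s] i r by (simp add: m_def)
    then have "(- qq_inv) ^ (s - 1) \<odot>\<^bsub>B\<^esub> R.qdet (i # ks s) = ((- qq) ^ (r - s) * ((- qq) ^ (s - 1) * (- qq_inv) ^ (s - 1))) \<odot>\<^bsub>B\<^esub> m s"
      using mc[OF s] by (simp add: B.smult_assoc[symmetric] power_add mult.commute mult.left_commute)
    then show ?thesis by (simp add: neg_qq_inverse)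
  qed
  have nr: "ralg.near B q1 (if a = b then 1 else 0) (x a b)" if "a \<in> {1..r}" "b \<in> {1..r}" for a b
    using near that r by auto
  have xi: "x i \<in> {1..r} \<rightarrow> carrier B" using i r by auto
  obtain y where y: "\<And>k. k \<in> {1..r} \<Longrightarrow> y k \<in> carrier B" and ye: "\<And>c. c \<in> {1..r} \<Longrightarrow> (\<Oplus>\<^bsub>B\<^esub>l\<in>{1..r}. y l \<otimes>\<^bsub>B\<^esub> x l c) = x i c"
    using B.near_solve[OF finite_atLeastAtMost xi nr] by blast
  have ys: "y s = (- qq) ^ (r - s) \<odot>\<^bsub>B\<^esub> (m s \<otimes>\<^bsub>B\<^esub> inv\<^bsub>B\<^esub> d)" if s: "s \<in> {1..r}" for s
  proof -
    define A where "A c = (- qq_inv) ^ (s - 1) \<odot>\<^bsub>B\<^esub> R.cof (ks s) c" for c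
    have Ac: "A c \<in> carrier B" for c unfolding A_def using ksR(1)[OF s] by (intro B.smult_closed R.cof_closed)
    have rn: "a \<in> {1..r} \<Longrightarrow> a \<in> {1..n}" for a using r by auto
    have "(- qq) ^ (r - s) \<odot>\<^bsub>B\<^esub> m s = (\<Oplus>\<^bsub>B\<^esub>c\<in>{1..r}. x i c \<otimes>\<^bsub>B\<^esub> A c)"
      using adj[OF s, of i] low[OF s] i by (simp add: A_def)
    also have "\<dots> = (\<Oplus>\<^bsub>B\<^esub>c\<in>{1..r}. \<Oplus>\<^bsub>B\<^esub>l\<in>{1..r}. y l \<otimes>\<^bsub>B\<^esub> (x l c \<otimes>\<^bsub>B\<^esub> A c))"
    proof (intro B.finsum_cong' refl Pi_I)
      fix c assume c: "c \<in> {1..r}"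
      show "(\<Oplus>\<^bsub>B\<^esub>l\<in>{1..r}. y l \<otimes>\<^bsub>B\<^esub> (x l c \<otimes>\<^bsub>B\<^esub> A c)) \<in> carrier B"
        using y Ac rn c by (intro B.finsum_closed Pi_I B.m_closed xc) auto
      have "x i c \<otimes>\<^bsub>B\<^esub> A c = (\<Oplus>\<^bsub>B\<^esub>l\<in>{1..r}. y l \<otimes>\<^bsub>B\<^esub> x l c) \<otimes>\<^bsub>B\<^esub> A c" using ye[OF c] by simp
      also have "\<dots> = (\<Oplus>\<^bsub>B\<^esub>l\<in>{1..r}. y l \<otimes>\<^bsub>B\<^esub> x l c \<otimes>\<^bsub>B\<^esub> A c)"
        using y Ac rn c by (intro B.finsum_ldistr) auto
      also have "\<dots> = (\<Oplus>\<^bsub>B\<^esub>l\<in>{1..r}. y l \<otimes>\<^bsub>B\<^esub> (x l c \<otimes>\<^bsub>B\<^esub> A c))"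
        using y Ac rn c by (intro B.finsum_cong' refl Pi_I B.m_closed xc B.m_assoc) auto
      finally show "x i c \<otimes>\<^bsub>B\<^esub> A c = (\<Oplus>\<^bsub>B\<^esub>l\<in>{1..r}. y l \<otimes>\<^bsub>B\<^esub> (x l c \<otimes>\<^bsub>B\<^esub> A c))" .
    qed
    also have "\<dots> = (\<Oplus>\<^bsub>B\<^esub>l\<in>{1..r}. \<Oplus>\<^bsub>B\<^esub>c\<in>{1..r}. y l \<otimes>\<^bsub>B\<^esub> (x l c \<otimes>\<^bsub>B\<^esub> A c))"
      using y Ac rn by (intro B.finsum_swap B.m_closed xc) auto
    also have "\<dots> = (\<Oplus>\<^bsub>B\<^esub>l\<in>{1..r}. if s = l then y l \<otimes>\<^bsub>B\<^esub> d else \<zero>\<^bsub>B\<^esub>)"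
    proof (intro B.finsum_cong' refl Pi_I)
      fix l assume l: "l \<in> {1..r}"
      show "(if s = l then y l \<otimes>\<^bsub>B\<^esub> d else \<zero>\<^bsub>B\<^esub>) \<in> carrier B" using y[OF l] d by simp
      have "(\<Oplus>\<^bsub>B\<^esub>c\<in>{1..r}. y l \<otimes>\<^bsub>B\<^esub> (x l c \<otimes>\<^bsub>B\<^esub> A c)) = y l \<otimes>\<^bsub>B\<^esub> (\<Oplus>\<^bsub>B\<^esub>c\<in>{1..r}. x l c \<otimes>\<^bsub>B\<^esub> A c)"
        using y Ac rn l by (intro B.finsum_rdistr[symmetric] Pi_I B.m_closed xc) auto
      also have "\<dots> = y l \<otimes>\<^bsub>B\<^esub> (if l = s then d else \<zero>\<^bsub>B\<^esub>)" unfolding A_def using adj[OF s rn[OF l]] diag[OF s l] by simp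
      finally show "(\<Oplus>\<^bsub>B\<^esub>c\<in>{1..r}. y l \<otimes>\<^bsub>B\<^esub> (x l c \<otimes>\<^bsub>B\<^esub> A c)) = (if s = l then y l \<otimes>\<^bsub>B\<^esub> d else \<zero>\<^bsub>B\<^esub>)" using y[OF l] by simp
    qed
    also have "\<dots> = y s \<otimes>\<^bsub>B\<^esub> d" using s y d by (intro B.finsum_singleton[where f = "\<lambda>l. y l \<otimes>\<^bsub>B\<^esub> d"]) auto
    finally have "y s \<otimes>\<^bsub>B\<^esub> d \<otimes>\<^bsub>B\<^esub> inv\<^bsub>B\<^esub> d = (- qq) ^ (r - s) \<odot>\<^bsub>B\<^esub> m s \<otimes>\<^bsub>B\<^esub> inv\<^bsub>B\<^esub> d" by simp
    then show ?thesis using y[OF s] d di mc[OF s] by (simp add: B.m_assoc B.smult_mult_l)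
  qed
  have meq: "qdet_of B x (sorted_list_of_set (insert i ({1..r} - {s}))) = m s" if "s \<in> {1..r}" for s
    by (simp only: len[OF that] m_def)
  have deq: "qdet_of B x [1..<Suc r] = d" by (simp only: d_def length_upt diff_Suc_1)
  have "x i c = (\<Oplus>\<^bsub>B\<^esub>s\<in>{1..r}. (- qq) ^ (r - s) \<odot>\<^bsub>B\<^esub> (m s \<otimes>\<^bsub>B\<^esub> inv\<^bsub>B\<^esub> d) \<otimes>\<^bsub>B\<^esub> x s c)"
    unfolding ye[OF c, symmetric] using ys mc di c r
    by (intro B.finsum_cong' refl Pi_I B.m_closed B.smult_closed) auto
  also have "\<dots> = (\<Oplus>\<^bsub>B\<^esub>s\<in>{1..r}. (- qq) ^ (r - s) \<odot>\<^bsub>B\<^esub>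
    (qdet_of B x (sorted_list_of_set (insert i ({1..r} - {s}))) \<otimes>\<^bsub>B\<^esub> inv\<^bsub>B\<^esub> qdet_of B x [1..<Suc r]) \<otimes>\<^bsub>B\<^esub> x s c)"
    unfolding deq using mc di c le_trans[OF _ less_imp_le[OF r(2)]]
    by (intro B.finsum_cong' refl Pi_I B.m_closed B.smult_closed) (auto simp only: meq atLeastAtMost_iff intro!: xc)
  finally show ?thesis .
qed

text \<open>Universal property of the localization: besides a quantum matrix with invertible
  determinant it asks for an inverse of the leading r by r minor. Both the counit of the
  localization and its map to the completion are obtained in this way.\<close>

lemma loc_hom:
  fixes B :: "('k::field laurent, 'b) module"
  assumes B: "ralg B" and f: "f \<in> loc_gens n \<rightarrow> carrier B" and qm: "qmat B n (\<lambda>i j. f (X i j))" and r: "r < n"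
    and inv: "qdet_of B (\<lambda>i j. f (X i j)) [1..<Suc n] \<otimes>\<^bsub>B\<^esub> f Dinv = \<one>\<^bsub>B\<^esub>"
      "f Dinv \<otimes>\<^bsub>B\<^esub> qdet_of B (\<lambda>i j. f (X i j)) [1..<Suc n] = \<one>\<^bsub>B\<^esub>"
    and inv0: "qdet_of B (\<lambda>i j. f (X i j)) [1..<Suc r] \<otimes>\<^bsub>B\<^esub> f D0inv = \<one>\<^bsub>B\<^esub>"
      "f D0inv \<otimes>\<^bsub>B\<^esub> qdet_of B (\<lambda>i j. f (X i j)) [1..<Suc r] = \<one>\<^bsub>B\<^esub>"
  shows "ahom (OG_loc n r) B (pres_hom B f)"
    and "r < i \<Longrightarrow> i \<le> n \<Longrightarrow> j \<in> {1..r} \<Longrightarrow> pres_hom B f (cell_coord n r i j)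
      = (- qq) ^ (r - j) \<odot>\<^bsub>B\<^esub> (qdet_of B (\<lambda>i j. f (X i j)) (sorted_list_of_set (insert i ({1..r} - {j}))) \<otimes>\<^bsub>B\<^esub> f D0inv)"
proof -
  interpret B: ralg B by (rule B)
  note L = presentation_loc[of r n, OF less_imp_le[OF r]]
  have GX: "i \<in> {1..n} \<Longrightarrow> j \<in> {1..n} \<Longrightarrow> X i j \<in> loc_gens n" for i j by (intro GL_loc_gens GL_gens_X)
  have fG: "f \<in> GL_gens n \<rightarrow> carrier B" using f GL_loc_gens by auto
  have D: "free_hom B f (qminor {1..m}) = qdet_of B (\<lambda>i j. f (X i j)) [1..<Suc m]" if "m \<le> n" for m
    using free_hom_qminor'[OF B f GX qm, of "{1..m}"] that by (simp add: sorted_interval del: upt_Suc)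
  have q: "qminor {1..n} \<in> carrier (free_alg (GL_gens n) :: ('k laurent, _) module)" by (intro qminor_free' GL_gens_X) auto
  have q0: "qminor {1..r} \<in> carrier (free_alg (loc_gens n) :: ('k laurent, _) module)" using r by (intro qminor_free' GX) auto
  have rel: "free_hom B f \<rho> = \<zero>\<^bsub>B\<^esub>" if "\<rho> \<in> loc_rels n r" for \<rho>
  proof -
    from that consider "\<rho> \<in> mat_rels n" | "\<rho> \<in> inverse_rels (GL_gens n) (qminor {1..n}) Dinv"
      | "\<rho> \<in> inverse_rels (loc_gens n) (qminor {1..r}) D0inv" unfolding loc_rels_def GL_rels_def by blast
    then show ?thesis
    proof cases
      case 1 then show ?thesis by (intro rels_of_qmat[OF B f GX qm])
    next
      case 2 then show ?thesis by (intro free_hom_inverse_rels[OF B fG GL_gens_X q GL_gens_Dinv inv[folded D[OF order.refl]]])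
    next
      case 3 then show ?thesis by (intro free_hom_inverse_rels[OF B f GX q0 loc_gens_D0inv inv0[folded D[OF less_imp_le[OF r]]]])
    qed
  qed
  show h: "ahom (OG_loc n r) B (pres_hom B f)" unfolding OG_loc_def by (rule presentation.ahom_pres_hom[OF L B f rel])
  have c: "pres_hom B f (OG_loc_class n r p) = free_hom B f p" if "p \<in> carrier (free_alg (loc_gens n))" for p
    unfolding OG_loc_class_def by (rule presentation.pres_hom_class[OF L B f rel that])
  have cc: "OG_loc_class n r p \<in> carrier (OG_loc n r)" if "p \<in> carrier (free_alg (loc_gens n))" for p :: "'k word_poly"
    unfolding OG_loc_class_def OG_loc_def by (rule ahomD(3)[OF presentation.ahom_pres_class[OF L] that])
  interpret Lo: ralg "OG_loc n r :: ('k laurent, _) module" unfolding OG_loc_def by (rule presentation.ralg_pres[OF L])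
  show "pres_hom B f (cell_coord n r i j)
      = (- qq) ^ (r - j) \<odot>\<^bsub>B\<^esub> (qdet_of B (\<lambda>i j. f (X i j)) (sorted_list_of_set (insert i ({1..r} - {j}))) \<otimes>\<^bsub>B\<^esub> f D0inv)"
    if ij: "r < i" "i \<le> n" "j \<in> {1..r}"
  proof -
    let ?I = "insert i ({1..r} - {j})"
    have I: "?I \<subseteq> {1..n}" using ij r by auto
    have p: "qminor ?I \<in> carrier (free_alg (loc_gens n) :: ('k laurent, _) module)" using I by (intro qminor_free' GX) auto
    have g: "Poly_Mapping.single [D0inv] 1 \<in> carrier (free_alg (loc_gens n) :: ('k laurent, _) module)"
      by (intro single_free) (auto simp: loc_gens_D0inv)
    have fD: "f D0inv \<in> carrier B" using f loc_gens_D0inv by auto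
    have "free_hom B f (Poly_Mapping.single [D0inv] 1) = f D0inv"
      by (subst free_hom_single[OF B f]) (use fD in \<open>auto simp: loc_gens_D0inv\<close>)
    then show ?thesis unfolding cell_coord_def
      using free_hom_qminor'[OF B f GX qm I] cc[OF p] cc[OF g] by (simp add: ahomD(5,6)[OF h] c[OF p] c[OF g])
  qed
qed

section \<open>The embedding of the big cell\<close>

text \<open>The argument \<open>field_type\<close> makes the ground field a type parameter of the
  locale, since the types of \<open>n\<close> and \<open>r\<close> do not mention it.\<close>

locale grassmannian =
  fixes n r :: nat and field_type :: "'k::field itself"
  assumes r: "0 < r" "r < n"
begin

abbreviation "A \<equiv> OG n :: ('k laurent, 'k word_poly set) module"
abbreviation "VA \<equiv> OG_vee n :: ('k laurent, 'k vee_elem) module"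
abbreviation "H \<equiv> OG_hat n :: ('k laurent, 'k vee_elem hat) module"
abbreviation "E \<equiv> big_cell n r :: ('k laurent, 'k word_poly set) module"
abbreviation "VE \<equiv> OGP_vee n r :: ('k laurent, 'k vee_elem) module"
abbreviation "CE \<equiv> OGP_hat n r :: ('k laurent, 'k vee_elem hat) module"
abbreviation "Loc \<equiv> OG_loc n r :: ('k laurent, 'k word_poly set) module"

sublocale G: augmented A counit q1
  by (intro augmented.intro augmented_axioms.intro ralg_OG ahom_counit_OG q1_nonzero)

lemma VA_eq: "VA = G.V" by (simp add: OG_vee_def)

sublocale VA: completing VA q1
  unfolding completing_def VA_eq by (rule G.ralg_V)

lemma H_eq: "H = VA.C" by (simp add: OG_hat_def)

sublocale H: cralg H q1 unfolding H_eq by (rule VA.cralg_completion)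

lemma VA_torsion_free: "torsion_free q1 VA" unfolding VA_eq by (rule G.V_torsion_free[OF q1_nonzero])

text \<open>The step from q - 1 to all nonzero scalars uses completeness. It is what lets
  \<open>H\<close> embed into its extension to k(q).\<close>

lemma H_torsion_free: "c \<noteq> 0 \<Longrightarrow> torsion_free c H"
proof (rule cralg_torsion_free[OF H.cralg_axioms])
  show "torsion_free q1 H" unfolding torsion_free_def H_eq
    using VA.completion_torsion_free torsion_freeD[OF VA_torsion_free] by blast
qed

lemma ahom_VA_H: "ahom VA H (to_completion q1 VA)"
  unfolding H_eq by (rule VA.ahom_to_completion)

lemma ahom_OG_to_hat: "ahom A H (OG_to_hat n)"
  unfolding OG_to_hat_def[abs_def] by (rule ahom_comp[OF G.ahom_base_V[folded VA_eq] ahom_VA_H])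

lemma near_OG_to_hat: "a \<in> carrier A \<Longrightarrow> H.near q1 (counit a) (OG_to_hat n a)"
  unfolding OG_to_hat_def by (rule near_hom[OF VA.ralg ahom_VA_H _ H.ralg]) (use G.near_base in \<open>simp add: VA_eq\<close>)

abbreviation xi ("\<xi>") where "\<xi> i j \<equiv> OG_to_hat n (OG_gen n (X i j)) :: 'k vee_elem hat"

lemma qmat_xi: "qmat H n \<xi>"
  by (rule qmat_hom[OF qmat_OG G.A.ralg ahom_OG_to_hat])

lemma near_xi: "i \<in> {1..n} \<Longrightarrow> j \<in> {1..n} \<Longrightarrow> H.near q1 (if i = j then 1 else 0) (\<xi> i j)"
  using near_OG_to_hat[OF OG_gen_closed[OF GL_gens_X, of i n j]] counit_OG_gen[OF GL_gens_X, of i n j, where 'k = 'k]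
  by (simp add: counit_gen_def)

text \<open>In \<open>H\<close> every element of \<open>A\<close> is congruent to its counit, and
  the counit of a minor is its value at the identity matrix. Hence D_0 becomes a unit and minors
  with a different row set become divisible by q - 1.\<close>

lemma hat_minor:
  assumes "I \<subseteq> {1..n}"
  shows "OG_to_hat n (OG_class n (qminor I)) = qdet_of H \<xi> (sorted_list_of_set I)"
    and "H.near q1 (if I = {1..card I} then (- qq) ^ linv (sorted_list_of_set I) else 0) (OG_to_hat n (OG_class n (qminor I)))"
proof -
  have fin: "finite I" using assms finite_subset by blast
  have ca: "card I \<le> n" using card_mono[OF _ assms] by simp
  have q: "qminor I \<in> carrier (free_alg (GL_gens n) :: ('k laurent, _) module)"
    by (rule qminor_free'[OF fin assms GL_gens_X])
  have f: "(\<lambda>g. OG_to_hat n (OG_gen n g)) \<in> GL_gens n \<rightarrow> carrier H"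
    using ahomD(3)[OF ahom_OG_to_hat] OG_gen_closed by blast
  show "OG_to_hat n (OG_class n (qminor I)) = qdet_of H \<xi> (sorted_list_of_set I)"
    unfolding OG_hom_class[OF H.ralg ahom_OG_to_hat q] by (rule free_hom_qminor'[OF H.ralg f GL_gens_X qmat_xi assms])
  have "counit (OG_class n (qminor I) :: 'k word_poly set) = (if I = {1..card I} then (- qq) ^ linv (sorted_list_of_set I) else 0)"
  proof -
    have "counit (OG_class n (qminor I) :: 'k word_poly set) = qdet_of (scalar_alg :: ('k laurent, _) module) (\<lambda>i j. counit_gen (X i j)) (sorted_list_of_set I)"
      unfolding counit_OG_class[OF q] by (rule free_hom_qminor'[OF ralg_scalar _ GL_gens_X qmat_counit assms]) simp
    also have "\<dots> = (if I = {1..card I} then (- qq) ^ linv (sorted_list_of_set I) else 0)"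
      by (subst qdet_counit[where n = n]) (use fin ca assms in auto)
    finally show ?thesis .
  qed
  then show "H.near q1 (if I = {1..card I} then (- qq) ^ linv (sorted_list_of_set I) else 0) (OG_to_hat n (OG_class n (qminor I)))"
    using near_OG_to_hat[OF OG_class_closed[OF q]] by simp
qed

definition d0 where "d0 = OG_to_hat n (OG_class n (qminor {1..r} :: 'k word_poly))"

lemma d0_qdet: "d0 = qdet_of H \<xi> [1..<Suc r]"
  unfolding d0_def using hat_minor(1)[of "{1..r}"] r by (simp add: sorted_interval del: upt_Suc)

lemma d0_unit: "d0 \<in> Units H"
  using hat_minor(2)[of "{1..r}"] r unfolding d0_def by (intro H.near_one_unit) (auto simp: sorted_interval linv_upt simp del: upt_Suc)

lemma inv_d0: "d0 \<in> carrier H" "inv\<^bsub>H\<^esub> d0 \<in> carrier H" "d0 \<otimes>\<^bsub>H\<^esub> inv\<^bsub>H\<^esub> d0 = \<one>\<^bsub>H\<^esub>" "inv\<^bsub>H\<^esub> d0 \<otimes>\<^bsub>H\<^esub> d0 = \<one>\<^bsub>H\<^esub>"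
  using d0_unit H.Units_closed H.Units_inv_closed H.Units_r_inv H.Units_l_inv by auto

definition loc_gen :: "gen \<Rightarrow> 'k vee_elem hat" where
  "loc_gen g = (case g of D0inv \<Rightarrow> inv\<^bsub>H\<^esub> d0 | _ \<Rightarrow> OG_to_hat n (OG_gen n g))"

lemma loc_to_hat_eq: "loc_to_hat n r = pres_hom H loc_gen"
  unfolding loc_to_hat_def loc_gen_def[abs_def] d0_def ..

text \<open>The image of t_ij in the completion, in explicit form.\<close>

definition th where
  "th i j = (- qq) ^ (r - j) \<odot>\<^bsub>H\<^esub> (qdet_of H \<xi> (sorted_list_of_set (insert i ({1..r} - {j}))) \<otimes>\<^bsub>H\<^esub> inv\<^bsub>H\<^esub> d0)"

lemma ahom_loc_to_hat: "ahom Loc H (loc_to_hat n r)"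
  and loc_to_hat_coord: "i \<in> {r<..n} \<Longrightarrow> j \<in> {1..r} \<Longrightarrow> loc_to_hat n r (cell_coord n r i j) = th i j"
proof -
  have f: "loc_gen \<in> loc_gens n \<rightarrow> carrier H"
    using inv_d0(2) ahomD(3)[OF ahom_OG_to_hat OG_gen_closed] unfolding loc_gen_def loc_gens_def
    by (auto simp: GL_gens_def split: gen.split)
  have x: "(\<lambda>i j. loc_gen (X i j)) = \<xi>" by (simp add: loc_gen_def fun_eq_iff)
  have D: "OG_to_hat n (qdet_of A (\<lambda>i j. OG_gen n (X i j)) [1..<Suc n]) = qdet_of H \<xi> [1..<Suc n]"
    using hat_minor(1)[of "{1..n}"] OG_D_inverse(4)[of n, where 'k = 'k] by (simp add: sorted_interval del: upt_Suc)
  have Di: "OG_gen n Dinv \<in> carrier A" using OG_gen_closed[OF GL_gens_Dinv] .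
  have inv: "qdet_of H \<xi> [1..<Suc n] \<otimes>\<^bsub>H\<^esub> loc_gen Dinv = \<one>\<^bsub>H\<^esub>" "loc_gen Dinv \<otimes>\<^bsub>H\<^esub> qdet_of H \<xi> [1..<Suc n] = \<one>\<^bsub>H\<^esub>"
    using ahomD(6)[OF ahom_OG_to_hat OG_D_inverse(1) Di] ahomD(6)[OF ahom_OG_to_hat Di OG_D_inverse(1)]
      OG_D_inverse(2,3)[of n, where 'k = 'k] ahomD(2)[OF ahom_OG_to_hat] unfolding D by (simp_all add: loc_gen_def del: upt_Suc)
  have inv0: "qdet_of H \<xi> [1..<Suc r] \<otimes>\<^bsub>H\<^esub> loc_gen D0inv = \<one>\<^bsub>H\<^esub>" "loc_gen D0inv \<otimes>\<^bsub>H\<^esub> qdet_of H \<xi> [1..<Suc r] = \<one>\<^bsub>H\<^esub>"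
    using inv_d0(3,4) unfolding d0_qdet[symmetric] by (simp_all add: loc_gen_def)
  note l = loc_hom[OF H.ralg f _ r(2), unfolded x, OF qmat_xi inv inv0]
  show "ahom Loc H (loc_to_hat n r)" unfolding loc_to_hat_eq by (rule l(1))
  show "i \<in> {r<..n} \<Longrightarrow> j \<in> {1..r} \<Longrightarrow> loc_to_hat n r (cell_coord n r i j) = th i j"
    unfolding loc_to_hat_eq th_def by (subst l(2)) (auto simp: loc_gen_def)
qed

text \<open>The row set contains i > r, so it differs from 1, ..., r and the counit of the minor is
  0.\<close>

lemma th_near: assumes "i \<in> {r<..n}" "j \<in> {1..r}" shows "H.near q1 0 (th i j)"
proof -
  let ?I = "insert i ({1..r} - {j})"
  have I: "?I \<subseteq> {1..n}" using assms r by auto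
  have "card ?I = r" "i \<notin> {1..r}" using assms by (auto simp: card_insert_if)
  then have "?I \<noteq> {1..card ?I}" by (metis insertI1)
  have "H.near q1 0 (qdet_of H \<xi> (sorted_list_of_set ?I))"
    using hat_minor[OF I] \<open>?I \<noteq> {1..card ?I}\<close> by simp
  then have "H.near q1 0 (qdet_of H \<xi> (sorted_list_of_set ?I) \<otimes>\<^bsub>H\<^esub> inv\<^bsub>H\<^esub> d0)"
    by (rule H.near_zero_mult[OF _ inv_d0(2)])
  from H.near_smult[OF this, of "(- qq) ^ (r - j)"] show ?thesis by (simp add: th_def)
qed

lemma ralg_Loc: "ralg Loc"
  unfolding OG_loc_def by (rule presentation.ralg_pres[OF presentation_loc]) (use r in simp)

lemma counit_Loc: "ahom Loc scalar_alg counit"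
  and counit_coord: "i \<in> {r<..n} \<Longrightarrow> j \<in> {1..r} \<Longrightarrow> counit (cell_coord n r i j :: 'k word_poly set) = 0"
proof -
  have f: "counit_gen \<in> loc_gens n \<rightarrow> carrier (scalar_alg :: ('k laurent, _) module)" by simp
  have one: "counit_gen Dinv = (1 :: 'k laurent)" "counit_gen D0inv = (1 :: 'k laurent)" by (simp_all add: counit_gen_def)
  note l = loc_hom[OF ralg_scalar f qmat_counit r(2)]
  have i: "qdet_of (scalar_alg :: ('k laurent, _) module) (\<lambda>i j. counit_gen (X i j)) [1..<Suc m] = 1" if "m \<le> n" for m
    using qdet_counit_one[OF that] .
  show "ahom Loc scalar_alg counit" unfolding counit_eq
    by (rule l(1)) (simp_all only: i[OF order.refl] i[OF less_imp_le[OF r(2)]] one scalar_alg_simps mult_1)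
  show "counit (cell_coord n r i j :: 'k word_poly set) = 0" if ij: "i \<in> {r<..n}" "j \<in> {1..r}"
  proof -
    let ?I = "insert i ({1..r} - {j})"
    have "i \<notin> {1..r}" using ij by auto
    then have "?I \<noteq> {1..r}" by (metis insertI1)
    moreover have "?I \<subseteq> {1..n}" "card ?I = r" using ij r by (auto simp: card_insert_if)
    ultimately have I: "?I \<subseteq> {1..n}" "?I \<noteq> {1..r}" "card ?I = r" by simp_all
    have "qdet_of (scalar_alg :: ('k laurent, _) module) (\<lambda>i j. counit_gen (X i j)) (sorted_list_of_set ?I) = 0"
    proof -
      have ms: "set (sorted_list_of_set ?I) = ?I" "length (sorted_list_of_set ?I) = r"
        unfolding length_sorted_list_of_set I(3) by (rule set_sorted_list_of_set) auto
      show ?thesis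
        by (subst qdet_counit[where n = n]) (simp_all only: ms I if_False simp_thms distinct_sorted_list_of_set less_imp_le[OF r(2)])
    qed
    then show ?thesis unfolding counit_eq
      by (subst l(2)) (use ij in \<open>simp_all only: i[OF order.refl] i[OF less_imp_le[OF r(2)]] one scalar_alg_simps mult_1
        mult_zero_left mult_zero_right greaterThanAtMost_iff\<close>)
  qed
qed

abbreviation "coords \<equiv> {cell_coord n r i j | i j. 1 \<le> j \<and> j \<le> r \<and> r < i \<and> i \<le> n} :: 'k word_poly set set"

lemma coord_Loc: assumes "i \<in> {r<..n}" "j \<in> {1..r}" shows "cell_coord n r i j \<in> carrier Loc"
proof -
  note L = presentation_loc[of r n, OF less_imp_le[OF r(2)]]
  interpret Loc: ralg Loc by (rule ralg_Loc)
  have cc: "OG_loc_class n r p \<in> carrier (OG_loc n r)" if "p \<in> carrier (free_alg (loc_gens n))" for p :: "'k word_poly"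
    unfolding OG_loc_class_def OG_loc_def by (rule ahomD(3)[OF presentation.ahom_pres_class[OF L] that])
  have "qminor (insert i ({1..r} - {j})) \<in> carrier (free_alg (loc_gens n) :: ('k laurent, _) module)"
    using assms r by (intro qminor_free'[where n = n] GL_loc_gens GL_gens_X) auto
  moreover have "Poly_Mapping.single [D0inv] 1 \<in> carrier (free_alg (loc_gens n) :: ('k laurent, _) module)"
    by (intro single_free) (auto simp: loc_gens_D0inv)
  ultimately show ?thesis unfolding cell_coord_def using cc by (intro Loc.smult_closed Loc.m_closed)
qed

lemma coords_Loc: "coords \<subseteq> carrier Loc" using coord_Loc by auto

lemma subalg_E: "subalg Loc (carrier E)"
  unfolding big_cell_def by (rule subalg_subalg_gen[OF ralg_Loc coords_Loc])

lemma E_eq: "E = Loc\<lparr>carrier := carrier E\<rparr>"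
  unfolding big_cell_def by (rule subalg_gen_alt)

lemma coord_E: "i \<in> {r<..n} \<Longrightarrow> j \<in> {1..r} \<Longrightarrow> cell_coord n r i j \<in> carrier E"
  unfolding big_cell_def using subalg_gen_incl[of coords Loc] by auto

lemma ahom_E: "ahom Loc B f \<Longrightarrow> ahom E B f"
  by (subst E_eq) (rule ahom_restrict[OF subalg_E])

lemma ralg_E: "ralg E" unfolding big_cell_def by (rule ralg_subalg_gen[OF ralg_Loc coords_Loc])

section \<open>The big cell as an augmented algebra\<close>

sublocale P: augmented E counit q1
  by (intro augmented.intro augmented_axioms.intro ralg_E ahom_E counit_Loc q1_nonzero)

lemma VE_eq: "VE = P.V" by (simp add: OGP_vee_def)

sublocale VE: completing VE q1 unfolding completing_def VE_eq by (rule P.ralg_V)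

lemma CE_eq: "CE = VE.C" by (simp add: OGP_hat_def)

sublocale CE: cralg CE q1 unfolding CE_eq by (rule VE.cralg_completion)

text \<open>The counit vanishes on the coordinates, so \<open>P.dq\<close> of a coordinate is
  (q-1)^{-1} t_ij; the coordinates generate the big cell.\<close>

lemma VE_generated:
  assumes S: "subalg VE S" and "\<And>i j. i \<in> {r<..n} \<Longrightarrow> j \<in> {1..r} \<Longrightarrow> P.dq (cell_coord n r i j) \<in> S"
  shows "carrier VE \<subseteq> S"
  unfolding VE_eq
proof (rule P.V_generated[of S coords])
  show "subalg P.AK S" using subalg_trans[OF P.subalg_V, of S] S P.V_eq by (simp add: VE_eq)
  show "coords \<subseteq> carrier E" using coord_E by auto
  show "carrier E \<subseteq> Q" if "subalg E Q" "coords \<subseteq> Q" for Q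
    unfolding big_cell_def using that subalg_trans[OF subalg_E, of Q] E_eq
    by (intro subalg_gen_induct[OF ralg_Loc coords_Loc]) auto
  show "P.dq g \<in> S" if "g \<in> coords" for g using that assms(2) by auto
qed

section \<open>The embedding into the completion of \<open>OG_vee n\<close>\<close>

sublocale HK: tensor H fract_alg by (intro tensor.intro H.ralg ralg_fract)

abbreviation "loc_map \<equiv> tensor_map H fract_alg (loc_to_hat n r) (\<lambda>c. c)"

lemma ahom_loc_map: "ahom P.AK HK.T loc_map"
  by (rule ahom_tensor_map[OF ralg_E ralg_fract H.ralg ralg_fract ahom_E[OF ahom_loc_to_hat] ahom_id])

lemma loc_map_pure: "a \<in> carrier E \<Longrightarrow> loc_map (P.K.pt a c) = HK.pt (loc_to_hat n r a) c"
  by (rule tensor_map_pure[OF ralg_E ralg_fract H.ralg ralg_fract])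
    (auto intro: ahomD(1)[OF ahom_E[OF ahom_loc_to_hat]] ahomD(1)[OF ahom_id])

text \<open>The kernel of b \<mapsto> b \<otimes> 1 is torsion, and \<open>H\<close> is
  torsion-free. Consequently the element chosen by \<open>SOME\<close> in \<open>OGP_embed\<close>
  is unique.\<close>

lemma hat_pt_inj:
  assumes "b \<in> carrier H" "b' \<in> carrier H" "HK.pt b 1 = HK.pt b' 1" shows "b = b'"
proof -
  have "HK.pt (b \<ominus>\<^bsub>H\<^esub> b') 1 = HK.pt b 1 \<ominus>\<^bsub>HK.T\<^esub> HK.pt b' 1"
    using lin_diff[OF H.ralg HK.ralg_tensor ahomD(1)[OF HK.ahom_pt_l] assms(1,2)] by simp
  also have "\<dots> = \<zero>\<^bsub>HK.T\<^esub>" using assms HK.T.minus_self_eq[OF HK.pt_closed HK.pt_closed, of b' 1 b' 1] by simp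
  finally obtain d where "d \<noteq> 0" "d \<odot>\<^bsub>H\<^esub> (b \<ominus>\<^bsub>H\<^esub> b') = \<zero>\<^bsub>H\<^esub>"
    using fract_tensor_kernel[OF H.ralg H.minus_closed[OF assms(1,2)]] by blast
  then have "b \<ominus>\<^bsub>H\<^esub> b' = \<zero>\<^bsub>H\<^esub>" using torsion_freeD[OF H_torsion_free] assms by blast
  then show ?thesis using H.minus_self_eq[OF assms(1,2)] by blast
qed

text \<open>The image of t_ij is divisible by q - 1 in \<open>H\<close>, so that of (q-1)^{-1} t_ij,
  a priori only an element of the extension to k(q), comes from \<open>H\<close>.\<close>

lemma tau_exists:
  assumes "i \<in> {r<..n}" "j \<in> {1..r}"
  obtains b where "b \<in> carrier H" "th i j = q1 \<odot>\<^bsub>H\<^esub> b" "loc_map (P.dq (cell_coord n r i j)) = HK.pt b 1"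
proof -
  note t = coord_E[OF assms] and L = loc_to_hat_coord[OF assms]
  obtain b where b: "b \<in> carrier H" "th i j = q1 \<odot>\<^bsub>H\<^esub> b" using H.near_zeroD[OF th_near[OF assms]] by blast
  have "cell_coord n r i j \<ominus>\<^bsub>E\<^esub> counit (cell_coord n r i j) \<odot>\<^bsub>E\<^esub> \<one>\<^bsub>E\<^esub> = cell_coord n r i j"
    using t counit_coord[OF assms] by (simp add: P.A.minus_eq)
  then have "loc_map (P.dq (cell_coord n r i j)) = HK.pt (q1 \<odot>\<^bsub>H\<^esub> b) (P.ph 1)"
    using loc_map_pure[OF t] L b(2) by (simp add: P.dq_def)
  also have "\<dots> = HK.pt b (q1 \<odot>\<^bsub>fract_alg\<^esub> P.ph 1)" using b(1) HK.pt_smult_l[of b "P.ph 1" q1] HK.pt_smult_r[of b "P.ph 1" q1] by (simp del: fract_alg_simps(6))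
  also have "q1 \<odot>\<^bsub>fract_alg\<^esub> P.ph 1 = 1" using P.ph_simps(3)[of 0] P.ph_simps(1) by simp
  finally show thesis using that b by blast
qed

abbreviation "e \<equiv> OGP_embed n r :: 'k vee_elem \<Rightarrow> 'k vee_elem hat"

lemma embed_unique: "b \<in> carrier H \<Longrightarrow> HK.pt b 1 = loc_map y \<Longrightarrow> e y = b"
  unfolding OGP_embed_def by (rule some_equality) (auto intro: hat_pt_inj)

text \<open>The elements of \<open>VE\<close> whose image in the extension to k(q) comes from
  \<open>H\<close> form a subalgebra, and by \<open>tau_exists\<close> it contains the
  generators.\<close>

lemma embed: assumes "y \<in> carrier VE" shows "e y \<in> carrier H" "HK.pt (e y) 1 = loc_map y"
proof -
  have im: "subalg HK.T ((\<lambda>b. HK.pt b 1) ` carrier H)"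
    using subalg_image[OF H.ralg HK.ralg_tensor HK.ahom_pt_l] by simp
  have "carrier VE \<subseteq> {y \<in> carrier VE. loc_map y \<in> (\<lambda>b. HK.pt b 1) ` carrier H}"
  proof (rule VE_generated)
    show "subalg VE {y \<in> carrier VE. loc_map y \<in> (\<lambda>b. HK.pt b 1) ` carrier H}"
      using subalg_preimage[OF VE.ralg HK.ralg_tensor _ im] ahom_comp[OF P.ahom_V_inc ahom_loc_map] by (simp add: VE_eq)
    fix i j assume ij: "i \<in> {r<..n}" "j \<in> {1..r}"
    from tau_exists[OF this] obtain b where "b \<in> carrier H" "loc_map (P.dq (cell_coord n r i j)) = HK.pt b 1" by metis
    then show "P.dq (cell_coord n r i j) \<in> {y \<in> carrier VE. loc_map y \<in> (\<lambda>b. HK.pt b 1) ` carrier H}"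
      using P.dq_gen[OF coord_E[OF ij]] by (auto simp: VE_eq)
  qed
  from subsetD[OF this assms] have "loc_map y \<in> (\<lambda>b. HK.pt b 1) ` carrier H" by simp
  then obtain b where b: "loc_map y = HK.pt b 1" "b \<in> carrier H" by (rule imageE)
  have "e y = b" by (rule embed_unique[OF b(2) b(1)[symmetric]])
  then show "e y \<in> carrier H" "HK.pt (e y) 1 = loc_map y" by (simp_all only: b)
qed

lemma ahom_embed: "ahom VE H e"
proof -
  have l: "ahom VE HK.T loc_map" using ahom_comp[OF P.ahom_V_inc ahom_loc_map] by (simp add: VE_eq)
  note p = ahomD[OF HK.ahom_pt_l, simplified]
  show ?thesis
  proof (intro ahomI linI)
    show "e \<one>\<^bsub>VE\<^esub> = \<one>\<^bsub>H\<^esub>" by (rule embed_unique) (use p(2) ahomD(2)[OF l] in auto)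
  qed (auto intro!: embed_unique simp: embed p(4-6) ahomD(4-6)[OF l])
qed

lemma embed_tau:
  assumes "i \<in> {r<..n}" "j \<in> {1..r}"
  shows "th i j = q1 \<odot>\<^bsub>H\<^esub> e (P.dq (cell_coord n r i j))"
proof -
  obtain b where "b \<in> carrier H" "th i j = q1 \<odot>\<^bsub>H\<^esub> b" "loc_map (P.dq (cell_coord n r i j)) = HK.pt b 1"
    using tau_exists[OF assms] .
  then show ?thesis using embed_unique[of b] by simp
qed

lemma embed_base: assumes "a \<in> carrier E" shows "e (P.K.pt a 1) = loc_to_hat n r a"
  by (rule embed_unique) (use assms loc_map_pure ahomD(3)[OF ahom_E[OF ahom_loc_to_hat]] in auto)

sublocale emb: hat_extension VE VA q1 e
  by (intro hat_extension.intro hat_extension_axioms.intro VE.completing_axioms VA.completing_axioms)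
    (use ahomD(1)[OF ahom_embed] in \<open>simp add: H_eq\<close>)

abbreviation "eh \<equiv> OGP_hat_embed n r :: 'k vee_elem hat \<Rightarrow> 'k vee_elem hat"

lemma ahom_eh: "ahom CE H eh"
  unfolding OGP_hat_embed_def CE_eq H_eq by (rule emb.ahom_hat_ext) (use ahom_embed in \<open>simp add: H_eq\<close>)

lemma eh_to_completion: "y \<in> carrier VE \<Longrightarrow> eh (to_completion q1 VE y) = e y"
  unfolding OGP_hat_embed_def by (rule emb.hat_ext_to_completion)

text \<open>The matrix \<open>E\<close> of the factorization \<open>x\<^sub>l\<^sub>c = \<Sum>\<^sub>s E\<^sub>l\<^sub>s x\<^sub>s\<^sub>c\<close>, with entries in the completed big cell.\<close>

definition cell :: "nat \<Rightarrow> nat \<Rightarrow> 'k vee_elem hat" where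
  "cell i j = (if i \<le> r then (if i = j then \<one>\<^bsub>CE\<^esub> else \<zero>\<^bsub>CE\<^esub>)
    else to_completion q1 VE (P.K.pt (cell_coord n r i j) 1))"

lemma eh_cell: "j \<in> {1..r} \<Longrightarrow> i \<in> {1..n} \<Longrightarrow>
    eh (cell i j) = (if i \<le> r then (if i = j then \<one>\<^bsub>H\<^esub> else \<zero>\<^bsub>H\<^esub>) else th i j)"
proof (cases "i \<le> r")
  case True
  then show ?thesis by (simp add: cell_def ahomD(2)[OF ahom_eh] lin_zero[OF CE.ralg H.ralg ahomD(1)[OF ahom_eh]])
next
  case False
  assume "j \<in> {1..r}" "i \<in> {1..n}"
  with False have ij: "i \<in> {r<..n}" "j \<in> {1..r}" by auto
  have "P.K.pt (cell_coord n r i j) 1 \<in> carrier VE" unfolding VE_eq by (rule P.V_base[OF coord_E[OF ij]])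
  then have "eh (to_completion q1 VE (P.K.pt (cell_coord n r i j) 1)) = th i j"
    using eh_to_completion embed_base[OF coord_E[OF ij]] loc_to_hat_coord[OF ij] by metis
  then show ?thesis using False by (simp add: cell_def)
qed

lemma near_cell: assumes "j \<in> {1..r}" "i \<in> {1..n}" shows "CE.near q1 (if i = j then 1 else 0) (cell i j)"
proof (cases "i \<le> r")
  case True
  then show ?thesis by (simp add: cell_def CE.near_one CE.near_zero)
next
  case False
  then have i: "i \<in> {r<..n}" using assms by auto
  have "ralg.near VE q1 0 (P.K.pt (cell_coord n r i j) 1)"
    using P.near_base[OF coord_E[OF i assms(1)]] counit_coord[OF i assms(1)] by (simp add: VE_eq)
  from near_hom[OF VE.ralg VE.ahom_to_completion this VE.ralg_completion]
  show ?thesis using False i assms by (auto simp: cell_def CE_eq)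
qed

text \<open>For i \<le> r the row i of \<open>cell\<close> is a unit vector. For i > r this is
  \<open>cell_factorization\<close>, applicable because \<open>\<xi>\<close> is a quantum matrix
  congruent to the identity and \<open>d0\<close> is a unit.\<close>

lemma xi_factor:
  assumes "i \<in> {1..n}" "c \<in> {1..r}"
  shows "\<xi> i c = (\<Oplus>\<^bsub>H\<^esub>s\<in>{1..r}. eh (cell i s) \<otimes>\<^bsub>H\<^esub> \<xi> s c)"
proof (cases "i \<le> r")
  case True
  have x: "\<xi> s c \<in> carrier H" if "s \<in> {1..r}" for s using qmatD(1)[OF qmat_xi] that assms r by auto
  have "(\<Oplus>\<^bsub>H\<^esub>s\<in>{1..r}. eh (cell i s) \<otimes>\<^bsub>H\<^esub> \<xi> s c) = (\<Oplus>\<^bsub>H\<^esub>s\<in>{1..r}. if i = s then \<xi> s c else \<zero>\<^bsub>H\<^esub>)"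
    using x True assms by (intro H.finsum_cong' refl) (auto simp: eh_cell)
  also have "\<dots> = \<xi> i c" using x True assms by (intro H.finsum_singleton[where f = "\<lambda>s. \<xi> s c"]) auto
  finally show ?thesis by (rule sym)
next
  case False
  then have i: "i \<in> {r<..n}" using assms by auto
  have "\<xi> i c = (\<Oplus>\<^bsub>H\<^esub>s\<in>{1..r}. th i s \<otimes>\<^bsub>H\<^esub> \<xi> s c)"
    unfolding th_def d0_qdet
    by (rule cell_factorization[OF H.cralg_axioms qmat_xi r near_xi _ i assms(2)]) (use d0_unit d0_qdet in auto)
  also have "\<dots> = (\<Oplus>\<^bsub>H\<^esub>s\<in>{1..r}. eh (cell i s) \<otimes>\<^bsub>H\<^esub> \<xi> s c)"
    using i assms r H.near_closed[OF th_near[OF i]] qmatD(1)[OF qmat_xi]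
    by (intro H.finsum_cong' refl Pi_I H.m_closed) (auto simp: eh_cell ahomD(3)[OF ahom_eh])
  finally show ?thesis .
qed

end

section \<open>The completed coproduct\<close>

context grassmannian begin

section \<open>Tensor squares and their torsion\<close>

abbreviation "B2 \<equiv> tensor_alg G.AK G.AK"
abbreviation "V2 \<equiv> tensor_alg VA VA"
abbreviation "T \<equiv> tensor_alg H H"
abbreviation "U \<equiv> ctensor_alg q1 H H"

sublocale B2: tensor G.AK G.AK by (intro tensor.intro G.K.ralg_tensor)
sublocale V2: tensor VA VA by (intro tensor.intro VA.ralg)
sublocale T: tensor H H by (intro tensor.intro H.ralg)
sublocale A2: tensor A A by (intro tensor.intro G.A.ralg)

lemma B2_torsion_free: "torsion_free q1 B2"
  by (rule B2.torsion_free_tensor[OF G.AK_torsion_free G.AK_torsion_free laurent_residue]) (rule q1_nonzero)+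

lemma V2_torsion_free: "torsion_free q1 V2"
  by (rule V2.torsion_free_tensor[OF VA_torsion_free VA_torsion_free laurent_residue])

lemma T_torsion_free: "torsion_free q1 T"
  by (rule T.torsion_free_tensor[OF H_torsion_free H_torsion_free laurent_residue]) (rule q1_nonzero)+

sublocale CT: completing T q1 by (unfold_locales)

lemma U_eq: "U = CT.C" by (simp add: ctensor_alg_def)

sublocale U: cralg U q1 unfolding U_eq by (rule CT.cralg_completion)

lemma U_torsion_free: "torsion_free q1 U"
  unfolding torsion_free_def U_eq using CT.completion_torsion_free torsion_freeD[OF T_torsion_free] by blast

lemma ahom_T_U: "ahom T U (to_completion q1 T)" unfolding U_eq by (rule CT.ahom_to_completion)

text \<open>The action of k(q) on the tensor square, realized by elements of the algebra: as a
  record the tensor square has only Laurent polynomials as scalars.\<close>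

definition scal :: "'k laurent fract \<Rightarrow> ('k laurent, 'k vee_elem, 'k vee_elem) tensor" where
  "scal c = B2.pt (G.K.pt \<one>\<^bsub>A\<^esub> c) \<one>\<^bsub>G.AK\<^esub>"

lemma ahom_scal: "ahom fract_alg B2 scal"
  unfolding scal_def[abs_def] by (rule ahom_comp[OF G.K.ahom_pt_r B2.ahom_pt_l])

lemma scal_closed [simp]: "scal c \<in> carrier B2" using ahomD(3)[OF ahom_scal] by simp

text \<open>Moves scalars past the coproduct of an element of \<open>A\<close>, which makes
  \<open>base_Delta\<close> multiplicative.\<close>

lemma scal_central: assumes "x \<in> carrier B2" shows "scal c \<otimes>\<^bsub>B2\<^esub> x = x \<otimes>\<^bsub>B2\<^esub> scal c"
proof -
  have K: "G.K.pt \<one>\<^bsub>A\<^esub> c \<otimes>\<^bsub>G.AK\<^esub> u = u \<otimes>\<^bsub>G.AK\<^esub> G.K.pt \<one>\<^bsub>A\<^esub> c" if "u \<in> carrier G.AK" for u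
    using that
  proof (induction u rule: G.K.tensor_induct)
    case (pure a b)
    then show ?case by (simp add: G.K.pt_mult mult.commute)
  next
    case (add x y)
    then show ?case by (simp add: G.K.T.r_distr G.K.T.l_distr)
  qed
  from assms show ?thesis
  proof (induction x rule: B2.tensor_induct)
    case (pure a b)
    then show ?case unfolding scal_def by (simp add: B2.pt_mult K)
  next
    case (add x y)
    then show ?case by (simp add: B2.T.r_distr B2.T.l_distr)
  qed
qed

definition mu :: "'k word_poly set \<Rightarrow> ('k laurent, 'k vee_elem, 'k vee_elem) tensor" where
  "mu a = tensor_map G.AK G.AK (to_base n) (to_base n) (OG_Delta n a)"

lemma ahom_to_base: "ahom A G.AK (to_base n)" using G.K.ahom_pt_l by simp

lemma ahom_mu: "ahom A B2 mu"
  unfolding mu_def[abs_def]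
  by (rule ahom_comp[OF ahom_OG_Delta ahom_tensor_map[OF G.A.ralg G.A.ralg G.K.ralg_tensor G.K.ralg_tensor ahom_to_base ahom_to_base]])

lemma base_Delta_eq: "base_Delta n = tensor_lift B2 (\<lambda>a c. scal c \<otimes>\<^bsub>B2\<^esub> mu a)"
  unfolding base_Delta_def scal_def mu_def ..

lemma ahom_base_Delta: "ahom G.AK B2 (base_Delta n)"
  and base_Delta_pt: "a \<in> carrier A \<Longrightarrow> base_Delta n (G.K.pt a c) = scal c \<otimes>\<^bsub>B2\<^esub> mu a"
proof -
  note m = ahomD(2-6)[OF ahom_mu] and s = ahomD(2-6)[OF ahom_scal, simplified]
  have b: "bilin A fract_alg B2 (\<lambda>a c. scal c \<otimes>\<^bsub>B2\<^esub> mu a)"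
    unfolding bilin_def
  proof (intro conjI ballI linI)
    fix a b and c assume a: "a \<in> carrier A"
    show "scal (b \<oplus>\<^bsub>fract_alg\<^esub> c) \<otimes>\<^bsub>B2\<^esub> mu a = scal b \<otimes>\<^bsub>B2\<^esub> mu a \<oplus>\<^bsub>B2\<^esub> scal c \<otimes>\<^bsub>B2\<^esub> mu a"
      using a m(2) s(3)[of b c] by (simp add: B2.T.l_distr)
  next
    fix a c and d :: "'k laurent fract" assume a: "a \<in> carrier A"
    show "scal (c \<odot>\<^bsub>fract_alg\<^esub> d) \<otimes>\<^bsub>B2\<^esub> mu a = c \<odot>\<^bsub>B2\<^esub> (scal d \<otimes>\<^bsub>B2\<^esub> mu a)"
      using a m(2) s(4)[of c d] by (simp add: B2.T.smult_mult_l)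
  qed (simp_all add: m B2.T.r_distr B2.T.smult_mult_r)
  have mult: "scal (c \<otimes>\<^bsub>fract_alg\<^esub> c') \<otimes>\<^bsub>B2\<^esub> mu (a \<otimes>\<^bsub>A\<^esub> a') = (scal c \<otimes>\<^bsub>B2\<^esub> mu a) \<otimes>\<^bsub>B2\<^esub> (scal c' \<otimes>\<^bsub>B2\<^esub> mu a')"
    if "a \<in> carrier A" "a' \<in> carrier A" for a a' c c'
  proof -
    note cl = scal_closed[of c] scal_closed[of c'] m(2)[OF that(1)] m(2)[OF that(2)]
    have "scal (c * c') = scal c \<otimes>\<^bsub>B2\<^esub> scal c'" by (rule s(5))
    then have "scal (c \<otimes>\<^bsub>fract_alg\<^esub> c') \<otimes>\<^bsub>B2\<^esub> mu (a \<otimes>\<^bsub>A\<^esub> a') = scal c \<otimes>\<^bsub>B2\<^esub> (scal c' \<otimes>\<^bsub>B2\<^esub> mu a) \<otimes>\<^bsub>B2\<^esub> mu a'"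
      using m(5)[OF that] cl by (simp add: B2.T.m_assoc)
    also have "\<dots> = (scal c \<otimes>\<^bsub>B2\<^esub> mu a) \<otimes>\<^bsub>B2\<^esub> (scal c' \<otimes>\<^bsub>B2\<^esub> mu a')"
      unfolding scal_central[OF cl(3), of c'] using cl by (simp add: B2.T.m_assoc)
    finally show ?thesis .
  qed
  have one: "scal \<one>\<^bsub>fract_alg\<^esub> \<otimes>\<^bsub>B2\<^esub> mu \<one>\<^bsub>A\<^esub> = \<one>\<^bsub>B2\<^esub>" using m(1) s(1) by simp
  show "ahom G.AK B2 (base_Delta n)" unfolding base_Delta_eq
    by (rule G.K.ahom_tensor_lift[OF B2.ralg_tensor b one mult])
  show "a \<in> carrier A \<Longrightarrow> base_Delta n (G.K.pt a c) = scal c \<otimes>\<^bsub>B2\<^esub> mu a" unfolding base_Delta_eq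
    by (rule G.K.tensor_lift_pt[OF B2.ralg_tensor b]) auto
qed

lemma base_Delta_base: "a \<in> carrier A \<Longrightarrow> base_Delta n (to_base n a) = mu a"
  using base_Delta_pt[of a 1] ahomD(2)[OF ahom_scal] ahomD(3)[OF ahom_mu] by simp

abbreviation "inc \<equiv> tensor_map G.AK G.AK (\<lambda>x. x) (\<lambda>x. x)
  :: ('k laurent, 'k vee_elem, 'k vee_elem) tensor \<Rightarrow> ('k laurent, 'k vee_elem, 'k vee_elem) tensor"

lemma ahom_VA_AK: "ahom VA G.AK (\<lambda>x. x)" unfolding VA_eq by (rule G.ahom_V_inc)

lemma ahom_inc: "ahom V2 B2 inc"
  by (rule ahom_tensor_map[OF VA.ralg VA.ralg G.K.ralg_tensor G.K.ralg_tensor ahom_VA_AK ahom_VA_AK])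

lemma inc_pt: "a \<in> carrier VA \<Longrightarrow> b \<in> carrier VA \<Longrightarrow> inc (V2.pt a b) = B2.pt a b"
  by (rule tensor_map_pure[OF VA.ralg VA.ralg G.K.ralg_tensor G.K.ralg_tensor ahomD(1)[OF ahom_VA_AK] ahomD(1)[OF ahom_VA_AK]])

lemma to_base_VA: "a \<in> carrier A \<Longrightarrow> to_base n a \<in> carrier VA"
  unfolding VA_eq by (rule G.V_base)

text \<open>An explicit lift of the coproduct of a generator to the tensor square of
  \<open>OG_vee n\<close>, to be compared with the lift chosen in \<open>vee_Delta\<close>. The last
  case is meant for \<open>Dinv\<close>.\<close>

definition gen_Delta :: "gen \<Rightarrow> ('k laurent, 'k vee_elem, 'k vee_elem) tensor" where
  "gen_Delta g = (case g of
      X i j \<Rightarrow> \<Oplus>\<^bsub>V2\<^esub>k\<in>{1..n}. V2.pt (to_base n (OG_gen n (X i k))) (to_base n (OG_gen n (X k j)))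
    | _ \<Rightarrow> V2.pt (to_base n (OG_gen n Dinv)) (to_base n (OG_gen n Dinv)))"

lemma gen_cases: assumes "g \<in> GL_gens n"
  obtains i j where "g = X i j" "i \<in> {1..n}" "j \<in> {1..n}" | "g = Dinv"
  using assms unfolding GL_gens_def by auto

lemma near_gen: "g \<in> GL_gens n \<Longrightarrow> VA.near q1 (counit_gen g) (to_base n (OG_gen n g))"
  using G.near_base[OF OG_gen_closed, of g] counit_OG_gen[of g n, where 'k = 'k] by (simp add: VA_eq)

lemma near_pt:
  assumes "VA.near q1 c x" "VA.near q1 d y" shows "V2.T.near q1 (c * d) (V2.pt x y)"
proof -
  have cl: "x \<in> carrier VA" "y \<in> carrier VA" using VA.near_closed assms by blast+
  have "V2.T.near q1 (c * d) (V2.pt x \<one>\<^bsub>VA\<^esub> \<otimes>\<^bsub>V2\<^esub> V2.pt \<one>\<^bsub>VA\<^esub> y)"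
    by (rule V2.T.near_mult[OF near_hom[OF VA.ralg V2.ahom_pt_l assms(1) V2.ralg_tensor] near_hom[OF VA.ralg V2.ahom_pt_r assms(2) V2.ralg_tensor]])
  then show ?thesis using cl by (simp add: V2.pt_mult)
qed

lemma sum_delta: "i \<in> {1..n} \<Longrightarrow> (\<Sum>k\<in>{1..n}. (if i = k then 1 else 0) * (if k = j then 1 else 0)) = (if i = j then 1 else (0 :: 'k laurent))"
  by (subst sum.remove[of _ i]) auto

text \<open>The matrix entries are congruent to their counits, and the identity matrix is its own
  square.\<close>

lemma near_gen_Delta: assumes "g \<in> GL_gens n" shows "V2.T.near q1 (counit_gen g) (gen_Delta g)"
  using assms
proof (cases rule: gen_cases)
  case (1 i j)
  have "V2.T.near q1 (\<Sum>k\<in>{1..n}. counit_gen (X i k) * counit_gen (X k j)) (gen_Delta g)"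
    unfolding gen_Delta_def 1 gen.case
    by (intro V2.T.near_finsum near_pt near_gen GL_gens_X 1)
  then show ?thesis using sum_delta[OF 1(2), of j] by (simp add: counit_gen_def 1)
next
  case 2
  have "V2.T.near q1 (counit_gen Dinv * counit_gen Dinv) (gen_Delta Dinv)"
    unfolding gen_Delta_def gen.case by (intro near_pt near_gen GL_gens_Dinv)
  then show ?thesis by (simp add: counit_gen_def 2)
qed

lemma inc_gen_Delta: assumes "g \<in> GL_gens n" shows "inc (gen_Delta g) = mu (OG_gen n g)"
proof -
  note gc = OG_gen_closed
  have t: "tensor_map G.AK G.AK (to_base n) (to_base n) (A2.pt a b) = B2.pt (to_base n a) (to_base n b)"
    if "a \<in> carrier A" "b \<in> carrier A" for a b
    by (rule tensor_map_pure[OF G.A.ralg G.A.ralg G.K.ralg_tensor G.K.ralg_tensor ahomD(1)[OF ahom_to_base] ahomD(1)[OF ahom_to_base] that])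
  have l: "lin A2.T B2 (tensor_map G.AK G.AK (to_base n) (to_base n))"
    by (rule lin_tensor_map[OF G.A.ralg G.A.ralg G.K.ralg_tensor G.K.ralg_tensor ahomD(1)[OF ahom_to_base] ahomD(1)[OF ahom_to_base]])
  from assms show ?thesis
  proof (cases rule: gen_cases)
    case (1 i j)
    have c: "k \<in> {1..n} \<Longrightarrow> OG_gen n (X i k) \<in> carrier A" "k \<in> {1..n} \<Longrightarrow> OG_gen n (X k j) \<in> carrier A" for k
      using gc GL_gens_X 1 by blast+
    have "inc (gen_Delta g) = (\<Oplus>\<^bsub>B2\<^esub>k\<in>{1..n}. inc (V2.pt (to_base n (OG_gen n (X i k))) (to_base n (OG_gen n (X k j)))))"
      unfolding gen_Delta_def 1 gen.case
      by (rule lin_finsum[OF V2.ralg_tensor B2.ralg_tensor ahomD(1)[OF ahom_inc]]) (use c to_base_VA in auto)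
    also have "\<dots> = (\<Oplus>\<^bsub>B2\<^esub>k\<in>{1..n}. tensor_map G.AK G.AK (to_base n) (to_base n) (A2.pt (OG_gen n (X i k)) (OG_gen n (X k j))))"
      using c to_base_VA by (intro B2.T.finsum_cong' refl Pi_I linD(1)[OF l]) (auto simp: inc_pt t)
    also have "\<dots> = tensor_map G.AK G.AK (to_base n) (to_base n) (Delta_gen n (X i j))"
      unfolding Delta_gen_def gen.case
      by (rule lin_finsum[OF A2.ralg_tensor B2.ralg_tensor l, symmetric]) (use c in auto)
    also have "\<dots> = mu (OG_gen n g)" unfolding mu_def 1(1)[symmetric] OG_Delta_gen[OF assms] ..
    finally show ?thesis .
  next
    case 2
    have c: "OG_gen n Dinv \<in> carrier A" by (rule OG_gen_closed[OF GL_gens_Dinv])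
    show ?thesis unfolding mu_def OG_Delta_gen[OF assms] unfolding 2 gen_Delta_def Delta_gen_def gen.case
      using c to_base_VA[OF c] by (simp add: t inc_pt)
  qed
qed

text \<open>It suffices to treat (g - \<epsilon>(g)) / (q-1) for generators g. The explicit lift of
  \<Delta>(g) has the form \<epsilon>(g) + (q-1) y, and y is the lift sought: multiplied by q - 1,
  its image agrees with the coproduct of the quotient, and the tensor square of
  \<open>OG_base n\<close> has no (q-1)-torsion.\<close>

lemma vee_Delta_exists:
  assumes "v \<in> carrier VA" shows "base_Delta n v \<in> inc ` carrier V2"
proof -
  let ?S = "{v \<in> carrier G.AK. base_Delta n v \<in> inc ` carrier V2}"
  have "carrier G.V \<subseteq> ?S"
  proof (rule G.V_generated[of _ "OG_gen n ` GL_gens n"])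
    show "subalg G.AK ?S"
      by (rule subalg_preimage[OF G.K.ralg_tensor B2.ralg_tensor ahom_base_Delta subalg_image[OF V2.ralg_tensor B2.ralg_tensor ahom_inc]])
    show "OG_gen n ` GL_gens n \<subseteq> carrier A" using OG_gen_closed by blast
    show "carrier A \<subseteq> Q" if Q: "subalg A Q" "OG_gen n ` GL_gens n \<subseteq> Q" for Q
      unfolding OG_eq using Q by (intro presentation.pres_generated[OF GL_pres]) (auto simp: OG_eq)
    fix a :: "'k word_poly set" assume "a \<in> OG_gen n ` (GL_gens n)"
    then obtain g where g: "g \<in> GL_gens n" "a = OG_gen n g" by blast
    have a: "a \<in> carrier A" unfolding g(2) by (rule OG_gen_closed[OF g(1)])
    obtain y where y: "y \<in> carrier V2" "gen_Delta g = counit_gen g \<odot>\<^bsub>V2\<^esub> \<one>\<^bsub>V2\<^esub> \<oplus>\<^bsub>V2\<^esub> q1 \<odot>\<^bsub>V2\<^esub> y"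
      using near_gen_Delta[OF g(1)] unfolding V2.T.near_def by blast
    have d: "G.dq a \<in> carrier G.AK" by (rule G.dq_closed[OF a])
    note I = ahomD(2-5)[OF ahom_inc] and D = ahomD(2-5)[OF ahom_base_Delta]
    have "counit_gen g \<odot>\<^bsub>B2\<^esub> \<one>\<^bsub>B2\<^esub> \<oplus>\<^bsub>B2\<^esub> q1 \<odot>\<^bsub>B2\<^esub> base_Delta n (G.dq a) = base_Delta n (to_base n a)"
      using G.pt_dq[OF a] d counit_OG_gen[OF g(1), where 'k = 'k] g(2)
      by (simp add: D)
    also have "\<dots> = inc (gen_Delta g)" using base_Delta_base[OF a] inc_gen_Delta[OF g(1)] g(2) by simp
    also have "\<dots> = counit_gen g \<odot>\<^bsub>B2\<^esub> \<one>\<^bsub>B2\<^esub> \<oplus>\<^bsub>B2\<^esub> q1 \<odot>\<^bsub>B2\<^esub> inc y"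
      using y by (simp add: I)
    finally have "q1 \<odot>\<^bsub>B2\<^esub> base_Delta n (G.dq a) = q1 \<odot>\<^bsub>B2\<^esub> inc y"
      using B2.T.add_minus_left[of "counit_gen g \<odot>\<^bsub>B2\<^esub> \<one>\<^bsub>B2\<^esub>"] B2.T.smult_closed[OF D(2)[OF d]] B2.T.smult_closed[OF I(2)[OF y(1)]]
        B2.T.smult_closed[OF B2.T.one_closed] by metis
    then have "q1 \<odot>\<^bsub>B2\<^esub> (base_Delta n (G.dq a) \<ominus>\<^bsub>B2\<^esub> inc y) = \<zero>\<^bsub>B2\<^esub>"
      unfolding B2.T.smult_diff_r[OF D(2)[OF d] I(2)[OF y(1)]]
      using B2.T.minus_self_eq[OF B2.T.smult_closed[OF D(2)[OF d]] B2.T.smult_closed[OF I(2)[OF y(1)]]] by blast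
    then have "base_Delta n (G.dq a) \<ominus>\<^bsub>B2\<^esub> inc y = \<zero>\<^bsub>B2\<^esub>"
      by (rule torsion_freeD[OF B2_torsion_free B2.T.minus_closed[OF D(2)[OF d] I(2)[OF y(1)]]])
    then have "base_Delta n (G.dq a) = inc y" using B2.T.minus_self_eq[OF D(2)[OF d] I(2)[OF y(1)]] by blast
    then show "G.dq a \<in> ?S" using d y(1) by blast
  qed
  then show ?thesis using assms unfolding VA_eq by blast
qed

lemma vee_Delta: assumes "v \<in> carrier VA"
  shows "vee_Delta n v \<in> carrier V2" "inc (vee_Delta n v) = base_Delta n v"
proof -
  obtain w where "base_Delta n v = inc w" "w \<in> carrier V2" using vee_Delta_exists[OF assms] by (rule imageE)
  then have "\<exists>w. w \<in> carrier V2 \<and> inc w = base_Delta n v" by metis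
  from someI_ex[OF this] show "vee_Delta n v \<in> carrier V2" "inc (vee_Delta n v) = base_Delta n v"
    unfolding vee_Delta_def by blast+
qed

section \<open>Passage to the completed tensor square\<close>

definition theta :: "('k laurent, 'k vee_elem, 'k vee_elem) tensor \<Rightarrow> ('k laurent, 'k vee_elem hat, 'k vee_elem hat) tensor hat" where
  "theta w = to_completion q1 T (tensor_map H H (to_completion q1 VA) (to_completion q1 VA) w)"

lemma ahom_theta: "ahom V2 U theta"
  unfolding theta_def[abs_def]
  by (rule ahom_comp[OF ahom_tensor_map[OF VA.ralg VA.ralg H.ralg H.ralg ahom_VA_H ahom_VA_H] ahom_T_U])

text \<open>The difference of two lifts is killed by a nonzero scalar, by
  \<open>tensor_sub_kernel\<close>, so \<open>torsion_divisible\<close> applies in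
  \<open>V2\<close>. Since \<open>U\<close> is separated, the choice made in
  \<open>vee_Delta\<close> becomes immaterial.\<close>

lemma theta_unique:
  assumes w: "w \<in> carrier V2" and w': "w' \<in> carrier V2" and eq: "inc w = inc w'" shows "theta w = theta w'"
proof -
  define x where "x = w \<ominus>\<^bsub>V2\<^esub> w'"
  have x: "x \<in> carrier V2" using w w' by (simp add: x_def)
  have V: "VA = G.AK\<lparr>carrier := carrier VA\<rparr>" using G.V_eq unfolding VA_eq .
  have "inc x = inc w \<ominus>\<^bsub>B2\<^esub> inc w'" unfolding x_def by (rule lin_diff[OF V2.ralg_tensor B2.ralg_tensor ahomD(1)[OF ahom_inc] w w'])
  also have "\<dots> = \<zero>\<^bsub>B2\<^esub>" unfolding eq using B2.T.minus_self_eq ahomD(3)[OF ahom_inc w'] by blast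
  finally have x0: "inc x = \<zero>\<^bsub>B2\<^esub>" .
  have sub: "subalg G.AK (carrier VA)" unfolding VA_eq by (rule G.subalg_V)
  have den: "\<exists>d. d \<noteq> 0 \<and> d \<odot>\<^bsub>G.AK\<^esub> a \<in> carrier VA" if "a \<in> carrier G.AK" for a
    unfolding VA_eq by (rule G.V_denominators[OF that])
  have "\<exists>d. d \<noteq> 0 \<and> d \<odot>\<^bsub>V2\<^esub> x = \<zero>\<^bsub>V2\<^esub>"
    using tensor_sub_kernel[OF G.K.ralg_tensor G.K.ralg_tensor sub sub den den, folded V, OF _ _ x] x0 by blast
  then obtain d where d: "d \<noteq> 0" "d \<odot>\<^bsub>V2\<^esub> x = \<zero>\<^bsub>V2\<^esub>" by blast
  have "\<exists>y\<in>carrier U. theta x = q1 ^ m \<odot>\<^bsub>U\<^esub> y" for m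
  proof -
    obtain y where "y \<in> carrier V2" "x = q1 ^ m \<odot>\<^bsub>V2\<^esub> y"
      using torsion_divisible[OF V2.ralg_tensor V2_torsion_free x d] by blast
    then show ?thesis using ahomD(3,5)[OF ahom_theta] by blast
  qed
  then have "theta x = \<zero>\<^bsub>U\<^esub>" by (intro U.sep ahomD(3)[OF ahom_theta x])
  then have "theta w \<ominus>\<^bsub>U\<^esub> theta w' = \<zero>\<^bsub>U\<^esub>"
    unfolding x_def lin_diff[OF V2.ralg_tensor U.ralg ahomD(1)[OF ahom_theta] w w'] .
  then show ?thesis using U.minus_self_eq ahomD(3)[OF ahom_theta] w w' by blast
qed

text \<open>The chosen lifts need not be additive or multiplicative. Their failure lies in the
  kernel of \<open>inc\<close>, where \<open>theta_unique\<close> applies.\<close>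

lemma ahom_delta: "ahom VA U (\<lambda>v. theta (vee_Delta n v))"
proof -
  note I = ahomD(2-6)[OF ahom_inc] and t = ahomD(2-6)[OF ahom_theta] and D = ahomD(2-6)[OF ahom_base_Delta]
  have k: "v \<in> carrier VA \<Longrightarrow> v \<in> carrier G.AK" for v using G.V_sub unfolding VA_eq by blast
  note o = G.V_ops[folded VA_eq]
  have bD: "base_Delta n (a \<oplus>\<^bsub>VA\<^esub> b) = base_Delta n a \<oplus>\<^bsub>B2\<^esub> base_Delta n b"
    "base_Delta n (a \<otimes>\<^bsub>VA\<^esub> b) = base_Delta n a \<otimes>\<^bsub>B2\<^esub> base_Delta n b"
    "base_Delta n (c \<odot>\<^bsub>VA\<^esub> a) = c \<odot>\<^bsub>B2\<^esub> base_Delta n a" "base_Delta n \<one>\<^bsub>VA\<^esub> = \<one>\<^bsub>B2\<^esub>"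
    if "a \<in> carrier VA" "b \<in> carrier VA" for a b c
    unfolding o using that[THEN k] by (simp_all only: D)
  note bD = bD(1-3) bD(4)[OF VA.one_closed VA.one_closed]
  show ?thesis
  proof (intro ahomI linI)
    show "theta (vee_Delta n a) \<in> carrier U" if "a \<in> carrier VA" for a by (intro t(2) vee_Delta that)
    show "theta (vee_Delta n (a \<oplus>\<^bsub>VA\<^esub> b)) = theta (vee_Delta n a) \<oplus>\<^bsub>U\<^esub> theta (vee_Delta n b)" if "a \<in> carrier VA" "b \<in> carrier VA" for a b
      unfolding t(3)[OF vee_Delta(1)[OF that(1)] vee_Delta(1)[OF that(2)], symmetric]
      by (rule theta_unique) (use that bD in \<open>simp_all add: vee_Delta I\<close>)
    show "theta (vee_Delta n (c \<odot>\<^bsub>VA\<^esub> a)) = c \<odot>\<^bsub>U\<^esub> theta (vee_Delta n a)" if "a \<in> carrier VA" for a c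
      unfolding t(4)[OF vee_Delta(1)[OF that], symmetric]
      by (rule theta_unique) (use that bD in \<open>simp_all add: vee_Delta I\<close>)
    show "theta (vee_Delta n \<one>\<^bsub>VA\<^esub>) = \<one>\<^bsub>U\<^esub>"
      unfolding t(1)[symmetric] by (rule theta_unique) (use bD in \<open>simp_all add: vee_Delta I\<close>)
    show "theta (vee_Delta n (a \<otimes>\<^bsub>VA\<^esub> b)) = theta (vee_Delta n a) \<otimes>\<^bsub>U\<^esub> theta (vee_Delta n b)" if "a \<in> carrier VA" "b \<in> carrier VA" for a b
      unfolding t(5)[OF vee_Delta(1)[OF that(1)] vee_Delta(1)[OF that(2)], symmetric]
      by (rule theta_unique) (use that bD in \<open>simp_all add: vee_Delta I\<close>)
  qed
qed

abbreviation "Dh \<equiv> Delta_hat n :: 'k vee_elem hat \<Rightarrow> ('k laurent, 'k vee_elem hat, 'k vee_elem hat) tensor hat"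

lemma Dh_eq: "Dh = hat_ext (\<lambda>v. theta (vee_Delta n v))"
  unfolding Delta_hat_def theta_def ..

sublocale del: hat_extension VA T q1 "\<lambda>v. theta (vee_Delta n v)"
  by (intro hat_extension.intro hat_extension_axioms.intro VA.completing_axioms CT.completing_axioms)
    (use ahomD(1)[OF ahom_delta] in \<open>simp add: U_eq\<close>)

lemma ahom_Dh: "ahom H U Dh"
proof -
  have "ahom VA.C CT.C (hat_ext (\<lambda>v. theta (vee_Delta n v)))"
    by (rule del.ahom_hat_ext[OF ahom_delta[unfolded U_eq]])
  then show ?thesis unfolding Dh_eq U_eq H_eq[symmetric] .
qed

abbreviation "lft x \<equiv> to_completion q1 T (T.pt x \<one>\<^bsub>H\<^esub>)"
abbreviation "rgt y \<equiv> to_completion q1 T (T.pt \<one>\<^bsub>H\<^esub> y)"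

lemma ahom_lft: "ahom H U (\<lambda>x. lft x)" by (rule ahom_comp[OF T.ahom_pt_l ahom_T_U])
lemma ahom_rgt: "ahom H U (\<lambda>x. rgt x)" by (rule ahom_comp[OF T.ahom_pt_r ahom_T_U])

text \<open>By \<open>theta_unique\<close> the chosen lift of the coproduct of an entry may be
  replaced by the explicit one.\<close>

lemma Dh_xi:
  assumes "i \<in> {1..n}" "j \<in> {1..n}"
  shows "Dh (\<xi> i j) = (\<Oplus>\<^bsub>U\<^esub>k\<in>{1..n}. lft (\<xi> i k) \<otimes>\<^bsub>U\<^esub> rgt (\<xi> k j))"
proof -
  note g = GL_gens_X[OF assms]
  note t = ahomD[OF ahom_tensor_map[OF VA.ralg VA.ralg H.ralg H.ralg ahom_VA_H ahom_VA_H]]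
  have a: "OG_gen n (X i j) \<in> carrier A" by (rule OG_gen_closed[OF g])
  have c: "k \<in> {1..n} \<Longrightarrow> to_base n (OG_gen n (X i k)) \<in> carrier VA" "k \<in> {1..n} \<Longrightarrow> to_base n (OG_gen n (X k j)) \<in> carrier VA" for k
    using to_base_VA[OF OG_gen_closed[OF GL_gens_X]] assms by blast+
  have x: "k \<in> {1..n} \<Longrightarrow> \<xi> i k \<in> carrier H" "k \<in> {1..n} \<Longrightarrow> \<xi> k j \<in> carrier H" for k
    using qmatD(1)[OF qmat_xi] assms by blast+
  have "Dh (\<xi> i j) = theta (vee_Delta n (to_base n (OG_gen n (X i j))))"
    unfolding Dh_eq OG_to_hat_def by (rule del.hat_ext_to_completion[OF to_base_VA[OF a]])
  also have "\<dots> = theta (gen_Delta (X i j))"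
    by (rule theta_unique[OF vee_Delta(1)[OF to_base_VA[OF a]] V2.T.near_closed[OF near_gen_Delta[OF g]]])
      (simp only: vee_Delta(2)[OF to_base_VA[OF a]] base_Delta_base[OF a] inc_gen_Delta[OF g])
  also have "\<dots> = (\<Oplus>\<^bsub>U\<^esub>k\<in>{1..n}. theta (V2.pt (to_base n (OG_gen n (X i k))) (to_base n (OG_gen n (X k j)))))"
    unfolding gen_Delta_def gen.case
    by (rule lin_finsum[OF V2.ralg_tensor U.ralg ahomD(1)[OF ahom_theta]]) (use c in auto)
  also have "\<dots> = (\<Oplus>\<^bsub>U\<^esub>k\<in>{1..n}. lft (\<xi> i k) \<otimes>\<^bsub>U\<^esub> rgt (\<xi> k j))"
  proof (intro U.finsum_cong' refl Pi_I U.m_closed ahomD(3)[OF ahom_lft] ahomD(3)[OF ahom_rgt] x)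
    fix k assume k: "k \<in> {1..n}"
    have "theta (V2.pt (to_base n (OG_gen n (X i k))) (to_base n (OG_gen n (X k j)))) = to_completion q1 T (T.pt (\<xi> i k) (\<xi> k j))"
      unfolding theta_def OG_to_hat_def
      by (subst tensor_map_pure[OF VA.ralg VA.ralg H.ralg H.ralg ahomD(1)[OF ahom_VA_H] ahomD(1)[OF ahom_VA_H] c[OF k]]) (rule refl)
    also have "T.pt (\<xi> i k) (\<xi> k j) = T.pt (\<xi> i k) \<one>\<^bsub>H\<^esub> \<otimes>\<^bsub>T\<^esub> T.pt \<one>\<^bsub>H\<^esub> (\<xi> k j)"
      using x[OF k] by (simp add: T.pt_mult)
    also have "to_completion q1 T \<dots> = lft (\<xi> i k) \<otimes>\<^bsub>U\<^esub> rgt (\<xi> k j)"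
      using x[OF k] by (intro ahomD(6)[OF ahom_T_U]) auto
    finally show "theta (V2.pt (to_base n (OG_gen n (X i k))) (to_base n (OG_gen n (X k j)))) = lft (\<xi> i k) \<otimes>\<^bsub>U\<^esub> rgt (\<xi> k j)" .
  qed
  finally show ?thesis .
qed

section \<open>The completed tensor product with the big cell\<close>

abbreviation "S0 \<equiv> tensor_alg H CE"
abbreviation "S \<equiv> ctensor_alg q1 H CE"

sublocale S0: tensor H CE by (intro tensor.intro H.ralg CE.ralg)
sublocale CS: completing S0 q1 by unfold_locales

lemma S_eq: "S = CS.C" by (simp add: ctensor_alg_def)

sublocale S: cralg S q1 unfolding S_eq by (rule CS.cralg_completion)

lemma ahom_S0_S: "ahom S0 S (to_completion q1 S0)" unfolding S_eq by (rule CS.ahom_to_completion)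

abbreviation "F0 \<equiv> tensor_map H H (\<lambda>a. a) eh"
abbreviation "F \<equiv> ctensor_map q1 H H (\<lambda>a. a) eh"

lemma ahom_F0: "ahom S0 T F0"
  by (rule ahom_tensor_map[OF H.ralg CE.ralg H.ralg H.ralg ahom_id ahom_eh])

lemma F0_pt: "a \<in> carrier H \<Longrightarrow> b \<in> carrier CE \<Longrightarrow> F0 (S0.pt a b) = T.pt a (eh b)"
  by (rule tensor_map_pure[OF H.ralg CE.ralg H.ralg H.ralg ahomD(1)[OF ahom_id] ahomD(1)[OF ahom_eh]])

sublocale Fx: hat_extension S0 T q1 "\<lambda>x. to_completion q1 T (F0 x)"
  by (intro hat_extension.intro hat_extension_axioms.intro CS.completing_axioms CT.completing_axioms)
    (rule lin_comp[OF ahomD(1)[OF ahom_F0] ahomD(1)[OF CT.ahom_to_completion]])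

lemma ahom_F: "ahom S U F"
  unfolding ctensor_map_def S_eq U_eq by (rule Fx.ahom_hat_ext[OF ahom_comp[OF ahom_F0 CT.ahom_to_completion]])

lemma F_to_completion: "x \<in> carrier S0 \<Longrightarrow> F (to_completion q1 S0 x) = to_completion q1 T (F0 x)"
  unfolding ctensor_map_def by (rule Fx.hat_ext_to_completion)

text \<open>The matrix \<open>C\<^sub>i\<^sub>t = \<Sum>\<^sub>k x\<^sub>i\<^sub>k \<otimes> E\<^sub>k\<^sub>t\<close>.\<close>

definition comat :: "nat \<Rightarrow> nat \<Rightarrow> ('k laurent, 'k vee_elem hat, 'k vee_elem hat) tensor hat" where
  "comat i t = to_completion q1 S0 (\<Oplus>\<^bsub>S0\<^esub>k\<in>{1..n}. S0.pt (\<xi> i k) (cell k t))"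

lemma cell_closed: "t \<in> {1..r} \<Longrightarrow> k \<in> {1..n} \<Longrightarrow> cell k t \<in> carrier CE"
  using CE.near_closed[OF near_cell] .

lemma comat_sum_closed: "i \<in> {1..n} \<Longrightarrow> t \<in> {1..r} \<Longrightarrow> (\<Oplus>\<^bsub>S0\<^esub>k\<in>{1..n}. S0.pt (\<xi> i k) (cell k t)) \<in> carrier S0"
  using qmatD(1)[OF qmat_xi] cell_closed by (intro S0.T.finsum_closed Pi_I S0.pt_closed) auto

text \<open>Modulo q - 1 both factors of C have Kronecker deltas as entries, hence so has C. This
  single statement covers the identity in the upper block and the zeros in the lower one.\<close>

lemma near_comat:
  assumes "i \<in> {1..n}" "t \<in> {1..r}" shows "S.near q1 (if i = t then 1 else 0) (comat i t)"
proof -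
  have "S0.T.near q1 (\<Sum>k\<in>{1..n}. (if i = k then 1 else 0) * (if k = t then 1 else 0)) (\<Oplus>\<^bsub>S0\<^esub>k\<in>{1..n}. S0.pt (\<xi> i k) (cell k t))"
  proof (rule S0.T.near_finsum)
    fix k assume k: "k \<in> {1..n}"
    have "S0.T.near q1 ((if i = k then 1 else 0) * (if k = t then 1 else 0)) (S0.pt (\<xi> i k) \<one>\<^bsub>CE\<^esub> \<otimes>\<^bsub>S0\<^esub> S0.pt \<one>\<^bsub>H\<^esub> (cell k t))"
      by (rule S0.T.near_mult[OF near_hom[OF H.ralg S0.ahom_pt_l near_xi[OF assms(1) k] S0.ralg_tensor]
        near_hom[OF CE.ralg S0.ahom_pt_r near_cell[OF assms(2) k] S0.ralg_tensor]])
    then show "S0.T.near q1 ((if i = k then 1 else 0) * (if k = t then 1 else 0)) (S0.pt (\<xi> i k) (cell k t))"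
      using qmatD(1)[OF qmat_xi assms(1) k] cell_closed[OF assms(2) k] by (simp add: S0.pt_mult)
  qed
  then have "S0.T.near q1 (if i = t then 1 else 0) (\<Oplus>\<^bsub>S0\<^esub>k\<in>{1..n}. S0.pt (\<xi> i k) (cell k t))"
    unfolding sum_delta[OF assms(1)] .
  from near_hom[OF S0.ralg_tensor ahom_S0_S this S.ralg] show ?thesis unfolding comat_def .
qed

lemma F_comat:
  assumes "i \<in> {1..n}" "t \<in> {1..r}"
  shows "F (comat i t) = (\<Oplus>\<^bsub>U\<^esub>k\<in>{1..n}. lft (\<xi> i k) \<otimes>\<^bsub>U\<^esub> rgt (eh (cell k t)))"
proof -
  have x: "k \<in> {1..n} \<Longrightarrow> \<xi> i k \<in> carrier H" for k using qmatD(1)[OF qmat_xi] assms by blast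
  note c = cell_closed[OF assms(2)] and E = ahomD(3)[OF ahom_eh cell_closed[OF assms(2)]]
  have "F (comat i t) = to_completion q1 T (F0 (\<Oplus>\<^bsub>S0\<^esub>k\<in>{1..n}. S0.pt (\<xi> i k) (cell k t)))"
    unfolding comat_def by (rule F_to_completion[OF comat_sum_closed[OF assms]])
  also have "F0 (\<Oplus>\<^bsub>S0\<^esub>k\<in>{1..n}. S0.pt (\<xi> i k) (cell k t)) = (\<Oplus>\<^bsub>T\<^esub>k\<in>{1..n}. F0 (S0.pt (\<xi> i k) (cell k t)))"
    by (rule lin_finsum[OF S0.ralg_tensor T.ralg_tensor ahomD(1)[OF ahom_F0]]) (use x c in blast)
  also have "\<dots> = (\<Oplus>\<^bsub>T\<^esub>k\<in>{1..n}. T.pt (\<xi> i k) \<one>\<^bsub>H\<^esub> \<otimes>\<^bsub>T\<^esub> T.pt \<one>\<^bsub>H\<^esub> (eh (cell k t)))"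
    using x c E by (intro T.T.finsum_cong' refl Pi_I T.T.m_closed T.pt_closed H.one_closed) (simp_all add: F0_pt T.pt_mult)
  also have "to_completion q1 T \<dots> = (\<Oplus>\<^bsub>U\<^esub>k\<in>{1..n}. to_completion q1 T (T.pt (\<xi> i k) \<one>\<^bsub>H\<^esub> \<otimes>\<^bsub>T\<^esub> T.pt \<one>\<^bsub>H\<^esub> (eh (cell k t))))"
    by (rule lin_finsum[OF T.ralg_tensor U.ralg ahomD(1)[OF ahom_T_U]]) (use x E in \<open>intro Pi_I T.T.m_closed T.pt_closed H.one_closed\<close>)
  also have "\<dots> = (\<Oplus>\<^bsub>U\<^esub>k\<in>{1..n}. lft (\<xi> i k) \<otimes>\<^bsub>U\<^esub> rgt (eh (cell k t)))"
    using x E by (intro U.finsum_cong' refl Pi_I U.m_closed ahomD(3)[OF ahom_lft] ahomD(3)[OF ahom_rgt] ahomD(6)[OF ahom_T_U] T.pt_closed H.one_closed)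
  finally show ?thesis .
qed

text \<open>Only the second tensor factor is rewritten: \<open>rgt\<close> is a homomorphism and
  carries \<open>xi_factor\<close> into \<open>U\<close>; exchanging the sums over k and t then
  collects C.\<close>

lemma Dh_xi_comat:
  assumes "i \<in> {1..n}" "c \<in> {1..r}"
  shows "Dh (\<xi> i c) = (\<Oplus>\<^bsub>U\<^esub>t\<in>{1..r}. F (comat i t) \<otimes>\<^bsub>U\<^esub> rgt (\<xi> t c))"
proof -
  have rn: "a \<in> {1..r} \<Longrightarrow> a \<in> {1..n}" for a using r by auto
  note x = qmatD(1)[OF qmat_xi] and E = ahomD(3)[OF ahom_eh cell_closed]
  note L = ahomD(3)[OF ahom_lft x] and R = ahomD(3)[OF ahom_rgt x] and RE = ahomD(3)[OF ahom_rgt E]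
  have "Dh (\<xi> i c) = (\<Oplus>\<^bsub>U\<^esub>k\<in>{1..n}. lft (\<xi> i k) \<otimes>\<^bsub>U\<^esub> rgt (\<xi> k c))"
    by (rule Dh_xi[OF assms(1) rn[OF assms(2)]])
  also have "\<dots> = (\<Oplus>\<^bsub>U\<^esub>k\<in>{1..n}. \<Oplus>\<^bsub>U\<^esub>t\<in>{1..r}. lft (\<xi> i k) \<otimes>\<^bsub>U\<^esub> rgt (eh (cell k t)) \<otimes>\<^bsub>U\<^esub> rgt (\<xi> t c))"
  proof (rule U.finsum_cong'[OF refl])
    show "(\<lambda>k. \<Oplus>\<^bsub>U\<^esub>t\<in>{1..r}. lft (\<xi> i k) \<otimes>\<^bsub>U\<^esub> rgt (eh (cell k t)) \<otimes>\<^bsub>U\<^esub> rgt (\<xi> t c)) \<in> {1..n} \<rightarrow> carrier U"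
      using rn assms by (intro Pi_I U.finsum_closed U.m_closed L R RE; blast)
    fix k assume k: "k \<in> {1..n}"
    have "rgt (\<xi> k c) = (\<Oplus>\<^bsub>U\<^esub>t\<in>{1..r}. rgt (eh (cell k t) \<otimes>\<^bsub>H\<^esub> \<xi> t c))"
      unfolding xi_factor[OF k assms(2)]
      by (rule lin_finsum[OF H.ralg U.ralg ahomD(1)[OF ahom_rgt]]) (use k rn assms in \<open>intro Pi_I H.m_closed E x; blast\<close>)
    also have "\<dots> = (\<Oplus>\<^bsub>U\<^esub>t\<in>{1..r}. rgt (eh (cell k t)) \<otimes>\<^bsub>U\<^esub> rgt (\<xi> t c))"
      using k rn assms by (intro U.finsum_cong' refl Pi_I U.m_closed R RE ahomD(6)[OF ahom_rgt] E x; blast)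
    finally have "lft (\<xi> i k) \<otimes>\<^bsub>U\<^esub> rgt (\<xi> k c) = lft (\<xi> i k) \<otimes>\<^bsub>U\<^esub> (\<Oplus>\<^bsub>U\<^esub>t\<in>{1..r}. rgt (eh (cell k t)) \<otimes>\<^bsub>U\<^esub> rgt (\<xi> t c))" by (rule arg_cong)
    also have "\<dots> = (\<Oplus>\<^bsub>U\<^esub>t\<in>{1..r}. lft (\<xi> i k) \<otimes>\<^bsub>U\<^esub> (rgt (eh (cell k t)) \<otimes>\<^bsub>U\<^esub> rgt (\<xi> t c)))"
      using k rn assms by (intro U.finsum_rdistr finite_atLeastAtMost Pi_I U.m_closed L R RE; blast)
    also have "\<dots> = (\<Oplus>\<^bsub>U\<^esub>t\<in>{1..r}. lft (\<xi> i k) \<otimes>\<^bsub>U\<^esub> rgt (eh (cell k t)) \<otimes>\<^bsub>U\<^esub> rgt (\<xi> t c))"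
      using k rn assms by (intro U.finsum_cong' refl Pi_I U.m_closed U.m_assoc[symmetric] L R RE; blast)
    finally show "lft (\<xi> i k) \<otimes>\<^bsub>U\<^esub> rgt (\<xi> k c) = (\<Oplus>\<^bsub>U\<^esub>t\<in>{1..r}. lft (\<xi> i k) \<otimes>\<^bsub>U\<^esub> rgt (eh (cell k t)) \<otimes>\<^bsub>U\<^esub> rgt (\<xi> t c))" .
  qed
  also have "\<dots> = (\<Oplus>\<^bsub>U\<^esub>t\<in>{1..r}. \<Oplus>\<^bsub>U\<^esub>k\<in>{1..n}. lft (\<xi> i k) \<otimes>\<^bsub>U\<^esub> rgt (eh (cell k t)) \<otimes>\<^bsub>U\<^esub> rgt (\<xi> t c))"
    using rn assms by (intro U.finsum_swap finite_atLeastAtMost U.m_closed L R RE; blast)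
  also have "\<dots> = (\<Oplus>\<^bsub>U\<^esub>t\<in>{1..r}. F (comat i t) \<otimes>\<^bsub>U\<^esub> rgt (\<xi> t c))"
  proof (rule U.finsum_cong'[OF refl])
    show "(\<lambda>t. F (comat i t) \<otimes>\<^bsub>U\<^esub> rgt (\<xi> t c)) \<in> {1..r} \<rightarrow> carrier U"
      using rn assms by (intro Pi_I U.m_closed R ahomD(3)[OF ahom_F] S.near_closed[OF near_comat]; blast)
    fix t assume t: "t \<in> {1..r}"
    show "(\<Oplus>\<^bsub>U\<^esub>k\<in>{1..n}. lft (\<xi> i k) \<otimes>\<^bsub>U\<^esub> rgt (eh (cell k t)) \<otimes>\<^bsub>U\<^esub> rgt (\<xi> t c)) = F (comat i t) \<otimes>\<^bsub>U\<^esub> rgt (\<xi> t c)"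
      unfolding F_comat[OF assms(1) t] using rn assms t
      by (intro U.finsum_ldistr[symmetric] finite_atLeastAtMost Pi_I U.m_closed L R RE; blast)
  qed
  finally show ?thesis .
qed

text \<open>\<open>coordinate_divisible\<close> is fed with two expressions for \<Delta>(x_im): the
  one through C, and the one that arises by applying \<Delta> to \<open>xi_factor\<close>, where the
  row i of E is q - 1 times \<open>\<tau>\<close>.\<close>

lemma Dh_tau:
  assumes i: "i \<in> {r<..n}" and s: "s \<in> {1..r}"
  shows "Dh (e (P.dq (cell_coord n r i s))) \<in> F ` carrier S"
proof -
  have rn: "a \<in> {1..r} \<Longrightarrow> a \<in> {1..n}" for a using r by auto
  have i': "i \<in> {1..n}" "\<not> i \<le> r" using i by auto
  define \<tau> where "\<tau> s = e (P.dq (cell_coord n r i s))" for s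
  have \<tau>: "\<tau> s \<in> carrier H" if "s \<in> {1..r}" for s
    unfolding \<tau>_def using ahomD(3)[OF ahom_embed] P.dq_gen[OF coord_E[OF i that]] by (simp add: VE_eq)
  have \<tau>e: "eh (cell i s) = q1 \<odot>\<^bsub>H\<^esub> \<tau> s" if "s \<in> {1..r}" for s
    unfolding \<tau>_def using eh_cell[OF that i'(1)] i'(2) embed_tau[OF i that] by simp
  note x = qmatD(1)[OF qmat_xi] and D = ahomD(3)[OF ahom_Dh]
  have "Dh (\<tau> s) \<in> F ` carrier S"
  proof (rule coordinate_divisible[OF S.cralg_axioms U.cralg_axioms ahom_F U_torsion_free, of "{1..r}" comat "comat i" "\<lambda>t m. rgt (\<xi> t m)"])
    show "finite {1..r}" by simp
    show "S.near q1 (if l = t then 1 else 0) (comat l t)" if "l \<in> {1..r}" "t \<in> {1..r}" for l t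
      by (rule near_comat[OF rn[OF that(1)] that(2)])
    show "S.near q1 0 (comat i t)" if "t \<in> {1..r}" for t
      using near_comat[OF i'(1) that] i that by (simp split: if_splits)
    show "U.near q1 (if t = m then 1 else 0) (rgt (\<xi> t m))" if "t \<in> {1..r}" "m \<in> {1..r}" for t m
      by (rule near_hom[OF H.ralg ahom_rgt near_xi[OF rn[OF that(1)] rn[OF that(2)]] U.ralg])
    show "Dh (\<tau> s) \<in> carrier U" if "s \<in> {1..r}" for s by (rule D[OF \<tau>[OF that]])
    show "(\<Oplus>\<^bsub>U\<^esub>l\<in>{1..r}. q1 \<odot>\<^bsub>U\<^esub> Dh (\<tau> l) \<otimes>\<^bsub>U\<^esub> (\<Oplus>\<^bsub>U\<^esub>t\<in>{1..r}. F (comat l t) \<otimes>\<^bsub>U\<^esub> rgt (\<xi> t m)))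
      = (\<Oplus>\<^bsub>U\<^esub>t\<in>{1..r}. F (comat i t) \<otimes>\<^bsub>U\<^esub> rgt (\<xi> t m))" if m: "m \<in> {1..r}" for m
    proof -
      \<comment> \<open>Both sides are the coproduct of the entry in row i and column m.\<close>
      have "(\<Oplus>\<^bsub>U\<^esub>t\<in>{1..r}. F (comat i t) \<otimes>\<^bsub>U\<^esub> rgt (\<xi> t m)) = Dh (\<Oplus>\<^bsub>H\<^esub>s\<in>{1..r}. eh (cell i s) \<otimes>\<^bsub>H\<^esub> \<xi> s m)"
        unfolding Dh_xi_comat[OF i'(1) m, symmetric] xi_factor[OF i'(1) m, symmetric] ..
      also have "\<dots> = (\<Oplus>\<^bsub>U\<^esub>s\<in>{1..r}. Dh (eh (cell i s) \<otimes>\<^bsub>H\<^esub> \<xi> s m))"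
        using rn m \<tau> by (intro lin_finsum[OF H.ralg U.ralg ahomD(1)[OF ahom_Dh]] Pi_I H.m_closed x ahomD(3)[OF ahom_eh] cell_closed i'(1); blast)
      also have "\<dots> = (\<Oplus>\<^bsub>U\<^esub>l\<in>{1..r}. q1 \<odot>\<^bsub>U\<^esub> Dh (\<tau> l) \<otimes>\<^bsub>U\<^esub> (\<Oplus>\<^bsub>U\<^esub>t\<in>{1..r}. F (comat l t) \<otimes>\<^bsub>U\<^esub> rgt (\<xi> t m)))"
      proof (rule U.finsum_cong'[OF refl])
        show eq: "Dh (eh (cell i l) \<otimes>\<^bsub>H\<^esub> \<xi> l m) = q1 \<odot>\<^bsub>U\<^esub> Dh (\<tau> l) \<otimes>\<^bsub>U\<^esub> (\<Oplus>\<^bsub>U\<^esub>t\<in>{1..r}. F (comat l t) \<otimes>\<^bsub>U\<^esub> rgt (\<xi> t m))"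
          if l: "l \<in> {1..r}" for l
          unfolding \<tau>e[OF l] Dh_xi_comat[OF rn[OF l] m, symmetric] ahomD(5)[OF ahom_Dh \<tau>[OF l], symmetric]
          by (rule ahomD(6)[OF ahom_Dh H.smult_closed[OF \<tau>[OF l]] x[OF rn[OF l] rn[OF m]]])
        show "(\<lambda>l. q1 \<odot>\<^bsub>U\<^esub> Dh (\<tau> l) \<otimes>\<^bsub>U\<^esub> (\<Oplus>\<^bsub>U\<^esub>t\<in>{1..r}. F (comat l t) \<otimes>\<^bsub>U\<^esub> rgt (\<xi> t m))) \<in> {1..r} \<rightarrow> carrier U"
        proof (rule Pi_I)
          fix l assume l: "l \<in> {1..r}"
          show "q1 \<odot>\<^bsub>U\<^esub> Dh (\<tau> l) \<otimes>\<^bsub>U\<^esub> (\<Oplus>\<^bsub>U\<^esub>t\<in>{1..r}. F (comat l t) \<otimes>\<^bsub>U\<^esub> rgt (\<xi> t m)) \<in> carrier U"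
            unfolding eq[OF l, symmetric] \<tau>e[OF l] by (rule D[OF H.m_closed[OF H.smult_closed[OF \<tau>[OF l]] x[OF rn[OF l] rn[OF m]]]])
        qed
      qed
      finally show ?thesis by (rule sym)
    qed
    show "s \<in> {1..r}" by fact
  qed
  then show ?thesis by (simp only: \<tau>_def)
qed

text \<open>The image of \<open>F\<close> is a subalgebra, so its preimage in \<open>VE\<close> is
  everything once it contains the generators. For limits no closedness of the image is established;
  \<open>image_subset_of_dense\<close> sums preimages in the complete source instead.\<close>

theorem left_coideal: "Dh ` (eh ` carrier CE) \<subseteq> F ` carrier S"
proof -
  have c: "ahom VE U (\<lambda>y. Dh (e y))" by (rule ahom_comp[OF ahom_embed ahom_Dh])
  have im: "subalg U (F ` carrier S)" by (rule subalg_image[OF S.ralg U.ralg ahom_F])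
  have "carrier VE \<subseteq> {y \<in> carrier VE. Dh (e y) \<in> F ` carrier S}"
  proof (rule VE_generated[OF subalg_preimage[OF VE.ralg U.ralg c im]])
    fix i j assume ij: "i \<in> {r<..n}" "j \<in> {1..r}"
    then show "P.dq (cell_coord n r i j) \<in> {y \<in> carrier VE. Dh (e y) \<in> F ` carrier S}"
      using Dh_tau[OF ij] P.dq_gen[OF coord_E[OF ij]] by (simp add: VE_eq)
  qed
  then have dense: "Dh (eh (to_completion q1 VE y)) \<in> F ` carrier S" if "y \<in> carrier VE" for y
    using that unfolding eh_to_completion[OF that] by blast
  have l: "lin VE.C U (\<lambda>z. Dh (eh z))" unfolding CE_eq[symmetric] by (rule lin_comp[OF ahomD(1)[OF ahom_eh] ahomD(1)[OF ahom_Dh]])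
  have "Dh (eh z) \<in> F ` carrier S" if "z \<in> carrier CE" for z
    by (rule VE.image_subset_of_dense[OF S.cralg_axioms U.cralg_axioms l ahomD(1)[OF ahom_F] dense]) (use that in \<open>simp_all add: CE_eq\<close>)
  then show ?thesis by blast
qed

end

theorem proposition4p10:
  fixes n r :: nat
  assumes "0 < r" and "r < n"
  shows "(Delta_hat n :: 'k::field_char_0 vee_elem hat \<Rightarrow> _)
           ` (OGP_hat_embed n r ` carrier (OGP_hat n r))
         \<subseteq> ctensor_map q1 (OG_hat n) (OG_hat n) (\<lambda>a. a) (OGP_hat_embed n r)
             ` carrier (ctensor_alg q1 (OG_hat n) (OGP_hat n r))"
  by (rule grassmannian.left_coideal) (use assms in \<open>rule grassmannian.intro\<close>)

end
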